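(* Let $N=4$, $a>0$, $c>0$, $b>0$, and $I_0(u)=\frac a2|\nabla u|_2^2+\frac b4|\nabla u|_2^4-\frac14|u|_4^4$. Then $$\inf_{u\in S_c}I_0(u)=\begin{cases}0,& b\ge S^{-2},\\ -\infty,&0<b<S^{-2},\end{cases}$$ and for $b\ge S^{-2}$ the infimum $\inf_{u\in S_c}I_0(u)$ is not achieved. Moreover, for $0<b<S^{-2}$, $$\inf_{u\in\mathcal P_0}I_0(u)=\inf_{u\in\mathcal P_0^-}I_0(u)=\Lambda:=\frac{a^2S^2}{4(1-bS^2)},$$ and this infimum is not achieved.
   Context: Notation: $|\cdot|_p$ is the $L^p(\mathbb R^4)$ norm; $S=\inf_{u\in D^{1,2}(\mathbb R^4)\setminus\{0\}}|\nabla u|_2^2/|u|_4^2$ is the best Sobolev constant, where $D^{1,2}(\mathbb R^4)$ is the completion of $C_0^\infty(\mathbb R^4)$ under $|\nabla u|_2$. $S_c=\{u\in H^1_{rad}(\mathbb R^4):|u|_2^2=c\}$ (real-valued radial functions). $\mathcal P_0=\{u\in S_c: a|\nabla u|_2^2+b|\nabla u|_2^4-|u|_4^4=0\}$ and $\mathcal P_0^-=\{u\in\mathcal P_0: 2a|\nabla u|_2^2+4b|\nabla u|_2^4-4|u|_4^4<0\}$. *)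

theory Defs
  imports "HOL-Analysis.Analysis"
begin

text \<open>Elements of Lebesgue and Sobolev spaces are represented by functions; the spaces and norms below are
  invariant under changes on a Lebesgue null set.\<close>

definition Lp_space :: "real \<Rightarrow> ('a::euclidean_space \<Rightarrow> 'b::euclidean_space) set" where
  "Lp_space p = {u \<in> borel_measurable lebesgue. integrable lebesgue (\<lambda>x. norm (u x) powr p)}"

text \<open>Only meaningful on \<open>Lp_space p\<close>: the Bochner integral of a non-integrable function is 0.\<close>

definition Lp_norm :: "real \<Rightarrow> ('a::euclidean_space \<Rightarrow> 'b::euclidean_space) \<Rightarrow> real" where
  "Lp_norm p u = (\<integral>x. norm (u x) powr p \<partial>lebesgue) powr (1 / p)"

definition locally_integrable :: "('a::euclidean_space \<Rightarrow> 'b::euclidean_space) \<Rightarrow> bool" where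
  "locally_integrable u \<longleftrightarrow> (\<forall>K. compact K \<longrightarrow> set_integrable lebesgue K u)"

definition partial_deriv :: "'a::euclidean_space \<Rightarrow> ('a \<Rightarrow> real) \<Rightarrow> 'a \<Rightarrow> real" where
  "partial_deriv e f x = frechet_derivative f (at x) e"

definition grad :: "('a::euclidean_space \<Rightarrow> real) \<Rightarrow> 'a \<Rightarrow> 'a" where
  "grad f x = (\<Sum>e\<in>Basis. partial_deriv e f x *\<^sub>R e)"

primrec C_k :: "nat \<Rightarrow> ('a::euclidean_space \<Rightarrow> real) \<Rightarrow> bool" where
  "C_k 0 f \<longleftrightarrow> continuous_on UNIV f"
| "C_k (Suc k) f \<longleftrightarrow> f differentiable_on UNIV \<and> (\<forall>e\<in>Basis. C_k k (partial_deriv e f))"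

definition test_function :: "('a::euclidean_space \<Rightarrow> real) \<Rightarrow> bool" where
  "test_function \<phi> \<longleftrightarrow> (\<forall>k. C_k k \<phi>) \<and> (\<exists>K. compact K \<and> (\<forall>x. x \<notin> K \<longrightarrow> \<phi> x = 0))"

definition is_weak_grad :: "('a::euclidean_space \<Rightarrow> real) \<Rightarrow> ('a \<Rightarrow> 'a) \<Rightarrow> bool" where
  "is_weak_grad u g \<longleftrightarrow> locally_integrable u \<and> locally_integrable g \<and>
     (\<forall>\<phi>. test_function \<phi> \<longrightarrow> (\<forall>e\<in>Basis.
        (\<integral>x. u x * partial_deriv e \<phi> x \<partial>lebesgue) = - (\<integral>x. (g x \<bullet> e) * \<phi> x \<partial>lebesgue)))"

text \<open>A weak gradient is unique almost everywhere, so the choice is immaterial.\<close>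

definition weak_grad :: "('a::euclidean_space \<Rightarrow> real) \<Rightarrow> 'a \<Rightarrow> 'a" where
  "weak_grad u = (SOME g. is_weak_grad u g)"

definition H1 :: "('a::euclidean_space \<Rightarrow> real) set" where
  "H1 = {u \<in> Lp_space 2. (\<exists>g. is_weak_grad u g) \<and> weak_grad u \<in> Lp_space 2}"

definition radial :: "('a::euclidean_space \<Rightarrow> real) \<Rightarrow> bool" where
  "radial u \<longleftrightarrow> (\<exists>f. AE x in lebesgue. u x = f (norm x))"

definition H1_rad :: "('a::euclidean_space \<Rightarrow> real) set" where
  "H1_rad = {u \<in> H1. radial u}"

text \<open>The completion of the test functions under the \<open>L\<^sup>2\<close> norm of the gradient, realised in the usual
  way as a space of functions: by the Sobolev inequality, a Cauchy sequence for this norm converges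
  in \<open>L\<^sup>4\<close> (4 is the critical exponent in dimension 4), and the \<open>L\<^sup>4\<close> limit identifies the class
  of the sequence.\<close>

definition D12 :: "(real^4 \<Rightarrow> real) set" where
  "D12 = {u \<in> Lp_space 4. (\<exists>g. is_weak_grad u g) \<and> weak_grad u \<in> Lp_space 2 \<and>
     (\<exists>\<phi>. (\<forall>n::nat. test_function (\<phi> n)) \<and>
          (\<lambda>n. Lp_norm 4 (\<lambda>x. \<phi> n x - u x)) \<longlonglongrightarrow> 0 \<and>
          (\<lambda>n. Lp_norm 2 (\<lambda>x. grad (\<phi> n) x - weak_grad u x)) \<longlonglongrightarrow> 0)}"

definition sobolev_const :: real where
  "sobolev_const =
     (INF u\<in>{u \<in> D12. \<not> (AE x in lebesgue. u x = 0)}. (Lp_norm 2 (weak_grad u))\<^sup>2 / (Lp_norm 4 u)\<^sup>2)"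

definition S_mass :: "real \<Rightarrow> (real^4 \<Rightarrow> real) set" where
  "S_mass c = {u \<in> H1_rad. (Lp_norm 2 u)\<^sup>2 = c}"

definition I0 :: "real \<Rightarrow> real \<Rightarrow> (real^4 \<Rightarrow> real) \<Rightarrow> real" where
  "I0 a b u = a / 2 * (Lp_norm 2 (weak_grad u))\<^sup>2 + b / 4 * (Lp_norm 2 (weak_grad u)) ^ 4
     - 1 / 4 * (Lp_norm 4 u) ^ 4"

definition P0 :: "real \<Rightarrow> real \<Rightarrow> real \<Rightarrow> (real^4 \<Rightarrow> real) set" where
  "P0 a b c = {u \<in> S_mass c.
     a * (Lp_norm 2 (weak_grad u))\<^sup>2 + b * (Lp_norm 2 (weak_grad u)) ^ 4 - (Lp_norm 4 u) ^ 4 = 0}"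

definition P0_minus :: "real \<Rightarrow> real \<Rightarrow> real \<Rightarrow> (real^4 \<Rightarrow> real) set" where
  "P0_minus a b c = {u \<in> P0 a b c.
     2 * a * (Lp_norm 2 (weak_grad u))\<^sup>2 + 4 * b * (Lp_norm 2 (weak_grad u)) ^ 4
       - 4 * (Lp_norm 4 u) ^ 4 < 0}"

end

theory Submission
  imports Defs
begin

text \<open>The sharp inequality \<open>S |u|\<^sub>4\<^sup>2 \<le> |\<nabla>u|\<^sub>2\<^sup>2\<close> holds on all of \<open>H\<^sup>1\<close>, is strict on functions in \<open>L\<^sup>2\<close>, and is nearly
  attained by radial \<open>C\<^sup>1\<close> functions with compact support; in dimension 4 the maps \<open>u \<mapsto> t u(\<lambda>x)\<close> turn such a
  function into one of any prescribed mass while multiplying \<open>|\<nabla>u|\<^sub>2\<close> and \<open>|u|\<^sub>4\<close> by the same arbitrary factor. Everything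
  else is algebra in these two numbers.

  Near-extremals can be taken radial because of a derivative-free form of the Polya--Szego inequality: if
  \<open>F\<^sub>t(x)\<close> is the supremum of \<open>F\<close> over the ball of radius \<open>t\<close> about \<open>x\<close>, Brunn--Minkowski shows that the superlevel
  sets of \<open>F\<^sub>t\<close> are at least as large as those of \<open>(F\<^sup>*)\<^sub>t\<close>, so that \<open>\<integral>(F\<^sub>t - F)\<^sup>2 \<ge> \<integral>((F\<^sup>*)\<^sub>t - F\<^sup>*)\<^sup>2\<close>; averaging the profile of
  \<open>F\<^sup>*\<close> over intervals of length \<open>t\<close> gives a \<open>C\<^sup>1\<close> function whose gradient is exactly \<open>((F\<^sup>*)\<^sub>t - F\<^sup>*) / t\<close> in modulus.
  Hardy's inequality for radially decreasing functions then also gives \<open>S > 0\<close>.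

  Strictness: an extremal \<open>v\<close> satisfies \<open>- S\<^sup>2 \<integral>|v|\<^sup>3 \<psi> \<ge> |\<nabla>v|\<^sub>2\<^sup>2 \<integral>|v| \<Delta>\<psi>\<close> for all test functions \<open>\<psi> \<ge> 0\<close>, and
  spreading \<open>\<psi>\<close> out makes the right-hand side vanish in the limit if \<open>v\<close> is in \<open>L\<^sup>2\<close>. Hence \<open>v = 0\<close>.\<close>

section \<open>The Brunn--Minkowski inequality\<close>

text \<open>With X = |grad u|_2^2 and Y = |u|_4^4 the functional is a X/2 + (b X^2 - Y)/4. The
  constraint Y = a X + b X^2 turns it into a X/4 and the expression in \<open>P0_minus\<close> into
  -2 a X, so that set is all of \<open>P0\<close>. Since S^2 Y < X^2 on \<open>S_mass c\<close>, the
  constraint forces X > a S^2/(1 - b S^2): this is the origin of \<Lambda>, and b = S^-2 is the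
  threshold at which b X^2 - Y can become negative. Every claim of non-attainment is the strictness
  of the Sobolev inequality. The classical extremals are multiples, translates and dilates of 1/(1 +
  |x|^2), whose square is not integrable on R^4. Their classification is avoided: an extremal in L^2
  is assumed and only its first variation is used. Radial near-extremals have to be produced because
  \<open>S_mass\<close> consists of radial functions, whereas the infimum defining S runs over all
  of \<open>D12\<close>. A weak gradient gives no direct hold on |u| or on a rearrangement, so the
  estimates are made for C^1 functions of compact support, with errors as small as desired relative
  to the sharp constant, and are carried to H^1 by Fatou's lemma.\<close>

definition msum :: "'a::ab_group_add set \<Rightarrow> 'a set \<Rightarrow> 'a set" where
  "msum A B = {x + y |x y. x \<in> A \<and> y \<in> B}"

lemma msum_commute: "msum A B = msum B A"
  unfolding msum_def by (auto simp: add.commute) (use add.commute in blast)+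

lemma msum_mono: "A \<subseteq> A' \<Longrightarrow> B \<subseteq> B' \<Longrightarrow> msum A B \<subseteq> msum A' B'"
  unfolding msum_def by blast

lemma open_msum: "open A \<Longrightarrow> open (msum A (B :: 'a::real_normed_vector set))"
proof -
  assume A: "open A"
  have "msum A B = (\<Union>y\<in>B. (+) y ` A)"
  proof
    show "msum A B \<subseteq> (\<Union>y\<in>B. (+) y ` A)"
    proof
      fix z assume "z \<in> msum A B"
      then obtain x y where "x \<in> A" "y \<in> B" "z = y + x" by (auto simp: msum_def add.commute)
      then show "z \<in> (\<Union>y\<in>B. (+) y ` A)" by blast
    qed
    show "(\<Union>y\<in>B. (+) y ` A) \<subseteq> msum A B"
    proof
      fix z assume "z \<in> (\<Union>y\<in>B. (+) y ` A)"
      then obtain x y where "x \<in> A" "y \<in> B" "z = x + y" by (auto simp: add.commute)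
      then show "z \<in> msum A B" by (auto simp: msum_def)
    qed
  qed
  then show ?thesis using A by (auto intro!: open_translation)
qed

lemma bounded_msum: "bounded A \<Longrightarrow> bounded B \<Longrightarrow> bounded (msum A (B :: 'a::real_normed_vector set))"
proof -
  assume "bounded A" "bounded B"
  then have "bounded (\<Union>x\<in>A. \<Union>y\<in>B. {x + y})" by (rule bounded_sums)
  moreover have "(\<Union>x\<in>A. \<Union>y\<in>B. {x + y}) = msum A B" by (auto simp: msum_def)
  ultimately show ?thesis by simp
qed

lemma msum_box:
  assumes "box a b \<noteq> {}" "box c d \<noteq> {}"
  shows "msum (box a b) (box c d) = box (a + c) (b + d :: 'a::euclidean_space)"
proof
  show "msum (box a b) (box c d) \<subseteq> box (a + c) (b + d)"
    unfolding msum_def by (auto simp: box_def inner_simps intro!: add_strict_mono)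
  show "box (a + c) (b + d) \<subseteq> msum (box a b) (box c d)"
  proof
    fix z assume z: "z \<in> box (a + c) (b + d)"
    have ne: "a \<bullet> i < b \<bullet> i" "c \<bullet> i < d \<bullet> i" if "i \<in> Basis" for i
      using assms that by (auto simp: box_ne_empty)
    \<comment> \<open>\<open>l i\<close> is the relative position of \<open>z\<close> in the
      \<open>i\<close>-th edge of the large box; placing \<open>x\<close> at the same relative
      position in \<open>box a b\<close> leaves \<open>z - x\<close> at that position in
      \<open>box c d\<close>.\<close>
    define l where "l i = (z \<bullet> i - (a + c) \<bullet> i) / ((b + d) \<bullet> i - (a + c) \<bullet> i)" for i
    have l: "0 < l i" "l i < 1" if "i \<in> Basis" for i
      using z ne[OF that] that by (auto simp: l_def box_def inner_simps field_simps)
    define x where "x = (\<Sum>i\<in>Basis. (a \<bullet> i + l i * (b \<bullet> i - a \<bullet> i)) *\<^sub>R i)"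
    have xi: "x \<bullet> i = a \<bullet> i + l i * (b \<bullet> i - a \<bullet> i)" if "i \<in> Basis" for i
      using that by (simp add: x_def)
    have zi: "z \<bullet> i - x \<bullet> i = c \<bullet> i + l i * (d \<bullet> i - c \<bullet> i)" if "i \<in> Basis" for i
    proof -
      have "l i * ((b + d) \<bullet> i - (a + c) \<bullet> i) = z \<bullet> i - (a + c) \<bullet> i"
        using ne[OF that] by (simp add: l_def inner_simps)
      then show ?thesis by (simp add: xi[OF that] inner_simps algebra_simps)
    qed
    have between: "p < p + t * (q - p) \<and> p + t * (q - p) < q" if "p < q" "0 < t" "t < 1" for p q t :: real
    proof -
      have "0 < t * (q - p)" "t * (q - p) < 1 * (q - p)" using that by auto
      then show ?thesis by simp
    qed
    have "x \<in> box a b"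
      by (auto simp: box_def xi between ne l)
    moreover have "z - x \<in> box c d"
      by (auto simp: box_def inner_diff_left zi between ne l)
    moreover have "z = x + (z - x)" by simp
    ultimately show "z \<in> msum (box a b) (box c d)"
      unfolding msum_def by blast
  qed
qed

text \<open>The cut-off at 0 makes one formula cover empty boxes as well, so the volume is a
  continuous function of the corners; \<open>disjoint_boxes_level\<close> depends on that.\<close>

lemma measure_box_max:
  "measure lborel (box a b) = (\<Prod>i\<in>Basis. max 0 (b \<bullet> i - a \<bullet> (i::'a::euclidean_space)))"
proof (cases "\<forall>i\<in>Basis. a \<bullet> i \<le> b \<bullet> i")
  case True
  then show ?thesis
    by (auto simp: measure_lborel_box_eq inner_simps max_def intro!: prod.cong)
next
  case False
  then show ?thesis
    by (subst measure_lborel_box_eq) (auto intro!: prod_zero[symmetric] simp: max_def prod_zero_iff)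
qed

text \<open>AM-GM for the ratios \<open>\<alpha> i / (\<alpha> i + \<beta> i)\<close> and for the
  ratios \<open>\<beta> i / (\<alpha> i + \<beta> i)\<close> gives two upper bounds whose sum is 1;
  the common denominator is then cleared. With edge lengths as entries this is Brunn--Minkowski for
  two boxes.\<close>

lemma root_prod_add_le:
  fixes \<alpha> \<beta> :: "'i \<Rightarrow> real"
  assumes I: "finite I" "I \<noteq> {}" and pos: "\<And>i. i \<in> I \<Longrightarrow> 0 < \<alpha> i" "\<And>i. i \<in> I \<Longrightarrow> 0 < \<beta> i"
  shows "root (card I) (prod \<alpha> I) + root (card I) (prod \<beta> I) \<le> root (card I) (\<Prod>i\<in>I. \<alpha> i + \<beta> i)"
proof -
  let ?n = "card I"
  have n: "?n > 0" using I by (simp add: card_gt_0_iff)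
  let ?c = "\<lambda>i. \<alpha> i + \<beta> i"
  have c: "?c i > 0" if "i \<in> I" for i using pos[OF that] by simp
  have am: "root ?n (\<Prod>i\<in>I. x i / ?c i) \<le> (\<Sum>i\<in>I. x i / ?c i / ?n)"
    if "\<And>i. i \<in> I \<Longrightarrow> 0 < x i" for x
  proof -
    have "root ?n (\<Prod>i\<in>I. x i / ?c i) = (\<Prod>i\<in>I. x i / ?c i) powr (1 / ?n)"
      using n that c by (intro root_powr_inverse prod_nonneg divide_nonneg_nonneg) (auto simp: less_imp_le)
    also have "\<dots> \<le> (\<Sum>i\<in>I. x i / ?c i / ?n)"
      using I that c by (intro arith_geom_mean) (auto intro: less_imp_le)
    finally show ?thesis .
  qed
  have P: "prod ?c I > 0" using c by (intro prod_pos) auto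
  have eq: "root ?n (\<Prod>i\<in>I. x i / ?c i) = root ?n (prod x I) / root ?n (prod ?c I)" for x
    by (simp add: prod_dividef real_root_divide)
  have "root ?n (prod \<alpha> I) / root ?n (prod ?c I) + root ?n (prod \<beta> I) / root ?n (prod ?c I)
     \<le> (\<Sum>i\<in>I. \<alpha> i / ?c i / ?n) + (\<Sum>i\<in>I. \<beta> i / ?c i / ?n)"
    using am[of \<alpha>, OF pos(1)] am[of \<beta>, OF pos(2)] unfolding eq by (intro add_mono) auto
  also have "\<dots> = (\<Sum>i\<in>I. 1 / ?n)"
    unfolding sum.distrib[symmetric] using c
    by (intro sum.cong refl) (metis add_divide_distrib divide_self less_irrefl)
  also have "\<dots> = 1" using n by simp
  finally show ?thesis
    using P n by (simp add: add_divide_distrib[symmetric] pos_divide_le_eq real_root_gt_zero)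
qed

text \<open>Empty members are excluded so that a nonempty family has positive volume and its
  cardinality, on which the induction runs, counts genuine pieces.\<close>

definition disjoint_boxes :: "'a::euclidean_space set set \<Rightarrow> bool" where
  "disjoint_boxes \<A> \<longleftrightarrow> finite \<A> \<and> disjoint \<A> \<and> (\<forall>X\<in>\<A>. X \<noteq> {} \<and> (\<exists>a b. X = box a b))"

lemma disjoint_boxes_open: "disjoint_boxes \<A> \<Longrightarrow> open (\<Union>\<A>)"
  unfolding disjoint_boxes_def by (metis open_Union open_box)

lemma disjoint_boxes_bounded: "disjoint_boxes \<A> \<Longrightarrow> bounded (\<Union>\<A>)"
  unfolding disjoint_boxes_def by (metis bounded_Union bounded_box)

text \<open>Deleting the empty set makes the cardinality drop as soon as \<open>H\<close> misses a
  member.\<close>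

definition cut :: "'a set set \<Rightarrow> 'a set \<Rightarrow> 'a set set" where
  "cut \<A> H = (\<lambda>X. X \<inter> H) ` \<A> - {{}}"

lemma Union_cut: "\<Union>(cut \<A> H) = \<Union>\<A> \<inter> H"
  unfolding cut_def by auto

lemma card_cut_le: "finite \<A> \<Longrightarrow> card (cut \<A> H) \<le> card \<A>"
  unfolding cut_def by (meson Diff_subset card_image_le card_mono finite_imageI order_trans)

lemma card_cut_less: "finite \<A> \<Longrightarrow> X \<in> \<A> \<Longrightarrow> X \<inter> H = {} \<Longrightarrow> card (cut \<A> H) < card \<A>"
proof -
  assume *: "finite \<A>" "X \<in> \<A>" "X \<inter> H = {}"
  have "cut \<A> H \<subseteq> (\<lambda>X. X \<inter> H) ` (\<A> - {X})"
    using * unfolding cut_def by auto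
  then have "card (cut \<A> H) \<le> card (\<A> - {X})"
    using * by (meson card_image_le card_mono finite_Diff finite_imageI order_trans)
  also have "\<dots> < card \<A>" using * by (meson card_Diff1_less)
  finally show ?thesis .
qed

text \<open>Only the coordinate of the upper corner in direction \<open>e\<close> moves. A
  hyperplane above the box leaves it unchanged, and one below it makes the right-hand side an empty
  box.\<close>

lemma box_Int_lower:
  assumes "e \<in> Basis"
  shows "box a b \<inter> {x. x \<bullet> e < s} = box a (b + (min (b \<bullet> e) s - b \<bullet> e) *\<^sub>R (e::'a::euclidean_space))"
  using assms by (auto simp: box_def inner_simps inner_Basis split: if_splits)

lemma box_Int_upper:
  assumes "e \<in> Basis"
  shows "box a b \<inter> {x. s < x \<bullet> e} = box (a + (max (a \<bullet> e) s - a \<bullet> e) *\<^sub>R (e::'a::euclidean_space)) b"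
  using assms by (auto simp: box_def inner_simps inner_Basis split: if_splits)

lemma disjoint_boxes_cut:
  assumes "disjoint_boxes \<A>" and H: "\<And>a b. \<exists>c d. box a b \<inter> H = box c d"
  shows "disjoint_boxes (cut \<A> H)"
proof -
  have "X \<inter> Y = {}" if "X \<in> cut \<A> H" "Y \<in> cut \<A> H" "X \<noteq> Y" for X Y
  proof -
    obtain X' Y' where "X' \<in> \<A>" "Y' \<in> \<A>" "X = X' \<inter> H" "Y = Y' \<inter> H"
      using \<open>X \<in> cut \<A> H\<close> \<open>Y \<in> cut \<A> H\<close> unfolding cut_def by blast
    then show ?thesis using assms(1) that unfolding disjoint_boxes_def disjoint_def by blast
  qed
  then have "disjoint (cut \<A> H)" by (simp add: disjoint_def)
  moreover have "finite (cut \<A> H)" using assms(1) by (simp add: disjoint_boxes_def cut_def)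
  moreover have "X \<noteq> {} \<and> (\<exists>a b. X = box a b)" if X: "X \<in> cut \<A> H" for X
  proof -
    obtain Y where "Y \<in> \<A>" "X = Y \<inter> H" "X \<noteq> {}" using X unfolding cut_def by blast
    then show ?thesis using assms unfolding disjoint_boxes_def by metis
  qed
  ultimately show ?thesis by (simp add: disjoint_boxes_def)
qed

lemma disjoint_boxes_cut_lower:
  "disjoint_boxes \<A> \<Longrightarrow> e \<in> Basis \<Longrightarrow> disjoint_boxes (cut \<A> {x. x \<bullet> e < s})"
  by (rule disjoint_boxes_cut) (auto simp: box_Int_lower)

lemma disjoint_boxes_cut_upper:
  "disjoint_boxes \<A> \<Longrightarrow> e \<in> Basis \<Longrightarrow> disjoint_boxes (cut \<A> {x. s < x \<bullet> e})"
  by (rule disjoint_boxes_cut) (auto simp: box_Int_upper)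

lemma measure_open_bounded_mono:
  "A \<subseteq> B \<Longrightarrow> open A \<Longrightarrow> open B \<Longrightarrow> bounded B \<Longrightarrow> measure lborel A \<le> measure lborel (B :: 'a::euclidean_space set)"
  by (intro measure_mono_fmeasurable) (auto intro: fmeasurableI emeasure_bounded_finite)

lemma measure_split:
  assumes "e \<in> Basis" "open A" "bounded (A :: 'a::euclidean_space set)"
  shows "measure lborel A = measure lborel (A \<inter> {x. x \<bullet> e < s}) + measure lborel (A \<inter> {x. s < x \<bullet> e})"
proof -
  have N: "{x. x \<bullet> e = s} \<in> null_sets lborel"
  proof -
    have "closed {x. x \<bullet> e = s}" using closed_hyperplane[of e s] by (simp add: inner_commute)
    then have "{x. x \<bullet> e = s} \<in> sets lborel" by simp
    then show ?thesis
      using negligible_standard_hyperplane[OF assms(1), of s]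
      by (simp add: negligible_iff_null_sets null_sets_completion_iff)
  qed
  have o: "open {x. x \<bullet> e < s}" "open {x. s < x \<bullet> e}"
    by (simp_all add: open_halfspace_component_lt open_halfspace_component_gt)
  have fin: "emeasure lborel X < \<infinity>" if "X \<subseteq> A" for X
    using assms(3) bounded_subset that by (meson emeasure_bounded_finite)
  have "measure lborel A = measure lborel (A - {x. x \<bullet> e = s})"
    using N assms by (simp add: measure_Diff_null_set)
  also have "A - {x. x \<bullet> e = s} = (A \<inter> {x. x \<bullet> e < s}) \<union> (A \<inter> {x. s < x \<bullet> e})"
    by auto
  also have "measure lborel \<dots> = measure lborel (A \<inter> {x. x \<bullet> e < s}) + measure lborel (A \<inter> {x. s < x \<bullet> e})"
    using fin[of "A \<inter> {x. x \<bullet> e < s}"] fin[of "A \<inter> {x. s < x \<bullet> e}"] assms o 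
    by (intro measure_Union) (auto simp: less_top)
  finally show ?thesis .
qed

text \<open>The volume below the hyperplane at height \<open>r\<close> is a finite sum of continuous
  functions of \<open>r\<close>; it vanishes at \<open>r = - R\<close> and is the full volume at
  \<open>r = R\<close>, so the intermediate value theorem applies.\<close>

lemma disjoint_boxes_level:
  assumes \<B>: "disjoint_boxes \<B>" and e: "e \<in> Basis" and m: "0 < m" "m < measure lborel (\<Union>\<B>)"
  shows "\<exists>r. measure lborel (\<Union>\<B> \<inter> {x. x \<bullet> e < r}) = m"
proof -
  define g where "g r = measure lborel (\<Union>\<B> \<inter> {x. x \<bullet> e < r})" for r
  have o: "open {x. x \<bullet> e < s}" for s
    by (simp add: open_halfspace_component_lt)
  have g_eq: "g r = (\<Sum>X\<in>\<B>. measure lborel (X \<inter> {x. x \<bullet> e < r}))" for r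
  proof -
    have "g r = measure lborel (\<Union>X\<in>\<B>. X \<inter> {x. x \<bullet> e < r})"
      unfolding g_def by (rule arg_cong[where f = "measure lborel"]) auto
    also have "\<dots> = (\<Sum>X\<in>\<B>. measure lborel (X \<inter> {x. x \<bullet> e < r}))"
    proof (rule measure_UNION_AE)
      show "finite \<B>" using \<B> by (simp add: disjoint_boxes_def)
      show "X \<inter> {x. x \<bullet> e < r} \<in> fmeasurable lborel" if "X \<in> \<B>" for X
        using that \<B> o[of r] e by (auto simp: disjoint_boxes_def box_Int_lower intro!: fmeasurableI emeasure_bounded_finite)
      show "pairwise (\<lambda>X Y. AE x in lborel. x \<notin> X \<inter> {x. x \<bullet> e < r} \<or> x \<notin> Y \<inter> {x. x \<bullet> e < r}) \<B>"
        using \<B> unfolding pairwise_def disjoint_boxes_def disjnt_def by (intro ballI impI AE_I2) blast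
    qed
    finally show ?thesis .
  qed
  have cont: "isCont g r" for r
  proof -
    have "isCont (\<lambda>r. measure lborel (X \<inter> {x. x \<bullet> e < r})) r" if "X \<in> \<B>" for X
    proof -
      obtain a b where X: "X = box a b" using \<B> \<open>X \<in> \<B>\<close> unfolding disjoint_boxes_def by blast
      show ?thesis unfolding X box_Int_lower[OF e] measure_box_max inner_simps
        by (intro continuous_intros)
    qed
    then show ?thesis unfolding g_eq[abs_def] by (intro continuous_intros) auto
  qed
  obtain R where R: "R > 0" "\<And>x. x \<in> \<Union>\<B> \<Longrightarrow> norm x < R"
    using disjoint_boxes_bounded[OF \<B>] by (meson bounded_pos_less)
  have R': "- R < x \<bullet> e" "x \<bullet> e < R" if "x \<in> \<Union>\<B>" for x
    using R(2)[OF that] Basis_le_norm[OF e, of x] by auto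
  have "\<Union>\<B> \<inter> {x. x \<bullet> e < -R} = {}" using R'(1) by force
  then have "g (- R) = 0" by (simp add: g_def)
  moreover have "\<Union>\<B> \<inter> {x. x \<bullet> e < R} = \<Union>\<B>" using R'(2) by force
  then have "g R = measure lborel (\<Union>\<B>)" by (simp add: g_def)
  ultimately have "\<exists>r\<ge>-R. r \<le> R \<and> g r = m"
    using m cont R(1) by (intro IVT) auto
  then show ?thesis by (auto simp: g_def)
qed

text \<open>The form with the \<open>n\<close>-th power is homogeneous of degree one in the two
  volumes. The inequalities for two pieces cut off in the same ratio therefore simply add
  up.\<close>

definition brunn_minkowski :: "'a::euclidean_space set \<Rightarrow> 'a set \<Rightarrow> bool" where
  "brunn_minkowski A B \<longleftrightarrow> (root DIM('a) (measure lborel A) + root DIM('a) (measure lborel B)) ^ DIM('a)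
      \<le> measure lborel (msum A B)"

lemma brunn_minkowski_commute: "brunn_minkowski A B \<longleftrightarrow> brunn_minkowski B A"
  unfolding brunn_minkowski_def by (simp add: msum_commute add.commute)

lemma brunn_minkowski_box:
  fixes a b :: "'a::euclidean_space"
  assumes "box a b \<noteq> {}" "box c d \<noteq> {}"
  shows "brunn_minkowski (box a b) (box c d)"
proof -
  have ne: "a \<bullet> i < b \<bullet> i" "c \<bullet> i < d \<bullet> i" if "i \<in> Basis" for i
    using assms that by (auto simp: box_ne_empty)
  have "root DIM('a) (\<Prod>i\<in>Basis. b \<bullet> i - a \<bullet> i) + root DIM('a) (\<Prod>i\<in>Basis. d \<bullet> i - c \<bullet> i)
     \<le> root DIM('a) (\<Prod>i\<in>Basis. (b \<bullet> i - a \<bullet> i) + (d \<bullet> i - c \<bullet> i))"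
    using ne by (intro root_prod_add_le) auto
  then have "(root DIM('a) (\<Prod>i\<in>Basis. b \<bullet> i - a \<bullet> i) + root DIM('a) (\<Prod>i\<in>Basis. d \<bullet> i - c \<bullet> i)) ^ DIM('a)
     \<le> root DIM('a) (\<Prod>i\<in>Basis. (b \<bullet> i - a \<bullet> i) + (d \<bullet> i - c \<bullet> i)) ^ DIM('a)"
    using ne by (intro power_mono add_nonneg_nonneg real_root_ge_zero prod_nonneg) (auto simp: less_imp_le)
  also have "\<dots> = (\<Prod>i\<in>Basis. (b \<bullet> i - a \<bullet> i) + (d \<bullet> i - c \<bullet> i))"
    using ne by (intro real_root_pow_pos2 prod_nonneg add_nonneg_nonneg) (auto simp: less_imp_le)
  finally show ?thesis
    using ne unfolding brunn_minkowski_def msum_box[OF assms]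
    by (auto simp: measure_lborel_box_eq inner_simps less_imp_le add_mono algebra_simps)
qed

lemma measure_open_pos: "open X \<Longrightarrow> X \<noteq> {} \<Longrightarrow> bounded X \<Longrightarrow> 0 < measure lborel (X :: 'a::euclidean_space set)"
proof -
  assume X: "open X" "X \<noteq> {}" "bounded X"
  then obtain x where "x \<in> X" by auto
  then obtain r where r: "r > 0" "ball x r \<subseteq> X" using X open_contains_ball by blast
  have "0 < measure lborel (ball x r)" using r content_ball_pos[of r x] by simp
  also have "\<dots> \<le> measure lborel X" using r X by (intro measure_open_bounded_mono) auto
  finally show ?thesis .
qed

text \<open>The Hadwiger--Ohmann argument: a coordinate hyperplane separates two boxes of the first family, and a parallel
  one splits the second set in the same ratio.\<close>

lemma brunn_minkowski_boxes_step:
  fixes \<A> \<B> :: "'a::euclidean_space set set"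
  assumes IH: "\<And>\<A>' \<B>' :: 'a set set. card \<A>' + card \<B>' < card \<A> + card \<B> \<Longrightarrow> disjoint_boxes \<A>' \<Longrightarrow> disjoint_boxes \<B>' \<Longrightarrow>
      \<A>' \<noteq> {} \<Longrightarrow> \<B>' \<noteq> {} \<Longrightarrow> brunn_minkowski (\<Union>\<A>') (\<Union>\<B>')"
    and \<A>: "disjoint_boxes \<A>" and \<B>: "disjoint_boxes \<B>" and ne: "\<B> \<noteq> {}" and card: "card \<A> \<ge> 2"
  shows "brunn_minkowski (\<Union>\<A>) (\<Union>\<B>)"
proof -
  let ?n = "DIM('a)" and ?m = "measure lborel"
  obtain X Y where XY: "X \<in> \<A>" "Y \<in> \<A>" "X \<noteq> Y"
  proof -
    have "\<not> is_singleton \<A>" "\<A> \<noteq> {}" using card by (auto simp: is_singleton_altdef)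
    then show thesis using that by (meson is_singletonI')
  qed
  then obtain a b c d where X: "X = box a b" "X \<noteq> {}" and Y: "Y = box c d" "Y \<noteq> {}"
    using \<A> unfolding disjoint_boxes_def by meson
  have "X \<inter> Y = {}" using XY \<A> by (auto simp: disjoint_boxes_def disjoint_def)
  then obtain e where e: "e \<in> Basis" "b \<bullet> e \<le> c \<bullet> e \<or> d \<bullet> e \<le> a \<bullet> e"
  proof -
    have "\<exists>e\<in>Basis. b \<bullet> e \<le> a \<bullet> e \<or> d \<bullet> e \<le> c \<bullet> e \<or> b \<bullet> e \<le> c \<bullet> e \<or> d \<bullet> e \<le> a \<bullet> e"
      using \<open>X \<inter> Y = {}\<close> unfolding X(1) Y(1) disjoint_interval .
    then obtain e where "e \<in> Basis" "b \<bullet> e \<le> a \<bullet> e \<or> d \<bullet> e \<le> c \<bullet> e \<or> b \<bullet> e \<le> c \<bullet> e \<or> d \<bullet> e \<le> a \<bullet> e"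
      by blast
    moreover have "a \<bullet> e < b \<bullet> e" "c \<bullet> e < d \<bullet> e"
      using X Y calculation(1) by (auto simp: box_ne_empty)
    ultimately show thesis using that by fastforce
  qed
  \<comment> \<open>The upper face, in direction \<open>e\<close>, of whichever of the two boxes
    lies below the other.\<close>
  define s where "s = (if b \<bullet> e \<le> c \<bullet> e then b \<bullet> e else d \<bullet> e)"
  define lo where "lo r = {x::'a. x \<bullet> e < r}" for r
  define up where "up r = {x::'a. r < x \<bullet> e}" for r
  have o: "open (lo r)" "open (up r)" for r
    by (simp_all add: lo_def up_def open_halfspace_component_lt open_halfspace_component_gt)
  have XYs: "X \<inter> up s = {} \<and> Y \<inter> lo s = {} \<and> X \<inter> lo s \<noteq> {} \<and> Y \<inter> up s \<noteq> {} \<or>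
     Y \<inter> up s = {} \<and> X \<inter> lo s = {} \<and> Y \<inter> lo s \<noteq> {} \<and> X \<inter> up s \<noteq> {}"
  proof -
    have "lo s \<inter> up s = {}" by (auto simp: lo_def up_def)
    moreover have "X \<subseteq> lo s \<and> Y \<subseteq> up s \<or> Y \<subseteq> lo s \<and> X \<subseteq> up s"
    proof (cases "b \<bullet> e \<le> c \<bullet> e")
      case True
      then have "X \<subseteq> lo s \<and> Y \<subseteq> up s"
        using e(1) unfolding X(1) Y(1) by (auto simp: s_def lo_def up_def box_def intro: le_less_trans)
      then show ?thesis ..
    next
      case False
      then have "d \<bullet> e \<le> a \<bullet> e" using e by simp
      then have "Y \<subseteq> lo s \<and> X \<subseteq> up s"
        using e(1) False unfolding X(1) Y(1) by (auto simp: s_def lo_def up_def box_def intro: le_less_trans)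
      then show ?thesis ..
    qed
    ultimately show ?thesis using X(2) Y(2) by blast
  qed
  have fin: "finite \<A>" using \<A> by (simp add: disjoint_boxes_def)
  \<comment> \<open>Each half-space misses one of the two boxes, so both cut families are strictly
    smaller, while cutting the second family never increases its cardinality. The induction
    hypothesis thus covers both halves.\<close>
  have less: "card (cut \<A> (up s)) < card \<A>" "card (cut \<A> (lo s)) < card \<A>"
    using XYs card_cut_less[OF fin XY(1)] card_cut_less[OF fin XY(2)] by blast+
  have Ane: "cut \<A> (up s) \<noteq> {}" "cut \<A> (lo s) \<noteq> {}"
    using XYs XY by (auto simp: cut_def)
  have Adb: "disjoint_boxes (cut \<A> (up s))" "disjoint_boxes (cut \<A> (lo s))"
    using \<A> e unfolding lo_def up_def by (auto intro: disjoint_boxes_cut_lower disjoint_boxes_cut_upper)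
  define A where "A = \<Union>\<A>"
  define B where "B = \<Union>\<B>"
  have AB: "open A" "bounded A" "open B" "bounded B"
    using \<A> \<B> by (simp_all add: A_def B_def disjoint_boxes_open disjoint_boxes_bounded)
  have Bpos: "?m B > 0"
    using \<B> ne AB by (intro measure_open_pos) (auto simp: B_def disjoint_boxes_def)
  have Aspl: "?m A = ?m (A \<inter> lo s) + ?m (A \<inter> up s)"
    using measure_split[OF e(1) AB(1,2)] by (simp add: lo_def up_def)
  have Apos: "?m (A \<inter> lo s) > 0" "?m (A \<inter> up s) > 0"
    using Ane AB o XYs XY by (auto intro!: measure_open_pos simp: A_def)
  \<comment> \<open>The share of \<open>A\<close> below its hyperplane; \<open>r\<close> is chosen
    next so that \<open>B\<close> is divided in the same proportion.\<close>
  define \<theta> where "\<theta> = ?m (A \<inter> lo s) / ?m A"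
  have lam: "0 < \<theta>" "\<theta> < 1" using Apos Aspl by (auto simp: \<theta>_def)
  obtain r where r: "?m (B \<inter> lo r) = \<theta> * ?m B"
    using disjoint_boxes_level[OF \<B> e(1), of "\<theta> * ?m B"] lam Bpos by (auto simp: B_def lo_def)
  have Bspl: "?m B = ?m (B \<inter> lo r) + ?m (B \<inter> up r)"
    using measure_split[OF e(1) AB(3,4)] by (simp add: lo_def up_def)
  then have r': "?m (B \<inter> up r) = (1 - \<theta>) * ?m B" using r by (simp add: algebra_simps)
  have s1: "?m (A \<inter> lo s) = \<theta> * ?m A" "?m (A \<inter> up s) = (1 - \<theta>) * ?m A"
    using Apos Aspl by (auto simp: \<theta>_def field_simps)
  have Bne: "cut \<B> (lo r) \<noteq> {}" "cut \<B> (up r) \<noteq> {}"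
  proof -
    have "B \<inter> lo r \<noteq> {}" "B \<inter> up r \<noteq> {}" using r r' lam Bpos by force+
    then show "cut \<B> (lo r) \<noteq> {}" "cut \<B> (up r) \<noteq> {}" by (auto simp: cut_def B_def)
  qed
  have Bdb: "disjoint_boxes (cut \<B> (up r))" "disjoint_boxes (cut \<B> (lo r))"
    using \<B> e unfolding lo_def up_def by (auto intro: disjoint_boxes_cut_lower disjoint_boxes_cut_upper)
  have Bc: "card (cut \<B> H) \<le> card \<B>" for H
    using \<B> by (auto simp: disjoint_boxes_def intro: card_cut_le)
  have BMlo: "brunn_minkowski (A \<inter> lo s) (B \<inter> lo r)" and BMup: "brunn_minkowski (A \<inter> up s) (B \<inter> up r)"
    using IH[of "cut \<A> (lo s)" "cut \<B> (lo r)"] IH[of "cut \<A> (up s)" "cut \<B> (up r)"] less Bc Ane Bne Adb Bdb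
    by (auto simp: Union_cut A_def B_def add_less_le_mono)
  \<comment> \<open>The hyperplane at height \<open>s + r\<close> separates the two partial sums, so
    their volumes add.\<close>
  have disj: "msum (A \<inter> lo s) (B \<inter> lo r) \<inter> msum (A \<inter> up s) (B \<inter> up r) = {}"
  proof -
    have "x + y \<noteq> x' + y'" if "x \<in> lo s" "y \<in> lo r" "x' \<in> up s" "y' \<in> up r" for x y x' y'
    proof -
      have "(x + y) \<bullet> e < (x' + y') \<bullet> e" using that by (simp add: lo_def up_def inner_simps)
      then show ?thesis by (metis less_irrefl)
    qed
    then show ?thesis unfolding msum_def by blast
  qed
  have homog: "(root ?n (l * x) + root ?n (l * y)) ^ ?n = l * (root ?n x + root ?n y) ^ ?n" if "l > 0" for l x y :: real
    using that by (simp add: real_root_mult distrib_left[symmetric] power_mult_distrib)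
  have op: "open (msum (A \<inter> H) (B \<inter> H'))" if "open H" for H H' using that AB by (intro open_msum) auto
  have bd: "bounded (msum A B)" using AB by (intro bounded_msum)
  have sub: "msum (A \<inter> H) (B \<inter> H') \<subseteq> msum A B" for H H' by (intro msum_mono) auto
  have fm: "msum (A \<inter> H) (B \<inter> H') \<in> fmeasurable lborel" if "open H" for H H'
    using op[OF that] emeasure_bounded_finite[OF bounded_subset[OF bd sub]] by (intro fmeasurableI) auto
  have "(root ?n (?m A) + root ?n (?m B)) ^ ?n
     = \<theta> * (root ?n (?m A) + root ?n (?m B)) ^ ?n + (1 - \<theta>) * (root ?n (?m A) + root ?n (?m B)) ^ ?n"
    by (simp add: algebra_simps)
  also have "\<dots> \<le> ?m (msum (A \<inter> lo s) (B \<inter> lo r)) + ?m (msum (A \<inter> up s) (B \<inter> up r))"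
    using BMlo BMup lam unfolding brunn_minkowski_def s1 r r' by (intro add_mono) (auto simp: homog)
  also have "\<dots> = ?m (msum (A \<inter> lo s) (B \<inter> lo r) \<union> msum (A \<inter> up s) (B \<inter> up r))"
    using disj fm o by (intro measure_Un_AE[symmetric]) auto
  also have "\<dots> \<le> ?m (msum A B)"
    using sub bd op o AB by (intro measure_open_bounded_mono open_msum open_Un) auto
  finally show ?thesis unfolding brunn_minkowski_def A_def B_def .
qed

text \<open>Induction on the total number of boxes. The cutting step wants two boxes in its first
  family; symmetry of the inequality supplies the other case, and a pair of single boxes is the
  base.\<close>

lemma brunn_minkowski_boxes:
  fixes \<A> \<B> :: "'a::euclidean_space set set"
  assumes "disjoint_boxes \<A>" "disjoint_boxes \<B>" "\<A> \<noteq> {}" "\<B> \<noteq> {}"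
  shows "brunn_minkowski (\<Union>\<A>) (\<Union>\<B>)"
  using assms
proof (induction "card \<A> + card \<B>" arbitrary: \<A> \<B> rule: less_induct)
  case less
  have pos: "card \<A> > 0" "card \<B> > 0"
    using less.prems by (auto simp: disjoint_boxes_def card_gt_0_iff)
  consider "card \<A> \<ge> 2" | "card \<B> \<ge> 2" | "card \<A> = 1" "card \<B> = 1" using pos by linarith
  then show ?case
  proof cases
    case 1
    show ?thesis by (rule brunn_minkowski_boxes_step[OF less.hyps less.prems(1,2,4) 1])
  next
    case 2
    have "brunn_minkowski (\<Union>\<B>) (\<Union>\<A>)"
      by (rule brunn_minkowski_boxes_step[OF less.hyps less.prems(2,1,3) 2]) (simp_all add: add.commute)
    then show ?thesis by (simp add: brunn_minkowski_commute)
  next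
    case 3
    obtain X where "\<A> = {X}" using 3(1) by (rule card_1_singletonE)
    moreover obtain Y where "\<B> = {Y}" using 3(2) by (rule card_1_singletonE)
    ultimately have "\<A> = {X}" "\<B> = {Y}" by auto
    have "X \<noteq> {} \<and> (\<exists>a b. X = box a b)" "Y \<noteq> {} \<and> (\<exists>c d. Y = box c d)"
      using less.prems(1,2) \<open>\<A> = {X}\<close> \<open>\<B> = {Y}\<close> by (simp_all add: disjoint_boxes_def)
    then obtain a b c d where "X = box a b" "Y = box c d" "X \<noteq> {}" "Y \<noteq> {}" by metis
    then show ?thesis using brunn_minkowski_box[of a b c d] \<open>\<A> = {X}\<close> \<open>\<B> = {Y}\<close> by simp
  qed
qed

text \<open>An open set is a countable union of closed boxes, so finitely many of them already carry
  nearly all of its volume. A division of that finite union has non-overlapping cells, and passing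
  to their interiors loses only a null set.\<close>

lemma open_approx_disjoint_boxes:
  fixes A :: "'a::euclidean_space set"
  assumes A: "open A" "bounded A" "A \<noteq> {}" and "\<epsilon> > 0"
  shows "\<exists>\<A>. disjoint_boxes \<A> \<and> \<A> \<noteq> {} \<and> \<Union>\<A> \<subseteq> A \<and> measure lborel A - \<epsilon> < measure lborel (\<Union>\<A>)"
proof -
  obtain \<D> where \<D>: "countable \<D>" "\<And>X. X \<in> \<D> \<Longrightarrow> X \<subseteq> A" "\<And>X. X \<in> \<D> \<Longrightarrow> \<exists>a b. X = cbox a b" "\<Union>\<D> = A"
    using open_countable_Union_open_cbox[OF A(1)] by (metis Pow_iff subset_iff)
  have "\<D> \<noteq> {}" using A(3) \<D>(4) by auto
  define f where "f = from_nat_into \<D>"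
  have f: "range f = \<D>" unfolding f_def using \<open>\<D> \<noteq> {}\<close> \<D>(1) by (rule range_from_nat_into)
  define U where "U n = (\<Union>i\<le>(n::nat). f i)" for n
  have Uborel: "U n \<in> sets borel" for n
    unfolding U_def using \<D>(3) f by (intro sets.finite_UN) (metis borel_closed closed_cbox finite_atMost rangeI)+
  have "(\<lambda>n. emeasure lborel (U n)) \<longlonglongrightarrow> emeasure lborel (\<Union>n. U n)"
    using Uborel by (intro Lim_emeasure_incseq) (auto simp: incseq_def U_def intro: order_trans)
  moreover have UA: "(\<Union>n. U n) = A" using \<D>(4) f unfolding U_def by auto
  moreover have fin: "emeasure lborel A < \<infinity>" using emeasure_bounded_finite[OF A(2)] .
  ultimately have "(\<lambda>n. measure lborel (U n)) \<longlonglongrightarrow> measure lborel A"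
    unfolding measure_def UA by (intro tendsto_enn2real) auto
  moreover have mA: "measure lborel A > 0" using A by (intro measure_open_pos)
  \<comment> \<open>The maximum with 0 also forces the finite union to have positive volume, and
    hence the family of boxes to be nonempty.\<close>
  then have "max 0 (measure lborel A - \<epsilon>) < measure lborel A" using \<open>\<epsilon> > 0\<close> by simp
  ultimately have "\<forall>\<^sub>F n in sequentially. max 0 (measure lborel A - \<epsilon>) < measure lborel (U n)"
    by (rule order_tendstoD)
  then obtain n where n: "max 0 (measure lborel A - \<epsilon>) < measure lborel (U n)"
    by (auto simp: eventually_sequentially)
  obtain p where p: "p division_of (U n)"
    unfolding U_def by (rule elementary_unions_intervals[of "f ` {..n}"]) (use \<D>(3) f in auto)
  \<comment> \<open>Degenerate cells have empty interior and are dropped.\<close>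
  define \<A> where "\<A> = interior ` p - {{}}"
  have db: "disjoint_boxes \<A>"
    unfolding disjoint_boxes_def
  proof (intro conjI ballI)
    show "finite \<A>" using p by (auto simp: \<A>_def division_of_def)
    show "disjoint \<A>" using p unfolding \<A>_def disjoint_def division_of_def by (metis DiffD1 imageE)
    fix X assume X: "X \<in> \<A>"
    then show "X \<noteq> {}" by (simp add: \<A>_def)
    show "\<exists>a b. X = box a b"
      using X p unfolding \<A>_def by (metis (no_types, lifting) DiffD1 division_ofD(4) imageE interior_cbox)
  qed
  have sub: "\<Union>\<A> \<subseteq> U n"
  proof
    fix x assume "x \<in> \<Union>\<A>"
    then obtain K where "K \<in> p" "x \<in> interior K" unfolding \<A>_def by auto
    then show "x \<in> U n" using interior_subset[of K] division_ofD(2)[OF p] by blast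
  qed
  have diff: "U n - \<Union>\<A> \<subseteq> (\<Union>K\<in>p. K - interior K)"
  proof
    fix x assume x: "x \<in> U n - \<Union>\<A>"
    then obtain K where "K \<in> p" "x \<in> K" using division_ofD(6)[OF p] by blast
    then show "x \<in> (\<Union>K\<in>p. K - interior K)" using x unfolding \<A>_def by blast
  qed
  have "negligible (\<Union>K\<in>p. K - interior K)"
  proof (rule negligible_Union[of "(\<lambda>K. K - interior K) ` p", simplified image_image])
    show "finite ((\<lambda>K. K - interior K) ` p)" using p by (auto simp: division_of_def)
    fix T assume "T \<in> (\<lambda>K. K - interior K) ` p"
    then obtain a b where "T = cbox a b - box a b"
      using p by (metis (no_types, lifting) division_ofD(4) imageE interior_cbox)
    then show "negligible T" by (simp add: negligible_frontier_interval)
  qed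
  then have N: "negligible (U n - \<Union>\<A>)" using diff negligible_subset by blast
  have oA: "open (\<Union>\<A>)" using db by (rule disjoint_boxes_open)
  then have "U n - \<Union>\<A> \<in> sets lborel" using Uborel by auto
  then have "U n - \<Union>\<A> \<in> null_sets lborel"
    using N by (simp add: negligible_iff_null_sets null_sets_completion_iff)
  then have "measure lborel (U n) = measure lborel (\<Union>\<A>)"
    using sub oA by (metis Diff_Diff_Int Int_absorb1 Uborel measure_Diff_null_set sets_lborel)
  then have "measure lborel A - \<epsilon> < measure lborel (\<Union>\<A>)" "0 < measure lborel (\<Union>\<A>)" using n by auto
  moreover have "\<Union>\<A> \<subseteq> A" using sub UA by auto
  moreover have "\<A> \<noteq> {}" using calculation by auto
  ultimately show ?thesis using db by blast
qed

text \<open>Inner approximation by boxes costs \<epsilon> in either volume, and \<epsilon> then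
  tends to 0; the maximum with 0 keeps the bases of the powers nonnegative. For open sets the sum is
  open, so its measurability is immediate.\<close>

theorem Brunn_Minkowski_open:
  fixes A B :: "'a::euclidean_space set"
  assumes A: "open A" "bounded A" "A \<noteq> {}" and B: "open B" "bounded B" "B \<noteq> {}"
  shows "(root DIM('a) (measure lborel A) + root DIM('a) (measure lborel B)) ^ DIM('a)
      \<le> measure lborel (msum A B)"
proof -
  let ?n = "DIM('a)" and ?m = "measure lborel"
  have *: "(root ?n (max 0 (?m A - \<epsilon>)) + root ?n (max 0 (?m B - \<epsilon>))) ^ ?n \<le> ?m (msum A B)" if "\<epsilon> > 0" for \<epsilon>
  proof -
    obtain \<A> where \<A>: "disjoint_boxes \<A>" "\<A> \<noteq> {}" "\<Union>\<A> \<subseteq> A" "?m A - \<epsilon> < ?m (\<Union>\<A>)"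
      using open_approx_disjoint_boxes[OF A \<open>\<epsilon> > 0\<close>] by blast
    obtain \<B> where \<B>: "disjoint_boxes \<B>" "\<B> \<noteq> {}" "\<Union>\<B> \<subseteq> B" "?m B - \<epsilon> < ?m (\<Union>\<B>)"
      using open_approx_disjoint_boxes[OF B \<open>\<epsilon> > 0\<close>] by blast
    have "(root ?n (max 0 (?m A - \<epsilon>)) + root ?n (max 0 (?m B - \<epsilon>))) ^ ?n
      \<le> (root ?n (?m (\<Union>\<A>)) + root ?n (?m (\<Union>\<B>))) ^ ?n"
      using \<A>(4) \<B>(4) by (intro power_mono add_mono real_root_le_mono add_nonneg_nonneg real_root_ge_zero) auto
    also have "\<dots> \<le> ?m (msum (\<Union>\<A>) (\<Union>\<B>))"
      using brunn_minkowski_boxes[OF \<A>(1) \<B>(1) \<A>(2) \<B>(2)] by (simp add: brunn_minkowski_def)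
    also have "\<dots> \<le> ?m (msum A B)"
      using \<A> \<B> A B by (intro measure_open_bounded_mono msum_mono open_msum bounded_msum disjoint_boxes_open) auto
    finally show ?thesis .
  qed
  have "((\<lambda>\<epsilon>. (root ?n (max 0 (?m A - \<epsilon>)) + root ?n (max 0 (?m B - \<epsilon>))) ^ ?n)
      \<longlongrightarrow> (root ?n (max 0 (?m A - 0)) + root ?n (max 0 (?m B - 0))) ^ ?n) (at_right 0)"
    by (intro tendsto_intros)
  then have "(root ?n (max 0 (?m A - 0)) + root ?n (max 0 (?m B - 0))) ^ ?n \<le> ?m (msum A B)"
    by (rule tendsto_upperbound) (auto simp: eventually_at_right_less * intro!: eventually_at_rightI[of 0 1])
  then show ?thesis by simp
qed

section \<open>Smooth and continuously differentiable functions\<close>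

lemma partial_deriv_eq: "(f has_derivative f') (at x) \<Longrightarrow> partial_deriv e f x = f' e"
  unfolding partial_deriv_def using frechet_derivative_at by metis

lemma inner_grad: "e \<in> Basis \<Longrightarrow> grad f x \<bullet> e = partial_deriv e f x"
  unfolding grad_def by simp

lemma has_derivative_grad:
  assumes "f differentiable at x"
  shows "(f has_derivative (\<lambda>h. grad f x \<bullet> h)) (at x)"
proof -
  have D: "(f has_derivative frechet_derivative f (at x)) (at x)"
    using assms frechet_derivative_works by blast
  then interpret bounded_linear "frechet_derivative f (at x)" by (rule has_derivative_bounded_linear)
  have "frechet_derivative f (at x) h = grad f x \<bullet> h" for h
  proof -
    have "frechet_derivative f (at x) h = frechet_derivative f (at x) (\<Sum>e\<in>Basis. (h \<bullet> e) *\<^sub>R e)"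
      by (simp add: euclidean_representation)
    also have "\<dots> = (\<Sum>e\<in>Basis. (h \<bullet> e) * frechet_derivative f (at x) e)"
      by (simp add: sum scaleR)
    also have "\<dots> = grad f x \<bullet> h"
      unfolding grad_def partial_deriv_def inner_sum_left
      by (intro sum.cong) (auto simp: inner_commute mult.commute)
    finally show ?thesis .
  qed
  then have "frechet_derivative f (at x) = (\<lambda>h. grad f x \<bullet> h)" by blast
  with D show ?thesis by metis
qed

lemma grad_eqI:
  assumes "(f has_derivative (\<lambda>h. g \<bullet> h)) (at x)"
  shows "grad f x = g"
  by (rule euclidean_eqI) (simp add: inner_grad partial_deriv_eq[OF assms])

lemma C_k_Suc_differentiable: "C_k (Suc k) f \<Longrightarrow> f differentiable at x"
  by (simp add: differentiable_on_def)

text \<open>Reduces regularity to that of an explicitly known derivative \<open>f'\<close>, so that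
  \<open>frechet_derivative\<close> need not be handled in each instance.\<close>

lemma C_k_SucI:
  assumes "\<And>x. (f has_derivative f' x) (at x)" "\<And>e. e \<in> Basis \<Longrightarrow> C_k k (\<lambda>x. f' x e)"
  shows "C_k (Suc k) f"
proof -
  have "partial_deriv e f = (\<lambda>x. f' x e)" for e
    using partial_deriv_eq[OF assms(1)] by blast
  then show ?thesis
    using assms by (auto simp: differentiable_on_def differentiable_def intro: has_derivative_at_withinI)
qed

lemma C_k_decseq: "C_k (Suc k) f \<Longrightarrow> C_k k f"
proof (induction k arbitrary: f)
  case 0
  then show ?case by (simp add: differentiable_imp_continuous_on)
next
  case (Suc k)
  have "C_k k (partial_deriv e f)" if "e \<in> Basis" for e
    using Suc that by (metis C_k.simps(2))
  then show ?case using Suc by simp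
qed

lemma C_k_0I: "C_k k f \<Longrightarrow> continuous_on UNIV f"
  by (induction k) (auto intro: differentiable_imp_continuous_on)

lemma C_k_const: "C_k k (\<lambda>x. c)"
proof (induction k arbitrary: c)
  case (Suc k)
  then show ?case by (intro C_k_SucI[where f' = "\<lambda>x h. 0"]) auto
qed simp

lemma C_k_bounded_linear:
  assumes "bounded_linear f"
  shows "C_k k f"
proof (cases k)
  case 0
  then show ?thesis using assms by (simp add: linear_continuous_on)
next
  case (Suc l)
  show ?thesis unfolding Suc
    by (rule C_k_SucI[where f' = "\<lambda>x. f"]) (intro bounded_linear_imp_has_derivative assms C_k_const)+
qed

lemma C_k_add: "C_k k f \<Longrightarrow> C_k k g \<Longrightarrow> C_k k (\<lambda>x. f x + g x)"
proof (induction k arbitrary: f g)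
  case 0
  then show ?case by (simp add: continuous_on_add)
next
  case (Suc k)
  have D: "((\<lambda>x. f x + g x) has_derivative (\<lambda>h. grad f x \<bullet> h + grad g x \<bullet> h)) (at x)" for x
    using Suc.prems by (intro derivative_intros has_derivative_grad C_k_Suc_differentiable)
  show ?case
  proof (rule C_k_SucI[OF D])
    fix e :: 'a assume e: "e \<in> Basis"
    show "C_k k (\<lambda>x. grad f x \<bullet> e + grad g x \<bullet> e)"
      unfolding inner_grad[OF e] using Suc e by auto
  qed
qed

lemma C_k_mult: "C_k k f \<Longrightarrow> C_k k g \<Longrightarrow> C_k k (\<lambda>x. f x * g x)"
proof (induction k arbitrary: f g)
  case 0
  then show ?case by (simp add: continuous_on_mult)
next
  case (Suc k)
  have D: "((\<lambda>x. f x * g x) has_derivative (\<lambda>h. f x * (grad g x \<bullet> h) + (grad f x \<bullet> h) * g x)) (at x)" for x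
    using Suc.prems by (intro has_derivative_mult has_derivative_grad C_k_Suc_differentiable)
  show ?case
  proof (rule C_k_SucI[OF D])
    fix e :: 'a assume e: "e \<in> Basis"
    show "C_k k (\<lambda>x. f x * (grad g x \<bullet> e) + (grad f x \<bullet> e) * g x)"
      unfolding inner_grad[OF e] using Suc e C_k_decseq[OF Suc.prems(1)] C_k_decseq[OF Suc.prems(2)]
      by (intro C_k_add Suc.IH) auto
  qed
qed

lemma has_derivative_affine:
  assumes "f differentiable at (z + s *\<^sub>R x)"
  shows "((\<lambda>y. f (z + s *\<^sub>R y)) has_derivative (\<lambda>h. (s *\<^sub>R grad f (z + s *\<^sub>R x)) \<bullet> h)) (at x)"
proof -
  have "((\<lambda>y. z + s *\<^sub>R y) has_derivative (\<lambda>h. 0 + s *\<^sub>R h)) (at x)"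
    by (intro derivative_intros)
  from has_derivative_compose[OF this has_derivative_grad[OF assms]]
  show ?thesis by simp
qed

lemma C_k_affine: "C_k k f \<Longrightarrow> C_k k (\<lambda>y. f (z + s *\<^sub>R y))"
proof (induction k arbitrary: f)
  case 0
  then have "continuous_on UNIV f" by simp
  then show ?case
    by (auto intro!: continuous_intros continuous_on_compose2[of UNIV f UNIV])
next
  case (Suc k)
  show ?case
  proof (rule C_k_SucI[OF has_derivative_affine])
    show "f differentiable at (z + s *\<^sub>R x)" for x
      using Suc.prems by (rule C_k_Suc_differentiable)
    fix e :: 'a assume e: "e \<in> Basis"
    show "C_k k (\<lambda>x. (s *\<^sub>R grad f (z + s *\<^sub>R x)) \<bullet> e)"
      using Suc e by (auto simp: inner_grad[OF e] intro!: C_k_mult C_k_const)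
  qed
qed

text \<open>The powers of \<open>1 / t\<close> make this family closed under differentiation.\<close>

definition cutexp :: "nat \<Rightarrow> real \<Rightarrow> real" where
  "cutexp m t = (if t > 0 then (1 / t) ^ m * exp (- (1 / t)) else 0)"

lemma cutexp_nonneg: "0 \<le> cutexp m t"
  by (simp add: cutexp_def)

lemma power_le_fact_exp: "0 \<le> y \<Longrightarrow> y ^ n \<le> fact n * exp (y :: real)"
proof -
  assume y: "0 \<le> y"
  have "y ^ n / fact n = (\<Sum>k\<in>{n}. y ^ k /\<^sub>R fact k)" by (simp add: divide_inverse mult.commute)
  also have "\<dots> \<le> (\<Sum>k. y ^ k /\<^sub>R fact k)"
    using y summable_exp_generic[of y] by (intro sum_le_suminf) auto
  also have "\<dots> = exp y" by (simp add: exp_def)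
  finally show ?thesis by (simp add: field_simps)
qed

text \<open>From \<open>y ^ (m + 2) \<le> fact (m + 2) * exp y\<close> at \<open>y = 1 / t\<close>.
  The quadratic bound makes the difference quotient at 0 tend to 0, the one delicate point in the
  smoothness of \<open>cutexp\<close>.\<close>

lemma cutexp_le_square: "cutexp m t \<le> fact (m + 2) * t\<^sup>2"
proof (cases "t > 0")
  case True
  have "(1 / t) ^ (m + 2) * exp (- (1 / t)) \<le> fact (m + 2)"
    using power_le_fact_exp[of "1 / t" "m + 2"] True by (simp add: exp_minus field_simps)
  then have "t\<^sup>2 * ((1 / t) ^ (m + 2) * exp (- (1 / t))) \<le> t\<^sup>2 * fact (m + 2)"
    by (intro mult_left_mono) auto
  moreover have "t\<^sup>2 * ((1 / t) ^ (m + 2) * exp (- (1 / t))) = cutexp m t"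
    using True by (simp add: cutexp_def power_add power2_eq_square)
  ultimately show ?thesis by (simp add: mult.commute)
qed (simp add: cutexp_def)

lemma cutexp_has_derivative:
  "(cutexp m has_real_derivative cutexp (m + 2) t - m * cutexp (m + 1) t) (at t)"
proof -
  consider "t > 0" | "t = 0" | "t < 0" by linarith
  then show ?thesis
  proof cases
    case 1
    have "((\<lambda>t. (1 / t) ^ m * exp (- (1 / t))) has_real_derivative cutexp (m + 2) t - m * cutexp (m + 1) t) (at t)"
    proof -
      have "((\<lambda>t. (1 / t) ^ m * exp (- (1 / t))) has_real_derivative
         (1 / t) ^ m * (exp (- (1 / t)) * (1 / t ^ 2)) + (m * (1 / t) ^ (m - 1) * (- (1 / t ^ 2))) * exp (- (1 / t))) (at t)"
        using 1 by (auto intro!: derivative_eq_intros simp: power2_eq_square)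
      moreover have "m * (1 / t) ^ (m - 1) * (1 / t ^ 2) = m * (1 / t) ^ (m + 1)"
        using 1 by (cases m) (auto simp: power2_eq_square)
      then have "(1 / t) ^ m * (exp (- (1 / t)) * (1 / t ^ 2)) + (m * (1 / t) ^ (m - 1) * (- (1 / t ^ 2))) * exp (- (1 / t))
        = (1 / t) ^ m * (exp (- (1 / t)) * (1 / t ^ 2)) - (m * (1 / t) ^ (m + 1)) * exp (- (1 / t))"
        by simp
      also have "\<dots> = cutexp (m + 2) t - m * cutexp (m + 1) t"
        using 1 by (simp add: cutexp_def power_add power2_eq_square)
      ultimately show ?thesis by simp
    qed
    then show ?thesis
      by (rule has_field_derivative_transform_within_open[where S = "{0<..}"]) (use 1 in \<open>auto simp: cutexp_def\<close>)
  next
    case 2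
    have "((\<lambda>h. (cutexp m (0 + h) - cutexp m 0) / h) \<longlongrightarrow> 0) (at 0)"
    proof (rule Lim_null_comparison)
      show "\<forall>\<^sub>F h in at 0. norm ((cutexp m (0 + h) - cutexp m 0) / h) \<le> fact (m + 2) * \<bar>h\<bar>"
      proof (rule eventually_at_filter[THEN iffD2], rule always_eventually, intro allI impI)
        fix h :: real assume "h \<noteq> 0"
        have "\<bar>cutexp m h\<bar> \<le> fact (m + 2) * \<bar>h\<bar> * \<bar>h\<bar>"
          using cutexp_le_square[of m h] cutexp_nonneg[of m h] by (simp add: power2_eq_square mult.assoc)
        then show "norm ((cutexp m (0 + h) - cutexp m 0) / h) \<le> fact (m + 2) * \<bar>h\<bar>"
          using \<open>h \<noteq> 0\<close> by (simp add: abs_divide divide_le_eq cutexp_def)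
      qed
      show "((\<lambda>h::real. fact (m + 2) * \<bar>h\<bar>) \<longlongrightarrow> 0) (at 0)"
        by (auto intro!: tendsto_eq_intros)
    qed
    then show ?thesis using 2 by (simp add: DERIV_def cutexp_def)
  next
    case 3
    have "((\<lambda>t. 0) has_real_derivative 0) (at t)" by simp
    then have "(cutexp m has_real_derivative 0) (at t)"
      by (rule has_field_derivative_transform_within_open[where S = "{..<0}"]) (use 3 in \<open>auto simp: cutexp_def\<close>)
    then show ?thesis using 3 by (simp add: cutexp_def)
  qed
qed

lemma C_k_cutexp: "C_k k (\<lambda>x::'a::euclidean_space. cutexp m (c - x \<bullet> x))"
proof (induction k arbitrary: m)
  case 0
  have "isCont (cutexp m) t" for t using cutexp_has_derivative DERIV_isCont by blast
  then have "continuous_on UNIV (cutexp m)" by (simp add: continuous_at_imp_continuous_on)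
  then show ?case by (auto intro!: continuous_intros continuous_on_compose2[of UNIV "cutexp m" UNIV])
next
  case (Suc k)
  have D: "((\<lambda>x. cutexp m (c - x \<bullet> x)) has_derivative
     (\<lambda>h. (cutexp (m + 2) (c - x \<bullet> x) + (- real m) * cutexp (m + 1) (c - x \<bullet> x)) * ((- 2) * (x \<bullet> h)))) (at x)" for x :: 'a
  proof -
    have "((\<lambda>x. c - x \<bullet> x) has_derivative (\<lambda>h. 0 - (x \<bullet> h + h \<bullet> x))) (at x)"
      by (intro derivative_intros)
    from has_derivative_compose[OF this cutexp_has_derivative[unfolded has_field_derivative_def]]
    show ?thesis by (simp add: inner_commute mult.commute algebra_simps)
  qed
  show ?case
    by (rule C_k_SucI[OF D])
      (intro C_k_mult C_k_add C_k_const Suc.IH C_k_bounded_linear bounded_linear_inner_left)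
qed

text \<open>The classical function exp(-1/(r^2 - |x|^2)) on the ball of radius \<open>r\<close>,
  extended by 0.\<close>

definition bump :: "real \<Rightarrow> 'a::euclidean_space \<Rightarrow> real" where
  "bump r x = cutexp 0 (r\<^sup>2 - x \<bullet> x)"

lemma bump_nonneg: "0 \<le> bump r x"
  by (simp add: bump_def cutexp_nonneg)

lemma bump_pos_iff: "r > 0 \<Longrightarrow> 0 < bump r x \<longleftrightarrow> norm x < r"
  by (auto simp: bump_def cutexp_def dot_square_norm power_strict_mono intro: power2_less_imp_less)

section \<open>Test functions and continuously differentiable functions of compact support\<close>

lemma test_functionI:
  assumes "\<And>k. C_k k f" "\<And>x. R < norm x \<Longrightarrow> f x = 0"
  shows "test_function f"
  unfolding test_function_def using assms
  by (intro conjI allI exI[of _ "cball 0 R"]) auto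

lemma test_function_support:
  assumes "test_function f"
  shows "\<exists>R>0. \<forall>x. R \<le> norm x \<longrightarrow> f x = 0"
proof -
  obtain K where K: "compact K" "\<And>x. x \<notin> K \<Longrightarrow> f x = 0" using assms by (auto simp: test_function_def)
  obtain R where "R > 0" "\<And>x. x \<in> K \<Longrightarrow> norm x < R" using K(1) by (meson bounded_pos_less compact_imp_bounded)
  then show ?thesis using K(2) by (meson not_le)
qed

lemma test_function_C_k: "test_function f \<Longrightarrow> C_k k f"
  by (simp add: test_function_def)

lemma test_function_bump: "r > 0 \<Longrightarrow> test_function (bump r :: 'a::euclidean_space \<Rightarrow> real)"
proof (rule test_functionI[where R = r])
  show "C_k k (bump r :: 'a \<Rightarrow> real)" for k unfolding bump_def[abs_def] by (rule C_k_cutexp)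
  show "bump r x = 0" if "r > 0" "r < norm x" for x :: 'a
    using that bump_pos_iff[of r x] bump_nonneg[of r x] by simp
qed

lemma test_function_mult:
  assumes "test_function f" "\<And>k. C_k k g"
  shows "test_function (\<lambda>x. f x * g x)"
proof -
  obtain R where "\<And>x. R \<le> norm x \<Longrightarrow> f x = 0" using test_function_support[OF assms(1)] by blast
  then show ?thesis
    using assms by (intro test_functionI[where R = R] C_k_mult) (auto simp: test_function_def)
qed

lemma test_function_cmult: "test_function f \<Longrightarrow> test_function (\<lambda>x. c * f x)"
  using test_function_mult[of f "\<lambda>x. c"] by (simp add: C_k_const mult.commute)

lemma test_function_affine:
  fixes z :: "'a::euclidean_space"
  assumes "test_function f" "s \<noteq> 0"
  shows "test_function (\<lambda>y. f (z + s *\<^sub>R y))"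
proof -
  obtain R where R: "R > 0" "\<And>x. R \<le> norm x \<Longrightarrow> f x = 0" using test_function_support[OF assms(1)] by blast
  show ?thesis
  proof (rule test_functionI[where R = "(R + norm z) / \<bar>s\<bar>"])
    show "C_k k (\<lambda>y. f (z + s *\<^sub>R y))" for k using assms by (intro C_k_affine test_function_C_k)
    fix y :: 'a assume "(R + norm z) / \<bar>s\<bar> < norm y"
    then have "R + norm z < norm (s *\<^sub>R y)" using assms(2) by (simp add: divide_less_eq mult.commute)
    then have "R \<le> norm (z + s *\<^sub>R y)" using norm_triangle_ineq2[of "s *\<^sub>R y" "- z"] by (simp add: add.commute)
    then show "f (z + s *\<^sub>R y) = 0" by (rule R)
  qed
qed

lemma test_function_partial_deriv:
  assumes "test_function f" "e \<in> Basis"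
  shows "test_function (partial_deriv e f)"
proof -
  obtain R where R: "\<And>x. R \<le> norm x \<Longrightarrow> f x = 0" using test_function_support[OF assms(1)] by blast
  have "partial_deriv e f x = 0" if "R < norm x" for x
  proof -
    have "open {x::'a. R < norm x}" by (intro open_Collect_less continuous_intros)
    then have "(f has_derivative (\<lambda>h. 0)) (at x)"
      by (rule has_derivative_transform_within_open[OF has_derivative_const[of 0]]) (use that R in auto)
    then show ?thesis by (simp add: partial_deriv_eq)
  qed
  moreover have "C_k k (partial_deriv e f)" for k
    using test_function_C_k[OF assms(1), of "Suc k"] assms(2) by simp
  ultimately show ?thesis by (intro test_functionI) auto
qed

text \<open>The working class: it contains the test functions and is wide enough for the smoothed
  rearrangements, which are shown to be C^1 and no more.\<close>

definition C1c :: "('a::euclidean_space \<Rightarrow> real) \<Rightarrow> bool" where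
  "C1c f \<longleftrightarrow> (\<forall>x. f differentiable at x) \<and> continuous_on UNIV (grad f) \<and> (\<exists>R. \<forall>x. R \<le> norm x \<longrightarrow> f x = 0)"

lemma C1cI:
  assumes "\<And>x. (f has_derivative (\<lambda>h. g x \<bullet> h)) (at x)" "continuous_on UNIV g" "\<And>x. R \<le> norm x \<Longrightarrow> f x = 0"
  shows "C1c f" "grad f = g"
proof -
  show "grad f = g" using grad_eqI[OF assms(1)] by blast
  then show "C1c f" using assms unfolding C1c_def differentiable_def by auto
qed

lemma C1c_has_derivative: "C1c f \<Longrightarrow> (f has_derivative (\<lambda>h. grad f x \<bullet> h)) (at x)"
  by (simp add: C1c_def has_derivative_grad)

lemma C1c_continuous: "C1c f \<Longrightarrow> continuous_on UNIV f"
  by (meson C1c_def continuous_at_imp_continuous_on differentiable_imp_continuous_within)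

lemma C1c_continuous_grad: "C1c f \<Longrightarrow> continuous_on UNIV (grad f)"
  by (simp add: C1c_def)

lemma C1c_support:
  assumes "C1c f"
  shows "\<exists>R>0. \<forall>x. R \<le> norm x \<longrightarrow> f x = 0 \<and> grad f x = 0"
proof -
  obtain R where R: "\<And>x. R \<le> norm x \<Longrightarrow> f x = 0" using assms by (auto simp: C1c_def)
  have "grad f x = 0" if "R < norm x" for x
  proof -
    have "open {x::'a. R < norm x}" by (intro open_Collect_less continuous_intros)
    then have "(f has_derivative (\<lambda>h. 0)) (at x)"
      by (rule has_derivative_transform_within_open[OF has_derivative_const[of 0]]) (use that R in auto)
    then show ?thesis by (intro grad_eqI) simp
  qed
  \<comment> \<open>The gradient is known to vanish strictly outside \<open>R\<close> only, hence
    the added 1; the maximum with 0 makes the radius positive.\<close>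
  then show ?thesis using R by (intro exI[of _ "max R 0 + 1"]) auto
qed

lemma test_function_C1c:
  assumes "test_function f"
  shows "C1c f"
proof -
  have "f differentiable at x" for x using test_function_C_k[OF assms] by (rule C_k_Suc_differentiable)
  moreover have "continuous_on UNIV (grad f)"
    unfolding grad_def[abs_def] using test_function_C_k[OF assms, of "Suc 0"] by (auto intro!: continuous_intros)
  ultimately show ?thesis using test_function_support[OF assms] by (auto simp: C1c_def)
qed

lemma C1c_mult:
  assumes "C1c f" "\<And>x. (g has_derivative (\<lambda>h. g' x \<bullet> h)) (at x)" "continuous_on UNIV g'"
  shows "C1c (\<lambda>x. f x * g x)" "grad (\<lambda>x. f x * g x) = (\<lambda>x. f x *\<^sub>R g' x + g x *\<^sub>R grad f x)"
proof -
  obtain R where R: "\<And>x. R \<le> norm x \<Longrightarrow> f x = 0" using assms(1) by (auto simp: C1c_def)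
  have D: "((\<lambda>x. f x * g x) has_derivative (\<lambda>h. (f x *\<^sub>R g' x + g x *\<^sub>R grad f x) \<bullet> h)) (at x)" for x
    using has_derivative_mult[OF C1c_has_derivative[OF assms(1)] assms(2)]
    by (simp add: inner_add_left mult.commute)
  have "continuous_on UNIV g"
    by (meson assms(2) continuous_at_imp_continuous_on has_derivative_continuous)
  then have c: "continuous_on UNIV (\<lambda>x. f x *\<^sub>R g' x + g x *\<^sub>R grad f x)"
    using assms C1c_continuous C1c_continuous_grad by (intro continuous_intros) auto
  show "C1c (\<lambda>x. f x * g x)" "grad (\<lambda>x. f x * g x) = (\<lambda>x. f x *\<^sub>R g' x + g x *\<^sub>R grad f x)"
    using C1cI[OF D c, of R] R by auto
qed

lemma C1c_add:
  assumes "C1c f" "C1c g"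
  shows "C1c (\<lambda>x. f x + g x)" "grad (\<lambda>x. f x + g x) = (\<lambda>x. grad f x + grad g x)"
proof -
  obtain R1 R2 where R: "\<And>x. R1 \<le> norm x \<Longrightarrow> f x = 0" "\<And>x. R2 \<le> norm x \<Longrightarrow> g x = 0"
    using assms by (meson C1c_def)
  have D: "((\<lambda>x. f x + g x) has_derivative (\<lambda>h. (grad f x + grad g x) \<bullet> h)) (at x)" for x
    using has_derivative_add[OF C1c_has_derivative[OF assms(1)] C1c_has_derivative[OF assms(2)]]
    by (simp add: inner_add_left)
  have c: "continuous_on UNIV (\<lambda>x. grad f x + grad g x)"
    using assms by (intro continuous_intros C1c_continuous_grad)
  show "C1c (\<lambda>x. f x + g x)" "grad (\<lambda>x. f x + g x) = (\<lambda>x. grad f x + grad g x)"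
    using C1cI[OF D c, of "max R1 R2"] R by auto
qed

lemma C1c_cmult:
  assumes "C1c f"
  shows "C1c (\<lambda>x. c * f x)" "grad (\<lambda>x. c * f x) = (\<lambda>x. c *\<^sub>R grad f x)"
  using C1c_mult[OF assms, of "\<lambda>x. c" "\<lambda>x. 0"] by (auto simp: mult.commute)

lemma C1c_scale:
  assumes "C1c f" "s \<noteq> 0"
  shows "C1c (\<lambda>x. f (s *\<^sub>R x))" "grad (\<lambda>x. f (s *\<^sub>R x)) = (\<lambda>x. s *\<^sub>R grad f (s *\<^sub>R x))"
proof -
  obtain R where R: "\<And>x. R \<le> norm x \<Longrightarrow> f x = 0" using assms by (meson C1c_def)
  have D: "((\<lambda>y. f (s *\<^sub>R y)) has_derivative (\<lambda>h. (s *\<^sub>R grad f (s *\<^sub>R x)) \<bullet> h)) (at x)" for x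
    using has_derivative_affine[of f 0 s x] assms by (simp add: C1c_def)
  have c: "continuous_on UNIV (\<lambda>x. s *\<^sub>R grad f (s *\<^sub>R x))"
    using C1c_continuous_grad[OF assms(1)] by (auto intro!: continuous_intros continuous_on_compose2[of UNIV "grad f" UNIV])
  have "f (s *\<^sub>R x) = 0" if "R / \<bar>s\<bar> \<le> norm x" for x
    using that assms(2) by (intro R) (simp add: divide_le_eq mult.commute)
  then show "C1c (\<lambda>x. f (s *\<^sub>R x))" "grad (\<lambda>x. f (s *\<^sub>R x)) = (\<lambda>x. s *\<^sub>R grad f (s *\<^sub>R x))"
    using C1cI[OF D c, of "R / \<bar>s\<bar>"] by auto
qed

section \<open>Integration by parts for compactly supported functions\<close>

lemma integrable_compact_support:
  fixes f :: "'a::euclidean_space \<Rightarrow> 'b::euclidean_space"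
  assumes "continuous_on UNIV f" "\<And>x. R \<le> norm x \<Longrightarrow> f x = 0"
  shows "integrable lborel f"
proof -
  have "integrable lborel (\<lambda>x. indicator (cball 0 R) x *\<^sub>R f x)"
    using assms(1) by (intro borel_integrable_compact) (auto intro: continuous_on_subset)
  moreover have "(\<lambda>x. indicator (cball 0 R) x *\<^sub>R f x) = f"
    using assms(2) by (auto simp: indicator_def)
  ultimately show ?thesis by simp
qed

lemma C1c_bounded_grad:
  assumes "C1c f"
  shows "\<exists>L>0. (\<forall>x. norm (grad f x) \<le> L) \<and> (\<forall>x y. \<bar>f x - f y\<bar> \<le> L * norm (x - y))"
proof -
  obtain R where R: "\<And>x. R \<le> norm x \<Longrightarrow> grad f x = 0" using C1c_support[OF assms] by auto
  have "compact (grad f ` cball 0 R)"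
    using C1c_continuous_grad[OF assms] by (intro compact_continuous_image) (auto intro: continuous_on_subset)
  then obtain L where L: "L > 0" "\<And>x. x \<in> cball 0 R \<Longrightarrow> norm (grad f x) \<le> L"
    by (metis bounded_pos compact_imp_bounded image_eqI)
  have b: "norm (grad f x) \<le> L" for x using L R by (cases "norm x \<le> R") auto
  have "norm (f x - f y) \<le> L * norm (x - y)" for x y
  proof (rule differentiable_bound[OF convex_UNIV])
    show "(f has_derivative (\<lambda>h. grad f z \<bullet> h)) (at z within UNIV)" for z
      using C1c_has_derivative[OF assms] by simp
    show "onorm (\<lambda>h. grad f z \<bullet> h) \<le> L" for z
    proof (rule onorm_bound)
      show "0 \<le> L" using L(1) by simp
      fix x show "norm (grad f z \<bullet> x) \<le> L * norm x"
        using order_trans[OF Cauchy_Schwarz_ineq2[of "grad f z" x] mult_right_mono[OF b[of z]]] by simp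
    qed
  qed auto
  then show ?thesis using L(1) b by (intro exI[of _ L]) auto
qed

lemma integral_translate:
  fixes f :: "'a::euclidean_space \<Rightarrow> 'b::euclidean_space"
  assumes [measurable]: "f \<in> borel_measurable borel"
  shows "(\<integral>x. f (x + y) \<partial>lborel) = (\<integral>x. f x \<partial>lborel)"
proof -
  have "(\<integral>x. f x \<partial>lborel) = (\<integral>x. f x \<partial>distr lborel borel ((+) y))" by (simp only: lborel_distr_plus)
  also have "\<dots> = (\<integral>x. f (y + x) \<partial>lborel)" by (subst integral_distr) auto
  finally show ?thesis by (simp add: add.commute)
qed

text \<open>By translation invariance every difference quotient of \<open>f\<close> has integral 0,
  and the Lipschitz bound on a fixed ball dominates these quotients, so the limit passes under the
  integral. All integrations by parts below go back to this fact.\<close>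

lemma C1c_integral_grad:
  fixes f :: "'a::euclidean_space \<Rightarrow> real"
  assumes "C1c f"
  shows "(\<integral>x. grad f x \<bullet> e \<partial>lborel) = 0"
proof -
  obtain L where L: "L > 0" "\<And>x y. \<bar>f x - f y\<bar> \<le> L * norm (x - y)" using C1c_bounded_grad[OF assms] by blast
  obtain R where R: "R > 0" "\<And>x. R \<le> norm x \<Longrightarrow> f x = 0" using C1c_support[OF assms] by auto
  have [measurable]: "f \<in> borel_measurable borel" "grad f \<in> borel_measurable borel"
    using C1c_continuous[OF assms] C1c_continuous_grad[OF assms] by (auto intro: borel_measurable_continuous_onI)
  have int: "integrable lborel (\<lambda>x. f (x + y))" for y
  proof (rule integrable_compact_support[where R = "R + norm y"])
    show "continuous_on UNIV (\<lambda>x. f (x + y))"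
      using C1c_continuous[OF assms] by (auto intro!: continuous_intros continuous_on_compose2[of UNIV f UNIV])
    show "f (x + y) = 0" if "R + norm y \<le> norm x" for x
      using that norm_triangle_ineq2[of x "- y"] by (intro R) simp
  qed
  define t where "t n = 1 / real (Suc n)" for n
  define q where "q n x = (f (x + t n *\<^sub>R e) - f x) / t n" for n x
  have tpos: "t n > 0" "t n \<le> 1" for n by (auto simp: t_def)
  have t0: "t \<longlonglongrightarrow> 0" unfolding t_def by (rule lim_1_over_n[THEN LIMSEQ_Suc])
  have zero: "(\<integral>x. q n x \<partial>lborel) = 0" for n
    unfolding q_def using int[of "t n *\<^sub>R e"] int[of 0] by (simp add: integral_translate)
  have "(\<lambda>n. \<integral>x. q n x \<partial>lborel) \<longlonglongrightarrow> (\<integral>x. grad f x \<bullet> e \<partial>lborel)"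
  \<comment> \<open>Steps \<open>t n\<close> of length at most 1 keep all quotients supported in the
    ball of radius \<open>R + norm e\<close>.\<close>
  proof (rule integral_dominated_convergence[where w = "\<lambda>x. indicator (cball 0 (R + norm e)) x * (L * norm e)"])
    show "integrable lborel (\<lambda>x. indicator (cball 0 (R + norm e)) x * (L * norm e))"
      using emeasure_bounded_finite[OF bounded_cball[of 0 "R + norm e"]]
      by (intro integrable_mult_left integrable_real_indicator) auto
    show "AE x in lborel. (\<lambda>n. q n x) \<longlonglongrightarrow> grad f x \<bullet> e"
    proof (rule AE_I2)
      fix x
      have l: "((\<lambda>s. x + s *\<^sub>R e) has_derivative (\<lambda>h. 0 + h *\<^sub>R e)) (at 0)"
        by (intro derivative_intros)
      have "((\<lambda>s. f (x + s *\<^sub>R e)) has_derivative (\<lambda>h. grad f x \<bullet> (0 + h *\<^sub>R e))) (at 0)"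
        using has_derivative_compose[OF l, of f "\<lambda>h. grad f x \<bullet> h"] C1c_has_derivative[OF assms, of x] by simp
      then have "((\<lambda>s. f (x + s *\<^sub>R e)) has_real_derivative (grad f x \<bullet> e)) (at 0)"
        by (simp add: has_field_derivative_def mult.commute[of _ "grad f x \<bullet> e"])
      then have "((\<lambda>s. (f (x + s *\<^sub>R e) - f x) / s) \<longlongrightarrow> grad f x \<bullet> e) (at 0)"
        by (simp add: DERIV_def)
      moreover have "filterlim t (at 0) sequentially"
        using t0 tpos by (auto simp: filterlim_at intro!: always_eventually) (metis less_irrefl)
      ultimately show "(\<lambda>n. q n x) \<longlonglongrightarrow> grad f x \<bullet> e"
        unfolding q_def by (rule filterlim_compose)
    qed
    show "AE x in lborel. norm (q n x) \<le> indicator (cball 0 (R + norm e)) x * (L * norm e)" for n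
    proof (rule AE_I2)
      fix x
      show "norm (q n x) \<le> indicator (cball 0 (R + norm e)) x * (L * norm e)"
      proof (cases "norm x \<le> R + norm e")
        case True
        have "\<bar>f (x + t n *\<^sub>R e) - f x\<bar> \<le> L * (t n * norm e)"
          using L(2)[of "x + t n *\<^sub>R e" x] tpos[of n] by simp
        then show ?thesis using True tpos[of n] by (simp add: q_def abs_divide divide_le_eq mult_ac)
      next
        case False
        have "t n * norm e \<le> norm e" using tpos[of n] by (intro mult_left_le_one_le) auto
        then have "R \<le> norm (x + t n *\<^sub>R e)"
          using False norm_triangle_ineq2[of x "- (t n *\<^sub>R e)"] tpos[of n] by simp
        moreover have "R \<le> norm x" using False norm_ge_zero[of e] by linarith
        ultimately show ?thesis using False R(2) by (simp add: q_def)
      qed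
    qed
  qed (auto simp: q_def)
  then show ?thesis using zero LIMSEQ_unique[OF _ tendsto_const[of 0]] by simp
qed

lemma continuous_locally_integrable:
  fixes f :: "'a::euclidean_space \<Rightarrow> 'b::euclidean_space"
  assumes "continuous_on UNIV f"
  shows "locally_integrable f"
  unfolding locally_integrable_def set_integrable_def
proof (intro allI impI)
  fix K :: "'a set" assume K: "compact K"
  then have "integrable lborel (\<lambda>x. indicator K x *\<^sub>R f x)"
    using assms by (intro borel_integrable_compact) (auto intro: continuous_on_subset)
  then show "integrable lebesgue (\<lambda>x. indicat_real K x *\<^sub>R f x)"
    by (subst integrable_completion) auto
qed

text \<open>The gradient of the product \<open>u x * \<phi> x\<close> has integral 0.\<close>

lemma C1c_is_weak_grad:
  fixes u :: "'a::euclidean_space \<Rightarrow> real"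
  assumes "C1c u"
  shows "is_weak_grad u (grad u)"
  unfolding is_weak_grad_def
proof (intro conjI allI impI ballI)
  show "locally_integrable u" "locally_integrable (grad u)"
    using assms by (auto intro!: continuous_locally_integrable C1c_continuous C1c_continuous_grad)
  fix \<phi> :: "'a \<Rightarrow> real" and e :: 'a assume \<phi>: "test_function \<phi>" and e: "e \<in> Basis"
  have c\<phi>: "C1c \<phi>" using \<phi> by (rule test_function_C1c)
  note cont = C1c_continuous[OF assms] C1c_continuous_grad[OF assms] C1c_continuous[OF c\<phi>] C1c_continuous_grad[OF c\<phi>]
  obtain R where R: "\<And>x. R \<le> norm x \<Longrightarrow> u x = 0 \<and> grad u x = 0" using C1c_support[OF assms] by auto
  have I: "integrable lborel (\<lambda>x. u x * (grad \<phi> x \<bullet> e))" "integrable lborel (\<lambda>x. (grad u x \<bullet> e) * \<phi> x)"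
    using cont R by (auto intro!: integrable_compact_support[where R = R] continuous_intros)
  have "0 = (\<integral>x. grad (\<lambda>x. u x * \<phi> x) x \<bullet> e \<partial>lborel)"
    using C1c_mult(1)[OF assms C1c_has_derivative[OF c\<phi>] cont(4)] by (simp add: C1c_integral_grad)
  also have "\<dots> = (\<integral>x. u x * (grad \<phi> x \<bullet> e) + (grad u x \<bullet> e) * \<phi> x \<partial>lborel)"
    unfolding C1c_mult(2)[OF assms C1c_has_derivative[OF c\<phi>] cont(4)] by (simp add: inner_add_left mult.commute)
  also have "\<dots> = (\<integral>x. u x * (grad \<phi> x \<bullet> e) \<partial>lborel) + (\<integral>x. (grad u x \<bullet> e) * \<phi> x \<partial>lborel)"
    using I by simp
  finally have "(\<integral>x. u x * (grad \<phi> x \<bullet> e) \<partial>lborel) = - (\<integral>x. (grad u x \<bullet> e) * \<phi> x \<partial>lborel)" by simp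
  then show "(\<integral>x. u x * partial_deriv e \<phi> x \<partial>lebesgue) = - (\<integral>x. (grad u x \<bullet> e) * \<phi> x \<partial>lebesgue)"
    using I[THEN borel_measurable_integrable] by (simp add: integral_completion inner_grad[OF e, symmetric])
qed

section \<open>Mollification and weak gradients\<close>

lemma cball_integrable_const: "integrable lborel (\<lambda>x. indicator (cball (a::'a::euclidean_space) R) x * (c::real))"
  using emeasure_bounded_finite[OF bounded_cball[of a R]]
  by (intro integrable_mult_left integrable_real_indicator) auto

lemma compact_support_bounded:
  fixes f :: "'a::euclidean_space \<Rightarrow> 'b::euclidean_space"
  assumes "continuous_on UNIV f" "\<And>x. R \<le> norm x \<Longrightarrow> f x = 0"
  shows "\<exists>B>0. \<forall>x. norm (f x) \<le> B"
proof -
  have "compact (f ` cball 0 R)"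
    using assms(1) by (intro compact_continuous_image) (auto intro: continuous_on_subset)
  then obtain B where B: "B > 0" "\<And>x. x \<in> cball 0 R \<Longrightarrow> norm (f x) \<le> B"
    by (metis bounded_pos compact_imp_bounded image_eqI)
  have "norm (f x) \<le> B" for x using B assms(2) by (cases "norm x \<le> R") auto
  then show ?thesis using B by blast
qed

lemma compact_support_uniformly_continuous:
  fixes f :: "'a::euclidean_space \<Rightarrow> 'b::euclidean_space"
  assumes "continuous_on UNIV f" "\<And>x. R \<le> norm x \<Longrightarrow> f x = 0" "\<epsilon> > 0"
  shows "\<exists>\<delta>>0. \<forall>x y. norm (x - y) < \<delta> \<longrightarrow> norm (f x - f y) < \<epsilon>"
proof -
  have "uniformly_continuous_on (cball 0 (R + 1)) f"
    using assms(1) by (intro compact_uniformly_continuous) (auto intro: continuous_on_subset)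
  then obtain \<delta> where \<delta>: "\<delta> > 0"
    "\<And>x y. x \<in> cball 0 (R + 1) \<Longrightarrow> y \<in> cball 0 (R + 1) \<Longrightarrow> dist y x < \<delta> \<Longrightarrow> dist (f y) (f x) < \<epsilon>"
    using \<open>\<epsilon> > 0\<close> unfolding uniformly_continuous_on_def by metis
  have "norm (f x - f y) < \<epsilon>" if "norm (x - y) < min \<delta> 1" for x y
  proof (cases "norm x \<le> R \<or> norm y \<le> R")
    case True
    have "norm x \<le> norm y + norm (x - y)" "norm y \<le> norm x + norm (x - y)"
      using norm_triangle_sub[of x y] norm_triangle_sub[of y x] by (simp_all add: norm_minus_commute)
    then have "x \<in> cball 0 (R + 1)" "y \<in> cball 0 (R + 1)" using True that by auto
    then show ?thesis using \<delta>(2)[of y x] that by (simp add: dist_norm)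
  next
    case False
    then show ?thesis using assms(2,3) by simp
  qed
  then show ?thesis using \<delta>(1) by (intro exI[of _ "min \<delta> 1"]) auto
qed

text \<open>The mean value inequality for \<open>f\<close> minus its linear part at
  \<open>x\<close>, whose gradient is small near \<open>x\<close> by uniform continuity of
  \<open>grad f\<close>. Uniformity in \<open>x\<close> is what the differentiation of convolutions
  and the estimate of \<open>dil\<close> both rely on.\<close>

lemma C1c_uniform_differentiable:
  assumes "C1c f" "\<eta> > 0"
  shows "\<exists>\<delta>>0. \<forall>x h. norm h < \<delta> \<longrightarrow> \<bar>f (x + h) - f x - grad f x \<bullet> h\<bar> \<le> \<eta> * norm h"
proof -
  obtain R where R: "\<And>x. R \<le> norm x \<Longrightarrow> grad f x = 0" using C1c_support[OF assms(1)] by auto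
  obtain \<delta> where \<delta>: "\<delta> > 0" "\<And>x y. norm (x - y) < \<delta> \<Longrightarrow> norm (grad f x - grad f y) < \<eta>"
    using compact_support_uniformly_continuous[OF C1c_continuous_grad[OF assms(1)] R assms(2)] by metis
  have "\<bar>f (x + h) - f x - grad f x \<bullet> h\<bar> \<le> \<eta> * norm h" if "norm h < \<delta>" for x h
  proof -
    define k where "k z = f z - grad f x \<bullet> z" for z
    have "norm (k (x + h) - k x) \<le> \<eta> * norm ((x + h) - x)"
    proof (rule differentiable_bound[OF convex_ball[of x \<delta>]])
      show "(k has_derivative (\<lambda>v. (grad f z - grad f x) \<bullet> v)) (at z within ball x \<delta>)" for z
      proof -
        have "((\<lambda>z. f z - grad f x \<bullet> z) has_derivative (\<lambda>v. grad f z \<bullet> v - grad f x \<bullet> v)) (at z)"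
          by (intro has_derivative_diff C1c_has_derivative[OF assms(1)] has_derivative_inner_right has_derivative_ident)
        then show ?thesis unfolding k_def by (simp add: inner_diff_left has_derivative_at_withinI)
      qed
      show "onorm (\<lambda>v. (grad f z - grad f x) \<bullet> v) \<le> \<eta>" if "z \<in> ball x \<delta>" for z
      proof (rule onorm_bound)
        show "0 \<le> \<eta>" using assms(2) by simp
        have "norm (grad f z - grad f x) \<le> \<eta>" using that \<delta>(2)[of z x] by (simp add: dist_norm norm_minus_commute)
        then show "norm ((grad f z - grad f x) \<bullet> v) \<le> \<eta> * norm v" for v
          using order_trans[OF Cauchy_Schwarz_ineq2[of "grad f z - grad f x" v] mult_right_mono] by simp
      qed
      show "x + h \<in> ball x \<delta>" "x \<in> ball x \<delta>" using that \<delta>(1) by (auto simp: dist_norm)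
    qed
    then show ?thesis by (simp add: k_def inner_add_right algebra_simps)
  qed
  then show ?thesis using \<delta>(1) by blast
qed

text \<open>The Borel counterpart of \<open>locally_integrable\<close>. Functions given on
  \<open>lebesgue\<close> are replaced by Borel representatives, and Fubini, translations and
  convolutions are then carried out on \<open>lborel\<close>.\<close>

definition loc_int :: "('a::euclidean_space \<Rightarrow> 'b::euclidean_space) \<Rightarrow> bool" where
  "loc_int f \<longleftrightarrow> f \<in> borel_measurable borel \<and> (\<forall>R. integrable lborel (\<lambda>x. indicator (cball 0 R) x *\<^sub>R f x))"

lemma loc_int_mult:
  fixes f :: "'a::euclidean_space \<Rightarrow> 'b::euclidean_space"
  assumes f: "loc_int f" and [measurable]: "\<psi> \<in> borel_measurable borel"
    and B: "\<And>y. \<bar>\<psi> y\<bar> \<le> B" "\<And>y. R < norm y \<Longrightarrow> \<psi> y = 0"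
  shows "integrable lborel (\<lambda>y. \<psi> y *\<^sub>R f y)"
    "norm (\<integral>y. \<psi> y *\<^sub>R f y \<partial>lborel) \<le> B * (\<integral>y. indicator (cball 0 R) y * norm (f y) \<partial>lborel)"
proof -
  have [measurable]: "f \<in> borel_measurable borel" using f by (simp add: loc_int_def)
  have i: "integrable lborel (\<lambda>y. indicator (cball 0 R) y *\<^sub>R f y)" using f by (simp add: loc_int_def)
  have i': "integrable lborel (\<lambda>y. B * (indicator (cball 0 R) y * norm (f y)))"
    using integrable_norm[OF i] by (intro integrable_mult_right) (simp add: indicator_def if_distrib cong: if_cong)
  have le: "norm (\<psi> y *\<^sub>R f y) \<le> B * (indicator (cball 0 R) y * norm (f y))" for y
    using B[of y] mult_right_mono[OF B(1)[of y], of "norm (f y)"] by (auto simp: indicator_def)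
  have "0 \<le> B * (indicator (cball 0 R) y * norm (f y))" for y
    using order_trans[OF norm_ge_zero le[of y]] .
  then show 1: "integrable lborel (\<lambda>y. \<psi> y *\<^sub>R f y)"
    using le by (intro Bochner_Integration.integrable_bound[OF i']) auto
  have "norm (\<integral>y. \<psi> y *\<^sub>R f y \<partial>lborel) \<le> (\<integral>y. norm (\<psi> y *\<^sub>R f y) \<partial>lborel)"
    by (rule integral_norm_bound)
  also have "\<dots> \<le> (\<integral>y. B * (indicator (cball 0 R) y * norm (f y)) \<partial>lborel)"
    using integrable_norm[OF 1] i' le by (intro integral_mono) (simp_all del: norm_scaleR)
  finally show "norm (\<integral>y. \<psi> y *\<^sub>R f y \<partial>lborel) \<le> B * (\<integral>y. indicator (cball 0 R) y * norm (f y) \<partial>lborel)"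
    by simp
qed

text \<open>The kernel is scalar and \<open>f\<close> may be vector valued, so that a function and
  its weak gradient are mollified by the same operation.\<close>

definition conv :: "('a::euclidean_space \<Rightarrow> real) \<Rightarrow> ('a \<Rightarrow> 'b::euclidean_space) \<Rightarrow> 'a \<Rightarrow> 'b" where
  "conv \<rho> f x = (\<integral>y. \<rho> (x - y) *\<^sub>R f y \<partial>lborel)"

lemma continuous_reflect:
  fixes \<rho> :: "'a::euclidean_space \<Rightarrow> real"
  shows "continuous_on UNIV \<rho> \<Longrightarrow> continuous_on UNIV (\<lambda>y. \<rho> (x - y))"
proof -
  assume \<rho>: "continuous_on UNIV \<rho>"
  have "continuous_on UNIV (\<lambda>y. x - y)" by (intro continuous_on_diff continuous_on_const continuous_on_id)
  from continuous_on_compose2[OF \<rho> this] show ?thesis by simp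
qed

lemma test_function_measurable: "test_function \<rho> \<Longrightarrow> \<rho> \<in> borel_measurable borel"
  by (meson C_k_0I borel_measurable_continuous_onI test_function_C_k)

lemma conv_integrable:
  fixes f :: "'a::euclidean_space \<Rightarrow> 'b::euclidean_space"
  assumes "loc_int f" "test_function \<rho>"
  shows "integrable lborel (\<lambda>y. \<rho> (x - y) *\<^sub>R f y)"
proof -
  obtain R where R: "R > 0" "\<And>x. R \<le> norm x \<Longrightarrow> \<rho> x = 0" using test_function_support[OF assms(2)] by blast
  have c: "continuous_on UNIV \<rho>" using assms(2) C_k_0I test_function_C_k by blast
  obtain B where B: "\<And>x. norm (\<rho> x) \<le> B" using compact_support_bounded[OF c R(2)] by blast
  show ?thesis
  proof (rule loc_int_mult(1)[OF assms(1), where B = B and R = "norm x + R"])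
    show "(\<lambda>y. \<rho> (x - y)) \<in> borel_measurable borel"
      using continuous_reflect[OF c] by (rule borel_measurable_continuous_onI)
    show "\<bar>\<rho> (x - y)\<bar> \<le> B" for y using B[of "x - y"] by simp
    show "\<rho> (x - y) = 0" if "norm x + R < norm y" for y
      using that norm_triangle_ineq2[of y x] by (intro R(2)) (simp add: norm_minus_commute)
  qed
qed

text \<open>The linearisation error of the kernel is uniformly at most a small multiple of the
  increment and is integrated against \<open>f\<close> over one fixed ball.\<close>

lemma conv_has_derivative:
  fixes f :: "'a::euclidean_space \<Rightarrow> real"
  assumes f: "loc_int f" and \<rho>: "test_function \<rho>"
  shows "(conv \<rho> f has_derivative (\<lambda>h. conv (\<lambda>z. grad \<rho> z \<bullet> h) f x)) (at x)"
proof -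
  obtain R where R: "R > 0" "\<And>x. R \<le> norm x \<Longrightarrow> \<rho> x = 0 \<and> grad \<rho> x = 0"
    using C1c_support[OF test_function_C1c[OF \<rho>]] by blast
  have c: "continuous_on UNIV \<rho>" "continuous_on UNIV (grad \<rho>)"
    using C1c_continuous C1c_continuous_grad test_function_C1c[OF \<rho>] by blast+
  have [measurable]: "\<rho> \<in> borel_measurable borel" "grad \<rho> \<in> borel_measurable borel"
    using c by (auto intro: borel_measurable_continuous_onI)
  obtain B where B: "B > 0" "\<And>x. norm (grad \<rho> x) \<le> B" using compact_support_bounded[OF c(2)] R by blast
  have out: "R \<le> norm (x - y)" if "norm x + R < norm y" for x y :: 'a
    using that norm_triangle_ineq2[of y x] by (simp add: norm_minus_commute)
  have gi: "integrable lborel (\<lambda>y. (grad \<rho> (x - y) \<bullet> h) *\<^sub>R f y)"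
    "norm (conv (\<lambda>z. grad \<rho> z \<bullet> h) f x) \<le> (B * norm h) * (\<integral>y. indicator (cball 0 (norm x + R)) y * norm (f y) \<partial>lborel)" for h
  proof -
    have "\<bar>grad \<rho> (x - y) \<bullet> h\<bar> \<le> B * norm h" for y
      using order_trans[OF Cauchy_Schwarz_ineq2[of "grad \<rho> (x - y)" h] mult_right_mono[OF B(2)]] by simp
    moreover have "grad \<rho> (x - y) \<bullet> h = 0" if "norm x + R < norm y" for y
      using R(2)[OF out[OF that]] by simp
    ultimately show "integrable lborel (\<lambda>y. (grad \<rho> (x - y) \<bullet> h) *\<^sub>R f y)"
      "norm (conv (\<lambda>z. grad \<rho> z \<bullet> h) f x) \<le> (B * norm h) * (\<integral>y. indicator (cball 0 (norm x + R)) y * norm (f y) \<partial>lborel)"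
      using loc_int_mult[OF f, of "\<lambda>y. grad \<rho> (x - y) \<bullet> h" "B * norm h" "norm x + R"]
      unfolding conv_def by auto
  qed
  \<comment> \<open>Increments shorter than 1 move the support of the kernel by less than 1, hence
    the radius \<open>norm x + R + 1\<close>.\<close>
  define I where "I = (\<integral>y. indicator (cball 0 (norm x + R + 1)) y * norm (f y) \<partial>lborel)"
  have I0: "I \<ge> 0" unfolding I_def by (intro Bochner_Integration.integral_nonneg) auto
  show ?thesis
    unfolding has_derivative_at_alt
  proof (intro conjI allI impI)
    show "bounded_linear (\<lambda>h. conv (\<lambda>z. grad \<rho> z \<bullet> h) f x)"
    proof (rule bounded_linear_intro)
      show "conv (\<lambda>z. grad \<rho> z \<bullet> (h + k)) f x = conv (\<lambda>z. grad \<rho> z \<bullet> h) f x + conv (\<lambda>z. grad \<rho> z \<bullet> k) f x" for h k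
        unfolding conv_def inner_add_right scaleR_add_left by (rule Bochner_Integration.integral_add[OF gi(1) gi(1)])
      show "conv (\<lambda>z. grad \<rho> z \<bullet> (r *\<^sub>R h)) f x = r *\<^sub>R conv (\<lambda>z. grad \<rho> z \<bullet> h) f x" for r h
        by (simp add: conv_def mult.assoc)
      show "norm (conv (\<lambda>z. grad \<rho> z \<bullet> h) f x) \<le> norm h * (B * (\<integral>y. indicator (cball 0 (norm x + R)) y * norm (f y) \<partial>lborel))" for h
        using gi(2)[of h] by (simp add: mult_ac)
    qed
    fix e :: real assume "e > 0"
    \<comment> \<open>Adding 1 keeps the denominator positive when \<open>f\<close> vanishes on the
      ball.\<close>
    then have "e / (I + 1) > 0" using I0 by simp
    then obtain \<delta> where \<delta>: "\<delta> > 0"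
      "\<And>z h. norm h < \<delta> \<Longrightarrow> \<bar>\<rho> (z + h) - \<rho> z - grad \<rho> z \<bullet> h\<bar> \<le> e / (I + 1) * norm h"
      using C1c_uniform_differentiable[OF test_function_C1c[OF \<rho>]] by metis
    have "norm (conv \<rho> f y - conv \<rho> f x - conv (\<lambda>z. grad \<rho> z \<bullet> (y - x)) f x) \<le> e * norm (y - x)"
      if y: "norm (y - x) < min \<delta> 1" for y
    proof -
      define \<psi> where "\<psi> w = \<rho> ((x - w) + (y - x)) - \<rho> (x - w) - grad \<rho> (x - w) \<bullet> (y - x)" for w
      have "conv \<rho> f y - conv \<rho> f x - conv (\<lambda>z. grad \<rho> z \<bullet> (y - x)) f x = (\<integral>w. \<psi> w *\<^sub>R f w \<partial>lborel)"
        using conv_integrable[OF f \<rho>] gi(1)[of "y - x"]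
        by (simp add: conv_def \<psi>_def left_diff_distrib)
      also have "norm \<dots> \<le> (e / (I + 1) * norm (y - x)) * I"
        unfolding I_def
      proof (rule loc_int_mult(2)[OF f])
        show "\<psi> \<in> borel_measurable borel" unfolding \<psi>_def by measurable
        show "\<bar>\<psi> w\<bar> \<le> e / ((\<integral>y. indicator (cball 0 (norm x + R + 1)) y * norm (f y) \<partial>lborel) + 1) * norm (y - x)" for w
          unfolding \<psi>_def I_def[symmetric] using \<delta>(2)[of "y - x" "x - w"] y by simp
        fix w :: 'a assume w: "norm x + R + 1 < norm w"
        have "R \<le> norm (x - w)" using w by (intro out) simp
        moreover have "norm y \<le> norm x + 1" using y norm_triangle_sub[of y x] by simp
        then have "R \<le> norm (y - w)" using w by (intro out) simp
        ultimately show "\<psi> w = 0" using R(2) by (simp add: \<psi>_def)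
      qed
      also have "\<dots> \<le> e * norm (y - x)"
      proof -
        have "e / (I + 1) * I \<le> e" using \<open>e > 0\<close> I0 by (simp add: field_simps)
        then show ?thesis using mult_right_mono[of "e / (I + 1) * I" e "norm (y - x)"] by (simp add: mult_ac)
      qed
      finally show ?thesis .
    qed
    then show "\<exists>d>0. \<forall>y. norm (y - x) < d \<longrightarrow>
        norm (conv \<rho> f y - conv \<rho> f x - conv (\<lambda>z. grad \<rho> z \<bullet> (y - x)) f x) \<le> e * norm (y - x)"
      using \<delta>(1) by (intro exI[of _ "min \<delta> 1"]) auto
  qed
qed

lemma conv_C_k:
  fixes f :: "'a::euclidean_space \<Rightarrow> real"
  assumes "loc_int f" "test_function \<rho>"
  shows "C_k k (conv \<rho> f)"
  using assms(2)
proof (induction k arbitrary: \<rho>)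
  case 0
  then show ?case
    using conv_has_derivative[OF assms(1)]
    by (auto intro!: continuous_at_imp_continuous_on has_derivative_continuous)
next
  case (Suc k)
  show ?case
  proof (rule C_k_SucI[OF conv_has_derivative[OF assms(1) Suc.prems]])
    fix e :: 'a assume e: "e \<in> Basis"
    show "C_k k (\<lambda>x. conv (\<lambda>z. grad \<rho> z \<bullet> e) f x)"
      unfolding inner_grad[OF e] using Suc.IH test_function_partial_deriv[OF Suc.prems e] by simp
  qed
qed

section \<open>Mollifiers and their convergence\<close>

definition mol :: "real \<Rightarrow> 'a::euclidean_space \<Rightarrow> real" where
  "mol \<epsilon> x = bump \<epsilon> x / (\<integral>y. bump \<epsilon> (y::'a) \<partial>lborel)"

lemma bump_integral_pos: "\<epsilon> > 0 \<Longrightarrow> 0 < (\<integral>y. bump \<epsilon> (y::'a::euclidean_space) \<partial>lborel)"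
proof -
  assume \<epsilon>: "\<epsilon> > 0"
  have c: "continuous_on UNIV (bump \<epsilon> :: 'a \<Rightarrow> real)"
    using test_function_bump[OF \<epsilon>] C_k_0I test_function_C_k by blast
  have i: "integrable lborel (bump \<epsilon> :: 'a \<Rightarrow> real)"
    using test_function_support[OF test_function_bump[OF \<epsilon>]] integrable_compact_support[OF c] by blast
  have "(\<integral>y. bump \<epsilon> (y::'a) \<partial>lborel) \<noteq> 0"
  proof
    assume "(\<integral>y. bump \<epsilon> (y::'a) \<partial>lborel) = 0"
    then have "AE x in lborel. bump \<epsilon> (x::'a) = 0"
      using i integral_nonneg_eq_0_iff_AE[OF i] by (simp add: bump_nonneg)
    then have "AE x in lborel. x \<notin> ball (0::'a) \<epsilon>"
      by eventually_elim (use bump_pos_iff[OF \<epsilon>] in force)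
    then have "ball (0::'a) \<epsilon> \<in> null_sets lborel" by (simp add: AE_iff_null_sets)
    then have "measure lborel (ball (0::'a) \<epsilon>) = 0" by (simp add: measure_eq_0_null_sets)
    then show False using \<epsilon> content_ball_pos[of \<epsilon> "0::'a"] by simp
  qed
  moreover have "(\<integral>y. bump \<epsilon> (y::'a) \<partial>lborel) \<ge> 0" by (simp add: bump_nonneg)
  ultimately show ?thesis by simp
qed

lemma mol_nonneg: "0 \<le> mol \<epsilon> x"
  unfolding mol_def by (intro divide_nonneg_nonneg) (auto simp: bump_nonneg)

lemma test_function_mol: "\<epsilon> > 0 \<Longrightarrow> test_function (mol \<epsilon>)"
  unfolding mol_def[abs_def] using test_function_cmult[OF test_function_bump, of \<epsilon> "1 / (\<integral>y. bump \<epsilon> (y::'a) \<partial>lborel)"]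
  by simp

lemma mol_support: "\<epsilon> > 0 \<Longrightarrow> \<epsilon> \<le> norm x \<Longrightarrow> mol \<epsilon> x = 0"
  unfolding mol_def using bump_pos_iff[of \<epsilon> x] bump_nonneg[of \<epsilon> x] by auto

lemma mol_integrable: "\<epsilon> > 0 \<Longrightarrow> integrable lborel (mol \<epsilon>)"
  using integrable_compact_support[OF C_k_0I[OF test_function_C_k[OF test_function_mol]]] mol_support by blast

lemma integral_mol: "\<epsilon> > 0 \<Longrightarrow> (\<integral>x. mol \<epsilon> (x::'a::euclidean_space) \<partial>lborel) = 1"
  unfolding mol_def using bump_integral_pos[of \<epsilon>, where 'a = 'a] by simp

lemma mol_reflect: "mol \<epsilon> (x - y) = mol \<epsilon> (y - x)"
  unfolding mol_def bump_def by (simp add: inner_diff_left inner_diff_right algebra_simps)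

lemma nn_integral_mol:
  fixes x :: "'a::euclidean_space"
  assumes "\<epsilon> > 0"
  shows "(\<integral>\<^sup>+y. ennreal (mol \<epsilon> (x - y)) \<partial>lborel) = 1" "(\<integral>\<^sup>+y. ennreal (mol \<epsilon> (y - x)) \<partial>lborel) = 1"
proof -
  have [measurable]: "(mol \<epsilon> :: 'a \<Rightarrow> real) \<in> borel_measurable borel" using assms by (simp add: test_function_mol test_function_measurable)
  have "(\<integral>\<^sup>+y. ennreal (mol \<epsilon> (y :: 'a)) \<partial>lborel) = (\<integral>\<^sup>+y. ennreal (mol \<epsilon> y) \<partial>distr lborel borel ((+) (- x)))"
    by (simp only: lborel_distr_plus)
  also have "\<dots> = (\<integral>\<^sup>+y. ennreal (mol \<epsilon> (- x + y)) \<partial>lborel)" by (subst nn_integral_distr) auto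
  finally have "(\<integral>\<^sup>+y. ennreal (mol \<epsilon> (y - x)) \<partial>lborel) = (\<integral>\<^sup>+y. ennreal (mol \<epsilon> (y :: 'a)) \<partial>lborel)" by simp
  also have "\<dots> = 1"
    using nn_integral_eq_integral[OF mol_integrable[OF assms, where 'a = 'a]] integral_mol[OF assms, where 'a = 'a]
    by (simp add: mol_nonneg)
  finally show "(\<integral>\<^sup>+y. ennreal (mol \<epsilon> (y - x)) \<partial>lborel) = 1" .
  then show "(\<integral>\<^sup>+y. ennreal (mol \<epsilon> (x - y)) \<partial>lborel) = 1" by (simp add: mol_reflect)
qed

lemma conv_measurable:
  fixes f :: "'a::euclidean_space \<Rightarrow> 'b::euclidean_space"
  assumes [measurable]: "f \<in> borel_measurable borel" "\<rho> \<in> borel_measurable borel"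
  shows "conv \<rho> f \<in> borel_measurable borel"
  unfolding conv_def[abs_def] by measurable

lemma norm_conv_le:
  fixes f :: "'a::euclidean_space \<Rightarrow> 'b::euclidean_space"
  assumes [measurable]: "f \<in> borel_measurable borel" and "\<epsilon> > 0"
  shows "ennreal (norm (conv (mol \<epsilon>) f x)) \<le> (\<integral>\<^sup>+y. ennreal (mol \<epsilon> (x - y)) * ennreal (norm (f y)) \<partial>lborel)"
proof (cases "integrable lborel (\<lambda>y. mol \<epsilon> (x - y) *\<^sub>R f y)")
  case True
  then show ?thesis
    using integral_norm_bound_ennreal[OF True] by (simp add: conv_def mol_nonneg ennreal_mult)
next
  case False
  \<comment> \<open>The Bochner integral of a non-integrable function is 0, so the bound is trivial
    here.\<close>
  then show ?thesis by (simp add: conv_def not_integrable_integral_eq)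
qed

lemma nn_integral_conv_mol:
  fixes F :: "'a::euclidean_space \<Rightarrow> ennreal"
  assumes [measurable]: "F \<in> borel_measurable borel" and "\<epsilon> > 0"
  shows "(\<integral>\<^sup>+x. (\<integral>\<^sup>+y. ennreal (mol \<epsilon> (x - y)) * F y \<partial>lborel) \<partial>lborel) = (\<integral>\<^sup>+y. F y \<partial>lborel)"
proof -
  have [measurable]: "mol \<epsilon> \<in> borel_measurable borel" using assms by (simp add: test_function_mol test_function_measurable)
  have "(\<integral>\<^sup>+x. (\<integral>\<^sup>+y. ennreal (mol \<epsilon> (x - y)) * F y \<partial>lborel) \<partial>lborel)
     = (\<integral>\<^sup>+y. (\<integral>\<^sup>+x. ennreal (mol \<epsilon> (x - y)) * F y \<partial>lborel) \<partial>lborel)"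
    by (rule lborel_pair.Fubini') measurable
  also have "\<dots> = (\<integral>\<^sup>+y. F y \<partial>lborel)"
    using assms(2) by (simp add: nn_integral_multc nn_integral_mol)
  finally show ?thesis .
qed

lemma Young_mol_1:
  fixes f :: "'a::euclidean_space \<Rightarrow> 'b::euclidean_space"
  assumes [measurable]: "f \<in> borel_measurable borel" and "\<epsilon> > 0"
  shows "(\<integral>\<^sup>+x. ennreal (norm (conv (mol \<epsilon>) f x)) \<partial>lborel) \<le> (\<integral>\<^sup>+x. ennreal (norm (f x)) \<partial>lborel)"
proof -
  have "(\<integral>\<^sup>+x. ennreal (norm (conv (mol \<epsilon>) f x)) \<partial>lborel)
     \<le> (\<integral>\<^sup>+x. (\<integral>\<^sup>+y. ennreal (mol \<epsilon> (x - y)) * ennreal (norm (f y)) \<partial>lborel) \<partial>lborel)"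
    by (intro nn_integral_mono norm_conv_le assms)
  then show ?thesis using nn_integral_conv_mol[of "\<lambda>y. ennreal (norm (f y))" \<epsilon>] assms(2) by simp
qed

text \<open>Jensen's inequality for the probability density \<open>mol \<epsilon>\<close>, obtained
  from Cauchy--Schwarz. The constant 1 is essential: mollification must not raise the
  energy.\<close>

lemma Young_mol_2:
  fixes f :: "'a::euclidean_space \<Rightarrow> 'b::euclidean_space"
  assumes [measurable]: "f \<in> borel_measurable borel" and \<epsilon>: "\<epsilon> > 0"
  shows "(\<integral>\<^sup>+x. ennreal ((norm (conv (mol \<epsilon>) f x))\<^sup>2) \<partial>lborel) \<le> (\<integral>\<^sup>+x. ennreal ((norm (f x))\<^sup>2) \<partial>lborel)"
proof -
  have [measurable]: "mol \<epsilon> \<in> borel_measurable borel" using assms by (simp add: test_function_mol test_function_measurable)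
  have "ennreal ((norm (conv (mol \<epsilon>) f x))\<^sup>2) \<le> (\<integral>\<^sup>+y. ennreal (mol \<epsilon> (x - y)) * ennreal ((norm (f y))\<^sup>2) \<partial>lborel)" for x
  proof -
    have "ennreal ((norm (conv (mol \<epsilon>) f x))\<^sup>2) = (ennreal (norm (conv (mol \<epsilon>) f x)))\<^sup>2"
      by (simp add: ennreal_power)
    also have "\<dots> \<le> (\<integral>\<^sup>+y. ennreal (mol \<epsilon> (x - y)) * ennreal (norm (f y)) \<partial>lborel)\<^sup>2"
      using norm_conv_le[OF assms] by (intro power_mono) auto
    \<comment> \<open>The weight is split into two square roots; the first of them has a squared
      integral equal to 1.\<close>
    also have "\<dots> = (\<integral>\<^sup>+y. ennreal (sqrt (mol \<epsilon> (x - y))) * ennreal (sqrt (mol \<epsilon> (x - y)) * norm (f y)) \<partial>lborel)\<^sup>2"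
      by (simp add: ennreal_mult'[symmetric] mult.assoc[symmetric] mol_nonneg)
    also have "\<dots> \<le> (\<integral>\<^sup>+y. ennreal (sqrt (mol \<epsilon> (x - y)))^2 \<partial>lborel) * (\<integral>\<^sup>+y. ennreal (sqrt (mol \<epsilon> (x - y)) * norm (f y))^2 \<partial>lborel)"
      by (rule Cauchy_Schwarz_nn_integral) measurable
    also have "\<dots> = (\<integral>\<^sup>+y. ennreal (mol \<epsilon> (x - y)) \<partial>lborel) * (\<integral>\<^sup>+y. ennreal (mol \<epsilon> (x - y)) * ennreal ((norm (f y))\<^sup>2) \<partial>lborel)"
      by (simp add: ennreal_power mol_nonneg power_mult_distrib ennreal_mult')
    also have "(\<integral>\<^sup>+y. ennreal (mol \<epsilon> (x - y)) \<partial>lborel) = 1" by (rule nn_integral_mol(1)[OF \<epsilon>])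
    finally show ?thesis by (simp only: mult_1)
  qed
  then have "(\<integral>\<^sup>+x. ennreal ((norm (conv (mol \<epsilon>) f x))\<^sup>2) \<partial>lborel)
     \<le> (\<integral>\<^sup>+x. (\<integral>\<^sup>+y. ennreal (mol \<epsilon> (x - y)) * ennreal ((norm (f y))\<^sup>2) \<partial>lborel) \<partial>lborel)"
    by (intro nn_integral_mono)
  also have "\<dots> = (\<integral>\<^sup>+x. ennreal ((norm (f x))\<^sup>2) \<partial>lborel)" using \<epsilon> by (intro nn_integral_conv_mol) measurable
  finally show ?thesis .
qed

text \<open>A measurable function is an almost everywhere limit of continuous ones; clipping their
  values and cutting them off in space supplies the dominating function for convergence in
  L^1.\<close>

lemma dense_continuous_bounded_support:
  fixes f :: "'a::euclidean_space \<Rightarrow> real"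
  assumes [measurable]: "f \<in> borel_measurable borel" and k: "\<And>x. \<bar>f x\<bar> \<le> k" "\<And>x. R < norm x \<Longrightarrow> f x = 0" and "\<eta> > 0"
  shows "\<exists>g. continuous_on UNIV g \<and> (\<exists>R. \<forall>x. R \<le> norm x \<longrightarrow> g x = 0) \<and> integrable lborel f \<and> (\<integral>x. \<bar>f x - g x\<bar> \<partial>lborel) < \<eta>"
proof -
  have "f measurable_on UNIV"
    using measurable_on_iff_borel_measurable[of UNIV f]
    by (simp add: measurable_completion lebesgue_on_UNIV_eq)
  then obtain N h where N: "negligible N" and h: "\<And>n. continuous_on UNIV (h n)" "\<And>x. x \<notin> N \<Longrightarrow> (\<lambda>n. h n x) \<longlonglongrightarrow> f x"
    unfolding measurable_on_def by auto
  have k0: "k \<ge> 0" using k(1)[of 0] by linarith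
  \<comment> \<open>Both modifications disappear in the limit: \<open>f\<close> takes values between
    \<open>-k\<close> and \<open>k\<close> and vanishes outside the ball of radius \<open>R\<close>,
    where the cut-off factor starts to fall below 1.\<close>
  define g where "g n x = max (- k) (min k (h n x)) * max 0 (min 1 (R + 1 - norm x))" for n x
  have gc: "continuous_on UNIV (g n)" for n
    unfolding g_def by (intro continuous_intros h(1))
  then have [measurable]: "g n \<in> borel_measurable borel" for n by (rule borel_measurable_continuous_onI)
  have gs: "g n x = 0" if "R + 1 \<le> norm x" for n x using that by (simp add: g_def)
  have gb: "\<bar>g n x\<bar> \<le> k" for n x
  proof -
    have "\<bar>max (- k) (min k (h n x))\<bar> \<le> k" using k0 by auto
    then have "\<bar>g n x\<bar> \<le> k * 1" unfolding g_def abs_mult by (intro mult_mono) auto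
    then show ?thesis by simp
  qed
  have fs: "f x = 0" if "R + 1 < norm x" for x using k(2) that by simp
  have fi: "integrable lborel f"
    by (rule Bochner_Integration.integrable_bound[OF cball_integrable_const[of 0 R k]])
      (use order_trans[OF k(1) abs_ge_self] k(2) in \<open>auto simp: indicator_def not_le intro!: AE_I2\<close>)
  have "(\<lambda>n. \<integral>x. \<bar>f x - g n x\<bar> \<partial>lborel) \<longlonglongrightarrow> (\<integral>x. 0 \<partial>(lborel :: 'a measure))"
  proof (rule integral_dominated_convergence[where w = "\<lambda>x. indicator (cball 0 (R + 1)) x * (2 * k)"])
    show "integrable lborel (\<lambda>x::'a. indicator (cball 0 (R + 1)) x * (2 * k))" by (rule cball_integrable_const)
    show "AE x in lborel. norm \<bar>f x - g n x\<bar> \<le> indicator (cball 0 (R + 1)) x * (2 * k)" for n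
    proof (rule AE_I2)
      fix x :: 'a
      show "norm \<bar>f x - g n x\<bar> \<le> indicator (cball 0 (R + 1)) x * (2 * k)"
      proof (cases "norm x \<le> R + 1")
        case True
        have "\<bar>f x - g n x\<bar> \<le> 2 * k" using k(1)[of x] gb[of n x] by linarith
        then show ?thesis using True by simp
      next
        case False
        then show ?thesis using fs[of x] gs[of x n] by simp
      qed
    qed
    have "AE x in lebesgue. x \<notin> N" using N by (simp add: negligible_iff_null_sets AE_not_in)
    then have ae: "AE x in lborel. x \<notin> N" by (simp add: AE_completion_iff)
    show "AE x in lborel. (\<lambda>n. \<bar>f x - g n x\<bar>) \<longlonglongrightarrow> 0"
      using ae
    proof eventually_elim
      fix x assume "x \<notin> N"
      then have "(\<lambda>n. g n x) \<longlonglongrightarrow> max (- k) (min k (f x)) * max 0 (min 1 (R + 1 - norm x))"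
        unfolding g_def by (intro tendsto_intros h(2))
      moreover have "max (- k) (min k (f x)) * max 0 (min 1 (R + 1 - norm x)) = f x"
        using k(1)[of x] k(2)[of x] by (cases "norm x \<le> R") (auto simp: max_def min_def abs_le_iff)
      ultimately have "(\<lambda>n. \<bar>f x - g n x\<bar>) \<longlonglongrightarrow> \<bar>f x - f x\<bar>" by (intro tendsto_intros) simp
      then show "(\<lambda>n. \<bar>f x - g n x\<bar>) \<longlonglongrightarrow> 0" by simp
    qed
  qed auto
  then have "\<forall>\<^sub>F n in sequentially. (\<integral>x. \<bar>f x - g n x\<bar> \<partial>lborel) < \<eta>"
    using \<open>\<eta> > 0\<close> by (intro order_tendstoD) auto
  then obtain n where "(\<integral>x. \<bar>f x - g n x\<bar> \<partial>lborel) < \<eta>" by (auto simp: eventually_sequentially)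
  then show ?thesis using gc gs fi by (intro exI[of _ "g n"]) blast
qed

text \<open>Truncation in space and in value reduces to a bounded function with bounded
  support.\<close>

lemma dense_continuous_L1:
  fixes f :: "'a::euclidean_space \<Rightarrow> real"
  assumes f: "integrable lborel f" and "\<eta> > 0"
  shows "\<exists>g. continuous_on UNIV g \<and> (\<exists>R. \<forall>x. R \<le> norm x \<longrightarrow> g x = 0) \<and> (\<integral>x. \<bar>f x - g x\<bar> \<partial>lborel) < \<eta>"
proof -
  have [measurable]: "f \<in> borel_measurable borel" using f by auto
  define F where "F n x = (if norm x \<le> real n \<and> \<bar>f x\<bar> \<le> real n then f x else 0)" for n x
  have [measurable]: "F n \<in> borel_measurable borel" for n unfolding F_def by measurable
  have "(\<lambda>n. \<integral>x. \<bar>f x - F n x\<bar> \<partial>lborel) \<longlonglongrightarrow> (\<integral>x. 0 \<partial>(lborel :: 'a measure))"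
  proof (rule integral_dominated_convergence[where w = "\<lambda>x. \<bar>f x\<bar>"])
    show "integrable lborel (\<lambda>x. \<bar>f x\<bar>)" using f by simp
    show "AE x in lborel. norm \<bar>f x - F n x\<bar> \<le> \<bar>f x\<bar>" for n by (auto simp: F_def)
    show "AE x in lborel. (\<lambda>n. \<bar>f x - F n x\<bar>) \<longlonglongrightarrow> 0"
    proof (rule AE_I2)
      fix x
      have "\<forall>\<^sub>F n in sequentially. real n \<ge> max (norm x) \<bar>f x\<bar>"
        by (metis eventually_sequentiallyI nat_ceiling_le_eq of_nat_le_iff order_trans real_nat_ceiling_ge)
      then have "\<forall>\<^sub>F n in sequentially. \<bar>f x - F n x\<bar> = 0" by eventually_elim (auto simp: F_def)
      then show "(\<lambda>n. \<bar>f x - F n x\<bar>) \<longlonglongrightarrow> 0" by (rule tendsto_eventually)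
    qed
  qed auto
  then have "\<forall>\<^sub>F n in sequentially. (\<integral>x. \<bar>f x - F n x\<bar> \<partial>lborel) < \<eta> / 2"
    using \<open>\<eta> > 0\<close> by (intro order_tendstoD) auto
  then obtain n where n: "(\<integral>x. \<bar>f x - F n x\<bar> \<partial>lborel) < \<eta> / 2" by (auto simp: eventually_sequentially)
  have "\<bar>F n x\<bar> \<le> real n" "real n < norm x \<Longrightarrow> F n x = 0" for x by (auto simp: F_def)
  then have "\<exists>g. continuous_on UNIV g \<and> (\<exists>R. \<forall>x. R \<le> norm x \<longrightarrow> g x = 0) \<and> integrable lborel (F n) \<and>
      (\<integral>x. \<bar>F n x - g x\<bar> \<partial>lborel) < \<eta> / 2"
    using \<open>\<eta> > 0\<close> by (intro dense_continuous_bounded_support) auto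
  then obtain g R where g: "continuous_on UNIV g" "\<And>x. R \<le> norm x \<Longrightarrow> g x = 0" and Fi: "integrable lborel (F n)"
      and Fg: "(\<integral>x. \<bar>F n x - g x\<bar> \<partial>lborel) < \<eta> / 2"
    by blast
  have gi: "integrable lborel g" using g by (rule integrable_compact_support)
  have "(\<integral>x. \<bar>f x - g x\<bar> \<partial>lborel) \<le> (\<integral>x. \<bar>f x - F n x\<bar> + \<bar>F n x - g x\<bar> \<partial>lborel)"
    using f Fi gi by (intro integral_mono) auto
  also have "\<dots> = (\<integral>x. \<bar>f x - F n x\<bar> \<partial>lborel) + (\<integral>x. \<bar>F n x - g x\<bar> \<partial>lborel)"
    using f Fi gi by simp
  finally show ?thesis using n Fg g by (intro exI[of _ g]) auto
qed

lemma cball_borel [measurable]: "cball (a::'a::euclidean_space) R \<in> sets borel"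
  by simp

lemma integrable_loc_int: "integrable lborel f \<Longrightarrow> loc_int f"
  unfolding loc_int_def by (auto intro!: integrable_mult_indicator)

lemma has_bochner_integral_mol_shift:
  fixes x :: "'a::euclidean_space"
  assumes "\<epsilon> > 0"
  shows "has_bochner_integral lborel (\<lambda>y. mol \<epsilon> (x - y)) 1"
proof (rule has_bochner_integral_nn_integral)
  have [measurable]: "(mol \<epsilon> :: 'a \<Rightarrow> real) \<in> borel_measurable borel" using assms by (simp add: test_function_mol test_function_measurable)
  show "(\<lambda>y. mol \<epsilon> (x - y)) \<in> borel_measurable lborel" by measurable
  show "(\<integral>\<^sup>+y. ennreal (mol \<epsilon> (x - y)) \<partial>lborel) = ennreal 1" using nn_integral_mol(1)[OF assms] by simp
qed (auto simp: mol_nonneg)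

lemma mol_uniform:
  fixes g :: "'a::euclidean_space \<Rightarrow> real"
  assumes "continuous_on UNIV g" "\<And>x. R \<le> norm x \<Longrightarrow> g x = 0"
    and "0 < \<epsilon>" "\<And>y. norm (y - x) < \<epsilon> \<Longrightarrow> \<bar>g y - g x\<bar> \<le> \<eta>"
  shows "\<bar>conv (mol \<epsilon>) g x - g x\<bar> \<le> \<eta>"
proof -
  have m: "integrable lborel (\<lambda>y. mol \<epsilon> (x - y))" "(\<integral>y. mol \<epsilon> (x - y) \<partial>lborel) = 1"
    using has_bochner_integral_mol_shift[OF assms(3), of x] by (auto simp: has_bochner_integral_iff)
  have i: "integrable lborel (\<lambda>y. mol \<epsilon> (x - y) *\<^sub>R g y)"
    using assms by (intro conv_integrable integrable_loc_int integrable_compact_support[of g R] test_function_mol)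
  have "conv (mol \<epsilon>) g x - g x = (\<integral>y. mol \<epsilon> (x - y) *\<^sub>R g y \<partial>lborel) - (\<integral>y. mol \<epsilon> (x - y) * g x \<partial>lborel)"
    using m by (simp add: conv_def)
  also have "\<dots> = (\<integral>y. mol \<epsilon> (x - y) * (g y - g x) \<partial>lborel)"
    using i m by (simp add: right_diff_distrib)
  also have "norm \<dots> \<le> (\<integral>y. norm (mol \<epsilon> (x - y) * (g y - g x)) \<partial>lborel)" by (rule integral_norm_bound)
  also have "\<dots> \<le> (\<integral>y. mol \<epsilon> (x - y) * \<eta> \<partial>lborel)"
  proof (rule integral_mono)
    have "integrable lborel (\<lambda>y. mol \<epsilon> (x - y) * (g y - g x))"
      using i m by (simp add: right_diff_distrib)
    then show "integrable lborel (\<lambda>y. norm (mol \<epsilon> (x - y) * (g y - g x)))" by (rule integrable_norm)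
    show "integrable lborel (\<lambda>y. mol \<epsilon> (x - y) * \<eta>)" using m by simp
    fix y
    show "norm (mol \<epsilon> (x - y) * (g y - g x)) \<le> mol \<epsilon> (x - y) * \<eta>"
    proof (cases "norm (y - x) < \<epsilon>")
      case True
      then show ?thesis using assms(4)[of y] by (auto simp: abs_mult mol_nonneg intro!: mult_left_mono)
    next
      case False
      then show ?thesis using mol_support[OF assms(3), of "x - y"] by (simp add: norm_minus_commute)
    qed
  qed
  also have "\<dots> = \<eta>" using m by simp
  finally show ?thesis by simp
qed

lemma mol_tendsto_L1_continuous:
  fixes g :: "'a::euclidean_space \<Rightarrow> real"
  assumes "continuous_on UNIV g" "\<And>x. R \<le> norm x \<Longrightarrow> g x = 0" and "\<eta> > 0"
  shows "\<exists>\<delta>>0. \<forall>\<epsilon>. 0 < \<epsilon> \<and> \<epsilon> < \<delta> \<longrightarrow> (\<integral>\<^sup>+x. ennreal \<bar>conv (mol \<epsilon>) g x - g x\<bar> \<partial>lborel) \<le> ennreal \<eta>"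
proof -
  define V where "V = measure lborel (cball (0::'a) (R + 1))"
  define \<eta>' where "\<eta>' = \<eta> / (V + 1)"
  have V0: "V \<ge> 0" by (simp add: V_def)
  then have \<eta>': "\<eta>' > 0" "\<eta>' * V \<le> \<eta>" using assms(3) by (auto simp: \<eta>'_def field_simps)
  obtain \<delta> where \<delta>: "\<delta> > 0" "\<And>x y. norm (x - y) < \<delta> \<Longrightarrow> norm (g x - g y) < \<eta>'"
    using compact_support_uniformly_continuous[OF assms(1,2) \<eta>'(1)] by blast
  have "(\<integral>\<^sup>+x. ennreal \<bar>conv (mol \<epsilon>) g x - g x\<bar> \<partial>lborel) \<le> ennreal \<eta>" if \<epsilon>: "0 < \<epsilon>" "\<epsilon> < min \<delta> 1" for \<epsilon>
  proof -
    have "\<bar>conv (mol \<epsilon>) g x - g x\<bar> \<le> \<eta>' * indicator (cball 0 (R + 1)) x" for x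
    proof (cases "norm x \<le> R + 1")
      case True
      have "\<bar>conv (mol \<epsilon>) g x - g x\<bar> \<le> \<eta>'"
      proof (rule mol_uniform[OF assms(1,2) \<epsilon>(1)])
        fix y assume "norm (y - x) < \<epsilon>"
        then show "\<bar>g y - g x\<bar> \<le> \<eta>'" using \<delta>(2)[of y x] \<epsilon>(2) by simp
      qed
      then show ?thesis using True by simp
    next
      case False
      have "\<bar>conv (mol \<epsilon>) g x - g x\<bar> \<le> 0"
      proof (rule mol_uniform[OF assms(1,2) \<epsilon>(1)])
        fix y assume y: "norm (y - x) < \<epsilon>"
        have "norm x \<le> norm y + norm (y - x)" using norm_triangle_sub[of x y] by (simp add: norm_minus_commute)
        then have "R \<le> norm y" "R \<le> norm x" using y \<epsilon>(2) False by auto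
        then show "\<bar>g y - g x\<bar> \<le> 0" using assms(2) by simp
      qed
      then show ?thesis using False by simp
    qed
    then have "(\<integral>\<^sup>+x. ennreal \<bar>conv (mol \<epsilon>) g x - g x\<bar> \<partial>lborel) \<le> (\<integral>\<^sup>+x. ennreal (\<eta>' * indicator (cball 0 (R + 1)) (x :: 'a)) \<partial>lborel)"
      by (intro nn_integral_mono ennreal_leI)
    also have "\<dots> = ennreal (\<eta>' * V)"
    proof -
      have "emeasure lborel (cball (0::'a) (R + 1)) = ennreal V"
        unfolding V_def using emeasure_bounded_finite[OF bounded_cball[of "0::'a" "R + 1"]]
        by (intro emeasure_eq_ennreal_measure) (auto simp: less_top)
      then show ?thesis using \<eta>'(1) V0
        by (simp add: ennreal_mult' ennreal_indicator nn_integral_cmult_indicator ennreal_mult less_imp_le)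
    qed
    also have "\<dots> \<le> ennreal \<eta>" using \<eta>'(2) by (rule ennreal_leI)
    finally show ?thesis .
  qed
  then show ?thesis using \<delta>(1) by (intro exI[of _ "min \<delta> 1"]) auto
qed

text \<open>A three-term estimate: \<open>f\<close> is replaced by a continuous \<open>g\<close> of
  compact support, for which uniform continuity suffices, and the difference \<open>f - g\<close>
  costs no more after mollification than before by \<open>Young_mol_1\<close>.\<close>

lemma mol_tendsto_L1:
  fixes f :: "'a::euclidean_space \<Rightarrow> real"
  assumes f: "integrable lborel f" and "\<eta> > 0"
  shows "\<exists>\<delta>>0. \<forall>\<epsilon>. 0 < \<epsilon> \<and> \<epsilon> < \<delta> \<longrightarrow> (\<integral>\<^sup>+x. ennreal \<bar>conv (mol \<epsilon>) f x - f x\<bar> \<partial>lborel) \<le> ennreal \<eta>"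
proof -
  have "\<eta> / 3 > 0" using assms by simp
  from dense_continuous_L1[OF f this] obtain g R where g: "continuous_on UNIV g" "\<And>x. R \<le> norm x \<Longrightarrow> g x = 0"
    and fg: "(\<integral>x. \<bar>f x - g x\<bar> \<partial>lborel) < \<eta> / 3" by blast
  have gi: "integrable lborel g" using g by (rule integrable_compact_support)
  have [measurable]: "f \<in> borel_measurable borel" "g \<in> borel_measurable borel" using f gi by auto
  have fg': "(\<integral>\<^sup>+x. ennreal \<bar>f x - g x\<bar> \<partial>lborel) \<le> ennreal (\<eta> / 3)"
    using fg f gi by (subst nn_integral_eq_integral) (auto intro!: ennreal_leI)
  obtain \<delta> where \<delta>: "\<delta> > 0"
    "\<And>\<epsilon>. 0 < \<epsilon> \<and> \<epsilon> < \<delta> \<Longrightarrow> (\<integral>\<^sup>+x. ennreal \<bar>conv (mol \<epsilon>) g x - g x\<bar> \<partial>lborel) \<le> ennreal (\<eta> / 3)"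
    using mol_tendsto_L1_continuous[OF g \<open>\<eta> / 3 > 0\<close>] by blast
  have "(\<integral>\<^sup>+x. ennreal \<bar>conv (mol \<epsilon>) f x - f x\<bar> \<partial>lborel) \<le> ennreal \<eta>" if \<epsilon>: "0 < \<epsilon>" "\<epsilon> < \<delta>" for \<epsilon>
  proof -
    have [measurable]: "(mol \<epsilon> :: 'a \<Rightarrow> real) \<in> borel_measurable borel" using \<epsilon> by (simp add: test_function_mol test_function_measurable)
    have [measurable]: "conv (mol \<epsilon>) f \<in> borel_measurable borel" "conv (mol \<epsilon>) g \<in> borel_measurable borel"
       "conv (mol \<epsilon>) (\<lambda>x. f x - g x) \<in> borel_measurable borel"
      by (auto intro!: conv_measurable)
    have eq: "conv (mol \<epsilon>) f x = conv (mol \<epsilon>) (\<lambda>x. f x - g x) x + conv (mol \<epsilon>) g x" for x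
      using conv_integrable[OF integrable_loc_int[OF f] test_function_mol[OF \<epsilon>(1)], of x]
        conv_integrable[OF integrable_loc_int[OF gi] test_function_mol[OF \<epsilon>(1)], of x]
      unfolding conv_def by (simp add: right_diff_distrib)
    have "(\<integral>\<^sup>+x. ennreal \<bar>conv (mol \<epsilon>) f x - f x\<bar> \<partial>lborel)
      \<le> (\<integral>\<^sup>+x. ennreal (norm (conv (mol \<epsilon>) (\<lambda>x. f x - g x) x)) + ennreal \<bar>conv (mol \<epsilon>) g x - g x\<bar> + ennreal \<bar>f x - g x\<bar> \<partial>lborel)"
      by (intro nn_integral_mono) (auto simp: ennreal_plus[symmetric] eq simp del: ennreal_plus intro!: ennreal_leI)
    also have "\<dots> = (\<integral>\<^sup>+x. ennreal (norm (conv (mol \<epsilon>) (\<lambda>x. f x - g x) x)) \<partial>lborel)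
       + (\<integral>\<^sup>+x. ennreal \<bar>conv (mol \<epsilon>) g x - g x\<bar> \<partial>lborel) + (\<integral>\<^sup>+x. ennreal \<bar>f x - g x\<bar> \<partial>lborel)"
      by (simp add: nn_integral_add)
    also have "\<dots> \<le> ennreal (\<eta> / 3) + ennreal (\<eta> / 3) + ennreal (\<eta> / 3)"
    proof (intro add_mono fg')
      show "(\<integral>\<^sup>+x. ennreal \<bar>conv (mol \<epsilon>) g x - g x\<bar> \<partial>lborel) \<le> ennreal (\<eta> / 3)" using \<delta>(2) \<epsilon> by blast
      have "(\<integral>\<^sup>+x. ennreal (norm (conv (mol \<epsilon>) (\<lambda>x. f x - g x) x)) \<partial>lborel) \<le> (\<integral>\<^sup>+x. ennreal (norm (f x - g x)) \<partial>lborel)"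
        using \<epsilon>(1) by (intro Young_mol_1) auto
      then show "(\<integral>\<^sup>+x. ennreal (norm (conv (mol \<epsilon>) (\<lambda>x. f x - g x) x)) \<partial>lborel) \<le> ennreal (\<eta> / 3)"
        using fg' by simp
    qed
    also have "\<dots> = ennreal \<eta>" using assms by (simp add: ennreal_plus[symmetric] del: ennreal_plus)
    finally show ?thesis .
  qed
  then show ?thesis using \<delta>(1) by blast
qed

text \<open>Cutting \<open>f\<close> off outside the ball of radius \<open>R + 1\<close> makes it
  integrable, and for \<epsilon> < 1 its mollification on the ball of radius \<open>R\<close> does
  not see the cut.\<close>

lemma mol_tendsto_local:
  fixes f :: "'a::euclidean_space \<Rightarrow> real"
  assumes f: "loc_int f" and "\<eta> > 0"
  shows "\<exists>\<delta>>0. \<forall>\<epsilon>. 0 < \<epsilon> \<and> \<epsilon> < \<delta> \<longrightarrow>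
    (\<integral>\<^sup>+x. indicator (cball 0 R) x * ennreal \<bar>conv (mol \<epsilon>) f x - f x\<bar> \<partial>lborel) \<le> ennreal \<eta>"
proof -
  define F where "F x = indicator (cball 0 (R + 1)) x *\<^sub>R f x" for x
  have F: "integrable lborel F" using f unfolding F_def loc_int_def by blast
  obtain \<delta> where \<delta>: "\<delta> > 0"
    "\<And>\<epsilon>. 0 < \<epsilon> \<and> \<epsilon> < \<delta> \<Longrightarrow> (\<integral>\<^sup>+x. ennreal \<bar>conv (mol \<epsilon>) F x - F x\<bar> \<partial>lborel) \<le> ennreal \<eta>"
    using mol_tendsto_L1[OF F assms(2)] by blast
  have "(\<integral>\<^sup>+x. indicator (cball 0 R) x * ennreal \<bar>conv (mol \<epsilon>) f x - f x\<bar> \<partial>lborel) \<le> ennreal \<eta>"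
    if \<epsilon>: "0 < \<epsilon>" "\<epsilon> < min \<delta> 1" for \<epsilon>
  proof -
    have "conv (mol \<epsilon>) F x = conv (mol \<epsilon>) f x" if x: "norm x \<le> R" for x
    proof -
      have "mol \<epsilon> (x - y) *\<^sub>R F y = mol \<epsilon> (x - y) *\<^sub>R f y" for y
      proof (cases "norm y \<le> R + 1")
        case False
        then have "\<epsilon> \<le> norm (x - y)" using x \<epsilon> norm_triangle_ineq2[of y x] by (simp add: norm_minus_commute)
        then show ?thesis using mol_support[OF \<epsilon>(1), of "x - y"] by simp
      qed (simp add: F_def)
      then show ?thesis unfolding conv_def by (intro Bochner_Integration.integral_cong refl)
    qed
    then have "indicator (cball 0 R) x * ennreal \<bar>conv (mol \<epsilon>) f x - f x\<bar> \<le> ennreal \<bar>conv (mol \<epsilon>) F x - F x\<bar>" for x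
      by (auto simp: indicator_def F_def)
    then have "(\<integral>\<^sup>+x. indicator (cball 0 R) x * ennreal \<bar>conv (mol \<epsilon>) f x - f x\<bar> \<partial>lborel)
       \<le> (\<integral>\<^sup>+x. ennreal \<bar>conv (mol \<epsilon>) F x - F x\<bar> \<partial>lborel)"
      by (intro nn_integral_mono)
    also have "\<dots> \<le> ennreal \<eta>" using \<delta>(2) \<epsilon> by simp
    finally show ?thesis .
  qed
  then show ?thesis using \<delta>(1) by (intro exI[of _ "min \<delta> 1"]) auto
qed

text \<open>The reflected mollifier centred at \<open>x\<close> is itself a test function, so every
  mollification of \<open>w\<close> vanishes identically, while the mollifications converge to
  \<open>w\<close> in L^1 on every ball.\<close>

lemma fundamental_lemma:
  fixes w :: "'a::euclidean_space \<Rightarrow> real"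
  assumes w: "loc_int w" and 0: "\<And>\<phi>. test_function \<phi> \<Longrightarrow> (\<integral>x. \<phi> x * w x \<partial>lborel) = 0"
  shows "AE x in lborel. w x = 0"
proof -
  have [measurable]: "w \<in> borel_measurable borel" using w by (simp add: loc_int_def)
  have conv0: "conv (mol \<epsilon>) w x = 0" if "\<epsilon> > 0" for \<epsilon> x
    using 0[OF test_function_affine[OF test_function_mol[OF that], of "-1" x]] by (simp add: conv_def)
  have "AE x in lborel. x \<in> cball 0 (real n) \<longrightarrow> w x = 0" for n
  proof -
    have "(\<integral>\<^sup>+x. indicator (cball 0 (real n)) x * ennreal \<bar>w x\<bar> \<partial>lborel) \<le> ennreal \<eta>" if "\<eta> > 0" for \<eta>
    proof -
      obtain \<delta> where \<delta>: "\<delta> > 0" "\<And>\<epsilon>. 0 < \<epsilon> \<and> \<epsilon> < \<delta> \<Longrightarrow>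
        (\<integral>\<^sup>+x. indicator (cball 0 (real n)) x * ennreal \<bar>conv (mol \<epsilon>) w x - w x\<bar> \<partial>lborel) \<le> ennreal \<eta>"
        using mol_tendsto_local[OF w \<open>\<eta> > 0\<close>] by blast
      show ?thesis using \<delta>(2)[of "\<delta> / 2"] \<delta>(1) conv0[of "\<delta> / 2"] by simp
    qed
    then have le: "(\<integral>\<^sup>+x. indicator (cball 0 (real n)) x * ennreal \<bar>w x\<bar> \<partial>lborel) \<le> 0 + ennreal e" if "0 < e" for e
      using that by simp
    have "(\<integral>\<^sup>+x. indicator (cball 0 (real n)) x * ennreal \<bar>w x\<bar> \<partial>lborel) \<le> 0"
      by (rule ennreal_le_epsilon, rule le)
    then have "(\<integral>\<^sup>+x. indicator (cball 0 (real n)) x * ennreal \<bar>w x\<bar> \<partial>lborel) = 0" by simp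
    then have "AE x in lborel. indicator (cball 0 (real n)) x * ennreal \<bar>w x\<bar> = 0"
      by (subst (asm) nn_integral_0_iff_AE) auto
    then show ?thesis by eventually_elim (auto simp: indicator_def split: if_splits)
  qed
  then have "AE x in lborel. \<forall>n. x \<in> cball 0 (real n) \<longrightarrow> w x = 0" by (subst AE_all_countable) blast
  then show ?thesis
  proof eventually_elim
    fix x assume "\<forall>n. x \<in> cball 0 (real n) \<longrightarrow> w x = 0"
    moreover obtain n where "norm x \<le> real n" using real_arch_simple by blast
    ultimately show "w x = 0" by auto
  qed
qed

section \<open>Borel representatives and uniqueness of the weak gradient\<close>

lemma AE_lborel_lebesgue: "(AE x in lborel. P x) \<Longrightarrow> (AE x in lebesgue. P x)"
  by (rule AE_completion)

lemma borel_representative: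
  fixes f :: "'a::euclidean_space \<Rightarrow> 'b::euclidean_space"
  assumes f: "f \<in> borel_measurable lebesgue"
  shows "\<exists>f'\<in>borel_measurable borel. AE x in lebesgue. f x = f' x"
proof -
  have "\<exists>g\<in>borel_measurable lborel. AE x in lborel. f x \<bullet> e = g x" for e
    using f by (intro completion_ex_borel_measurable_real) auto
  then obtain g where g: "\<And>e. g e \<in> borel_measurable lborel" "\<And>e. AE x in lborel. f x \<bullet> e = g e x" by metis
  have [measurable]: "g e \<in> borel_measurable borel" for e using g(1) by simp
  have "AE x in lborel. \<forall>e\<in>Basis. f x \<bullet> e = g e x"
    using g(2) by (subst AE_finite_all) auto
  then have "AE x in lborel. f x = (\<Sum>e\<in>Basis. g e x *\<^sub>R e)"
    by eventually_elim (metis (no_types, lifting) euclidean_representation sum.cong)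
  then show ?thesis
    by (intro bexI[of _ "\<lambda>x. (\<Sum>e\<in>Basis. g e x *\<^sub>R e)"] AE_lborel_lebesgue) auto
qed

lemma locally_integrable_measurable:
  fixes f :: "'a::euclidean_space \<Rightarrow> 'b::euclidean_space"
  assumes "locally_integrable f"
  shows "f \<in> borel_measurable lebesgue"
proof (rule borel_measurable_LIMSEQ_metric)
  show "(\<lambda>x. indicat_real (cball 0 (real n)) x *\<^sub>R f x) \<in> borel_measurable lebesgue" for n
  proof -
    have "integrable lebesgue (\<lambda>x. indicat_real (cball 0 (real n)) x *\<^sub>R f x)"
      using assms unfolding locally_integrable_def set_integrable_def by auto
    then show ?thesis by (rule borel_measurable_integrable)
  qed
  fix x :: 'a
  have "\<forall>\<^sub>F n in sequentially. norm x \<le> real n"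
    by (metis eventually_sequentiallyI nat_ceiling_le_eq)
  then have "\<forall>\<^sub>F n in sequentially. indicat_real (cball 0 (real n)) x *\<^sub>R f x = f x"
    by eventually_elim simp
  then show "(\<lambda>n. indicat_real (cball 0 (real n)) x *\<^sub>R f x) \<longlonglongrightarrow> f x" by (rule tendsto_eventually)
qed

lemma locally_integrable_representative:
  fixes f :: "'a::euclidean_space \<Rightarrow> 'b::euclidean_space"
  assumes "locally_integrable f"
  shows "\<exists>f'. loc_int f' \<and> (AE x in lebesgue. f x = f' x)"
proof -
  obtain f' where f': "f' \<in> borel_measurable borel" "AE x in lebesgue. f x = f' x"
    using borel_representative[OF locally_integrable_measurable[OF assms]] by blast
  note [measurable] = f'(1)
  have "integrable lborel (\<lambda>x. indicator (cball 0 R) x *\<^sub>R f' x)" for R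
  proof -
    have "integrable lebesgue (\<lambda>x. indicator (cball 0 R) x *\<^sub>R f x)"
      using assms unfolding locally_integrable_def set_integrable_def by auto
    then have "integrable lebesgue (\<lambda>x. indicator (cball 0 R) x *\<^sub>R f' x)"
    proof (rule integrable_cong_AE_imp)
      show "(\<lambda>x. indicat_real (cball 0 R) x *\<^sub>R f' x) \<in> borel_measurable lebesgue"
        by (intro measurable_completion borel_measurable_scaleR borel_measurable_indicator) (use f'(1) in auto)
      show "AE x in lebesgue. indicat_real (cball 0 R) x *\<^sub>R f x = indicat_real (cball 0 R) x *\<^sub>R f' x"
        using f'(2) by eventually_elim simp
    qed
    then show ?thesis by (subst (asm) integrable_completion) auto
  qed
  then have "loc_int f'" using f'(1) by (auto simp: loc_int_def)
  then show ?thesis using f'(2) by blast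
qed

lemma loc_int_test:
  fixes f :: "'a::euclidean_space \<Rightarrow> 'b::euclidean_space"
  assumes "loc_int f" "test_function \<phi>"
  shows "integrable lborel (\<lambda>y. \<phi> y *\<^sub>R f y)"
  using conv_integrable[OF assms(1) test_function_affine[OF assms(2), of "-1" 0], of 0] by simp

lemma integral_lebesgue_cong_AE:
  fixes f :: "'a::euclidean_space \<Rightarrow> 'b::euclidean_space"
  assumes "f \<in> borel_measurable lebesgue" "f' \<in> borel_measurable borel" "AE x in lebesgue. f x = f' x"
  shows "(\<integral>x. f x \<partial>lebesgue) = (\<integral>x. f' x \<partial>lborel)"
proof -
  have "(\<integral>x. f x \<partial>lebesgue) = (\<integral>x. f' x \<partial>lebesgue)"
    using assms by (intro integral_cong_AE) (auto intro: measurable_completion)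
  then show ?thesis using assms by (simp add: integral_completion)
qed

text \<open>Transfers the defining identity from \<open>lebesgue\<close> to \<open>lborel\<close>,
  where the results on mollification apply.\<close>

lemma is_weak_grad_representative:
  fixes u :: "'a::euclidean_space \<Rightarrow> real"
  assumes "is_weak_grad u g"
  shows "\<exists>u' g'. loc_int u' \<and> loc_int g' \<and> (AE x in lebesgue. u x = u' x) \<and> (AE x in lebesgue. g x = g' x) \<and>
    (\<forall>\<phi>. test_function \<phi> \<longrightarrow> (\<forall>e\<in>Basis.
        (\<integral>x. u' x * partial_deriv e \<phi> x \<partial>lborel) = - (\<integral>x. (g' x \<bullet> e) * \<phi> x \<partial>lborel)))"
proof -
  have l: "locally_integrable u" "locally_integrable g" using assms by (auto simp: is_weak_grad_def)
  obtain u' where u': "loc_int u'" "AE x in lebesgue. u x = u' x" using locally_integrable_representative[OF l(1)] by blast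
  obtain g' where g': "loc_int g'" "AE x in lebesgue. g x = g' x" using locally_integrable_representative[OF l(2)] by blast
  have mL [measurable]: "u \<in> borel_measurable lebesgue" "g \<in> borel_measurable lebesgue"
    using l by (auto intro: locally_integrable_measurable)
  have mB [measurable]: "u' \<in> borel_measurable borel" "g' \<in> borel_measurable borel" using u' g' by (auto simp: loc_int_def)
  have "(\<integral>x. u' x * partial_deriv e \<phi> x \<partial>lborel) = - (\<integral>x. (g' x \<bullet> e) * \<phi> x \<partial>lborel)"
    if \<phi>: "test_function \<phi>" and e: "e \<in> Basis" for \<phi> e
  proof -
    have \<phi>m [measurable]: "\<phi> \<in> borel_measurable borel" "partial_deriv e \<phi> \<in> borel_measurable borel"
      using \<phi> test_function_partial_deriv[OF \<phi> e] by (auto intro: test_function_measurable)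
    have \<phi>l [measurable]: "\<phi> \<in> borel_measurable lebesgue" "partial_deriv e \<phi> \<in> borel_measurable lebesgue"
      using \<phi>m by (auto intro: measurable_completion)
    have "(\<integral>x. u x * partial_deriv e \<phi> x \<partial>lebesgue) = (\<integral>x. u' x * partial_deriv e \<phi> x \<partial>lborel)"
      using u'(2) by (intro integral_lebesgue_cong_AE) auto
    moreover have "(\<integral>x. (g x \<bullet> e) * \<phi> x \<partial>lebesgue) = (\<integral>x. (g' x \<bullet> e) * \<phi> x \<partial>lborel)"
      using g'(2) by (intro integral_lebesgue_cong_AE) auto
    ultimately show ?thesis using assms \<phi> e by (simp add: is_weak_grad_def)
  qed
  then show ?thesis using u' g' by blast
qed

lemma is_weak_grad_unique:
  fixes u :: "'a::euclidean_space \<Rightarrow> real"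
  assumes "is_weak_grad u g" "is_weak_grad u h"
  shows "AE x in lebesgue. g x = h x"
proof -
  obtain u1 g1 where 1: "loc_int u1" "loc_int g1" "AE x in lebesgue. u x = u1 x" "AE x in lebesgue. g x = g1 x"
     "\<And>\<phi> e. test_function \<phi> \<Longrightarrow> e\<in>Basis \<Longrightarrow> (\<integral>x. u1 x * partial_deriv e \<phi> x \<partial>lborel) = - (\<integral>x. (g1 x \<bullet> e) * \<phi> x \<partial>lborel)"
    using is_weak_grad_representative[OF assms(1)] by blast
  obtain u2 g2 where 2: "loc_int u2" "loc_int g2" "AE x in lebesgue. u x = u2 x" "AE x in lebesgue. h x = g2 x"
     "\<And>\<phi> e. test_function \<phi> \<Longrightarrow> e\<in>Basis \<Longrightarrow> (\<integral>x. u2 x * partial_deriv e \<phi> x \<partial>lborel) = - (\<integral>x. (g2 x \<bullet> e) * \<phi> x \<partial>lborel)"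
    using is_weak_grad_representative[OF assms(2)] by blast
  have [measurable]: "u1 \<in> borel_measurable borel" "u2 \<in> borel_measurable borel"
     "g1 \<in> borel_measurable borel" "g2 \<in> borel_measurable borel" using 1 2 by (auto simp: loc_int_def)
  have "AE x in lebesgue. u1 x = u2 x" using 1(3) 2(3) by eventually_elim simp
  then have uu: "AE x in lborel. u1 x = u2 x" by (simp add: AE_completion_iff)
  have "AE x in lborel. (g1 x - g2 x) \<bullet> e = 0" if e: "e \<in> Basis" for e
  proof (rule fundamental_lemma)
    have i: "integrable lborel (\<lambda>x. indicator (cball 0 R) x *\<^sub>R (g1 x - g2 x))" for R
      using 1(2) 2(2) unfolding loc_int_def scaleR_diff_right by auto
    have "integrable lborel (\<lambda>x. (indicator (cball 0 R) x *\<^sub>R (g1 x - g2 x)) \<bullet> e)" for R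
      by (intro integrable_inner_left i)
    then show "loc_int (\<lambda>x. (g1 x - g2 x) \<bullet> e)" unfolding loc_int_def by simp
    fix \<phi> :: "'a \<Rightarrow> real" assume \<phi>: "test_function \<phi>"
    have [measurable]: "partial_deriv e \<phi> \<in> borel_measurable borel"
      using test_function_partial_deriv[OF \<phi> e] by (rule test_function_measurable)
    have i1: "integrable lborel (\<lambda>x. (g1 x \<bullet> e) * \<phi> x)" "integrable lborel (\<lambda>x. (g2 x \<bullet> e) * \<phi> x)"
      using integrable_inner_left[OF loc_int_test[OF 1(2) \<phi>], of e] integrable_inner_left[OF loc_int_test[OF 2(2) \<phi>], of e]
      by (simp_all add: mult.commute)
    have "(\<integral>x. u1 x * partial_deriv e \<phi> x \<partial>lborel) = (\<integral>x. u2 x * partial_deriv e \<phi> x \<partial>lborel)"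
      using uu by (intro integral_cong_AE) auto
    then have "(\<integral>x. (g1 x \<bullet> e) * \<phi> x \<partial>lborel) = (\<integral>x. (g2 x \<bullet> e) * \<phi> x \<partial>lborel)"
      using 1(5)[OF \<phi> e] 2(5)[OF \<phi> e] by simp
    moreover have "(\<integral>x. \<phi> x * ((g1 x - g2 x) \<bullet> e) \<partial>lborel) = (\<integral>x. (g1 x \<bullet> e) * \<phi> x - (g2 x \<bullet> e) * \<phi> x \<partial>lborel)"
      by (intro Bochner_Integration.integral_cong) (auto simp: inner_diff_left algebra_simps)
    ultimately show "(\<integral>x. \<phi> x * ((g1 x - g2 x) \<bullet> e) \<partial>lborel) = 0"
      using i1 by simp
  qed
  then have "AE x in lborel. \<forall>e\<in>Basis. (g1 x - g2 x) \<bullet> e = 0"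
    by (subst AE_finite_all) auto
  then have "AE x in lborel. g1 x = g2 x"
    by eventually_elim (auto simp: inner_diff_left intro: euclidean_eqI)
  then have "AE x in lebesgue. g1 x = g2 x" by (rule AE_lborel_lebesgue)
  then show ?thesis using 1(4) 2(4) by eventually_elim simp
qed

lemma is_weak_grad_weak_grad: "is_weak_grad u g \<Longrightarrow> is_weak_grad u (weak_grad u)"
  unfolding weak_grad_def by (rule someI[of "is_weak_grad u"])

lemma weak_grad_AE: "is_weak_grad u g \<Longrightarrow> AE x in lebesgue. weak_grad u x = g x"
  using is_weak_grad_unique is_weak_grad_weak_grad by blast

text \<open>For fixed \<open>x\<close> the function \<open>\<rho> (x - y)\<close> of
  \<open>y\<close> is a test function whose derivative carries a minus sign; it cancels the sign in
  the definition of the weak gradient, so mollification commutes with weak differentiation.\<close>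

lemma grad_conv_mol:
  fixes u :: "'a::euclidean_space \<Rightarrow> real"
  assumes u: "loc_int u" and g: "loc_int g"
    and w: "\<And>\<phi> e. test_function \<phi> \<Longrightarrow> e \<in> Basis \<Longrightarrow> (\<integral>x. u x * partial_deriv e \<phi> x \<partial>lborel) = - (\<integral>x. (g x \<bullet> e) * \<phi> x \<partial>lborel)"
    and \<rho>: "test_function \<rho>"
  shows "grad (conv \<rho> u) x = conv \<rho> g x"
proof (rule euclidean_eqI)
  fix e :: 'a assume e: "e \<in> Basis"
  define \<phi> where "\<phi> y = \<rho> (x + (-1::real) *\<^sub>R y)" for y
  have \<phi>: "test_function \<phi>" unfolding \<phi>_def using \<rho> by (rule test_function_affine) simp
  have p: "partial_deriv e \<phi> y = - (grad \<rho> (x - y) \<bullet> e)" for y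
  proof -
    have "\<rho> differentiable at (x + (-1::real) *\<^sub>R y)" using test_function_C_k[OF \<rho>] by (rule C_k_Suc_differentiable)
    from partial_deriv_eq[OF has_derivative_affine[OF this], of e] show ?thesis by (simp add: \<phi>_def[abs_def])
  qed
  have "grad (conv \<rho> u) x \<bullet> e = conv (\<lambda>z. grad \<rho> z \<bullet> e) u x"
    using inner_grad[OF e] partial_deriv_eq[OF conv_has_derivative[OF u \<rho>, of x], of e] by simp
  also have "\<dots> = - (\<integral>y. u y * partial_deriv e \<phi> y \<partial>lborel)"
    unfolding conv_def p by (simp add: mult.commute)
  also have "\<dots> = (\<integral>y. (g y \<bullet> e) * \<phi> y \<partial>lborel)" using w[OF \<phi> e] by simp
  also have "\<dots> = (\<integral>y. (\<rho> (x - y) *\<^sub>R g y) \<bullet> e \<partial>lborel)" by (simp add: \<phi>_def mult.commute)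
  also have "\<dots> = conv \<rho> g x \<bullet> e"
    unfolding conv_def using conv_integrable[OF g \<rho>, of x] by (intro integral_inner_left)
  finally show "grad (conv \<rho> u) x \<bullet> e = conv \<rho> g x \<bullet> e" .
qed

text \<open>In the applications \<theta> is taken small: the coefficient of the main term then
  approaches 1, so sharp constants survive, and the large coefficient falls on a term that can be
  made small afterwards.\<close>

lemma norm_add_sq_le:
  fixes v w :: "'a::real_inner"
  assumes "\<theta> > 0"
  shows "(norm (v + w))\<^sup>2 \<le> (1 + \<theta>) * (norm v)\<^sup>2 + (1 + 1 / \<theta>) * (norm w)\<^sup>2"
proof -
  define s where "s = sqrt \<theta>"
  have s: "s > 0" "\<theta> = s\<^sup>2" using assms by (auto simp: s_def)
  have "0 \<le> (s * norm v - norm w / s)\<^sup>2" by simp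
  also have "\<dots> = \<theta> * (norm v)\<^sup>2 + (1 / \<theta>) * (norm w)\<^sup>2 - 2 * (norm v * norm w)"
    using s by (simp add: power2_diff power_mult_distrib power_divide)
  finally have "2 * (norm v * norm w) \<le> \<theta> * (norm v)\<^sup>2 + (1 / \<theta>) * (norm w)\<^sup>2" by simp
  moreover have "(norm (v + w))\<^sup>2 \<le> (norm v + norm w)\<^sup>2" by (intro power_mono norm_triangle_ineq) simp
  ultimately show ?thesis by (simp add: power2_sum algebra_simps)
qed

text \<open>Mollification does not raise the L^2 norm of the gradient, and a cut-off function
  stretched by 1/t contributes a gradient of size at most \<open>L * t\<close>. Hence the energy
  exceeds that of \<open>u\<close> by as little as desired, as the sharp constant demands; for
  \<open>u\<close> itself closeness in L^1 on a ball is enough.\<close>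

lemma weak_approximation:
  fixes u :: "'a::euclidean_space \<Rightarrow> real"
  assumes u: "loc_int u" and g: "loc_int g"
    and w: "\<And>\<phi> e. test_function \<phi> \<Longrightarrow> e \<in> Basis \<Longrightarrow> (\<integral>x. u x * partial_deriv e \<phi> x \<partial>lborel) = - (\<integral>x. (g x \<bullet> e) * \<phi> x \<partial>lborel)"
    and u2: "integrable lborel (\<lambda>x. (u x)\<^sup>2)" and g2: "integrable lborel (\<lambda>x. (norm (g x))\<^sup>2)" and "\<eta> > 0" and "R > 0"
  shows "\<exists>\<phi>. test_function \<phi> \<and> (\<integral>\<^sup>+x. indicator (cball 0 R) x * ennreal \<bar>\<phi> x - u x\<bar> \<partial>lborel) \<le> ennreal \<eta> \<and>
     (\<integral>x. (norm (grad \<phi> x))\<^sup>2 \<partial>lborel) \<le> (\<integral>x. (norm (g x))\<^sup>2 \<partial>lborel) + \<eta>"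
proof -
  have [measurable]: "u \<in> borel_measurable borel" "g \<in> borel_measurable borel" using u g by (auto simp: loc_int_def)
  have [measurable]: "cball (0::'a) R \<in> sets borel" by simp
  define G where "G = (\<integral>x. (norm (g x))\<^sup>2 \<partial>lborel)"
  define U where "U = (\<integral>x. (u x)\<^sup>2 \<partial>lborel)"
  define I where "I = (\<integral>x. indicator (cball 0 R) x * \<bar>u x\<bar> \<partial>lborel)"
  have nonneg: "G \<ge> 0" "U \<ge> 0" "I \<ge> 0" unfolding G_def U_def I_def by (auto intro!: Bochner_Integration.integral_nonneg)
  \<comment> \<open>\<open>bump 1\<close> has the value exp(-1) at the origin; the factor normalises
    it to 1.\<close>
  define ct where "ct x = exp 1 * bump 1 (x::'a)" for x
  have ct: "test_function ct" unfolding ct_def by (intro test_function_cmult test_function_bump) simp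
  have ct01: "0 \<le> ct x" "ct x \<le> 1" for x
  proof -
    show "0 \<le> ct x" by (simp add: ct_def bump_nonneg)
    show "ct x \<le> 1"
    proof (cases "norm x < 1")
      case True
      then have p: "0 < 1 - (norm x)\<^sup>2" by (simp add: power_less_one_iff)
      have "1 - (norm x)\<^sup>2 \<le> 1" by simp
      then have "1 \<le> 1 / (1 - (norm x)\<^sup>2)" using p by (simp add: le_divide_eq)
      then show ?thesis using p by (simp add: ct_def bump_def cutexp_def dot_square_norm exp_add[symmetric])
    next
      case False
      then show ?thesis using bump_pos_iff[of 1 x] bump_nonneg[of 1 x] by (simp add: ct_def)
    qed
  qed
  have ct0: "ct 0 = 1" by (simp add: ct_def bump_def cutexp_def exp_add[symmetric])
  obtain L where L: "L > 0" "\<And>x. norm (grad ct x) \<le> L" "\<And>x y. \<bar>ct x - ct y\<bar> \<le> L * norm (x - y)"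
    using C1c_bounded_grad[OF test_function_C1c[OF ct]] by blast
  \<comment> \<open>\<theta> is fixed before the stretching parameter \<open>t\<close>, because the
    smallness of \<open>t\<close> has to compensate the factor \<open>1 + 1 / \<theta>\<close>. The
    summand 1 keeps the denominator positive.\<close>
  define \<theta> where "\<theta> = \<eta> / (2 * (G + 1))"
  have \<theta>: "\<theta> > 0" "\<theta> * G \<le> \<eta> / 2"
    using \<open>\<eta> > 0\<close> nonneg by (auto simp: \<theta>_def field_simps)
  have "((\<lambda>t. (1 + 1 / \<theta>) * (L * t)\<^sup>2 * U) \<longlongrightarrow> (1 + 1 / \<theta>) * (L * 0)\<^sup>2 * U) (at_right 0)"
    "((\<lambda>t. (L * R * t) * I) \<longlongrightarrow> (L * R * 0) * I) (at_right 0)"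
    by (intro tendsto_intros)+
  then have "\<forall>\<^sub>F t in at_right 0. (1 + 1 / \<theta>) * (L * t)\<^sup>2 * U < \<eta> / 2 \<and> (L * R * t) * I < \<eta> / 2"
    using \<open>\<eta> > 0\<close> by (intro eventually_conj order_tendstoD) auto
  then obtain t where t: "t > 0" "(1 + 1 / \<theta>) * (L * t)\<^sup>2 * U \<le> \<eta> / 2" "(L * R * t) * I \<le> \<eta> / 2"
    unfolding eventually_at_right_field by (metis dense less_imp_le)
  define X where "X x = ct (t *\<^sub>R x)" for x
  have X: "test_function X" using test_function_affine[OF ct, of t 0] t(1) by (simp add: X_def[abs_def])
  have gX: "grad X = (\<lambda>x. t *\<^sub>R grad ct (t *\<^sub>R x))"
    unfolding X_def using t(1) by (intro C1c_scale test_function_C1c ct) auto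
  have [measurable]: "X \<in> borel_measurable borel" using X by (rule test_function_measurable)
  have \<eta>2: "\<eta> / 2 > 0" using \<open>\<eta> > 0\<close> by simp
  obtain \<epsilon> where \<epsilon>: "\<epsilon> > 0"
    "(\<integral>\<^sup>+x. indicator (cball 0 R) x * ennreal \<bar>conv (mol \<epsilon>) u x - u x\<bar> \<partial>lborel) \<le> ennreal (\<eta> / 2)"
  proof -
    obtain \<delta> where "\<delta> > 0" "\<And>\<epsilon>. 0 < \<epsilon> \<and> \<epsilon> < \<delta> \<Longrightarrow>
      (\<integral>\<^sup>+x. indicator (cball 0 R) x * ennreal \<bar>conv (mol \<epsilon>) u x - u x\<bar> \<partial>lborel) \<le> ennreal (\<eta> / 2)"
      using mol_tendsto_local[OF u \<eta>2] by blast
    then show thesis using that[of "\<delta> / 2"] by simp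
  qed
  have \<rho>: "test_function (mol \<epsilon> :: 'a \<Rightarrow> real)" using \<epsilon>(1) by (rule test_function_mol)
  have [measurable]: "(mol \<epsilon> :: 'a \<Rightarrow> real) \<in> borel_measurable borel" using \<rho> by (rule test_function_measurable)
  define v where "v = conv (mol \<epsilon>) u"
  have vC: "C_k k v" for k unfolding v_def by (rule conv_C_k[OF u \<rho>])
  have [measurable]: "v \<in> borel_measurable borel" "conv (mol \<epsilon>) g \<in> borel_measurable borel"
    unfolding v_def by (auto intro!: conv_measurable)
  have gv: "grad v = conv (mol \<epsilon>) g" unfolding v_def using grad_conv_mol[OF u g w \<rho>] by blast
  have vd: "(v has_derivative (\<lambda>h. grad v x \<bullet> h)) (at x)" for x
    using vC by (intro has_derivative_grad C_k_Suc_differentiable)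
  have gvc: "continuous_on UNIV (grad v)"
    unfolding grad_def[abs_def] using vC[of "Suc 0"] by (auto intro!: continuous_intros)
  define \<phi> where "\<phi> x = X x * v x" for x
  have \<phi>: "test_function \<phi>" unfolding \<phi>_def by (rule test_function_mult[OF X vC])
  have g\<phi>: "grad \<phi> x = X x *\<^sub>R conv (mol \<epsilon>) g x + v x *\<^sub>R grad X x" for x
    using C1c_mult(2)[OF test_function_C1c[OF X] vd gvc] by (simp add: \<phi>_def[abs_def] gv)
  have 1: "(\<integral>\<^sup>+x. indicator (cball 0 R) x * ennreal \<bar>\<phi> x - u x\<bar> \<partial>lborel) \<le> ennreal \<eta>"
  proof -
    have pt: "indicator (cball 0 R) x * ennreal \<bar>\<phi> x - u x\<bar>
       \<le> indicator (cball 0 R) x * ennreal \<bar>v x - u x\<bar> + ennreal ((L * R * t) * (indicator (cball 0 R) x * \<bar>u x\<bar>))" for x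
    proof (cases "norm x \<le> R")
      case True
      have "\<bar>X x - 1\<bar> \<le> L * norm (t *\<^sub>R x - 0)" using L(3)[of "t *\<^sub>R x" 0] by (simp add: X_def ct0)
      also have "\<dots> \<le> L * (t * R)" using True L(1) t(1) by (auto intro!: mult_left_mono)
      finally have X1: "\<bar>X x - 1\<bar> \<le> L * R * t" by (simp add: mult_ac)
      \<comment> \<open>Separates the error of mollification from that of the cut-off.\<close>
      have "\<phi> x - u x = X x * (v x - u x) + (X x - 1) * u x" by (simp add: \<phi>_def algebra_simps)
      also have "\<bar>\<dots>\<bar> \<le> \<bar>X x\<bar> * \<bar>v x - u x\<bar> + \<bar>X x - 1\<bar> * \<bar>u x\<bar>" by (metis abs_mult abs_triangle_ineq)
      also have "\<dots> \<le> 1 * \<bar>v x - u x\<bar> + (L * R * t) * \<bar>u x\<bar>"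
        using X1 ct01[of "t *\<^sub>R x"] by (intro add_mono mult_right_mono) (auto simp: X_def)
      finally show ?thesis using True L(1) t(1) \<open>R > 0\<close>
        by (simp add: ennreal_plus[symmetric] ennreal_leI del: ennreal_plus)
    qed simp
    have i: "integrable lborel (\<lambda>x. indicator (cball 0 R) x * \<bar>u x\<bar>)"
    proof -
      have "integrable lborel (\<lambda>x. norm (indicator (cball 0 R) x *\<^sub>R u x))"
        using u unfolding loc_int_def by (intro integrable_norm) blast
      then show ?thesis by (simp add: abs_mult)
    qed
    have "(\<integral>\<^sup>+x. indicator (cball 0 R) x * ennreal \<bar>\<phi> x - u x\<bar> \<partial>lborel)
      \<le> (\<integral>\<^sup>+x. indicator (cball 0 R) x * ennreal \<bar>v x - u x\<bar> \<partial>lborel) + (\<integral>\<^sup>+x. ennreal ((L * R * t) * (indicator (cball 0 R) x * \<bar>u x\<bar>)) \<partial>lborel)"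
      using pt by (subst nn_integral_add[symmetric]) (auto intro!: nn_integral_mono)
    also have "(\<integral>\<^sup>+x. ennreal ((L * R * t) * (indicator (cball 0 R) x * \<bar>u x\<bar>)) \<partial>lborel) = ennreal ((L * R * t) * I)"
      unfolding I_def using i L(1) t(1) \<open>R > 0\<close> by (subst nn_integral_eq_integral) auto
    also have "(\<integral>\<^sup>+x. indicator (cball 0 R) x * ennreal \<bar>v x - u x\<bar> \<partial>lborel) + ennreal ((L * R * t) * I)
       \<le> ennreal (\<eta> / 2) + ennreal (\<eta> / 2)"
      using \<epsilon>(2) t(3) unfolding v_def by (intro add_mono ennreal_leI)
    also have "\<dots> = ennreal \<eta>" using \<open>\<eta> > 0\<close> by (simp add: ennreal_plus[symmetric] del: ennreal_plus)
    finally show ?thesis .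
  qed
  have 2: "(\<integral>x. (norm (grad \<phi> x))\<^sup>2 \<partial>lborel) \<le> G + \<eta>"
  proof -
    have pt: "(norm (grad \<phi> x))\<^sup>2 \<le> (1 + \<theta>) * (norm (conv (mol \<epsilon>) g x))\<^sup>2 + (1 + 1 / \<theta>) * (L * t)\<^sup>2 * (norm (v x))\<^sup>2" for x
    proof -
      have "(norm (grad \<phi> x))\<^sup>2 \<le> (1 + \<theta>) * (norm (X x *\<^sub>R conv (mol \<epsilon>) g x))\<^sup>2 + (1 + 1 / \<theta>) * (norm (v x *\<^sub>R grad X x))\<^sup>2"
        unfolding g\<phi> by (rule norm_add_sq_le[OF \<theta>(1)])
      also have "\<dots> \<le> (1 + \<theta>) * (norm (conv (mol \<epsilon>) g x))\<^sup>2 + (1 + 1 / \<theta>) * ((L * t) * norm (v x))\<^sup>2"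
      proof (intro add_mono mult_left_mono power_mono)
        show "norm (X x *\<^sub>R conv (mol \<epsilon>) g x) \<le> norm (conv (mol \<epsilon>) g x)"
          using ct01[of "t *\<^sub>R x"] by (simp add: X_def mult_left_le_one_le)
        have "norm (grad X x) \<le> L * t" using L(2)[of "t *\<^sub>R x"] t(1) by (simp add: gX mult.commute)
        then show "norm (v x *\<^sub>R grad X x) \<le> (L * t) * norm (v x)"
          by (simp add: mult.commute mult_left_mono)
      qed (use \<theta>(1) in auto)
      finally show ?thesis by (simp add: power_mult_distrib)
    qed
    have "ennreal (\<integral>x. (norm (grad \<phi> x))\<^sup>2 \<partial>lborel) = (\<integral>\<^sup>+x. ennreal ((norm (grad \<phi> x))\<^sup>2) \<partial>lborel)"
    proof (rule nn_integral_eq_integral[symmetric])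
      obtain R0 where "\<And>x. R0 \<le> norm x \<Longrightarrow> \<phi> x = 0 \<and> grad \<phi> x = 0" using C1c_support[OF test_function_C1c[OF \<phi>]] by blast
      then show "integrable lborel (\<lambda>x. (norm (grad \<phi> x))\<^sup>2)"
        using C1c_continuous_grad[OF test_function_C1c[OF \<phi>]]
        by (intro integrable_compact_support[where R = R0] continuous_intros) auto
    qed auto
    also have "\<dots> \<le> (\<integral>\<^sup>+x. ennreal (1 + \<theta>) * ennreal ((norm (conv (mol \<epsilon>) g x))\<^sup>2) + ennreal ((1 + 1 / \<theta>) * (L * t)\<^sup>2) * ennreal ((norm (v x))\<^sup>2) \<partial>lborel)"
      using pt \<theta>(1) by (intro nn_integral_mono) (auto simp: ennreal_plus[symmetric] ennreal_mult'[symmetric] simp del: ennreal_plus intro!: ennreal_leI)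
    also have "\<dots> = ennreal (1 + \<theta>) * (\<integral>\<^sup>+x. ennreal ((norm (conv (mol \<epsilon>) g x))\<^sup>2) \<partial>lborel) + ennreal ((1 + 1 / \<theta>) * (L * t)\<^sup>2) * (\<integral>\<^sup>+x. ennreal ((norm (v x))\<^sup>2) \<partial>lborel)"
      by (simp add: nn_integral_add nn_integral_cmult)
    also have "\<dots> \<le> ennreal (1 + \<theta>) * ennreal G + ennreal ((1 + 1 / \<theta>) * (L * t)\<^sup>2) * ennreal U"
    proof (intro add_mono mult_left_mono)
      show "(\<integral>\<^sup>+x. ennreal ((norm (conv (mol \<epsilon>) g x))\<^sup>2) \<partial>lborel) \<le> ennreal G"
        using Young_mol_2[of g \<epsilon>] \<epsilon>(1) g2 by (simp add: nn_integral_eq_integral G_def)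
      show "(\<integral>\<^sup>+x. ennreal ((norm (v x))\<^sup>2) \<partial>lborel) \<le> ennreal U"
        using Young_mol_2[of u \<epsilon>] \<epsilon>(1) u2 by (simp add: nn_integral_eq_integral U_def v_def)
    qed auto
    also have "\<dots> = ennreal ((1 + \<theta>) * G + (1 + 1 / \<theta>) * (L * t)\<^sup>2 * U)"
      using \<theta>(1) nonneg by (simp add: ennreal_plus ennreal_mult)
    finally have "(\<integral>x. (norm (grad \<phi> x))\<^sup>2 \<partial>lborel) \<le> (1 + \<theta>) * G + (1 + 1 / \<theta>) * (L * t)\<^sup>2 * U"
      using \<theta>(1) nonneg by (subst (asm) ennreal_le_iff) auto
    also have "\<dots> = G + \<theta> * G + (1 + 1 / \<theta>) * (L * t)\<^sup>2 * U" by (simp add: distrib_right)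
    also have "\<dots> \<le> G + \<eta>" using add_mono[OF \<theta>(2) t(2)] by simp
    finally show ?thesis .
  qed
  show ?thesis using \<phi> 1 2 unfolding G_def by blast
qed

section \<open>Symmetric decreasing rearrangement\<close>

text \<open>Fubini for the region under the graph. Since \<open>ennreal\<close> sends negative
  values to 0, only levels from 0 on contribute.\<close>

lemma layer_cake:
  fixes G :: "'a::euclidean_space \<Rightarrow> real"
  assumes [measurable]: "G \<in> borel_measurable borel"
  shows "(\<integral>\<^sup>+x. ennreal (G x) \<partial>lborel) = (\<integral>\<^sup>+s. indicator {0..} s * emeasure lborel {x. s < G x} \<partial>lborel)"
proof -
  have "(\<integral>\<^sup>+x. ennreal (G x) \<partial>lborel) = (\<integral>\<^sup>+x. (\<integral>\<^sup>+s. (if 0 \<le> s \<and> s < G x then 1 else 0) \<partial>lborel) \<partial>lborel)"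
  proof (rule nn_integral_cong)
    fix x
    have "(\<integral>\<^sup>+s. (if 0 \<le> s \<and> s < G x then 1 else 0) \<partial>lborel) = (\<integral>\<^sup>+s. indicator {0..<G x} s \<partial>lborel)"
      by (intro nn_integral_cong) (auto simp: indicator_def)
    also have "\<dots> = ennreal (G x)" by (cases "0 \<le> G x") (auto simp: ennreal_neg)
    finally show "ennreal (G x) = (\<integral>\<^sup>+s. (if 0 \<le> s \<and> s < G x then 1 else 0) \<partial>lborel)" by simp
  qed
  also have "\<dots> = (\<integral>\<^sup>+s. (\<integral>\<^sup>+x. (if 0 \<le> s \<and> s < G x then 1 else 0) \<partial>lborel) \<partial>lborel)"
    by (rule lborel_pair.Fubini'[symmetric]) measurable
  also have "\<dots> = (\<integral>\<^sup>+s. indicator {0..} s * emeasure lborel {x. s < G x} \<partial>lborel)"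
  proof (rule nn_integral_cong)
    fix s :: real
    have "(\<integral>\<^sup>+x. (if 0 \<le> s \<and> s < G x then 1 else 0) \<partial>lborel) = (\<integral>\<^sup>+x. indicator {0..} s * indicator {x. s < G x} x \<partial>lborel)"
      by (intro nn_integral_cong) (auto simp: indicator_def)
    also have "\<dots> = indicator {0..} s * emeasure lborel {x. s < G x}"
      by (subst nn_integral_cmult_indicator) auto
    finally show "(\<integral>\<^sup>+x. (if 0 \<le> s \<and> s < G x then 1 else 0) \<partial>lborel) = indicator {0..} s * emeasure lborel {x. s < G x}" .
  qed
  finally show ?thesis .
qed

lemma nn_integral_level_mono:
  fixes f g :: "'a::euclidean_space \<Rightarrow> real"
  assumes [measurable]: "f \<in> borel_measurable borel" "g \<in> borel_measurable borel"
    and le: "\<And>s. 0 \<le> s \<Longrightarrow> emeasure lborel {x. s < f x} \<le> emeasure lborel {x. s < g x}"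
  shows "(\<integral>\<^sup>+x. ennreal (f x) \<partial>lborel) \<le> (\<integral>\<^sup>+x. ennreal (g x) \<partial>lborel)"
  unfolding layer_cake[OF assms(1)] layer_cake[OF assms(2)]
  using le by (intro nn_integral_mono) (auto simp: indicator_def)

text \<open>\<open>(\<alpha> - \<beta>)\<^sup>2\<close> is the area of the square of side \<open>[\<beta>, \<alpha>)\<close>.\<close>

lemma layer_cake_diff_sq:
  fixes \<alpha> \<beta> :: "'a::euclidean_space \<Rightarrow> real"
  assumes [measurable]: "\<alpha> \<in> borel_measurable borel" "\<beta> \<in> borel_measurable borel"
    and le: "\<And>x. \<beta> x \<le> \<alpha> x"
  shows "(\<integral>\<^sup>+x. ennreal ((\<alpha> x - \<beta> x)\<^sup>2) \<partial>lborel)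
    = (\<integral>\<^sup>+s. (\<integral>\<^sup>+\<sigma>. emeasure lborel {x. \<beta> x \<le> min s \<sigma> \<and> max s \<sigma> < \<alpha> x} \<partial>lborel) \<partial>lborel)"
proof -
  let ?I = "\<lambda>x s \<sigma>. (if \<beta> x \<le> min s \<sigma> \<and> max s \<sigma> < \<alpha> x then 1 else 0 :: ennreal)"
  have "(\<integral>\<^sup>+x. ennreal ((\<alpha> x - \<beta> x)\<^sup>2) \<partial>lborel) = (\<integral>\<^sup>+x. (\<integral>\<^sup>+s. (\<integral>\<^sup>+\<sigma>. ?I x s \<sigma> \<partial>lborel) \<partial>lborel) \<partial>lborel)"
  proof (rule nn_integral_cong)
    fix x
    have "(\<integral>\<^sup>+s. (\<integral>\<^sup>+\<sigma>. ?I x s \<sigma> \<partial>lborel) \<partial>lborel)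
       = (\<integral>\<^sup>+s. (\<integral>\<^sup>+\<sigma>. indicator {\<beta> x..<\<alpha> x} s * indicator {\<beta> x..<\<alpha> x} \<sigma> \<partial>lborel) \<partial>lborel)"
      by (intro nn_integral_cong) (auto simp: indicator_def)
    also have "\<dots> = (\<integral>\<^sup>+s. indicator {\<beta> x..<\<alpha> x} s * ennreal (\<alpha> x - \<beta> x) \<partial>lborel)"
      using le[of x] by (subst nn_integral_cmult_indicator) auto
    also have "\<dots> = ennreal (\<alpha> x - \<beta> x) * ennreal (\<alpha> x - \<beta> x)"
      using le[of x] by (subst nn_integral_multc) auto
    also have "\<dots> = ennreal ((\<alpha> x - \<beta> x)\<^sup>2)" using le[of x] by (simp add: ennreal_mult'[symmetric] power2_eq_square)
    finally show "ennreal ((\<alpha> x - \<beta> x)\<^sup>2) = (\<integral>\<^sup>+s. (\<integral>\<^sup>+\<sigma>. ?I x s \<sigma> \<partial>lborel) \<partial>lborel)" by simp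
  qed
  also have "\<dots> = (\<integral>\<^sup>+s. (\<integral>\<^sup>+x. (\<integral>\<^sup>+\<sigma>. ?I x s \<sigma> \<partial>lborel) \<partial>lborel) \<partial>lborel)"
    by (rule lborel_pair.Fubini'[symmetric]) measurable
  also have "\<dots> = (\<integral>\<^sup>+s. (\<integral>\<^sup>+\<sigma>. (\<integral>\<^sup>+x. ?I x s \<sigma> \<partial>lborel) \<partial>lborel) \<partial>lborel)"
    by (intro nn_integral_cong lborel_pair.Fubini'[symmetric]) measurable
  also have "\<dots> = (\<integral>\<^sup>+s. (\<integral>\<^sup>+\<sigma>. emeasure lborel {x. \<beta> x \<le> min s \<sigma> \<and> max s \<sigma> < \<alpha> x} \<partial>lborel) \<partial>lborel)"
  proof (intro nn_integral_cong)
    fix s \<sigma> :: real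
    have "(\<integral>\<^sup>+x. ?I x s \<sigma> \<partial>lborel) = (\<integral>\<^sup>+x. indicator {x. \<beta> x \<le> min s \<sigma> \<and> max s \<sigma> < \<alpha> x} x \<partial>lborel)"
      by (intro nn_integral_cong) (auto simp: indicator_def)
    also have "\<dots> = emeasure lborel {x. \<beta> x \<le> min s \<sigma> \<and> max s \<sigma> < \<alpha> x}"
      by (rule nn_integral_indicator) measurable
    finally show "(\<integral>\<^sup>+x. ?I x s \<sigma> \<partial>lborel) = emeasure lborel {x. \<beta> x \<le> min s \<sigma> \<and> max s \<sigma> < \<alpha> x}" .
  qed
  finally show ?thesis .
qed

text \<open>\<open>layer_cake_diff_sq\<close> integrates over pairs of levels, of which only the
  smaller and the larger one matter, so a comparison for \<open>s \<le> \<sigma>\<close> suffices. A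
  pair with a negative lower level contributes nothing on the left because \<open>\<beta>1\<close>
  is nonnegative.\<close>

lemma nn_integral_diff_sq_level_mono:
  fixes \<alpha>1 \<alpha>2 \<beta>1 \<beta>2 :: "'a::euclidean_space \<Rightarrow> real"
  assumes m: "\<alpha>1 \<in> borel_measurable borel" "\<beta>1 \<in> borel_measurable borel" "\<alpha>2 \<in> borel_measurable borel" "\<beta>2 \<in> borel_measurable borel"
    and o: "\<And>x. \<beta>1 x \<le> \<alpha>1 x" "\<And>x. \<beta>2 x \<le> \<alpha>2 x" "\<And>x. 0 \<le> \<beta>1 x"
    and le: "\<And>s \<sigma>. 0 \<le> s \<Longrightarrow> s \<le> \<sigma> \<Longrightarrow> emeasure lborel {x. \<beta>1 x \<le> s \<and> \<sigma> < \<alpha>1 x} \<le> emeasure lborel {x. \<beta>2 x \<le> s \<and> \<sigma> < \<alpha>2 x}"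
  shows "(\<integral>\<^sup>+x. ennreal ((\<alpha>1 x - \<beta>1 x)\<^sup>2) \<partial>lborel) \<le> (\<integral>\<^sup>+x. ennreal ((\<alpha>2 x - \<beta>2 x)\<^sup>2) \<partial>lborel)"
  unfolding layer_cake_diff_sq[OF m(1,2) o(1)] layer_cake_diff_sq[OF m(3,4) o(2)]
proof (intro nn_integral_mono)
  fix s \<sigma> :: real
  show "emeasure lborel {x. \<beta>1 x \<le> min s \<sigma> \<and> max s \<sigma> < \<alpha>1 x} \<le> emeasure lborel {x. \<beta>2 x \<le> min s \<sigma> \<and> max s \<sigma> < \<alpha>2 x}"
  proof (cases "0 \<le> min s \<sigma>")
    case True
    then show ?thesis by (intro le) auto
  next
    case False
    then have "{x. \<beta>1 x \<le> min s \<sigma> \<and> max s \<sigma> < \<alpha>1 x} = {}" using order_trans[OF o(3)] by blast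
    then show ?thesis by (simp only: emeasure_empty zero_le)
  qed
qed

text \<open>In this locale, \<open>dil t\<close> is \<open>F\<^sub>t\<close>, \<open>rad s\<close> is the radius of the ball with the volume of the superlevel set, and
  \<open>prof (norm x)\<close> is the symmetric decreasing rearrangement of \<open>F\<close>; \<open>prof\<close> is constant on negative numbers, so that
  \<open>prof (norm x - t)\<close> is the supremum of the rearrangement over the ball of radius \<open>t\<close> about \<open>x\<close>.\<close>

locale hill =
  fixes F :: "'a::euclidean_space \<Rightarrow> real" and L R :: real
  assumes nonneg: "0 \<le> F x" and lip: "\<bar>F x - F y\<bar> \<le> L * norm (x - y)" and supp: "R \<le> norm x \<Longrightarrow> F x = 0"
    and L_pos: "0 < L"
begin

section \<open>Superlevel sets, dilations and the rearranged profile\<close>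

lemma F_continuous: "continuous_on UNIV F"
proof -
  have "L-lipschitz_on UNIV F"
    using lip L_pos by (intro lipschitz_onI) (auto simp: dist_norm)
  then show ?thesis by (rule lipschitz_on_continuous_on)
qed

lemma F_measurable [measurable]: "F \<in> borel_measurable borel"
  using F_continuous by (rule borel_measurable_continuous_onI)

lemma F_bounded: "\<exists>M>0. \<forall>x. F x \<le> M"
  using compact_support_bounded[OF F_continuous supp] by (metis abs_le_D1 real_norm_def)

definition lev :: "real \<Rightarrow> 'a set" where "lev s = {x. s < F x}"

definition dil :: "real \<Rightarrow> 'a \<Rightarrow> real" where "dil t x = (SUP y\<in>ball 0 t. F (x + y))"

definition vol1 :: real where "vol1 = measure lborel (ball (0::'a) 1)"

definition rad :: "real \<Rightarrow> real" where "rad s = root DIM('a) (measure lborel (lev s) / vol1)"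

text \<open>The generalised inverse of the decreasing function \<open>rad\<close>. The inserted 0 is
  the value at radii that the superlevel sets do not reach.\<close>

definition prof :: "real \<Rightarrow> real" where "prof r = Sup (insert 0 {s. 0 \<le> s \<and> max r 0 < rad s})"

lemma vol1_pos: "0 < vol1"
  unfolding vol1_def using content_ball_pos[of 1 "0::'a"] by simp

lemma measure_ball: "0 \<le> r \<Longrightarrow> measure lborel (ball (0::'a) r) = r ^ DIM('a) * vol1"
  unfolding vol1_def by (rule content_ball_conv_unit_ball)

lemma lev_open: "open (lev s)"
  unfolding lev_def using F_continuous by (intro open_Collect_less continuous_intros)

lemma lev_bounded: "0 \<le> s \<Longrightarrow> bounded (lev s)"
proof -
  assume "0 \<le> s"
  then have "lev s \<subseteq> ball 0 R" unfolding lev_def using supp by (fastforce simp: not_less[symmetric])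
  then show ?thesis using bounded_ball bounded_subset by blast
qed

lemma rad_nonneg: "0 \<le> rad s"
  unfolding rad_def using vol1_pos by (intro real_root_ge_zero divide_nonneg_pos) auto

lemma measure_lev: "measure lborel (lev s) = rad s ^ DIM('a) * vol1"
  unfolding rad_def using vol1_pos by (simp add: real_root_pow_pos2)

lemma rad_antimono: "0 \<le> s \<Longrightarrow> s \<le> s' \<Longrightarrow> rad s' \<le> rad s"
proof -
  assume s: "0 \<le> s" "s \<le> s'"
  have "measure lborel (lev s') \<le> measure lborel (lev s)"
    using s lev_open lev_bounded by (intro measure_open_bounded_mono) (auto simp: lev_def)
  then show ?thesis unfolding rad_def using vol1_pos by (intro real_root_le_mono divide_right_mono) auto
qed

lemma rad_eq_0: "\<exists>M>0. \<forall>s\<ge>M. rad s = 0"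
proof -
  obtain M where "M > 0" "\<And>x. F x \<le> M" using F_bounded by blast
  moreover have "lev s = {}" if "M \<le> s" for s
    using \<open>\<And>x. F x \<le> M\<close> that by (auto simp: lev_def not_less intro: order_trans)
  then have "\<forall>s\<ge>M. rad s = 0" by (simp add: rad_def)
  ultimately show ?thesis by blast
qed

lemma rad_pos: "rad s > 0 \<Longrightarrow> lev s \<noteq> {}"
  by (auto simp: rad_def)

text \<open>Continuity of measure from below along the superlevel sets at levels decreasing to
  \<open>s\<close>. This is why strict inequalities for \<open>rad\<close> and for
  \<open>prof\<close> are equivalent.\<close>

lemma rad_right_continuous:
  assumes "0 \<le> s" "r < rad s"
  shows "\<exists>s'>s. r < rad s'"
proof -
  define A where "A n = lev (s + 1 / real (Suc n))" for n
  have "(\<lambda>n. measure lborel (A n)) \<longlonglongrightarrow> measure lborel (\<Union>n. A n)"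
  proof (rule Lim_measure_incseq)
    show "range A \<subseteq> sets lborel" unfolding A_def using lev_open by auto
    show "incseq A"
    proof (rule incseq_SucI)
      fix n
      have "1 / real (Suc (Suc n)) \<le> 1 / real (Suc n)" by (intro divide_left_mono) auto
      then show "A n \<le> A (Suc n)" unfolding A_def lev_def by auto
    qed
    have "(\<Union>n. A n) \<subseteq> lev s"
    proof
      fix x assume "x \<in> (\<Union>n. A n)"
      then obtain n where "s + 1 / real (Suc n) < F x" by (auto simp: A_def lev_def)
      moreover have "0 < 1 / real (Suc n)" by simp
      ultimately have "s < F x" by linarith
      then show "x \<in> lev s" unfolding lev_def by simp
    qed
    then have "bounded (\<Union>n. A n)" using lev_bounded[OF assms(1)] bounded_subset by blast
    then show "emeasure lborel (\<Union>n. A n) \<noteq> \<infinity>" using emeasure_bounded_finite by fastforce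
  qed
  moreover have "(\<Union>n. A n) = lev s"
  proof
    show "(\<Union>n. A n) \<subseteq> lev s"
    proof
      fix x assume "x \<in> (\<Union>n. A n)"
      then obtain n where "s + 1 / real (Suc n) < F x" by (auto simp: A_def lev_def)
      moreover have "0 < 1 / real (Suc n)" by simp
      ultimately have "s < F x" by linarith
      then show "x \<in> lev s" unfolding lev_def by simp
    qed
    show "lev s \<subseteq> (\<Union>n. A n)"
    proof
      fix x assume "x \<in> lev s"
      then have "0 < F x - s" by (simp add: lev_def)
      then obtain n where "inverse (real (Suc n)) < F x - s" using reals_Archimedean by blast
      then show "x \<in> (\<Union>n. A n)" by (auto simp: A_def lev_def inverse_eq_divide intro!: exI[of _ n])
    qed
  qed
  ultimately have "(\<lambda>n. measure lborel (A n)) \<longlonglongrightarrow> measure lborel (lev s)" by simp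
  then have "(\<lambda>n. rad (s + 1 / real (Suc n))) \<longlonglongrightarrow> rad s"
    unfolding rad_def A_def using vol1_pos by (intro tendsto_intros) auto
  then have "\<forall>\<^sub>F n in sequentially. r < rad (s + 1 / real (Suc n))" using assms(2) by (rule order_tendstoD)
  then obtain n where "r < rad (s + 1 / real (Suc n))" by (auto simp: eventually_sequentially)
  then show ?thesis by (intro exI[of _ "s + 1 / real (Suc n)"]) auto
qed

lemma prof_bdd: "bdd_above (insert 0 {s. 0 \<le> s \<and> max r 0 < rad s})"
proof -
  obtain M where M: "M > 0" "\<And>s. s \<ge> M \<Longrightarrow> rad s = 0" using rad_eq_0 by blast
  have "s \<le> M" if "max r 0 < rad s" for s using M(2)[of s] that by (cases "s \<le> M") auto
  then show ?thesis using M(1) by (intro bdd_aboveI[of _ M]) auto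
qed

lemma prof_nonneg: "0 \<le> prof r"
  unfolding prof_def by (intro cSup_upper prof_bdd) simp

text \<open>The adjunction between \<open>prof\<close> and \<open>rad\<close>. It identifies the
  superlevel sets of the rearrangement with balls; monotonicity, the Lipschitz bound and
  equimeasurability are read off from it.\<close>

lemma prof_gt: 
  assumes "0 \<le> s"
  shows "s < prof r \<longleftrightarrow> max r 0 < rad s"
proof
  assume "s < prof r"
  then obtain s' where s': "s' \<in> insert 0 {s. 0 \<le> s \<and> max r 0 < rad s}" "s < s'"
    unfolding prof_def by (subst (asm) less_cSup_iff) (auto simp: prof_bdd[simplified])
  then have "max r 0 < rad s'" using assms by auto
  also have "\<dots> \<le> rad s" using s'(2) assms by (intro rad_antimono) auto
  finally show "max r 0 < rad s" .
next
  assume "max r 0 < rad s"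
  then obtain s' where s': "s' > s" "max r 0 < rad s'" using rad_right_continuous[OF assms] by blast
  then have "s' \<le> prof r" unfolding prof_def using assms by (intro cSup_upper prof_bdd) auto
  then show "s < prof r" using s'(1) by simp
qed

lemma prof_antimono: "r \<le> r' \<Longrightarrow> prof r' \<le> prof r"
proof (rule ccontr)
  assume r: "r \<le> r'" and "\<not> prof r' \<le> prof r"
  then have "prof r < prof r'" by simp
  then have "max r' 0 < rad (prof r)" using prof_gt[OF prof_nonneg] by blast
  then have "max r 0 < rad (prof r)" using r by auto
  then show False using prof_gt[OF prof_nonneg, of r r] by simp
qed

lemma prof_eq_0: "rad 0 \<le> r \<Longrightarrow> prof r = 0"
  using prof_gt[of 0 r] prof_nonneg[of r] by auto

lemma dil_bdd: "bdd_above ((\<lambda>y. F (x + y)) ` ball 0 t)"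
proof -
  obtain M where "\<And>x. F x \<le> M" using F_bounded by blast
  then show ?thesis by (intro bdd_aboveI[of _ M]) auto
qed

text \<open>A supremum exceeds \<open>s\<close> exactly if some value does, and the ball is
  symmetric. Dilating \<open>F\<close> thus amounts to adding a ball to each of its superlevel sets,
  which is where Brunn--Minkowski enters.\<close>

lemma dil_level: "0 < t \<Longrightarrow> {x. s < dil t x} = msum (lev s) (ball 0 t)"
proof -
  assume t: "0 < t"
  have "s < dil t x \<longleftrightarrow> (\<exists>y\<in>ball 0 t. s < F (x + y))" for x
    unfolding dil_def using t by (subst less_cSUP_iff[OF _ dil_bdd]) auto
  moreover have "(\<exists>y\<in>ball 0 t. s < F (x + y)) \<longleftrightarrow> x \<in> msum (lev s) (ball 0 t)" for x
  proof
    assume "\<exists>y\<in>ball 0 t. s < F (x + y)"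
    then obtain y where "y \<in> ball 0 t" "s < F (x + y)" by blast
    then have "x = (x + y) + (- y)" "x + y \<in> lev s" "- y \<in> ball 0 t" by (auto simp: lev_def)
    then show "x \<in> msum (lev s) (ball 0 t)" unfolding msum_def by blast
  next
    assume "x \<in> msum (lev s) (ball 0 t)"
    then obtain z w where "x = z + w" "z \<in> lev s" "w \<in> ball 0 t" unfolding msum_def by blast
    then show "\<exists>y\<in>ball 0 t. s < F (x + y)" by (intro bexI[of _ "- w"]) (auto simp: lev_def)
  qed
  ultimately show ?thesis by blast
qed

lemma dil_measurable: "0 < t \<Longrightarrow> dil t \<in> borel_measurable borel"
proof (rule borel_measurableI_greater)
  fix s assume t: "0 < t"
  have "open {x. s < dil t x}" unfolding dil_level[OF t] using lev_open by (rule open_msum)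
  then show "{x \<in> space borel. s < dil t x} \<in> sets borel" by simp
qed

lemma dil_ge: "0 < t \<Longrightarrow> F x \<le> dil t x"
  unfolding dil_def using cSUP_upper[OF _ dil_bdd, of 0 t x] by simp

text \<open>Brunn--Minkowski for a superlevel set and a ball, expressed through radii. The
  hypothesis \<open>0 < rad s\<close> excludes the empty set, whose sum with the ball is empty as
  well.\<close>

lemma measure_dil_level:
  assumes "0 < t" "0 \<le> s" "0 < rad s"
  shows "(rad s + t) ^ DIM('a) * vol1 \<le> measure lborel {x. s < dil t x}"
proof -
  let ?n = "DIM('a)"
  have "(root ?n (measure lborel (lev s)) + root ?n (measure lborel (ball (0::'a) t))) ^ ?n \<le> measure lborel (msum (lev s) (ball 0 t))"
    using assms lev_open lev_bounded rad_pos by (intro Brunn_Minkowski_open) auto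
  moreover have "root ?n (measure lborel (lev s)) = rad s * root ?n vol1"
    unfolding measure_lev using rad_nonneg[of s] by (simp add: real_root_mult real_root_power_cancel)
  moreover have "root ?n (measure lborel (ball (0::'a) t)) = t * root ?n vol1"
    using assms(1) by (simp add: measure_ball real_root_mult real_root_power_cancel)
  ultimately have "(rad s * root ?n vol1 + t * root ?n vol1) ^ ?n \<le> measure lborel (msum (lev s) (ball 0 t))" by simp
  moreover have "(rad s * root ?n vol1 + t * root ?n vol1) ^ ?n = (rad s + t) ^ ?n * vol1"
    using vol1_pos by (simp add: distrib_right[symmetric] power_mult_distrib real_root_pow_pos2)
  ultimately show ?thesis by (simp add: dil_level[OF assms(1)])
qed

lemma dil_level_bounded: "0 < t \<Longrightarrow> 0 \<le> s \<Longrightarrow> bounded {x. s < dil t x}"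
  unfolding dil_level using lev_bounded by (intro bounded_msum) auto

text \<open>By the Lipschitz bound on \<open>F\<close>, the superlevel set at
  \<open>s + L * t\<close> enlarged by a ball of radius \<open>t\<close> stays inside the one at
  \<open>s\<close>; Brunn--Minkowski turns this inclusion into
  \<open>rad (s + L * t) + t \<le> rad s\<close>.\<close>

lemma prof_lipschitz:
  assumes "0 \<le> r" "0 < t"
  shows "prof r \<le> prof (r + t) + L * t"
proof (rule ccontr)
  define s where "s = prof (r + t)"
  have s0: "0 \<le> s" by (simp add: s_def prof_nonneg)
  have Lt: "0 < L * t" using L_pos assms by simp
  assume "\<not> prof r \<le> prof (r + t) + L * t"
  then have "s + L * t < prof r" by (simp add: s_def)
  then have rr: "max r 0 < rad (s + L * t)" using prof_gt[of "s + L * t" r] s0 Lt by simp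
  have sub: "{x. s + L * t < dil t x} \<subseteq> lev s"
  proof
    fix x assume "x \<in> {x. s + L * t < dil t x}"
    then obtain z w where x: "x = z + w" "s + L * t < F z" "norm w < t"
      unfolding dil_level[OF assms(2)] msum_def lev_def by auto
    have "\<bar>F z - F x\<bar> \<le> L * norm w" using lip[of z x] x(1) by simp
    also have "\<dots> \<le> L * t" using x(3) L_pos by simp
    finally show "x \<in> lev s" using x(2) by (simp add: lev_def)
  qed
  have "(rad (s + L * t) + t) ^ DIM('a) * vol1 \<le> measure lborel {x. s + L * t < dil t x}"
    using rr assms s0 Lt by (intro measure_dil_level) auto
  also have "\<dots> \<le> measure lborel (lev s)"
  proof (rule measure_open_bounded_mono[OF sub])
    show "open {x. s + L * t < dil t x}" unfolding dil_level[OF assms(2)] using lev_open by (rule open_msum)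
  qed (use s0 lev_open lev_bounded in auto)
  also have "\<dots> = rad s ^ DIM('a) * vol1" by (rule measure_lev)
  finally have "(rad (s + L * t) + t) ^ DIM('a) \<le> rad s ^ DIM('a)" using vol1_pos by simp
  then have "rad (s + L * t) + t \<le> rad s" using rad_nonneg by (subst (asm) power_mono_iff) (use assms rad_nonneg in auto)
  then have "max (r + t) 0 < rad s" using rr assms by auto
  then have "s < prof (r + t)" using prof_gt[OF s0] by blast
  then show False by (simp add: s_def)
qed

lemma prof_continuous: "continuous_on UNIV prof"
proof -
  have *: "\<bar>prof r - prof r'\<bar> \<le> L * \<bar>r - r'\<bar>" if "r \<le> r'" for r r'
  proof -
    have eq: "prof r = prof (max r 0)" for r unfolding prof_def by simp
    have "prof (max r 0) \<le> prof (max r' 0) + L * (max r' 0 - max r 0)"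
    proof (cases "max r 0 = max r' 0")
      case False
      then have "max r 0 < max r' 0" using that by auto
      then show ?thesis using prof_lipschitz[of "max r 0" "max r' 0 - max r 0"] by simp
    qed simp
    also have "\<dots> \<le> prof (max r' 0) + L * (r' - r)" using L_pos that by (auto simp: max_def mult_left_mono)
    finally show ?thesis using prof_antimono[OF that] that eq[of r] eq[of r'] by auto
  qed
  have "L-lipschitz_on UNIV prof"
  proof (rule lipschitz_onI)
    show "dist (prof r) (prof r') \<le> L * dist r r'" for r r'
      using *[of r r'] *[of r' r] by (cases "r \<le> r'") (auto simp: dist_real_def abs_minus_commute)
  qed (use L_pos in simp)
  then show ?thesis by (rule lipschitz_on_continuous_on)
qed

lemma prof_measurable [measurable]: "prof \<in> borel_measurable borel"
  using prof_continuous by (rule borel_measurable_continuous_onI)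

lemma emeasure_open_bounded: "open A \<Longrightarrow> bounded A \<Longrightarrow> emeasure lborel A = ennreal (measure lborel (A :: 'a set))"
  using emeasure_bounded_finite[of A] by (intro emeasure_eq_ennreal_measure) auto

lemma equimeasurable: "0 \<le> s \<Longrightarrow> emeasure lborel {x::'a. s < prof (norm x)} = emeasure lborel (lev s)"
proof -
  assume s: "0 \<le> s"
  have "{x::'a. s < prof (norm x)} = ball 0 (rad s)"
    unfolding prof_gt[OF s] by (auto simp: max_absorb1)
  then show ?thesis using rad_nonneg s lev_open lev_bounded
    by (simp add: emeasure_open_bounded measure_ball measure_lev)
qed

lemma nn_integral_rearrangement_4: "(\<integral>\<^sup>+x. ennreal (F x ^ 4) \<partial>lborel) \<le> (\<integral>\<^sup>+x. ennreal (prof (norm (x::'a)) ^ 4) \<partial>lborel)"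
proof (rule nn_integral_level_mono)
  fix s :: real assume s: "0 \<le> s"
  have *: "s < y ^ 4 \<longleftrightarrow> root 4 s < y" if "0 \<le> y" for y
  proof -
    have "root 4 s < root 4 (y ^ 4) \<longleftrightarrow> s < y ^ 4" by (rule real_root_less_iff) simp
    then show ?thesis using that by (simp add: real_root_power_cancel)
  qed
  have "{x. s < F x ^ 4} = lev (root 4 s)" unfolding lev_def by (rule Collect_cong, rule *[OF nonneg])
  moreover have "{x::'a. s < prof (norm x) ^ 4} = {x. root 4 s < prof (norm x)}"
    by (rule Collect_cong, rule *[OF prof_nonneg])
  ultimately show "emeasure lborel {x. s < F x ^ 4} \<le> emeasure lborel {x::'a. s < prof (norm x) ^ 4}"
    using equimeasurable[of "root 4 s"] s by simp
qed auto

text \<open>For the rearrangement the set to be measured lies in the shell between the radii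
  \<open>rad s\<close> and \<open>rad \<sigma> + t\<close>. For \<open>F\<close> it is
  \<open>{x. \<sigma> < dil t x}\<close> without \<open>lev s\<close>: the first has at least the
  volume of the outer ball by \<open>measure_dil_level\<close>, the second exactly that of the inner
  one.\<close>

lemma nn_integral_rearrangement_diff:
  assumes t: "0 < t"
  shows "(\<integral>\<^sup>+x. ennreal ((prof (norm (x::'a) - t) - prof (norm x))\<^sup>2) \<partial>lborel) \<le> (\<integral>\<^sup>+x. ennreal ((dil t x - F x)\<^sup>2) \<partial>lborel)"
proof (rule nn_integral_diff_sq_level_mono)
  show "(\<lambda>x::'a. prof (norm x - t)) \<in> borel_measurable borel" "(\<lambda>x::'a. prof (norm x)) \<in> borel_measurable borel"
    "dil t \<in> borel_measurable borel" "F \<in> borel_measurable borel"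
    using dil_measurable[OF t] by simp_all
  show "prof (norm x) \<le> prof (norm x - t)" for x :: 'a using t by (intro prof_antimono) simp
  show "F x \<le> dil t x" for x using t by (rule dil_ge)
  show "0 \<le> prof (norm x)" for x :: 'a by (rule prof_nonneg)
  fix s \<sigma> :: real assume s: "0 \<le> s" "s \<le> \<sigma>"
  let ?A = "{x::'a. prof (norm x) \<le> s \<and> \<sigma> < prof (norm x - t)}" and ?D = "{x. \<sigma> < dil t x}"
  have \<sigma>: "0 \<le> \<sigma>" using s by simp
  have oD: "open ?D" unfolding dil_level[OF t] using lev_open by (rule open_msum)
  show "emeasure lborel ?A \<le> emeasure lborel {x. F x \<le> s \<and> \<sigma> < dil t x}"
  \<comment> \<open>If the condition fails, no point satisfies both inequalities for the profile and
    the left-hand set is empty.\<close>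
  proof (cases "0 < rad \<sigma> \<and> rad s \<le> rad \<sigma> + t")
    case False
    have "?A = {}"
    proof (rule ccontr)
      assume "?A \<noteq> {}"
      then obtain x :: 'a where "\<not> s < prof (norm x)" "\<sigma> < prof (norm x - t)" by force
      then have "rad s \<le> norm x" "max (norm x - t) 0 < rad \<sigma>" using prof_gt[OF s(1)] prof_gt[OF \<sigma>] by auto
      then show False using False by auto
    qed
    then show ?thesis by (simp only: emeasure_empty zero_le)
  next
    case True
    have "?A \<subseteq> ball 0 (rad \<sigma> + t) - ball 0 (rad s)"
    proof
      fix x assume "x \<in> ?A"
      then have "\<not> s < prof (norm x)" "\<sigma> < prof (norm x - t)" by auto
      then have "rad s \<le> norm x" "max (norm x - t) 0 < rad \<sigma>" using prof_gt[OF s(1)] prof_gt[OF \<sigma>] by auto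
      then show "x \<in> ball 0 (rad \<sigma> + t) - ball 0 (rad s)" by auto
    qed
    then have "emeasure lborel ?A \<le> emeasure lborel (ball (0::'a) (rad \<sigma> + t) - ball 0 (rad s))"
      by (rule emeasure_mono) simp
    also have "\<dots> = emeasure lborel (ball (0::'a) (rad \<sigma> + t)) - emeasure lborel (ball (0::'a) (rad s))"
      using True emeasure_bounded_finite[OF bounded_ball[of "0::'a" "rad s"]] by (intro emeasure_Diff) (auto simp: subset_ball)
    also have "\<dots> = ennreal ((rad \<sigma> + t) ^ DIM('a) * vol1) - emeasure lborel (lev s)"
      using rad_nonneg[of s] rad_nonneg[of \<sigma>] t s lev_open lev_bounded
      by (simp add: emeasure_open_bounded measure_ball measure_lev)
    also have "\<dots> \<le> emeasure lborel ?D - emeasure lborel (lev s)"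
      using measure_dil_level[OF t \<sigma>] True emeasure_open_bounded[OF oD dil_level_bounded[OF t \<sigma>]]
      by (intro ennreal_minus_mono) (auto intro: ennreal_leI)
    also have "\<dots> \<le> emeasure lborel (?D - lev s)"
    proof -
      have "emeasure lborel ?D \<le> emeasure lborel ((?D - lev s) \<union> lev s)"
        using oD lev_open by (intro emeasure_mono) auto
      also have "\<dots> \<le> emeasure lborel (?D - lev s) + emeasure lborel (lev s)"
        using oD lev_open by (intro emeasure_subadditive) auto
      finally show ?thesis using emeasure_bounded_finite[OF lev_bounded[OF s(1)]]
        by (auto simp: ennreal_minus_le_iff add.commute)
    qed
    also have "?D - lev s = {x. F x \<le> s \<and> \<sigma> < dil t x}" by (auto simp: lev_def)
    finally show ?thesis .
  qed
qed

end

text \<open>The condition \<open>H' 0 = 0\<close> makes the radial extension differentiable at the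
  origin, with a gradient that is continuous there.\<close>

lemma C1c_radial:
  fixes H H' :: "real \<Rightarrow> real"
  assumes H: "\<And>r. (H has_real_derivative H' r) (at r)" and c: "continuous_on UNIV H'" and 0: "H' 0 = 0"
    and s: "\<And>r. R \<le> r \<Longrightarrow> H r = 0"
  shows "C1c (\<lambda>x::'a::euclidean_space. H (norm x))" "norm (grad (\<lambda>x::'a. H (norm x)) x) = \<bar>H' (norm x)\<bar>"
proof -
  define g where "g x = (H' (norm x) / norm x) *\<^sub>R x" for x :: 'a
  have ng: "norm (g x) = \<bar>H' (norm x)\<bar>" for x by (cases "x = 0") (auto simp: g_def 0)
  have D: "((\<lambda>x::'a. H (norm x)) has_derivative (\<lambda>h. g x \<bullet> h)) (at x)" for x
  proof (cases "x = 0")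
    case False
    have "((\<lambda>x::'a. norm x) has_derivative (\<lambda>h. sgn x \<bullet> h)) (at x)" using has_derivative_norm[OF False] by (simp add: inner_commute)
    from has_derivative_compose[OF this H[unfolded has_field_derivative_def]]
    show ?thesis by (simp add: g_def sgn_div_norm divide_inverse mult.assoc)
  next
    case True
    have "(H has_derivative (\<lambda>h. H' 0 * h)) (at 0)" using H[of 0] by (simp only: has_field_derivative_def)
    then have H0: "(H has_derivative (\<lambda>h. 0)) (at 0)" by (simp only: 0 mult_zero_left)
    show ?thesis unfolding has_derivative_at_alt True
    proof (intro conjI allI impI)
      show "bounded_linear (\<lambda>h. g 0 \<bullet> h)" by (rule bounded_linear_inner_right)
      fix e :: real assume "e > 0"
      then obtain d where d: "d > 0" "\<And>y. norm (y - 0) < d \<Longrightarrow> norm (H y - H 0 - 0) \<le> e * norm (y - 0)"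
        using H0 unfolding has_derivative_at_alt by metis
      then show "\<exists>d>0. \<forall>y::'a. norm (y - 0) < d \<longrightarrow> norm (H (norm y) - H (norm (0::'a)) - g 0 \<bullet> (y - 0)) \<le> e * norm (y - 0)"
        using d(2)[of "norm _"] by (intro exI[of _ d]) (auto simp: g_def)
    qed
  qed
  have gc: "continuous_on UNIV g"
  proof (rule continuous_at_imp_continuous_on, rule ballI)
    fix x :: 'a
    show "isCont g x"
    proof (cases "x = 0")
      case False
      have "isCont H' (norm x)" using c by (simp add: continuous_on_eq_continuous_at)
      have "isCont (\<lambda>x. norm x) x" by (intro continuous_intros)
      from isCont_o2[OF this \<open>isCont H' (norm x)\<close>] have "isCont (\<lambda>x. H' (norm x)) x" .
      then show ?thesis unfolding g_def using False by (intro continuous_intros) auto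
    next
      case True
      have "isCont H' (norm (0::'a))" using c by (simp add: continuous_on_eq_continuous_at)
      have "isCont (\<lambda>x::'a. norm x) 0" by (intro continuous_intros)
      from isCont_o2[OF this \<open>isCont H' (norm (0::'a))\<close>] have "isCont (\<lambda>x::'a. H' (norm x)) 0" .
      then have "((\<lambda>x::'a. \<bar>H' (norm x)\<bar>) \<longlongrightarrow> 0) (at 0)"
        unfolding isCont_def using 0 tendsto_rabs_zero by force
      then have "(g \<longlongrightarrow> 0) (at 0)" by (rule Lim_null_comparison[rotated]) (simp add: ng)
      then show ?thesis using True by (simp add: isCont_def g_def)
    qed
  qed
  show "C1c (\<lambda>x::'a. H (norm x))" using C1cI(1)[OF D gc, of R] s by simp
  show "norm (grad (\<lambda>x::'a. H (norm x)) x) = \<bar>H' (norm x)\<bar>" using C1cI(2)[OF D gc, of R] s ng by simp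
qed

context hill
begin

text \<open>The average over the interval from \<open>r - t\<close> to \<open>r\<close> is taken on
  the left of \<open>r\<close>, so \<open>H\<close> dominates the decreasing profile and the quartic
  integral cannot drop. Since \<open>prof\<close> is constant on negative numbers,
  \<open>H' 0 = 0\<close> and no kink arises at the origin.\<close>

lemma smooth_rearrangement:
  assumes t: "0 < t"
  shows "\<exists>H. C1c (\<lambda>x::'a. H (norm x)) \<and> (\<forall>r r'. r \<le> r' \<longrightarrow> H r' \<le> H r) \<and> (\<forall>r. 0 \<le> H r) \<and>
    (\<integral>\<^sup>+x. ennreal (F x ^ 4) \<partial>lborel) \<le> (\<integral>\<^sup>+x. ennreal (H (norm (x::'a)) ^ 4) \<partial>lborel) \<and>
    (\<integral>\<^sup>+x. ennreal ((norm (grad (\<lambda>x::'a. H (norm x)) x))\<^sup>2) \<partial>lborel) \<le> (\<integral>\<^sup>+x. ennreal (((dil t x - F x) / t)\<^sup>2) \<partial>lborel)"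
proof -
  have "\<exists>\<Phi>. \<forall>x::real. -\<infinity> < ereal x \<longrightarrow> ereal x < \<infinity> \<longrightarrow> (\<Phi> has_vector_derivative prof x) (at x)"
    using prof_continuous by (intro einterval_antiderivative) (auto simp: continuous_on_eq_continuous_at)
  then obtain \<Phi> where \<Phi>: "\<And>r. (\<Phi> has_real_derivative prof r) (at r)"
    by (auto simp: has_real_derivative_iff_has_vector_derivative)
  define H where "H r = (\<Phi> r - \<Phi> (r - t)) / t" for r
  define H' where "H' r = (prof r - prof (r - t)) / t" for r
  have HH: "(H has_real_derivative H' r) (at r)" for r
  proof -
    have "((\<lambda>r. \<Phi> (r - t)) has_real_derivative prof (r - t) * 1) (at r)"
      by (rule DERIV_chain2[OF \<Phi>]) (auto intro!: derivative_eq_intros)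
    then show ?thesis unfolding H_def H'_def using DERIV_cdivide[OF DERIV_diff[OF \<Phi>]] by simp
  qed
  have H'neg: "H' r \<le> 0" for r
    unfolding H'_def using prof_antimono[of "r - t" r] t by (simp add: divide_nonpos_pos)
  have H'c: "continuous_on UNIV H'"
  proof -
    have "continuous_on UNIV (\<lambda>r. prof (r - t))"
      by (rule continuous_on_compose2[OF prof_continuous]) (auto intro: continuous_intros)
    then show ?thesis unfolding H'_def using t
      by (intro continuous_on_divide continuous_on_diff prof_continuous continuous_on_const) auto
  qed
  have H'0: "H' 0 = 0"
    using t by (simp add: H'_def prof_def)
  \<comment> \<open>The average of the profile is one of its values on the interval; the lower bound
    for \<open>H\<close> and its support are read off from this.\<close>
  have mv: "\<exists>z. r - t < z \<and> z < r \<and> H r = prof z" for r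
  proof -
    have "\<exists>z. r - t < z \<and> z < r \<and> \<Phi> r - \<Phi> (r - t) = (r - (r - t)) * prof z"
      using t \<Phi> by (intro MVT2) auto
    then show ?thesis using t by (auto simp: H_def)
  qed
  have Hge: "prof r \<le> H r" for r
  proof -
    obtain z where "r - t < z" "z < r" "H r = prof z" using mv by blast
    then show ?thesis using prof_antimono[of z r] by simp
  qed
  have H0: "H r = 0" if "rad 0 + t \<le> r" for r
  proof -
    obtain z where "r - t < z" "z < r" "H r = prof z" using mv by blast
    then show ?thesis using that prof_eq_0[of z] by simp
  qed
  have Hanti: "H r' \<le> H r" if "r \<le> r'" for r r'
    by (rule DERIV_nonpos_imp_nonincreasing[OF that]) (use HH H'neg in blast)
  have Hnonneg: "0 \<le> H r" for r using Hge[of r] prof_nonneg[of r] by simp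
  have C: "C1c (\<lambda>x::'a. H (norm x))" "\<And>x. norm (grad (\<lambda>x::'a. H (norm x)) x) = \<bar>H' (norm x)\<bar>"
    using C1c_radial[OF HH H'c H'0 H0] by auto
  have I4: "(\<integral>\<^sup>+x. ennreal (F x ^ 4) \<partial>lborel) \<le> (\<integral>\<^sup>+x. ennreal (H (norm (x::'a)) ^ 4) \<partial>lborel)"
    by (rule order_trans[OF nn_integral_rearrangement_4])
      (intro nn_integral_mono ennreal_leI power_mono Hge prof_nonneg)
  have E: "(\<integral>\<^sup>+x. ennreal ((norm (grad (\<lambda>x::'a. H (norm x)) x))\<^sup>2) \<partial>lborel) \<le> (\<integral>\<^sup>+x. ennreal (((dil t x - F x) / t)\<^sup>2) \<partial>lborel)"
  proof -
    note [measurable] = dil_measurable[OF t]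
    have "(\<integral>\<^sup>+x. ennreal ((norm (grad (\<lambda>x::'a. H (norm x)) x))\<^sup>2) \<partial>lborel)
      = (\<integral>\<^sup>+x. ennreal (1 / t\<^sup>2) * ennreal ((prof (norm (x::'a) - t) - prof (norm x))\<^sup>2) \<partial>lborel)"
      by (intro nn_integral_cong) (simp add: C(2) H'_def ennreal_mult'[symmetric] power_divide power2_commute)
    also have "\<dots> = ennreal (1 / t\<^sup>2) * (\<integral>\<^sup>+x. ennreal ((prof (norm (x::'a) - t) - prof (norm x))\<^sup>2) \<partial>lborel)"
      by (intro nn_integral_cmult) measurable
    also have "\<dots> \<le> ennreal (1 / t\<^sup>2) * (\<integral>\<^sup>+x. ennreal ((dil t x - F x)\<^sup>2) \<partial>lborel)"
      by (intro mult_left_mono nn_integral_rearrangement_diff t) simp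
    also have "\<dots> = (\<integral>\<^sup>+x. ennreal (1 / t\<^sup>2) * ennreal ((dil t x - F x)\<^sup>2) \<partial>lborel)"
      by (intro nn_integral_cmult[symmetric]) measurable
    also have "\<dots> = (\<integral>\<^sup>+x. ennreal (((dil t x - F x) / t)\<^sup>2) \<partial>lborel)"
      by (intro nn_integral_cong) (simp add: ennreal_mult'[symmetric] power_divide)
    finally show ?thesis .
  qed
  show ?thesis using C(1) Hanti Hnonneg I4 E by blast
qed

end

section \<open>The Sobolev inequality\<close>

lemma le_if_le_add_mult:
  fixes a b c :: real
  assumes "\<And>\<delta>. 0 < \<delta> \<Longrightarrow> a \<le> b + \<delta> * c"
  shows "a \<le> b"
proof -
  have "((\<lambda>\<delta>. b + \<delta> * c) \<longlongrightarrow> b + 0 * c) (at_right 0)" by (intro tendsto_intros)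
  then have "a \<le> b + 0 * c"
    by (rule tendsto_lowerbound) (auto intro!: eventually_at_rightI[of 0 1] assms)
  then show ?thesis by simp
qed

section \<open>From dilations to the Polya--Szego inequality\<close>

definition energy :: "('a::euclidean_space \<Rightarrow> real) \<Rightarrow> real" where
  "energy f = (\<integral>x. (norm (grad f x))\<^sup>2 \<partial>lborel)"

definition quart :: "('a::euclidean_space \<Rightarrow> real) \<Rightarrow> real" where
  "quart f = (\<integral>x. f x ^ 4 \<partial>lborel)"

lemma energy_nonneg: "0 \<le> energy f"
  by (simp add: energy_def)

lemma quart_nonneg: "0 \<le> quart f"
  by (simp add: quart_def)

lemma C1c_measurable: "C1c f \<Longrightarrow> f \<in> borel_measurable borel" "C1c f \<Longrightarrow> grad f \<in> borel_measurable borel"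
  by (simp_all add: C1c_continuous C1c_continuous_grad borel_measurable_continuous_onI)

lemma C1c_integrable_energy: "C1c f \<Longrightarrow> integrable lborel (\<lambda>x. (norm (grad f x))\<^sup>2)"
proof -
  assume f: "C1c f"
  obtain R where "\<And>x. R \<le> norm x \<Longrightarrow> f x = 0 \<and> grad f x = 0" using C1c_support[OF f] by blast
  then show ?thesis using C1c_continuous_grad[OF f]
    by (intro integrable_compact_support[where R = R] continuous_intros) auto
qed

lemma C1c_integrable_mult:
  fixes g :: "'a::euclidean_space \<Rightarrow> real"
  assumes f: "C1c f" and g: "continuous_on UNIV g"
  shows "integrable lborel (\<lambda>x. f x * g x)"
proof -
  obtain R where "\<And>x. R \<le> norm x \<Longrightarrow> f x = 0 \<and> grad f x = 0" using C1c_support[OF f] by blast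
  then show ?thesis using C1c_continuous[OF f] g
    by (intro integrable_compact_support[where R = R] continuous_intros) auto
qed

lemma C1c_integrable_power: "C1c f \<Longrightarrow> 0 < n \<Longrightarrow> integrable lborel (\<lambda>x. f x ^ n)"
proof -
  assume f: "C1c f" and "0 < n"
  then obtain m where n: "n = Suc m" by (cases n) auto
  have "continuous_on UNIV (\<lambda>x. f x ^ m)" by (rule continuous_on_power[OF C1c_continuous[OF f]])
  from C1c_integrable_mult[OF f this] show ?thesis by (simp add: n)
qed

lemma C1c_hill:
  assumes f: "C1c f"
  shows "\<exists>L R. hill (\<lambda>x. \<bar>f x\<bar>) L R \<and> (\<forall>x. R \<le> norm x \<longrightarrow> f x = 0 \<and> grad f x = 0)"
proof -
  obtain L where L: "L > 0" "\<And>x y. \<bar>f x - f y\<bar> \<le> L * norm (x - y)" using C1c_bounded_grad[OF f] by blast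
  obtain R where R: "R > 0" "\<And>x. R \<le> norm x \<Longrightarrow> f x = 0 \<and> grad f x = 0" using C1c_support[OF f] by blast
  have "\<bar>\<bar>f x\<bar> - \<bar>f y\<bar>\<bar> \<le> L * norm (x - y)" for x y
    using L(2)[of x y] by linarith
  then have "hill (\<lambda>x. \<bar>f x\<bar>) L R" using L R by unfold_locales auto
  then show ?thesis using R(2) by blast
qed

text \<open>Near \<open>x\<close> the modulus of \<open>f\<close> grows at most at the rate
  \<open>norm (grad f x) + \<epsilon>\<close>, uniformly in \<open>x\<close>, and the quotient is
  bounded by that rate. The contribution of \<epsilon> is confined to the ball of radius
  \<open>R + 1\<close> and is absorbed by the weighted inequality for squares.\<close>

lemma dilation_quotient_le:
  fixes f :: "'a::euclidean_space \<Rightarrow> real"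
  assumes f: "C1c f" and h: "hill (\<lambda>x. \<bar>f x\<bar>) L R" and R: "\<And>x. R \<le> norm x \<Longrightarrow> f x = 0 \<and> grad f x = 0" and "\<eta> > 0"
  shows "\<exists>t>0. (\<integral>\<^sup>+x. ennreal (((hill.dil (\<lambda>x. \<bar>f x\<bar>) t x - \<bar>f x\<bar>) / t)\<^sup>2) \<partial>lborel) \<le> ennreal (energy f + \<eta>)"
proof -
  interpret hill "\<lambda>x. \<bar>f x\<bar>" L R by (rule h)
  define V where "V = measure lborel (cball (0::'a) (R + 1))"
  define \<theta> where "\<theta> = \<eta> / (2 * (energy f + 1))"
  have \<theta>: "\<theta> > 0" "\<theta> * energy f \<le> \<eta> / 2"
    using \<open>\<eta> > 0\<close> energy_nonneg[of f] by (auto simp: \<theta>_def field_simps)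
  \<comment> \<open>With \<theta> fixed, \<epsilon> is taken so small that its square, multiplied by
    the large coefficient and the volume of the ball, stays below \<eta>/2.\<close>
  have "((\<lambda>\<epsilon>. (1 + 1 / \<theta>) * \<epsilon>\<^sup>2 * V) \<longlongrightarrow> (1 + 1 / \<theta>) * 0\<^sup>2 * V) (at_right 0)" by (intro tendsto_intros)
  then have "\<forall>\<^sub>F \<epsilon> in at_right 0. (1 + 1 / \<theta>) * \<epsilon>\<^sup>2 * V < \<eta> / 2"
    using \<open>\<eta> > 0\<close> by (intro order_tendstoD) auto
  then obtain \<epsilon> where \<epsilon>: "\<epsilon> > 0" "(1 + 1 / \<theta>) * \<epsilon>\<^sup>2 * V \<le> \<eta> / 2"
    unfolding eventually_at_right_field by (metis dense less_imp_le)
  obtain \<delta> where \<delta>: "\<delta> > 0" "\<And>x h. norm h < \<delta> \<Longrightarrow> \<bar>f (x + h) - f x - grad f x \<bullet> h\<bar> \<le> \<epsilon> * norm h"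
    using C1c_uniform_differentiable[OF f \<epsilon>(1)] by blast
  define t where "t = min \<delta> 1"
  have t: "t > 0" "t \<le> 1" "t \<le> \<delta>" using \<delta>(1) by (auto simp: t_def)
  have d1: "dil t x - \<bar>f x\<bar> \<le> t * (norm (grad f x) + \<epsilon>)" for x
  proof -
    have "dil t x \<le> \<bar>f x\<bar> + t * (norm (grad f x) + \<epsilon>)"
      unfolding dil_def
    proof (rule cSUP_least)
      fix y assume "y \<in> ball (0::'a) t"
      then have y: "norm y < t" by simp
      have "\<bar>f (x + y)\<bar> \<le> \<bar>f x\<bar> + \<bar>grad f x \<bullet> y\<bar> + \<epsilon> * norm y"
        using \<delta>(2)[of y x] y t(3) by linarith
      also have "\<bar>grad f x \<bullet> y\<bar> \<le> norm (grad f x) * norm y" by (rule Cauchy_Schwarz_ineq2)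
      also have "\<bar>f x\<bar> + norm (grad f x) * norm y + \<epsilon> * norm y = \<bar>f x\<bar> + (norm (grad f x) + \<epsilon>) * norm y"
        by (simp add: algebra_simps)
      also have "\<dots> \<le> \<bar>f x\<bar> + (norm (grad f x) + \<epsilon>) * t"
        using y \<epsilon>(1) by (intro add_left_mono mult_left_mono) auto
      finally show "\<bar>f (x + y)\<bar> \<le> \<bar>f x\<bar> + t * (norm (grad f x) + \<epsilon>)" by (simp add: mult.commute)
    qed (use t in auto)
    then show ?thesis by simp
  qed
  have d2: "dil t x - \<bar>f x\<bar> = 0" if "R + 1 < norm x" for x
  proof -
    have "dil t x \<le> 0"
      unfolding dil_def
    proof (rule cSUP_least)
      fix y assume "y \<in> ball (0::'a) t"
      then have "norm y < t" by simp
      then have "R \<le> norm (x + y)" using that t(2) norm_triangle_ineq2[of x "- y"] by simp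
      then show "\<bar>f (x + y)\<bar> \<le> 0" using R by simp
    qed (use t in auto)
    then show ?thesis using dil_ge[OF t(1), of x] R[of x] that by auto
  qed
  have pt: "((dil t x - \<bar>f x\<bar>) / t)\<^sup>2 \<le> (1 + \<theta>) * (norm (grad f x))\<^sup>2 + (1 + 1 / \<theta>) * \<epsilon>\<^sup>2 * indicator (cball 0 (R + 1)) x" for x
  proof (cases "norm x \<le> R + 1")
    case True
    have "((dil t x - \<bar>f x\<bar>) / t)\<^sup>2 \<le> (norm (grad f x) + \<epsilon>)\<^sup>2"
      using d1[of x] dil_ge[OF t(1), of x] t(1) by (intro power_mono) (auto simp: divide_le_eq mult.commute)
    also have "\<dots> \<le> (1 + \<theta>) * (norm (grad f x))\<^sup>2 + (1 + 1 / \<theta>) * \<epsilon>\<^sup>2"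
      using norm_add_sq_le[OF \<theta>(1), of "norm (grad f x)" \<epsilon>] by simp
    finally show ?thesis using True by simp
  next
    case False
    then show ?thesis using d2[of x] \<theta>(1) by (simp add: indicator_def)
  qed
  have i: "integrable lborel (\<lambda>x::'a. indicator (cball 0 (R + 1)) x * ((1 + 1 / \<theta>) * \<epsilon>\<^sup>2))" by (rule cball_integrable_const)
  have "(\<integral>\<^sup>+x. ennreal (((dil t x - \<bar>f x\<bar>) / t)\<^sup>2) \<partial>lborel)
    \<le> (\<integral>\<^sup>+x. ennreal ((1 + \<theta>) * (norm (grad f x))\<^sup>2 + indicator (cball 0 (R + 1)) x * ((1 + 1 / \<theta>) * \<epsilon>\<^sup>2)) \<partial>lborel)"
    using pt by (intro nn_integral_mono ennreal_leI) (simp add: mult.commute)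
  also have "\<dots> = ennreal (\<integral>x. (1 + \<theta>) * (norm (grad f x))\<^sup>2 + indicator (cball 0 (R + 1)) x * ((1 + 1 / \<theta>) * \<epsilon>\<^sup>2) \<partial>lborel)"
    using i C1c_integrable_energy[OF f] \<theta>(1) by (intro nn_integral_eq_integral) auto
  also have "(\<integral>x. (1 + \<theta>) * (norm (grad f x))\<^sup>2 + indicator (cball 0 (R + 1)) x * ((1 + 1 / \<theta>) * \<epsilon>\<^sup>2) \<partial>lborel)
     = (1 + \<theta>) * energy f + V * ((1 + 1 / \<theta>) * \<epsilon>\<^sup>2)"
    using i C1c_integrable_energy[OF f] by (simp add: energy_def V_def)
  also have "ennreal \<dots> \<le> ennreal (energy f + \<eta>)"
  proof (rule ennreal_leI)
    have "(1 + \<theta>) * energy f + V * ((1 + 1 / \<theta>) * \<epsilon>\<^sup>2) = energy f + \<theta> * energy f + (1 + 1 / \<theta>) * \<epsilon>\<^sup>2 * V"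
      by (simp add: algebra_simps)
    also have "\<dots> \<le> energy f + \<eta>" using add_mono[OF \<theta>(2) \<epsilon>(2)] by simp
    finally show "(1 + \<theta>) * energy f + V * ((1 + 1 / \<theta>) * \<epsilon>\<^sup>2) \<le> energy f + \<eta>" .
  qed
  finally show ?thesis using t(1) by blast
qed

definition radial_decreasing :: "('a::euclidean_space \<Rightarrow> real) \<Rightarrow> bool" where
  "radial_decreasing U \<longleftrightarrow> (\<exists>H. U = (\<lambda>x. H (norm x)) \<and> (\<forall>r r'. r \<le> r' \<longrightarrow> H r' \<le> H r) \<and> (\<forall>r. 0 \<le> H r))"

text \<open>The quartic integral may grow and the energy may exceed the original one by \<eta>: this
  is enough, because only near-minimisers of the quotient of \<open>energy\<close> by the root of
  \<open>quart\<close> are wanted.\<close>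

lemma Polya_Szego:
  fixes f :: "'a::euclidean_space \<Rightarrow> real"
  assumes f: "C1c f" and "\<eta> > 0"
  shows "\<exists>U::'a \<Rightarrow> real. C1c U \<and> radial_decreasing U \<and> quart f \<le> quart U \<and> energy U \<le> energy f + \<eta>"
proof -
  obtain L R where h: "hill (\<lambda>x. \<bar>f x\<bar>) L R" and R: "\<And>x. R \<le> norm x \<Longrightarrow> f x = 0 \<and> grad f x = 0"
    using C1c_hill[OF f] by blast
  interpret hill "\<lambda>x. \<bar>f x\<bar>" L R by (rule h)
  obtain t where t: "t > 0" "(\<integral>\<^sup>+x. ennreal (((dil t x - \<bar>f x\<bar>) / t)\<^sup>2) \<partial>lborel) \<le> ennreal (energy f + \<eta>)"
    using dilation_quotient_le[OF f h R \<open>\<eta> > 0\<close>] by blast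
  obtain H where H: "C1c (\<lambda>x::'a. H (norm x))" "\<forall>r r'. r \<le> r' \<longrightarrow> H r' \<le> H r" "\<forall>r. 0 \<le> H r"
    and q: "(\<integral>\<^sup>+x. ennreal (\<bar>f x\<bar> ^ 4) \<partial>lborel) \<le> (\<integral>\<^sup>+x. ennreal (H (norm (x::'a)) ^ 4) \<partial>lborel)"
    and e: "(\<integral>\<^sup>+x. ennreal ((norm (grad (\<lambda>x::'a. H (norm x)) x))\<^sup>2) \<partial>lborel) \<le> (\<integral>\<^sup>+x. ennreal (((dil t x - \<bar>f x\<bar>) / t)\<^sup>2) \<partial>lborel)"
    using smooth_rearrangement[OF t(1)] by blast
  define U where "U x = H (norm x)" for x :: 'a
  have U: "C1c U" using H(1) by (simp add: U_def[abs_def])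
  have "radial_decreasing U" unfolding radial_decreasing_def U_def[abs_def] using H(2,3) by blast
  moreover have "ennreal (quart f) \<le> ennreal (quart U)"
    using q C1c_integrable_power[OF f, of 4] C1c_integrable_power[OF U, of 4]
    by (simp add: quart_def nn_integral_eq_integral[symmetric] U_def)
  then have "quart f \<le> quart U" by (simp add: quart_nonneg)
  moreover have "ennreal (energy U) \<le> ennreal (energy f + \<eta>)"
    using order_trans[OF e t(2)] C1c_integrable_energy[OF U]
    by (simp add: energy_def nn_integral_eq_integral[symmetric] U_def[abs_def])
  then have "energy U \<le> energy f + \<eta>" using energy_nonneg[of f] \<open>\<eta> > 0\<close> by (subst (asm) ennreal_le_iff) auto
  ultimately show ?thesis using U by blast
qed

text \<open>Integrate the divergence of \<open>U\<^sup>2 x / (|x|\<^sup>2 + \<delta>)\<close>.\<close>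

lemma Hardy:
  fixes U :: "real^4 \<Rightarrow> real"
  assumes U: "C1c U" and "\<delta> > 0"
  shows "(\<integral>x. (U x)\<^sup>2 / (x \<bullet> x + \<delta>) \<partial>lborel) \<le> energy U"
proof -
  have pos: "x \<bullet> x + \<delta> > 0" for x :: "real^4" using \<open>\<delta> > 0\<close> by (simp add: add_nonneg_pos)
  have ne: "x \<bullet> x + \<delta> \<noteq> 0" for x :: "real^4" using pos[of x] by simp
  \<comment> \<open>1/|x|^2, regularised at the origin by \<delta>, so that the vector field
    \<open>w x *\<^sub>R x\<close> is smooth.\<close>
  define w where "w x = 1 / (x \<bullet> x + \<delta>)" for x :: "real^4"
  have wpos: "w x > 0" for x using pos by (simp add: w_def)
  have wc: "continuous_on UNIV w" unfolding w_def using ne by (intro continuous_intros) auto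
  have Uc: "continuous_on UNIV U" "continuous_on UNIV (grad U)" using U C1c_continuous C1c_continuous_grad by auto
  have wle: "w x * (x \<bullet> x) \<le> 1" for x using pos[of x] \<open>\<delta> > 0\<close> by (simp add: w_def divide_le_eq)
  define \<psi> where "\<psi> e x = (x \<bullet> e) * w x" for e x :: "real^4"
  define \<psi>' where "\<psi>' e x = w x *\<^sub>R e - (2 * (w x)\<^sup>2 * (x \<bullet> e)) *\<^sub>R x" for e x :: "real^4"
  have wD: "(w has_derivative (\<lambda>h. - (2 * (w x)\<^sup>2 * (x \<bullet> h)))) (at x)" for x
  proof -
    have "((\<lambda>x. x \<bullet> x + \<delta>) has_derivative (\<lambda>h. (x \<bullet> h + h \<bullet> x) + 0)) (at x)" by (intro derivative_intros)
    from Deriv.has_derivative_inverse[OF _ this] have "((\<lambda>x. inverse (x \<bullet> x + \<delta>)) has_derivative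
        (\<lambda>h. - (inverse (x \<bullet> x + \<delta>) * ((x \<bullet> h + h \<bullet> x) + 0) * inverse (x \<bullet> x + \<delta>)))) (at x)" using ne by blast
    then show ?thesis by (simp add: w_def[abs_def] inverse_eq_divide inner_commute power2_eq_square)
  qed
  have \<psi>D: "(\<psi> e has_derivative (\<lambda>h. \<psi>' e x \<bullet> h)) (at x)" for e x
  proof -
    have "((\<lambda>x. (x \<bullet> e) * w x) has_derivative (\<lambda>h. (x \<bullet> e) * (- (2 * (w x)\<^sup>2 * (x \<bullet> h))) + (h \<bullet> e) * w x)) (at x)"
      by (intro has_derivative_mult wD has_derivative_inner_left has_derivative_ident)
    then show ?thesis by (simp add: \<psi>_def[abs_def] \<psi>'_def inner_diff_left inner_commute algebra_simps)
  qed
  have \<psi>'c: "continuous_on UNIV (\<psi>' e)" for e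
    unfolding \<psi>'_def by (intro continuous_intros wc)
  have \<psi>c: "continuous_on UNIV (\<psi> e)" for e
    unfolding \<psi>_def by (intro continuous_intros wc)
  have UU: "C1c (\<lambda>x. U x * U x)" "grad (\<lambda>x. U x * U x) = (\<lambda>x. U x *\<^sub>R grad U x + U x *\<^sub>R grad U x)"
    using C1c_mult[OF U C1c_has_derivative[OF U] Uc(2)] by auto
  have zero: "(\<integral>x. (U x)\<^sup>2 * (\<psi>' e x \<bullet> e) + 2 * U x * \<psi> e x * (grad U x \<bullet> e) \<partial>lborel) = 0" for e
  proof -
    have "(\<integral>x. grad (\<lambda>x. (U x * U x) * \<psi> e x) x \<bullet> e \<partial>lborel) = 0"
      using C1c_mult(1)[OF UU(1) \<psi>D \<psi>'c] by (rule C1c_integral_grad)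
    moreover have "grad (\<lambda>x. (U x * U x) * \<psi> e x) x \<bullet> e = (U x)\<^sup>2 * (\<psi>' e x \<bullet> e) + 2 * U x * \<psi> e x * (grad U x \<bullet> e)" for x
      unfolding C1c_mult(2)[OF UU(1) \<psi>D \<psi>'c] UU(2) inner_add_left inner_scaleR_left
      by (simp add: power2_eq_square)
    ultimately show ?thesis by simp
  qed
  have int: "integrable lborel (\<lambda>x. (U x)\<^sup>2 * (\<psi>' e x \<bullet> e) + 2 * U x * \<psi> e x * (grad U x \<bullet> e))" for e
  proof -
    have "integrable lborel (\<lambda>x. U x * (U x * (\<psi>' e x \<bullet> e) + 2 * \<psi> e x * (grad U x \<bullet> e)))"
      by (intro C1c_integrable_mult U continuous_intros Uc \<psi>c \<psi>'c)
    then show ?thesis by (simp add: power2_eq_square algebra_simps)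
  qed
  \<comment> \<open>The divergence of the field U^2 w x, summed over the coordinates; the factor 4
    is the dimension.\<close>
  have sum_eq: "(\<Sum>e\<in>Basis. (U x)\<^sup>2 * (\<psi>' e x \<bullet> e) + 2 * U x * \<psi> e x * (grad U x \<bullet> e))
     = (U x)\<^sup>2 * (4 * w x - 2 * (w x)\<^sup>2 * (x \<bullet> x)) + 2 * U x * w x * (x \<bullet> grad U x)" for x
  proof -
    have "(\<Sum>e\<in>Basis. \<psi>' e x \<bullet> e) = 4 * w x - 2 * (w x)\<^sup>2 * (x \<bullet> x)"
    proof -
      have "(\<Sum>e\<in>Basis. \<psi>' e x \<bullet> e) = (\<Sum>e\<in>(Basis::(real^4) set). w x - 2 * (w x)\<^sup>2 * ((x \<bullet> e) * (x \<bullet> e)))"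
        by (intro sum.cong) (auto simp: \<psi>'_def inner_diff_left)
      also have "\<dots> = 4 * w x - 2 * (w x)\<^sup>2 * (x \<bullet> x)"
        unfolding sum_subtractf sum_distrib_left[symmetric] euclidean_inner[of x x, symmetric] by simp
      finally show ?thesis .
    qed
    moreover have "(\<Sum>e\<in>Basis. \<psi> e x * (grad U x \<bullet> e)) = w x * (x \<bullet> grad U x)"
      unfolding \<psi>_def euclidean_inner[of x "grad U x"] sum_distrib_left by (intro sum.cong) auto
    ultimately show ?thesis
      by (simp add: sum.distrib sum_distrib_left[symmetric] mult.assoc)
  qed
  have "(\<integral>x. (U x)\<^sup>2 * (4 * w x - 2 * (w x)\<^sup>2 * (x \<bullet> x)) + 2 * U x * w x * (x \<bullet> grad U x) \<partial>lborel) = 0"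
    unfolding sum_eq[symmetric] using int zero by (subst Bochner_Integration.integral_sum) auto
  moreover have "(\<integral>x. (U x)\<^sup>2 * w x \<partial>lborel) - energy U
    \<le> (\<integral>x. (U x)\<^sup>2 * (4 * w x - 2 * (w x)\<^sup>2 * (x \<bullet> x)) + 2 * U x * w x * (x \<bullet> grad U x) \<partial>lborel)"
  proof -
    have i1: "integrable lborel (\<lambda>x. (U x)\<^sup>2 * w x)"
      using C1c_integrable_mult[OF U, of "\<lambda>x. U x * w x"] Uc wc
      by (simp add: power2_eq_square mult.assoc continuous_on_mult)
    have i2: "integrable lborel (\<lambda>x. (U x)\<^sup>2 * (4 * w x - 2 * (w x)\<^sup>2 * (x \<bullet> x)) + 2 * U x * w x * (x \<bullet> grad U x))"
      unfolding sum_eq[symmetric] using int by (intro Bochner_Integration.integrable_sum)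
    have "(\<integral>x. (U x)\<^sup>2 * w x \<partial>lborel) - energy U = (\<integral>x. (U x)\<^sup>2 * w x - (norm (grad U x))\<^sup>2 \<partial>lborel)"
      using i1 C1c_integrable_energy[OF U] by (simp add: energy_def)
    also have "\<dots> \<le> (\<integral>x. (U x)\<^sup>2 * (4 * w x - 2 * (w x)\<^sup>2 * (x \<bullet> x)) + 2 * U x * w x * (x \<bullet> grad U x) \<partial>lborel)"
    proof (rule integral_mono)
      show "integrable lborel (\<lambda>x. (U x)\<^sup>2 * w x - (norm (grad U x))\<^sup>2)" using i1 C1c_integrable_energy[OF U] by simp
      show "integrable lborel (\<lambda>x. (U x)\<^sup>2 * (4 * w x - 2 * (w x)\<^sup>2 * (x \<bullet> x)) + 2 * U x * w x * (x \<bullet> grad U x))" by (rule i2)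
      fix x
      have a: "(w x)\<^sup>2 * (x \<bullet> x) \<le> w x"
        using mult_left_mono[OF wle[of x] less_imp_le[OF wpos[of x]]] by (simp add: power2_eq_square mult.assoc)
      \<comment> \<open>Completing the square bounds the mixed term from below. Of the 4 in the
        divergence 1 remains, which is Hardy's constant ((n - 2)/2)^2 for n = 4.\<close>
      have "0 \<le> (norm ((U x * w x) *\<^sub>R x + grad U x))\<^sup>2" by simp
      also have "\<dots> = (U x)\<^sup>2 * ((w x)\<^sup>2 * (x \<bullet> x)) + 2 * U x * w x * (x \<bullet> grad U x) + (norm (grad U x))\<^sup>2"
        unfolding power2_norm_eq_inner by (simp add: inner_add_left inner_add_right inner_commute power2_eq_square algebra_simps)
      finally have b: "- (norm (grad U x))\<^sup>2 \<le> (U x)\<^sup>2 * ((w x)\<^sup>2 * (x \<bullet> x)) + 2 * U x * w x * (x \<bullet> grad U x)" by simp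
      have c: "(U x)\<^sup>2 * (3 * ((w x)\<^sup>2 * (x \<bullet> x))) \<le> (U x)\<^sup>2 * (3 * w x)"
        using a by (intro mult_left_mono) auto
      show "(U x)\<^sup>2 * w x - (norm (grad U x))\<^sup>2 \<le> (U x)\<^sup>2 * (4 * w x - 2 * (w x)\<^sup>2 * (x \<bullet> x)) + 2 * U x * w x * (x \<bullet> grad U x)"
        using b c by (simp add: algebra_simps)
    qed
    finally show ?thesis .
  qed
  ultimately show ?thesis by (simp add: w_def)
qed

section \<open>The Sobolev inequality for radially decreasing functions and its consequence\<close>

definition omega4 :: real where "omega4 = measure lborel (ball (0::real^4) 1)"

lemma omega4_pos: "0 < omega4"
  unfolding omega4_def using content_ball_pos[of 1 "0::real^4"] by simp

text \<open>On the ball of radius |x| the function is at least U(x), so the Hardy integral is at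
  least omega4 |x|^4 U(x)^2/(|x|^2 + \<delta>); then \<delta> tends to 0.\<close>

lemma radial_decay:
  fixes U :: "real^4 \<Rightarrow> real"
  assumes U: "C1c U" and r: "radial_decreasing U"
  shows "omega4 * ((x \<bullet> x) * (U x)\<^sup>2) \<le> energy U"
proof (cases "x = 0")
  case False
  obtain H where H: "U = (\<lambda>x. H (norm x))" "\<And>r r'. r \<le> r' \<Longrightarrow> H r' \<le> H r" "\<And>r. 0 \<le> H r"
    using r unfolding radial_decreasing_def by blast
  define \<rho> where "\<rho> = norm x"
  have \<rho>: "\<rho> > 0" using False by (simp add: \<rho>_def)
  have "omega4 * \<rho> ^ 4 * (H \<rho>)\<^sup>2 \<le> energy U * \<rho>\<^sup>2 + \<delta> * energy U" if "\<delta> > 0" for \<delta>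
  proof -
    have pos: "y \<bullet> y + \<delta> > 0" for y :: "real^4" using \<open>\<delta> > 0\<close> by (simp add: add_nonneg_pos)
    have "integrable lborel (\<lambda>y. U y * (U y / (y \<bullet> y + \<delta>)))"
      using U C1c_continuous[OF U] pos by (intro C1c_integrable_mult continuous_intros) (auto simp: less_imp_neq[symmetric])
    then have i: "integrable lborel (\<lambda>y. (U y)\<^sup>2 / (y \<bullet> y + \<delta>))" by (simp add: power2_eq_square)
    have "omega4 * \<rho> ^ 4 * ((H \<rho>)\<^sup>2 / (\<rho>\<^sup>2 + \<delta>)) = (\<integral>y. indicator (ball (0::real^4) \<rho>) y * ((H \<rho>)\<^sup>2 / (\<rho>\<^sup>2 + \<delta>)) \<partial>lborel)"
      using content_ball_conv_unit_ball[of \<rho> "0::real^4"] \<rho> by (simp add: omega4_def)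
    also have "\<dots> \<le> (\<integral>y. (U y)\<^sup>2 / (y \<bullet> y + \<delta>) \<partial>lborel)"
    proof (rule integral_mono[OF _ i])
      show "integrable lborel (\<lambda>y. indicator (ball (0::real^4) \<rho>) y * ((H \<rho>)\<^sup>2 / (\<rho>\<^sup>2 + \<delta>)))"
        using emeasure_bounded_finite[OF bounded_ball[of "0::real^4" \<rho>]]
        by (intro integrable_mult_left integrable_real_indicator) auto
      fix y :: "real^4"
      show "indicator (ball 0 \<rho>) y * ((H \<rho>)\<^sup>2 / (\<rho>\<^sup>2 + \<delta>)) \<le> (U y)\<^sup>2 / (y \<bullet> y + \<delta>)"
      proof (cases "norm y < \<rho>")
        case True
        have "(H \<rho>)\<^sup>2 \<le> (U y)\<^sup>2" using H(2)[of "norm y" \<rho>] H(3)[of \<rho>] True by (simp add: H(1) power_mono)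
        moreover have "y \<bullet> y \<le> \<rho>\<^sup>2" using True by (simp add: dot_square_norm power_mono)
        ultimately show ?thesis using True pos[of y] by (auto intro!: frac_le)
      qed (use pos[of y] in \<open>simp add: less_imp_le\<close>)
    qed
    also have "\<dots> \<le> energy U" by (rule Hardy[OF U \<open>\<delta> > 0\<close>])
    finally have "omega4 * \<rho> ^ 4 * (H \<rho>)\<^sup>2 / (\<rho>\<^sup>2 + \<delta>) \<le> energy U" by simp
    moreover have "\<rho>\<^sup>2 + \<delta> > 0" using \<rho> that by (simp add: add_pos_pos)
    ultimately show ?thesis by (simp add: pos_divide_le_eq algebra_simps)
  qed
  then have "omega4 * \<rho> ^ 4 * (H \<rho>)\<^sup>2 \<le> energy U * \<rho>\<^sup>2" by (rule le_if_le_add_mult)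
  then have "\<rho>\<^sup>2 * (omega4 * (\<rho>\<^sup>2 * (H \<rho>)\<^sup>2)) \<le> \<rho>\<^sup>2 * energy U" by (simp add: power4_eq_xxxx power2_eq_square mult_ac)
  then have "omega4 * (\<rho>\<^sup>2 * (H \<rho>)\<^sup>2) \<le> energy U" using \<rho> by (subst (asm) mult_le_cancel_left_pos) auto
  then show ?thesis by (simp add: H(1) \<rho>_def dot_square_norm)
qed (simp add: energy_nonneg)

text \<open>U^4 is the product of |x|^2 U^2, bounded by \<open>radial_decay\<close>, and U^2/|x|^2,
  integrated by \<open>Hardy\<close>. The regularisation costs a multiple of \<delta>, controlled by
  the bound \<open>M\<close> for U.\<close>

lemma Sobolev_radial:
  fixes U :: "real^4 \<Rightarrow> real"
  assumes U: "C1c U" and r: "radial_decreasing U"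
  shows "omega4 * quart U \<le> (energy U)\<^sup>2"
proof -
  obtain R where R: "\<And>x. R \<le> norm x \<Longrightarrow> U x = 0 \<and> grad U x = 0" using C1c_support[OF U] by blast
  obtain M where M: "M > 0" "\<And>x. norm (U x) \<le> M"
    using compact_support_bounded[OF C1c_continuous[OF U]] R by blast
  have "omega4 * quart U \<le> (energy U)\<^sup>2 + \<delta> * (omega4 * M\<^sup>2 * energy U)" if "\<delta> > 0" for \<delta>
  proof -
    have pos: "y \<bullet> y + \<delta> > 0" for y :: "real^4" using \<open>\<delta> > 0\<close> by (simp add: add_nonneg_pos)
    have "integrable lborel (\<lambda>y. U y * (U y / (y \<bullet> y + \<delta>)))"
      using U C1c_continuous[OF U] pos by (intro C1c_integrable_mult continuous_intros) (auto simp: less_imp_neq[symmetric])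
    then have i: "integrable lborel (\<lambda>y. (U y)\<^sup>2 / (y \<bullet> y + \<delta>))" by (simp add: power2_eq_square)
    have pt: "omega4 * U x ^ 4 \<le> (energy U + \<delta> * (omega4 * M\<^sup>2)) * ((U x)\<^sup>2 / (x \<bullet> x + \<delta>))" for x
    proof -
      have "omega4 * ((x \<bullet> x + \<delta>) * (U x)\<^sup>2) = omega4 * ((x \<bullet> x) * (U x)\<^sup>2) + \<delta> * (omega4 * (U x)\<^sup>2)"
        by (simp add: algebra_simps)
      also have "\<dots> \<le> energy U + \<delta> * (omega4 * M\<^sup>2)"
        using M(2)[of x] that omega4_pos by (intro add_mono radial_decay[OF U r] mult_left_mono) (auto simp: abs_le_square_iff[symmetric])
      finally have "omega4 * ((x \<bullet> x + \<delta>) * (U x)\<^sup>2) * ((U x)\<^sup>2 / (x \<bullet> x + \<delta>)) \<le> (energy U + \<delta> * (omega4 * M\<^sup>2)) * ((U x)\<^sup>2 / (x \<bullet> x + \<delta>))"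
        using pos[of x] by (intro mult_right_mono) auto
      moreover have "omega4 * ((x \<bullet> x + \<delta>) * (U x)\<^sup>2) * ((U x)\<^sup>2 / (x \<bullet> x + \<delta>)) = omega4 * U x ^ 4"
        using pos[of x] by (simp add: power4_eq_xxxx power2_eq_square)
      ultimately show ?thesis by simp
    qed
    have "omega4 * quart U = (\<integral>x. omega4 * U x ^ 4 \<partial>lborel)" by (simp add: quart_def)
    also have "\<dots> \<le> (\<integral>x. (energy U + \<delta> * (omega4 * M\<^sup>2)) * ((U x)\<^sup>2 / (x \<bullet> x + \<delta>)) \<partial>lborel)"
    proof (rule integral_mono)
      show "integrable lborel (\<lambda>x. (energy U + \<delta> * (omega4 * M\<^sup>2)) * ((U x)\<^sup>2 / (x \<bullet> x + \<delta>)))"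
        by (rule integrable_mult_right[OF i])
    qed (use pt C1c_integrable_power[OF U, of 4] in auto)
    also have "\<dots> = (energy U + \<delta> * (omega4 * M\<^sup>2)) * (\<integral>x. (U x)\<^sup>2 / (x \<bullet> x + \<delta>) \<partial>lborel)"
      by (rule integral_mult_right_zero)
    also have "\<dots> \<le> (energy U + \<delta> * (omega4 * M\<^sup>2)) * energy U"
      using Hardy[OF U that] energy_nonneg[of U] that omega4_pos
      by (intro mult_left_mono) auto
    finally show ?thesis by (simp add: power2_eq_square algebra_simps)
  qed
  then show ?thesis by (rule le_if_le_add_mult)
qed

text \<open>The constant is not the sharp one; the inequality serves to show that S is
  positive.\<close>

lemma Sobolev_C1c:
  fixes f :: "real^4 \<Rightarrow> real"
  assumes f: "C1c f"
  shows "sqrt omega4 * sqrt (quart f) \<le> energy f"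
proof -
  have "sqrt omega4 * sqrt (quart f) \<le> energy f + \<eta> * 1" if \<eta>: "\<eta> > 0" for \<eta>
  proof -
    obtain U :: "real^4 \<Rightarrow> real" where U: "C1c U" "radial_decreasing U" "quart f \<le> quart U" "energy U \<le> energy f + \<eta>"
      using Polya_Szego[OF f \<eta>] by blast
    have "sqrt omega4 * sqrt (quart f) \<le> sqrt omega4 * sqrt (quart U)"
      using U(3) omega4_pos by (intro mult_left_mono) auto
    also have "\<dots> = sqrt (omega4 * quart U)" by (simp add: real_sqrt_mult)
    also have "\<dots> \<le> sqrt ((energy U)\<^sup>2)" using Sobolev_radial[OF U(1,2)] by (rule real_sqrt_le_mono)
    also have "\<dots> = energy U" by (simp add: energy_nonneg)
    finally show ?thesis using U(4) by simp
  qed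
  then show ?thesis by (rule le_if_le_add_mult)
qed

section \<open>The Sobolev constant\<close>

lemma Lp_norm_2_sq: "(Lp_norm 2 g)\<^sup>2 = (\<integral>x. (norm (g x))\<^sup>2 \<partial>lebesgue)"
proof -
  have "(\<integral>x. norm (g x) powr 2 \<partial>lebesgue) = (\<integral>x. (norm (g x))\<^sup>2 \<partial>lebesgue)"
    using powr_realpow'[of "norm (g _)" 2] by (intro Bochner_Integration.integral_cong refl) auto
  moreover have "0 \<le> (\<integral>x. (norm (g x))\<^sup>2 \<partial>lebesgue)" by simp
  ultimately show ?thesis by (simp add: Lp_norm_def powr_half_sqrt)
qed

lemma Lp_norm_4_pow:
  fixes u :: "'a::euclidean_space \<Rightarrow> real"
  shows "(Lp_norm 4 u) ^ 4 = (\<integral>x. u x ^ 4 \<partial>lebesgue)" "(Lp_norm 4 u)\<^sup>2 = sqrt (\<integral>x. u x ^ 4 \<partial>lebesgue)"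
proof -
  have eq: "(\<integral>x. norm (u x) powr 4 \<partial>lebesgue) = (\<integral>x. u x ^ 4 \<partial>lebesgue)"
    using powr_realpow'[of "norm (u _)" 4] by (intro Bochner_Integration.integral_cong refl) auto
  have nonneg: "0 \<le> (\<integral>x. u x ^ 4 \<partial>lebesgue)" by simp
  then have r: "Lp_norm 4 u = root 4 (\<integral>x. u x ^ 4 \<partial>lebesgue)"
    using root_powr_inverse[of 4 "\<integral>x. u x ^ 4 \<partial>lebesgue"] by (simp add: Lp_norm_def eq)
  then show 4: "(Lp_norm 4 u) ^ 4 = (\<integral>x. u x ^ 4 \<partial>lebesgue)" using nonneg by (simp add: real_root_pow_pos2)
  have "((Lp_norm 4 u)\<^sup>2)\<^sup>2 = (\<integral>x. u x ^ 4 \<partial>lebesgue)" using 4 by (simp add: power_mult[symmetric])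
  then show "(Lp_norm 4 u)\<^sup>2 = sqrt (\<integral>x. u x ^ 4 \<partial>lebesgue)" by (metis real_sqrt_abs abs_of_nonneg zero_le_power2)
qed

lemma Lp_space_2_iff: "g \<in> Lp_space 2 \<longleftrightarrow> g \<in> borel_measurable lebesgue \<and> integrable lebesgue (\<lambda>x. (norm (g x))\<^sup>2)"
proof -
  have "(\<lambda>x. norm (g x) powr 2) = (\<lambda>x. (norm (g x))\<^sup>2)" using powr_realpow'[of "norm (g _)" 2] by auto
  then show ?thesis by (simp add: Lp_space_def)
qed

lemma Lp_space_4_iff:
  fixes u :: "'a::euclidean_space \<Rightarrow> real"
  shows "u \<in> Lp_space 4 \<longleftrightarrow> u \<in> borel_measurable lebesgue \<and> integrable lebesgue (\<lambda>x. u x ^ 4)"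
proof -
  have "(\<lambda>x. norm (u x) powr 4) = (\<lambda>x. u x ^ 4)" using powr_realpow'[of "norm (u _)" 4] by auto
  then show ?thesis by (simp add: Lp_space_def)
qed

text \<open>The dictionary between the quantities of the theorem, formed with
  \<open>lebesgue\<close> and the chosen weak gradient, and the classical ones formed with
  \<open>lborel\<close> and \<open>grad\<close>.\<close>

lemma C1c_lebesgue:
  fixes f :: "'a::euclidean_space \<Rightarrow> real"
  assumes f: "C1c f"
  shows "f \<in> H1" "(Lp_norm 2 (weak_grad f))\<^sup>2 = energy f" "(Lp_norm 4 f) ^ 4 = quart f"
    "(Lp_norm 2 f)\<^sup>2 = (\<integral>x. (f x)\<^sup>2 \<partial>lborel)" "weak_grad f \<in> Lp_space 2" "f \<in> Lp_space 4"
    "AE x in lebesgue. weak_grad f x = grad f x"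
proof -
  have [measurable]: "f \<in> borel_measurable borel" "grad f \<in> borel_measurable borel" using C1c_measurable[OF f] by auto
  have w: "is_weak_grad f (grad f)" using f by (rule C1c_is_weak_grad)
  show ae: "AE x in lebesgue. weak_grad f x = grad f x" using w by (rule weak_grad_AE)
  have "is_weak_grad f (weak_grad f)" using w by (rule is_weak_grad_weak_grad)
  then have wm [measurable]: "weak_grad f \<in> borel_measurable lebesgue"
    unfolding is_weak_grad_def using locally_integrable_measurable by blast
  have ae2: "AE x in lebesgue. (norm (weak_grad f x))\<^sup>2 = (norm (grad f x))\<^sup>2"
    using ae by eventually_elim simp
  show "(Lp_norm 2 (weak_grad f))\<^sup>2 = energy f"
    unfolding Lp_norm_2_sq energy_def using ae2 by (intro integral_lebesgue_cong_AE) auto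
  have "integrable lebesgue (\<lambda>x. (norm (grad f x))\<^sup>2)"
    using C1c_integrable_energy[OF f] by (subst integrable_completion) auto
  moreover have "AE x in lebesgue. (norm (grad f x))\<^sup>2 = (norm (weak_grad f x))\<^sup>2" using ae2 by eventually_elim simp
  ultimately have "integrable lebesgue (\<lambda>x. (norm (weak_grad f x))\<^sup>2)"
    by (intro integrable_cong_AE_imp[of lebesgue "\<lambda>x. (norm (grad f x))\<^sup>2" "\<lambda>x. (norm (weak_grad f x))\<^sup>2"]) auto
  then show W: "weak_grad f \<in> Lp_space 2" by (simp add: Lp_space_2_iff)
  have fm: "f \<in> borel_measurable lebesgue" by (intro measurable_completion) simp
  have "integrable lebesgue (\<lambda>x. (f x)\<^sup>2)" "integrable lebesgue (\<lambda>x. f x ^ 4)"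
    using C1c_integrable_power[OF f, of 2] C1c_integrable_power[OF f, of 4] by (subst integrable_completion; auto)+
  then show "f \<in> Lp_space 4" "f \<in> H1" using fm w W by (auto simp: Lp_space_4_iff Lp_space_2_iff H1_def)
  show "(Lp_norm 4 f) ^ 4 = quart f" by (simp add: Lp_norm_4_pow quart_def integral_completion)
  show "(Lp_norm 2 f)\<^sup>2 = (\<integral>x. (f x)\<^sup>2 \<partial>lborel)" by (simp add: Lp_norm_2_sq integral_completion)
qed

lemma test_function_D12:
  assumes f: "test_function f"
  shows "f \<in> D12"
proof -
  have c: "C1c f" using f by (rule test_function_C1c)
  have z4: "Lp_norm 4 (\<lambda>x. f x - f x) = 0" by (simp add: Lp_norm_def)
  have "(\<integral>x. norm (grad f x - weak_grad f x) powr 2 \<partial>lebesgue) = 0"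
  proof (rule integral_eq_zero_AE)
    show "AE x in lebesgue. norm (grad f x - weak_grad f x) powr 2 = 0"
      using C1c_lebesgue(7)[OF c] by eventually_elim simp
  qed
  then have z2: "Lp_norm 2 (\<lambda>x. grad f x - weak_grad f x) = 0" by (simp add: Lp_norm_def)
  show ?thesis
    unfolding D12_def using C1c_lebesgue(5,6)[OF c] C1c_is_weak_grad[OF c] f z2 z4
    by (auto intro!: exI[of _ "\<lambda>n. f"])
qed

text \<open>\<open>norm_add_sq_le\<close> applied twice: to the sum, and to the two summands of its
  bound.\<close>

lemma add_pow4_le:
  fixes v w :: real
  assumes "\<theta> > 0"
  shows "(v + w) ^ 4 \<le> (1 + \<theta>) ^ 3 * v ^ 4 + (1 + 1 / \<theta>) ^ 3 * w ^ 4"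
proof -
  have "(v + w) ^ 4 = ((v + w)\<^sup>2)\<^sup>2" by simp
  also have "\<dots> \<le> ((1 + \<theta>) * v\<^sup>2 + (1 + 1 / \<theta>) * w\<^sup>2)\<^sup>2"
    using norm_add_sq_le[OF assms, of v w] by (intro power_mono) auto
  also have "\<dots> \<le> (1 + \<theta>) * ((1 + \<theta>) * v\<^sup>2)\<^sup>2 + (1 + 1 / \<theta>) * ((1 + 1 / \<theta>) * w\<^sup>2)\<^sup>2"
    using norm_add_sq_le[OF assms, of "(1 + \<theta>) * v\<^sup>2" "(1 + 1 / \<theta>) * w\<^sup>2"] by simp
  also have "\<dots> = (1 + \<theta>) ^ 3 * v ^ 4 + (1 + 1 / \<theta>) ^ 3 * w ^ 4"
    by (simp add: power_mult_distrib power2_eq_square power3_eq_cube power4_eq_xxxx)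
  finally show ?thesis .
qed

text \<open>The approximating test functions are compared with \<open>u\<close> by the weighted
  inequalities for squares and fourth powers. For fixed \<theta> the index tends to infinity, then
  \<theta> tends to 0, and \<kappa> is recovered without loss.\<close>

lemma Sobolev_D12_if_test:
  assumes u: "u \<in> D12" and \<kappa>: "0 \<le> \<kappa>" "\<And>f::real^4 \<Rightarrow> real. test_function f \<Longrightarrow> \<kappa> * sqrt (quart f) \<le> energy f"
  shows "\<kappa> * (Lp_norm 4 u)\<^sup>2 \<le> (Lp_norm 2 (weak_grad u))\<^sup>2"
proof -
  obtain \<phi> where \<phi>: "\<And>n::nat. test_function (\<phi> n)" "(\<lambda>n. Lp_norm 4 (\<lambda>x. \<phi> n x - u x)) \<longlonglongrightarrow> 0"
      "(\<lambda>n. Lp_norm 2 (\<lambda>x. grad (\<phi> n) x - weak_grad u x)) \<longlonglongrightarrow> 0"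
    and u4: "u \<in> borel_measurable lebesgue" "integrable lebesgue (\<lambda>x. u x ^ 4)"
    and g2: "weak_grad u \<in> borel_measurable lebesgue" "integrable lebesgue (\<lambda>x. (norm (weak_grad u x))\<^sup>2)"
    using u unfolding D12_def by (auto simp: Lp_space_2_iff Lp_space_4_iff)
  note [measurable] = u4(1) g2(1)
  have \<phi>c: "C1c (\<phi> n)" for n using \<phi>(1) by (rule test_function_C1c)
  have [measurable]: "\<phi> n \<in> borel_measurable borel" "grad (\<phi> n) \<in> borel_measurable borel" for n
    using C1c_measurable[OF \<phi>c] by auto
  have \<phi>m [measurable]: "\<phi> n \<in> borel_measurable lebesgue" "grad (\<phi> n) \<in> borel_measurable lebesgue" for n
    by (intro measurable_completion; simp)+
  define Q E where "Q = (\<integral>x. u x ^ 4 \<partial>lebesgue)" and "E = (\<integral>x. (norm (weak_grad u x))\<^sup>2 \<partial>lebesgue)"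
  define a where "a n = (\<integral>x. (\<phi> n x - u x) ^ 4 \<partial>lebesgue)" for n
  define b where "b n = (\<integral>x. (norm (grad (\<phi> n) x - weak_grad u x))\<^sup>2 \<partial>lebesgue)" for n
  have a0: "a \<longlonglongrightarrow> 0"
    using tendsto_power[OF \<phi>(2), of 4] by (simp add: Lp_norm_4_pow a_def[abs_def])
  have b0: "b \<longlonglongrightarrow> 0"
    using tendsto_power[OF \<phi>(3), of 2] by (simp add: Lp_norm_2_sq b_def[abs_def])
  have \<phi>4: "integrable lebesgue (\<lambda>x. \<phi> n x ^ 4)" "(\<integral>x. \<phi> n x ^ 4 \<partial>lebesgue) = quart (\<phi> n)" for n
    using C1c_integrable_power[OF \<phi>c, of 4 n] by (simp_all add: integrable_completion integral_completion quart_def)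
  have \<phi>2: "integrable lebesgue (\<lambda>x. (norm (grad (\<phi> n) x))\<^sup>2)" "(\<integral>x. (norm (grad (\<phi> n) x))\<^sup>2 \<partial>lebesgue) = energy (\<phi> n)" for n
    using C1c_integrable_energy[OF \<phi>c, of n] by (simp_all add: integrable_completion integral_completion energy_def)
  have ia: "integrable lebesgue (\<lambda>x. (\<phi> n x - u x) ^ 4)" for n
  proof (rule Bochner_Integration.integrable_bound)
    show "integrable lebesgue (\<lambda>x. 2 ^ 3 * \<phi> n x ^ 4 + 2 ^ 3 * u x ^ 4)" using \<phi>4 u4 by simp
    show "AE x in lebesgue. norm ((\<phi> n x - u x) ^ 4) \<le> norm (2 ^ 3 * \<phi> n x ^ 4 + 2 ^ 3 * u x ^ 4)"
    proof (rule AE_I2)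
      fix x
      have "(\<phi> n x + (- u x)) ^ 4 \<le> (1 + 1) ^ 3 * \<phi> n x ^ 4 + (1 + 1 / 1) ^ 3 * (- u x) ^ 4" by (rule add_pow4_le) simp
      then show "norm ((\<phi> n x - u x) ^ 4) \<le> norm (2 ^ 3 * \<phi> n x ^ 4 + 2 ^ 3 * u x ^ 4)" by simp
    qed
  qed simp
  have ib: "integrable lebesgue (\<lambda>x. (norm (grad (\<phi> n) x - weak_grad u x))\<^sup>2)" for n
  proof (rule Bochner_Integration.integrable_bound)
    show "integrable lebesgue (\<lambda>x. 2 * (norm (grad (\<phi> n) x))\<^sup>2 + 2 * (norm (weak_grad u x))\<^sup>2)" using \<phi>2 g2 by simp
    show "AE x in lebesgue. norm ((norm (grad (\<phi> n) x - weak_grad u x))\<^sup>2) \<le> norm (2 * (norm (grad (\<phi> n) x))\<^sup>2 + 2 * (norm (weak_grad u x))\<^sup>2)"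
      using norm_add_sq_le[of 1 "grad (\<phi> n) _" "- weak_grad u _"] by (intro AE_I2) simp
  qed simp
  have E0: "E \<ge> 0" "b n \<ge> 0" for n by (auto simp: E_def b_def)
  have main: "\<kappa>\<^sup>2 * Q \<le> (1 + \<theta>) ^ 3 * ((1 + \<theta>) * E)\<^sup>2" if \<theta>: "\<theta> > 0" for \<theta>
  proof -
    have "\<kappa>\<^sup>2 * Q \<le> (1 + \<theta>) ^ 3 * ((1 + \<theta>) * E + (1 + 1 / \<theta>) * b n)\<^sup>2 + \<kappa>\<^sup>2 * ((1 + 1 / \<theta>) ^ 3 * a n)" for n
    proof -
      have "Q \<le> (\<integral>x. (1 + \<theta>) ^ 3 * \<phi> n x ^ 4 + (1 + 1 / \<theta>) ^ 3 * (\<phi> n x - u x) ^ 4 \<partial>lebesgue)"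
        unfolding Q_def
      proof (rule integral_mono[OF u4(2)])
        show "integrable lebesgue (\<lambda>x. (1 + \<theta>) ^ 3 * \<phi> n x ^ 4 + (1 + 1 / \<theta>) ^ 3 * (\<phi> n x - u x) ^ 4)"
          using \<phi>4 ia by simp
        fix x
        show "u x ^ 4 \<le> (1 + \<theta>) ^ 3 * \<phi> n x ^ 4 + (1 + 1 / \<theta>) ^ 3 * (\<phi> n x - u x) ^ 4"
          using add_pow4_le[OF \<theta>, of "\<phi> n x" "u x - \<phi> n x"] by (simp add: power4_eq_xxxx algebra_simps)
      qed
      also have "\<dots> = (1 + \<theta>) ^ 3 * quart (\<phi> n) + (1 + 1 / \<theta>) ^ 3 * a n"
        using \<phi>4 ia by (simp add: a_def)
      finally have Q: "\<kappa>\<^sup>2 * Q \<le> \<kappa>\<^sup>2 * ((1 + \<theta>) ^ 3 * quart (\<phi> n) + (1 + 1 / \<theta>) ^ 3 * a n)"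
        by (intro mult_left_mono) auto
      have "energy (\<phi> n) \<le> (\<integral>x. (1 + \<theta>) * (norm (weak_grad u x))\<^sup>2 + (1 + 1 / \<theta>) * (norm (grad (\<phi> n) x - weak_grad u x))\<^sup>2 \<partial>lebesgue)"
        unfolding \<phi>2(2)[symmetric]
      proof (rule integral_mono[OF \<phi>2(1)])
        show "integrable lebesgue (\<lambda>x. (1 + \<theta>) * (norm (weak_grad u x))\<^sup>2 + (1 + 1 / \<theta>) * (norm (grad (\<phi> n) x - weak_grad u x))\<^sup>2)"
          using g2 ib by simp
        show "(norm (grad (\<phi> n) x))\<^sup>2 \<le> (1 + \<theta>) * (norm (weak_grad u x))\<^sup>2 + (1 + 1 / \<theta>) * (norm (grad (\<phi> n) x - weak_grad u x))\<^sup>2" for x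
          using norm_add_sq_le[OF \<theta>, of "weak_grad u x" "grad (\<phi> n) x - weak_grad u x"] by simp
      qed
      also have "\<dots> = (1 + \<theta>) * E + (1 + 1 / \<theta>) * b n" using g2 ib by (simp add: E_def b_def)
      finally have e: "energy (\<phi> n) \<le> (1 + \<theta>) * E + (1 + 1 / \<theta>) * b n" .
      have "\<kappa>\<^sup>2 * quart (\<phi> n) = (\<kappa> * sqrt (quart (\<phi> n)))\<^sup>2" by (simp add: power_mult_distrib quart_nonneg)
      also have "\<dots> \<le> ((1 + \<theta>) * E + (1 + 1 / \<theta>) * b n)\<^sup>2"
        using order_trans[OF \<kappa>(2)[OF \<phi>(1)] e] \<kappa>(1) by (intro power_mono) (auto simp: quart_nonneg)
      finally have "(1 + \<theta>) ^ 3 * (\<kappa>\<^sup>2 * quart (\<phi> n)) \<le> (1 + \<theta>) ^ 3 * ((1 + \<theta>) * E + (1 + 1 / \<theta>) * b n)\<^sup>2"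
        using \<theta> by (intro mult_left_mono) auto
      then show ?thesis using Q by (simp add: distrib_left mult_ac)
    qed
    moreover have "(\<lambda>n. (1 + \<theta>) ^ 3 * ((1 + \<theta>) * E + (1 + 1 / \<theta>) * b n)\<^sup>2 + \<kappa>\<^sup>2 * ((1 + 1 / \<theta>) ^ 3 * a n))
       \<longlonglongrightarrow> (1 + \<theta>) ^ 3 * ((1 + \<theta>) * E + (1 + 1 / \<theta>) * 0)\<^sup>2 + \<kappa>\<^sup>2 * ((1 + 1 / \<theta>) ^ 3 * 0)"
      by (intro tendsto_intros a0 b0)
    ultimately have "\<kappa>\<^sup>2 * Q \<le> (1 + \<theta>) ^ 3 * ((1 + \<theta>) * E + (1 + 1 / \<theta>) * 0)\<^sup>2 + \<kappa>\<^sup>2 * ((1 + 1 / \<theta>) ^ 3 * 0)"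
      by (intro LIMSEQ_le_const) auto
    then show ?thesis by simp
  qed
  have "((\<lambda>\<theta>. (1 + \<theta>) ^ 3 * ((1 + \<theta>) * E)\<^sup>2) \<longlongrightarrow> (1 + 0) ^ 3 * ((1 + 0) * E)\<^sup>2) (at_right 0)" by (intro tendsto_intros)
  then have "\<kappa>\<^sup>2 * Q \<le> (1 + 0) ^ 3 * ((1 + 0) * E)\<^sup>2"
    by (rule tendsto_lowerbound) (auto intro!: eventually_at_rightI[of 0 1] main)
  then have "\<kappa>\<^sup>2 * Q \<le> E\<^sup>2" by simp
  then have "sqrt (\<kappa>\<^sup>2 * Q) \<le> sqrt (E\<^sup>2)" by (rule real_sqrt_le_mono)
  then show ?thesis
    using \<kappa>(1) E0 by (simp add: real_sqrt_mult Lp_norm_2_sq Lp_norm_4_pow Q_def E_def)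
qed

lemma quart_eq_0_iff:
  assumes "C1c f"
  shows "quart f = 0 \<longleftrightarrow> (AE x in lebesgue. f x = 0)"
proof -
  have [measurable]: "f \<in> borel_measurable borel" using C1c_measurable[OF assms] by simp
  have "quart f = 0 \<longleftrightarrow> (AE x in lborel. f x ^ 4 = 0)"
    unfolding quart_def using C1c_integrable_power[OF assms, of 4] by (intro integral_nonneg_eq_0_iff_AE) auto
  also have "\<dots> \<longleftrightarrow> (AE x in lebesgue. f x = 0)" by (simp add: AE_completion_iff)
  finally show ?thesis .
qed

section \<open>The constant as an infimum over test functions, and its extension to H^1\<close>

definition D12_nz :: "(real^4 \<Rightarrow> real) set" where
  "D12_nz = {u \<in> D12. \<not> (AE x in lebesgue. u x = 0)}"

lemma D12_nz_Lp_norm_pos: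
  assumes "u \<in> D12_nz"
  shows "0 < (Lp_norm 4 u)\<^sup>2"
proof -
  have m: "u \<in> borel_measurable lebesgue" "integrable lebesgue (\<lambda>x. u x ^ 4)" and nz: "\<not> (AE x in lebesgue. u x = 0)"
    using assms by (auto simp: D12_nz_def D12_def Lp_space_4_iff)
  have "(\<integral>x. u x ^ 4 \<partial>lebesgue) \<noteq> 0"
    using nz integral_nonneg_eq_0_iff_AE[OF m(2)] by auto
  then show ?thesis by (simp add: Lp_norm_4_pow less_le)
qed

lemma sobolev_const_alt: "sobolev_const = (INF u\<in>D12_nz. (Lp_norm 2 (weak_grad u))\<^sup>2 / (Lp_norm 4 u)\<^sup>2)"
  unfolding sobolev_const_def D12_nz_def ..

lemma D12_nz_nonempty: "D12_nz \<noteq> {}"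
proof -
  let ?f = "bump 1 :: real^4 \<Rightarrow> real"
  have t: "test_function ?f" by (rule test_function_bump) simp
  have "\<not> (AE x in lebesgue. ?f x = 0)"
  proof
    assume "AE x in lebesgue. ?f x = 0"
    then have "AE x in lborel. ?f x = 0" by (simp add: AE_completion_iff)
    then have "(\<integral>x. ?f x \<partial>lborel) = 0" by (rule integral_eq_zero_AE)
    then show False using bump_integral_pos[of 1, where 'a = "real^4"] by simp
  qed
  then have "?f \<in> D12_nz" using test_function_D12[OF t] by (simp add: D12_nz_def)
  then show ?thesis by blast
qed

text \<open>The converse of \<open>Sobolev_test\<close>: together they say that S is already
  determined by the test functions.\<close>

lemma sobolev_const_ge:
  assumes "0 \<le> \<kappa>" "\<And>f::real^4 \<Rightarrow> real. test_function f \<Longrightarrow> \<kappa> * sqrt (quart f) \<le> energy f"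
  shows "\<kappa> \<le> sobolev_const"
  unfolding sobolev_const_alt
proof (rule cINF_greatest[OF D12_nz_nonempty])
  fix u assume u: "u \<in> D12_nz"
  then show "\<kappa> \<le> (Lp_norm 2 (weak_grad u))\<^sup>2 / (Lp_norm 4 u)\<^sup>2"
    using Sobolev_D12_if_test[of u \<kappa>] assms D12_nz_Lp_norm_pos[OF u] by (simp add: D12_nz_def le_divide_eq)
qed

lemma sobolev_const_pos: "0 < sobolev_const"
proof -
  have "sqrt omega4 \<le> sobolev_const"
    using omega4_pos by (intro sobolev_const_ge Sobolev_C1c test_function_C1c) auto
  then show ?thesis using omega4_pos by (meson less_le_trans real_sqrt_gt_zero)
qed

lemma quart_sqrt: "C1c f \<Longrightarrow> (Lp_norm 4 f)\<^sup>2 = sqrt (quart f)"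
  using C1c_lebesgue(3)[of f] Lp_norm_4_pow[of f] by simp

lemma Sobolev_test:
  fixes f :: "real^4 \<Rightarrow> real"
  assumes f: "test_function f"
  shows "sobolev_const * sqrt (quart f) \<le> energy f"
proof (cases "AE x in lebesgue. f x = 0")
  case True
  then show ?thesis using quart_eq_0_iff[OF test_function_C1c[OF f]] by (simp add: energy_nonneg)
next
  case False
  then have nz: "f \<in> D12_nz" using test_function_D12[OF f] by (simp add: D12_nz_def)
  have "sobolev_const \<le> (Lp_norm 2 (weak_grad f))\<^sup>2 / (Lp_norm 4 f)\<^sup>2"
    unfolding sobolev_const_alt using nz by (intro cINF_lower bdd_belowI[of _ 0]) auto
  then show ?thesis
    using D12_nz_Lp_norm_pos[OF nz] C1c_lebesgue(2)[OF test_function_C1c[OF f]] quart_sqrt[OF test_function_C1c[OF f]]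
    by (simp add: le_divide_eq)
qed

lemma sobolev_const_approx:
  assumes "\<kappa> > sobolev_const"
  shows "\<exists>f::real^4 \<Rightarrow> real. test_function f \<and> energy f < \<kappa> * sqrt (quart f)"
proof (rule ccontr)
  assume "\<not> ?thesis"
  then have "\<kappa> \<le> sobolev_const" using assms sobolev_const_pos by (intro sobolev_const_ge) (auto simp: not_less)
  then show False using assms by simp
qed

text \<open>A nearly optimal test function is symmetrised with an error of half its gap to \<kappa>,
  so the strict inequality is kept.\<close>

lemma sobolev_const_approx_radial:
  assumes "\<kappa> > sobolev_const"
  shows "\<exists>U::real^4 \<Rightarrow> real. C1c U \<and> radial_decreasing U \<and> 0 < quart U \<and> energy U < \<kappa> * sqrt (quart U)"
proof -
  obtain f :: "real^4 \<Rightarrow> real" where f: "test_function f" "energy f < \<kappa> * sqrt (quart f)"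
    using sobolev_const_approx[OF assms] by blast
  have \<kappa>: "\<kappa> > 0" using assms sobolev_const_pos by simp
  define \<eta> where "\<eta> = (\<kappa> * sqrt (quart f) - energy f) / 2"
  have \<eta>: "\<eta> > 0" using f(2) by (simp add: \<eta>_def)
  obtain U :: "real^4 \<Rightarrow> real" where U: "C1c U" "radial_decreasing U" "quart f \<le> quart U" "energy U \<le> energy f + \<eta>"
    using Polya_Szego[OF test_function_C1c[OF f(1)] \<eta>] by blast
  have "0 < sqrt (quart f)" using f(2) energy_nonneg[of f] \<kappa> by (metis order_le_less_trans zero_less_mult_pos)
  then have "0 < quart U" using U(3) by simp
  moreover have "energy U < \<kappa> * sqrt (quart f)" using U(4) f(2) by (simp add: \<eta>_def field_simps)
  then have "energy U < \<kappa> * sqrt (quart U)"     using mult_left_mono[OF real_sqrt_le_mono[OF U(3)] less_imp_le[OF \<kappa>]] by (rule less_le_trans)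
  ultimately show ?thesis using U by blast
qed

text \<open>\<open>weak_approximation\<close> on the ball of radius n + 1 with error 1/(n + 1)
  yields convergence in L^1 on every ball, and a subsequence converges almost everywhere. The latter
  is for Fatou's lemma, the former for the linear term of the first variation.\<close>

lemma H1_approximation:
  fixes u :: "'a::euclidean_space \<Rightarrow> real"
  assumes u: "u \<in> H1"
  shows "\<exists>u' \<phi>. u' \<in> borel_measurable borel \<and> (AE x in lebesgue. u x = u' x) \<and> loc_int u' \<and> integrable lborel (\<lambda>x. (u' x)\<^sup>2) \<and>
    (\<forall>n::nat. test_function (\<phi> n)) \<and> (AE x in lborel. (\<lambda>n. \<phi> n x) \<longlonglongrightarrow> u' x) \<and>
    (\<forall>R. (\<lambda>n. \<integral>x. indicator (cball 0 R) x * \<bar>\<phi> n x - u' x\<bar> \<partial>lborel) \<longlonglongrightarrow> 0) \<and>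
    (\<forall>n. energy (\<phi> n) \<le> (Lp_norm 2 (weak_grad u))\<^sup>2 + 1 / real (Suc n))"
proof -
  obtain h where "is_weak_grad u h" using u by (auto simp: H1_def)
  then have wg: "is_weak_grad u (weak_grad u)" by (rule is_weak_grad_weak_grad)
  have uL: "u \<in> borel_measurable lebesgue" "integrable lebesgue (\<lambda>x. (u x)\<^sup>2)"
    and gL: "weak_grad u \<in> borel_measurable lebesgue" "integrable lebesgue (\<lambda>x. (norm (weak_grad u x))\<^sup>2)"
    using u by (auto simp: H1_def Lp_space_2_iff)
  note [measurable] = uL(1) gL(1)
  obtain v g where v: "loc_int v" "loc_int g" "AE x in lebesgue. u x = v x" "AE x in lebesgue. weak_grad u x = g x"
     "\<And>\<phi> e. test_function \<phi> \<Longrightarrow> e\<in>Basis \<Longrightarrow> (\<integral>x. v x * partial_deriv e \<phi> x \<partial>lborel) = - (\<integral>x. (g x \<bullet> e) * \<phi> x \<partial>lborel)"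
    using is_weak_grad_representative[OF wg] by blast
  have mv [measurable]: "v \<in> borel_measurable borel" "g \<in> borel_measurable borel" using v by (auto simp: loc_int_def)
  have [measurable]: "v \<in> borel_measurable lebesgue" "g \<in> borel_measurable lebesgue" using mv by (auto intro: measurable_completion)
  have "AE x in lebesgue. (u x)\<^sup>2 = (v x)\<^sup>2" using v(3) by eventually_elim simp
  then have "integrable lebesgue (\<lambda>x. (v x)\<^sup>2)" using uL(2)
    by (intro integrable_cong_AE_imp[of lebesgue "\<lambda>x. (u x)\<^sup>2" "\<lambda>x. (v x)\<^sup>2"]) auto
  then have v2: "integrable lborel (\<lambda>x. (v x)\<^sup>2)" by (simp add: integrable_completion)
  have ae: "AE x in lebesgue. (norm (weak_grad u x))\<^sup>2 = (norm (g x))\<^sup>2" using v(4) by eventually_elim simp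
  then have "integrable lebesgue (\<lambda>x. (norm (g x))\<^sup>2)" using gL(2)
    by (intro integrable_cong_AE_imp[of lebesgue "\<lambda>x. (norm (weak_grad u x))\<^sup>2" "\<lambda>x. (norm (g x))\<^sup>2"]) auto
  then have g2: "integrable lborel (\<lambda>x. (norm (g x))\<^sup>2)" by (simp add: integrable_completion)
  have Eg: "(Lp_norm 2 (weak_grad u))\<^sup>2 = (\<integral>x. (norm (g x))\<^sup>2 \<partial>lborel)"
    unfolding Lp_norm_2_sq using ae by (intro integral_lebesgue_cong_AE) auto
  have "\<exists>\<phi>. test_function \<phi> \<and> (\<integral>\<^sup>+x. indicator (cball 0 (real (Suc n))) x * ennreal \<bar>\<phi> x - v x\<bar> \<partial>lborel) \<le> ennreal (1 / real (Suc n)) \<and>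
     energy \<phi> \<le> (\<integral>x. (norm (g x))\<^sup>2 \<partial>lborel) + 1 / real (Suc n)" for n
    unfolding energy_def by (rule weak_approximation[OF v(1,2) v(5) v2 g2]) auto
  then have "\<forall>n. \<exists>\<phi>. test_function \<phi> \<and> (\<integral>\<^sup>+x. indicator (cball 0 (real (Suc n))) x * ennreal \<bar>\<phi> x - v x\<bar> \<partial>lborel) \<le> ennreal (1 / real (Suc n)) \<and>
     energy \<phi> \<le> (\<integral>x. (norm (g x))\<^sup>2 \<partial>lborel) + 1 / real (Suc n)" by blast
  from choice[OF this] obtain \<phi> where \<phi>: "\<And>n. test_function (\<phi> n)"
     "\<And>n. (\<integral>\<^sup>+x. indicator (cball 0 (real (Suc n))) x * ennreal \<bar>\<phi> n x - v x\<bar> \<partial>lborel) \<le> ennreal (1 / real (Suc n))"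
     "\<And>n. energy (\<phi> n) \<le> (\<integral>x. (norm (g x))\<^sup>2 \<partial>lborel) + 1 / real (Suc n)" by blast
  have [measurable]: "\<phi> n \<in> borel_measurable borel" for n using \<phi>(1) by (rule test_function_measurable)
  define D where "D n x = indicator (cball 0 (real (Suc n))) x * \<bar>\<phi> n x - v x\<bar>" for n x
  have [measurable]: "D n \<in> borel_measurable borel" for n unfolding D_def by measurable
  have Dnn: "(\<integral>\<^sup>+x. ennreal (D n x) \<partial>lborel) \<le> ennreal (1 / real (Suc n))" for n
  proof -
    have "(\<integral>\<^sup>+x. ennreal (D n x) \<partial>lborel) = (\<integral>\<^sup>+x. indicator (cball 0 (real (Suc n))) x * ennreal \<bar>\<phi> n x - v x\<bar> \<partial>lborel)"
      by (intro nn_integral_cong) (auto simp: D_def indicator_def)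
    then show ?thesis using \<phi>(2)[of n] by simp
  qed
  have D0: "0 \<le> D n x" for n x by (simp add: D_def)
  have Di: "integrable lborel (D n)" for n
    using Dnn[of n] D0 by (intro integrableI_nonneg) (auto intro: le_less_trans)
  have DI: "(\<integral>x. D n x \<partial>lborel) \<le> 1 / real (Suc n)" for n
  proof -
    have "ennreal (\<integral>x. D n x \<partial>lborel) \<le> ennreal (1 / real (Suc n))"
      using Dnn[of n] nn_integral_eq_integral[OF Di[of n]] D0 by simp
    then show ?thesis by (subst (asm) ennreal_le_iff) auto
  qed
  have lim0: "(\<lambda>n. \<integral>x. D n x \<partial>lborel) \<longlonglongrightarrow> 0"
  proof (rule tendsto_sandwich[where f = "\<lambda>_. 0" and h = "\<lambda>n. 1 / real (Suc n)"])
    show "(\<lambda>n. 1 / real (Suc n)) \<longlonglongrightarrow> 0" by (rule lim_1_over_n[THEN LIMSEQ_Suc])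
    show "\<forall>\<^sub>F n in sequentially. 0 \<le> (\<integral>x. D n x \<partial>lborel)" using D0 by (intro always_eventually allI Bochner_Integration.integral_nonneg)
    show "\<forall>\<^sub>F n in sequentially. (\<integral>x. D n x \<partial>lborel) \<le> 1 / real (Suc n)" using DI by simp
  qed simp
  then have "(\<lambda>n. \<integral>x. norm (D n x) \<partial>lborel) \<longlonglongrightarrow> 0" using D0 by simp
  from tendsto_L1_AE_subseq[OF Di this] obtain r :: "nat \<Rightarrow> nat" where r: "strict_mono r" "AE x in lborel. (\<lambda>n. D (r n) x) \<longlonglongrightarrow> 0" by blast
  \<comment> \<open>Because of this the bounds with index \<open>r n\<close> imply those with index
    \<open>n\<close>.\<close>
  have rn: "n \<le> r n" for n using r(1) by (rule seq_suble)
  have "AE x in lborel. (\<lambda>n. \<phi> (r n) x) \<longlonglongrightarrow> v x"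
    using r(2)
  proof eventually_elim
    fix x assume x: "(\<lambda>n. D (r n) x) \<longlonglongrightarrow> 0"
    obtain N :: nat where N: "norm x \<le> real N" using real_arch_simple by blast
    have "\<forall>\<^sub>F n in sequentially. D (r n) x = \<bar>\<phi> (r n) x - v x\<bar>"
    proof (rule eventually_sequentiallyI[of N])
      fix n assume "N \<le> n"
      then have "norm x \<le> real (Suc (r n))" using N rn[of n] by (simp add: order_trans[of _ "real N"])
      then show "D (r n) x = \<bar>\<phi> (r n) x - v x\<bar>" by (simp add: D_def)
    qed
    then have "(\<lambda>n. \<bar>\<phi> (r n) x - v x\<bar>) \<longlonglongrightarrow> 0" using x by (rule Lim_transform_eventually[rotated])
    then show "(\<lambda>n. \<phi> (r n) x) \<longlonglongrightarrow> v x" by (simp add: tendsto_rabs_zero_iff LIM_zero_iff)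
  qed
  moreover have "(\<lambda>n. \<integral>x. indicator (cball 0 R) x * \<bar>\<phi> (r n) x - v x\<bar> \<partial>lborel) \<longlonglongrightarrow> 0" for R
  proof (rule tendsto_sandwich[where f = "\<lambda>_. 0" and h = "\<lambda>n. \<integral>x. D (r n) x \<partial>lborel"])
    show "(\<lambda>n. \<integral>x. D (r n) x \<partial>lborel) \<longlonglongrightarrow> 0" using LIMSEQ_subseq_LIMSEQ[OF lim0 r(1)] by (simp add: comp_def)
    show "\<forall>\<^sub>F n in sequentially. 0 \<le> (\<integral>x. indicator (cball 0 R) x * \<bar>\<phi> (r n) x - v x\<bar> \<partial>lborel)"
      by (intro always_eventually allI Bochner_Integration.integral_nonneg) simp
    obtain N :: nat where N: "R \<le> real N" using real_arch_simple by blast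
    show "\<forall>\<^sub>F n in sequentially. (\<integral>x. indicator (cball 0 R) x * \<bar>\<phi> (r n) x - v x\<bar> \<partial>lborel) \<le> (\<integral>x. D (r n) x \<partial>lborel)"
    proof (rule eventually_sequentiallyI[of N])
      fix n assume "N \<le> n"
      then have R: "R \<le> real (Suc (r n))" using N rn[of n] by (simp add: order_trans[of _ "real N"])
      have le: "indicator (cball 0 R) x * \<bar>\<phi> (r n) x - v x\<bar> \<le> D (r n) x" for x
        using R by (auto simp: D_def indicator_def)
      show "(\<integral>x. indicator (cball 0 R) x * \<bar>\<phi> (r n) x - v x\<bar> \<partial>lborel) \<le> (\<integral>x. D (r n) x \<partial>lborel)"
        by (intro integral_mono_AE' Di AE_I2 le D0)
    qed
  qed simp
  moreover have "energy (\<phi> (r n)) \<le> (Lp_norm 2 (weak_grad u))\<^sup>2 + 1 / real (Suc n)" for n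
  proof -
    have "1 / real (Suc (r n)) \<le> 1 / real (Suc n)" using rn[of n] by (intro divide_left_mono) auto
    then show ?thesis using \<phi>(3)[of "r n"] Eg by simp
  qed
  ultimately show ?thesis
    using v(1,3) v2 \<phi>(1) mv(1) by (intro exI[of _ v] exI[of _ "\<lambda>n. \<phi> (r n)"]) auto
qed

text \<open>Fatou's lemma with varying bounds \<open>B n\<close>, since along the approximations the
  sharp bound is reached only in the limit.\<close>

lemma nn_integral_Fatou_le:
  fixes f :: "nat \<Rightarrow> 'a \<Rightarrow> real" and B :: "nat \<Rightarrow> real"
  assumes [measurable]: "\<And>n. f n \<in> borel_measurable M"
    and lim: "AE x in M. (\<lambda>n. f n x) \<longlonglongrightarrow> g x" and le: "\<And>n. (\<integral>\<^sup>+x. ennreal (f n x) \<partial>M) \<le> ennreal (B n)" and B: "B \<longlonglongrightarrow> b"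
  shows "(\<integral>\<^sup>+x. ennreal (g x) \<partial>M) \<le> ennreal b"
proof -
  have "(\<integral>\<^sup>+x. ennreal (g x) \<partial>M) = (\<integral>\<^sup>+x. liminf (\<lambda>n. ennreal (f n x)) \<partial>M)"
  proof (rule nn_integral_cong_AE)
    show "AE x in M. ennreal (g x) = liminf (\<lambda>n. ennreal (f n x))"
      using lim
    proof eventually_elim
      fix x assume "(\<lambda>n. f n x) \<longlonglongrightarrow> g x"
      then have "(\<lambda>n. ennreal (f n x)) \<longlonglongrightarrow> ennreal (g x)" by (rule tendsto_ennrealI)
      then show "ennreal (g x) = liminf (\<lambda>n. ennreal (f n x))" using lim_imp_Liminf[OF sequentially_bot] by metis
    qed
  qed
  also have "\<dots> \<le> liminf (\<lambda>n. \<integral>\<^sup>+x. ennreal (f n x) \<partial>M)" by (rule nn_integral_liminf) simp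
  also have "\<dots> \<le> liminf (\<lambda>n. ennreal (B n))" using le by (intro Liminf_mono) simp
  also have "\<dots> = ennreal b" using tendsto_ennrealI[OF B] lim_imp_Liminf[OF sequentially_bot] by metis
  finally show ?thesis .
qed

text \<open>Membership in \<open>D12\<close> is bypassed: the inequality for test functions passes
  to the almost everywhere limit by Fatou, which gives the integrability of the fourth power and the
  sharp constant at once.\<close>

lemma Sobolev_H1:
  fixes u :: "real^4 \<Rightarrow> real"
  assumes u: "u \<in> H1"
  shows "integrable lebesgue (\<lambda>x. u x ^ 4)" "sobolev_const * (Lp_norm 4 u)\<^sup>2 \<le> (Lp_norm 2 (weak_grad u))\<^sup>2"
proof -
  let ?K = sobolev_const
  define E where "E = (Lp_norm 2 (weak_grad u))\<^sup>2"
  obtain v \<phi> where v: "v \<in> borel_measurable borel" "AE x in lebesgue. u x = v x"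
    and \<phi>: "\<And>n::nat. test_function (\<phi> n)" "AE x in lborel. (\<lambda>n. \<phi> n x) \<longlonglongrightarrow> v x" "\<And>n. energy (\<phi> n) \<le> E + 1 / real (Suc n)"
    using H1_approximation[OF u] unfolding E_def by blast
  note [measurable] = v(1)
  have [measurable]: "\<phi> n \<in> borel_measurable borel" for n using \<phi>(1) by (rule test_function_measurable)
  have um [measurable]: "u \<in> borel_measurable lebesgue" using u by (simp add: H1_def Lp_space_2_iff)
  have K: "?K > 0" by (rule sobolev_const_pos)
  have E0: "E \<ge> 0" by (simp add: E_def)
  have le: "(\<integral>\<^sup>+x. ennreal (v x ^ 4) \<partial>lborel) \<le> ennreal (((E + 0) / ?K)\<^sup>2)"
  proof (rule nn_integral_Fatou_le)
    show "(\<lambda>x. \<phi> n x ^ 4) \<in> borel_measurable lborel" for n by simp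
    show "AE x in lborel. (\<lambda>n. \<phi> n x ^ 4) \<longlonglongrightarrow> v x ^ 4" using \<phi>(2) by eventually_elim (rule tendsto_power)
    show "(\<lambda>n. ((E + 1 / real (Suc n)) / ?K)\<^sup>2) \<longlonglongrightarrow> ((E + 0) / ?K)\<^sup>2"
      using K by (intro tendsto_intros lim_1_over_n[THEN LIMSEQ_Suc]) auto
    fix n
    have "sqrt (quart (\<phi> n)) \<le> (E + 1 / real (Suc n)) / ?K"
      using Sobolev_test[OF \<phi>(1)[of n]] \<phi>(3)[of n] K by (simp add: le_divide_eq mult.commute)
    then have "(sqrt (quart (\<phi> n)))\<^sup>2 \<le> ((E + 1 / real (Suc n)) / ?K)\<^sup>2" by (intro power_mono) (auto simp: quart_nonneg)
    then have "quart (\<phi> n) \<le> ((E + 1 / real (Suc n)) / ?K)\<^sup>2" by (simp add: quart_nonneg)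
    moreover have "(\<integral>\<^sup>+x. ennreal (\<phi> n x ^ 4) \<partial>lborel) = ennreal (quart (\<phi> n))"
      unfolding quart_def using C1c_integrable_power[OF test_function_C1c[OF \<phi>(1)], of 4 n]
      by (intro nn_integral_eq_integral) auto
    ultimately show "(\<integral>\<^sup>+x. ennreal (\<phi> n x ^ 4) \<partial>lborel) \<le> ennreal (((E + 1 / real (Suc n)) / ?K)\<^sup>2)"
      by (simp add: ennreal_leI)
  qed
  have vi: "integrable lborel (\<lambda>x. v x ^ 4)"
    using le by (intro integrableI_nonneg) (auto intro: le_less_trans)
  have vm [measurable]: "v \<in> borel_measurable lebesgue" by (intro measurable_completion) simp
  have ae: "AE x in lebesgue. v x ^ 4 = u x ^ 4" using v(2) by eventually_elim simp
  have "integrable lebesgue (\<lambda>x. v x ^ 4)" using vi by (simp add: integrable_completion)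
  then show "integrable lebesgue (\<lambda>x. u x ^ 4)" using ae
    by (intro integrable_cong_AE_imp[of lebesgue "\<lambda>x. v x ^ 4" "\<lambda>x. u x ^ 4"]) auto
  have "AE x in lebesgue. u x ^ 4 = v x ^ 4" using v(2) by eventually_elim simp
  then have eq: "(\<integral>x. u x ^ 4 \<partial>lebesgue) = (\<integral>x. v x ^ 4 \<partial>lborel)" by (intro integral_lebesgue_cong_AE) auto
  have "ennreal (\<integral>x. v x ^ 4 \<partial>lborel) \<le> ennreal ((E / ?K)\<^sup>2)" using le nn_integral_eq_integral[OF vi] by simp
  then have "(\<integral>x. v x ^ 4 \<partial>lborel) \<le> (E / ?K)\<^sup>2" by (subst (asm) ennreal_le_iff) auto
  then have "sqrt (\<integral>x. v x ^ 4 \<partial>lborel) \<le> sqrt ((E / ?K)\<^sup>2)" by (rule real_sqrt_le_mono)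
  also have "\<dots> = E / ?K" using E0 K by simp
  finally show "?K * (Lp_norm 4 u)\<^sup>2 \<le> (Lp_norm 2 (weak_grad u))\<^sup>2"
    using K by (simp add: Lp_norm_4_pow eq E_def le_divide_eq mult.commute)
qed

text \<open>The squared form, free of roots, in which the first variation is computed.\<close>

lemma Sobolev_sharp_C1c:
  fixes f :: "real^4 \<Rightarrow> real"
  assumes "C1c f"
  shows "sobolev_const\<^sup>2 * quart f \<le> (energy f)\<^sup>2"
proof -
  have "sobolev_const * sqrt (quart f) \<le> energy f"
    using Sobolev_H1(2)[OF C1c_lebesgue(1)[OF assms]] C1c_lebesgue(2)[OF assms] quart_sqrt[OF assms] by simp
  then have "(sobolev_const * sqrt (quart f))\<^sup>2 \<le> (energy f)\<^sup>2"
    using sobolev_const_pos by (intro power_mono) (auto simp: quart_nonneg)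
  then show ?thesis by (simp add: power_mult_distrib quart_nonneg)
qed

section \<open>Strictness of the Sobolev inequality on \<open>L\<^sup>2\<close>\<close>

definition lap :: "('a::euclidean_space \<Rightarrow> real) \<Rightarrow> 'a \<Rightarrow> real" where
  "lap f x = (\<Sum>e\<in>Basis. partial_deriv e (partial_deriv e f) x)"

text \<open>A differentiable substitute for the modulus of \<open>f\<close>. The chain rule factor
  \<open>f x / sqrt ((f x)\<^sup>2 + \<epsilon>\<^sup>2)\<close> has modulus at most 1, so the
  energy does not grow; subtracting \<epsilon> restores the compact support.\<close>

lemma C1c_sqrt:
  fixes f :: "'a::euclidean_space \<Rightarrow> real"
  assumes f: "C1c f" and \<epsilon>: "\<epsilon> > 0"
  defines "w \<equiv> \<lambda>x. sqrt ((f x)\<^sup>2 + \<epsilon>\<^sup>2) - \<epsilon>"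
  shows "C1c w" "energy w \<le> energy f" "\<bar>w x - \<bar>f x\<bar>\<bar> \<le> \<epsilon>"
proof -
  obtain R where R: "\<And>x. R \<le> norm x \<Longrightarrow> f x = 0 \<and> grad f x = 0" using C1c_support[OF f] by blast
  have pos: "(f x)\<^sup>2 + \<epsilon>\<^sup>2 > 0" for x using \<epsilon> by (simp add: add_nonneg_pos)
  define c where "c x = f x / sqrt ((f x)\<^sup>2 + \<epsilon>\<^sup>2)" for x
  have c1: "\<bar>c x\<bar> \<le> 1" for x
  proof -
    have "\<bar>f x\<bar> = sqrt ((f x)\<^sup>2)" by simp
    also have "\<dots> \<le> sqrt ((f x)\<^sup>2 + \<epsilon>\<^sup>2)" by (intro real_sqrt_le_mono) simp
    finally show ?thesis using pos[of x] by (simp add: c_def)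
  qed
  have D: "(w has_derivative (\<lambda>h. (c x *\<^sub>R grad f x) \<bullet> h)) (at x)" for x
  proof -
    have "((\<lambda>t. sqrt (t\<^sup>2 + \<epsilon>\<^sup>2) - \<epsilon>) has_real_derivative c x) (at (f x))"
    proof -
      have "((\<lambda>t. t\<^sup>2 + \<epsilon>\<^sup>2) has_real_derivative 2 * f x) (at (f x))"
        by (auto intro!: derivative_eq_intros)
      from DERIV_diff[OF DERIV_chain2[OF DERIV_real_sqrt[OF pos[of x]] this] DERIV_const[of \<epsilon>]]
      have "((\<lambda>t. sqrt (t\<^sup>2 + \<epsilon>\<^sup>2) - \<epsilon>) has_real_derivative
          inverse (sqrt ((f x)\<^sup>2 + \<epsilon>\<^sup>2)) / 2 * (2 * f x) - 0) (at (f x))" .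
      moreover have "inverse (sqrt ((f x)\<^sup>2 + \<epsilon>\<^sup>2)) / 2 * (2 * f x) - 0 = c x"
        proof -
        have "inverse r / 2 * (2 * y) - 0 = y / r" for r y :: real by (simp only: divide_inverse) simp
        then show ?thesis unfolding c_def .
      qed
      ultimately show ?thesis by metis
    qed
    from has_derivative_compose[OF C1c_has_derivative[OF f] this[unfolded has_field_derivative_def]]
    show ?thesis by (simp only: w_def inner_scaleR_left)
  qed
  have "sqrt ((f x)\<^sup>2 + \<epsilon>\<^sup>2) \<noteq> 0" for x using real_sqrt_gt_zero[OF pos[of x]] by linarith
  then have cc: "continuous_on UNIV (\<lambda>x. c x *\<^sub>R grad f x)"
    unfolding c_def using C1c_continuous[OF f] C1c_continuous_grad[OF f] by (intro continuous_intros) auto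
  have w0: "w x = 0" if "R \<le> norm x" for x using R[OF that] \<epsilon> by (simp add: w_def)
  show w: "C1c w" using C1cI(1)[OF D cc w0] by blast
  have g: "grad w = (\<lambda>x. c x *\<^sub>R grad f x)" using C1cI(2)[OF D cc w0] by blast
  show "energy w \<le> energy f"
    unfolding energy_def
  proof (rule integral_mono[OF C1c_integrable_energy[OF w] C1c_integrable_energy[OF f]])
    show "(norm (grad w x))\<^sup>2 \<le> (norm (grad f x))\<^sup>2" for x
      unfolding g using c1[of x] by (intro power_mono) (auto simp: mult_left_le_one_le)
  qed
  have "\<bar>f x\<bar> \<le> sqrt ((f x)\<^sup>2 + \<epsilon>\<^sup>2)" by (rule real_le_rsqrt) simp
  moreover have "sqrt ((f x)\<^sup>2 + \<epsilon>\<^sup>2) \<le> \<bar>f x\<bar> + \<epsilon>"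
    using \<epsilon> sqrt_add_le_add_sqrt[of "(f x)\<^sup>2" "\<epsilon>\<^sup>2"] by simp
  ultimately show "\<bar>w x - \<bar>f x\<bar>\<bar> \<le> \<epsilon>" using \<epsilon> by (simp add: w_def)
qed

lemma test_function_lap:
  assumes "test_function \<psi>"
  shows "continuous_on UNIV (lap \<psi>)" "\<exists>R. \<forall>x. R \<le> norm x \<longrightarrow> lap \<psi> x = 0"
proof -
  have t: "test_function (partial_deriv e (partial_deriv e \<psi>))" if "e \<in> Basis" for e
    using assms that by (intro test_function_partial_deriv)
  then show "continuous_on UNIV (lap \<psi>)"
    unfolding lap_def[abs_def] by (intro continuous_on_sum C1c_continuous test_function_C1c)
  have "\<forall>e\<in>Basis. \<exists>R. \<forall>x. R \<le> norm x \<longrightarrow> partial_deriv e (partial_deriv e \<psi>) x = 0"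
    using test_function_support[OF t] by blast
  then obtain R where R: "\<And>e x. e \<in> Basis \<Longrightarrow> R e \<le> norm x \<Longrightarrow> partial_deriv e (partial_deriv e \<psi>) x = 0"
    by (auto simp: bchoice_iff)
  have "lap \<psi> x = 0" if "Max (R ` Basis) \<le> norm x" for x
    unfolding lap_def using that by (intro sum.neutral ballI R) (auto intro: order_trans[OF Max_ge])
  then show "\<exists>R. \<forall>x. R \<le> norm x \<longrightarrow> lap \<psi> x = 0" by blast
qed

lemma integral_grad_grad:
  fixes w :: "'a::euclidean_space \<Rightarrow> real"
  assumes w: "C1c w" and \<psi>: "test_function \<psi>"
  shows "(\<integral>x. grad w x \<bullet> grad \<psi> x \<partial>lborel) = - (\<integral>x. w x * lap \<psi> x \<partial>lborel)"
proof -
  note [measurable] = C1c_measurable[OF w]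
  have 1: "(\<integral>x. (grad w x \<bullet> e) * partial_deriv e \<psi> x \<partial>lborel) = - (\<integral>x. w x * partial_deriv e (partial_deriv e \<psi>) x \<partial>lborel)"
    if e: "e \<in> Basis" for e
  proof -
    have t: "test_function (partial_deriv e \<psi>)" "test_function (partial_deriv e (partial_deriv e \<psi>))"
      using \<psi> e by (auto intro: test_function_partial_deriv)
    note [measurable] = t[THEN test_function_measurable]
    have "(\<integral>x. w x * partial_deriv e (partial_deriv e \<psi>) x \<partial>lebesgue) = - (\<integral>x. (grad w x \<bullet> e) * partial_deriv e \<psi> x \<partial>lebesgue)"
      using C1c_is_weak_grad[OF w] t(1) e unfolding is_weak_grad_def by blast
    then show ?thesis by (simp add: integral_completion)
  qed
  have c: "continuous_on UNIV (partial_deriv e \<psi>)" "continuous_on UNIV (partial_deriv e (partial_deriv e \<psi>))" if "e \<in> Basis" for e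
    using \<psi> that by (auto intro!: C1c_continuous test_function_C1c test_function_partial_deriv)
  have i1: "integrable lborel (\<lambda>x. (grad w x \<bullet> e) * partial_deriv e \<psi> x)" if "e \<in> Basis" for e
    using C1c_integrable_mult[OF test_function_C1c[OF test_function_partial_deriv[OF \<psi> that]], of "\<lambda>x. grad w x \<bullet> e"]
    by (simp add: mult.commute continuous_on_inner C1c_continuous_grad[OF w])
  have i2: "integrable lborel (\<lambda>x. w x * partial_deriv e (partial_deriv e \<psi>) x)" if "e \<in> Basis" for e
    by (rule C1c_integrable_mult[OF w c(2)[OF that]])
  have "(\<integral>x. grad w x \<bullet> grad \<psi> x \<partial>lborel) = (\<integral>x. (\<Sum>e\<in>Basis. (grad w x \<bullet> e) * partial_deriv e \<psi> x) \<partial>lborel)"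
    by (intro Bochner_Integration.integral_cong refl) (simp add: euclidean_inner[of "grad w _" "grad \<psi> _"] inner_grad)
  also have "\<dots> = (\<Sum>e\<in>Basis. \<integral>x. (grad w x \<bullet> e) * partial_deriv e \<psi> x \<partial>lborel)"
    by (rule Bochner_Integration.integral_sum[OF i1])
  also have "\<dots> = - (\<Sum>e\<in>Basis. \<integral>x. w x * partial_deriv e (partial_deriv e \<psi>) x \<partial>lborel)"
    using 1 by (simp add: sum_negf)
  also have "\<dots> = - (\<integral>x. (\<Sum>e\<in>Basis. w x * partial_deriv e (partial_deriv e \<psi>) x) \<partial>lborel)"
    by (simp add: Bochner_Integration.integral_sum[OF i2])
  finally show ?thesis by (simp add: lap_def sum_distrib_left)
qed

text \<open>In the mixed term both derivatives are moved to \<psi>, so that along a sequence its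
  limit follows from convergence of \<open>w\<close> itself, in L^1 on balls.\<close>

lemma energy_add:
  fixes w :: "'a::euclidean_space \<Rightarrow> real"
  assumes w: "C1c w" and \<psi>: "test_function \<psi>"
  shows "energy (\<lambda>x. w x + t * \<psi> x) = energy w - 2 * t * (\<integral>x. w x * lap \<psi> x \<partial>lborel) + t\<^sup>2 * energy \<psi>"
proof -
  have c\<psi>: "C1c \<psi>" using \<psi> by (rule test_function_C1c)
  have g: "grad (\<lambda>x. w x + t * \<psi> x) = (\<lambda>x. grad w x + t *\<^sub>R grad \<psi> x)"
    using C1c_add(2)[OF w C1c_cmult(1)[OF c\<psi>]] C1c_cmult(2)[OF c\<psi>] by simp
  have i: "integrable lborel (\<lambda>x. grad w x \<bullet> grad \<psi> x)"
  proof -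
    obtain R where "\<And>x. R \<le> norm x \<Longrightarrow> \<psi> x = 0 \<and> grad \<psi> x = 0" using C1c_support[OF c\<psi>] by blast
    then show ?thesis using C1c_continuous_grad[OF w] C1c_continuous_grad[OF c\<psi>]
      by (intro integrable_compact_support[where R = R] continuous_intros) auto
  qed
  have "energy (\<lambda>x. w x + t * \<psi> x) = (\<integral>x. (norm (grad w x))\<^sup>2 + 2 * t * (grad w x \<bullet> grad \<psi> x) + t\<^sup>2 * (norm (grad \<psi> x))\<^sup>2 \<partial>lborel)"
    unfolding energy_def g
  proof (intro Bochner_Integration.integral_cong refl)
    show "(norm (a + t *\<^sub>R b))\<^sup>2 = (norm a)\<^sup>2 + 2 * t * (a \<bullet> b) + t\<^sup>2 * (norm b)\<^sup>2" for a b :: 'a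
      unfolding power2_norm_eq_inner
      by (simp add: inner_add_left inner_add_right inner_commute[of b a] power2_eq_square algebra_simps)
  qed
  also have "\<dots> = energy w + 2 * t * (\<integral>x. grad w x \<bullet> grad \<psi> x \<partial>lborel) + t\<^sup>2 * energy \<psi>"
    using i C1c_integrable_energy[OF w] C1c_integrable_energy[OF c\<psi>] by (simp add: energy_def)
  finally show ?thesis by (simp add: integral_grad_grad[OF w \<psi>])
qed

lemma loc_int_bounded_mult:
  fixes v q :: "'a::euclidean_space \<Rightarrow> real"
  assumes "loc_int v" "continuous_on UNIV q" "\<And>x. R \<le> norm x \<Longrightarrow> q x = 0"
  shows "integrable lborel (\<lambda>x. \<bar>v x\<bar> * q x)"
proof -
  obtain B where B: "\<And>x. norm (q x) \<le> B" using compact_support_bounded[OF assms(2,3)] by blast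
  have "loc_int (\<lambda>x. \<bar>v x\<bar>)"
  proof -
    have "integrable lborel (\<lambda>x. norm (indicator (cball 0 R) x *\<^sub>R v x))" for R
      using assms(1) unfolding loc_int_def by (intro integrable_norm) blast
    moreover have "(\<lambda>x. \<bar>v x\<bar>) \<in> borel_measurable borel"
      using assms(1) unfolding loc_int_def by (intro borel_measurable_abs) blast
    ultimately show ?thesis by (simp add: loc_int_def abs_mult)
  qed
  from loc_int_mult(1)[OF this borel_measurable_continuous_onI[OF assms(2)], of B R]
  show ?thesis using B assms(3) by (simp add: mult.commute)
qed

text \<open>\<open>w n\<close> is within 1/(n + 1) of the modulus of \<open>\<phi> n\<close>, which
  converges to that of \<open>v\<close> in L^1 on a ball containing the support of \<open>q\<close>;
  since \<open>q\<close> is bounded, the integrals converge.\<close>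

lemma abs_approx_limit:
  fixes v q :: "'a::euclidean_space \<Rightarrow> real"
  assumes v: "loc_int v" and q: "continuous_on UNIV q" "\<And>x. R \<le> norm x \<Longrightarrow> q x = 0"
    and \<phi>: "\<And>n. C1c (\<phi> n)" "(\<lambda>n. \<integral>x. indicator (cball 0 R) x * \<bar>\<phi> n x - v x\<bar> \<partial>lborel) \<longlonglongrightarrow> 0"
    and w: "\<And>n. C1c (w n)" "\<And>n x. \<bar>w n x - \<bar>\<phi> n x\<bar>\<bar> \<le> 1 / real (Suc n)"
  shows "(\<lambda>n. \<integral>x. w n x * q x \<partial>lborel) \<longlonglongrightarrow> (\<integral>x. \<bar>v x\<bar> * q x \<partial>lborel)"
proof -
  obtain B where B: "B > 0" "\<And>x. norm (q x) \<le> B" using compact_support_bounded[OF q] by blast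
  have iv: "integrable lborel (\<lambda>x. \<bar>v x\<bar> * q x)" using loc_int_bounded_mult[OF v q] .
  have iw: "integrable lborel (\<lambda>x. w n x * q x)" for n using C1c_integrable_mult[OF w(1) q(1)] .
  have i\<phi>: "integrable lborel (\<lambda>x. indicator (cball 0 R) x * \<bar>\<phi> n x - v x\<bar>)" for n
  proof -
    have "loc_int (\<lambda>x. \<phi> n x - v x)"
      using v integrable_loc_int[OF C1c_integrable_power[OF \<phi>(1), of 1 n]] unfolding loc_int_def
      by (auto simp: right_diff_distrib)
    then have "integrable lborel (\<lambda>x. norm (indicator (cball 0 R) x *\<^sub>R (\<phi> n x - v x)))"
      unfolding loc_int_def by (intro integrable_norm) blast
    then show ?thesis by (simp add: abs_mult)
  qed
  define V :: real where "V = (\<integral>x. indicator (cball (0::'a) R) x * 1 \<partial>lborel)"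
  have ic: "integrable lborel (\<lambda>x::'a. indicator (cball 0 R) x * (1 / real (Suc n)))" for n by (rule cball_integrable_const)
  have bound: "\<bar>(\<integral>x. w n x * q x \<partial>lborel) - (\<integral>x. \<bar>v x\<bar> * q x \<partial>lborel)\<bar>
     \<le> B * ((\<integral>x. indicator (cball 0 R) x * \<bar>\<phi> n x - v x\<bar> \<partial>lborel) + V * (1 / real (Suc n)))" for n
  proof -
    have "\<bar>(\<integral>x. w n x * q x \<partial>lborel) - (\<integral>x. \<bar>v x\<bar> * q x \<partial>lborel)\<bar> = norm (\<integral>x. w n x * q x - \<bar>v x\<bar> * q x \<partial>lborel)"
      using iv iw[of n] by simp
    also have "\<dots> \<le> (\<integral>x. norm (w n x * q x - \<bar>v x\<bar> * q x) \<partial>lborel)" by (rule integral_norm_bound)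
    also have "\<dots> \<le> (\<integral>x. B * (indicator (cball 0 R) x * \<bar>\<phi> n x - v x\<bar> + indicator (cball 0 R) x * (1 / real (Suc n))) \<partial>lborel)"
    proof (rule integral_mono)
      show "integrable lborel (\<lambda>x. norm (w n x * q x - \<bar>v x\<bar> * q x))" using iv iw[of n] by (intro integrable_norm) simp
      show "integrable lborel (\<lambda>x. B * (indicator (cball 0 R) x * \<bar>\<phi> n x - v x\<bar> + indicator (cball 0 R) x * (1 / real (Suc n))))"
        using i\<phi>[of n] ic[of n] by (intro integrable_mult_right Bochner_Integration.integrable_add)
      fix x
      show "norm (w n x * q x - \<bar>v x\<bar> * q x) \<le> B * (indicator (cball 0 R) x * \<bar>\<phi> n x - v x\<bar> + indicator (cball 0 R) x * (1 / real (Suc n)))"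
      proof (cases "norm x \<le> R")
        case True
        have "\<bar>w n x - \<bar>v x\<bar>\<bar> \<le> \<bar>\<phi> n x - v x\<bar> + 1 / real (Suc n)" using w(2)[of n x] by linarith
        then have "\<bar>w n x - \<bar>v x\<bar>\<bar> * \<bar>q x\<bar> \<le> (\<bar>\<phi> n x - v x\<bar> + 1 / real (Suc n)) * B"
          using B by (intro mult_mono) auto
        then have "\<bar>(w n x - \<bar>v x\<bar>) * q x\<bar> \<le> B * (\<bar>\<phi> n x - v x\<bar> + 1 / real (Suc n))"
          by (simp only: abs_mult mult.commute)
        then show ?thesis using True by (simp add: left_diff_distrib)
      next
        case False
        then show ?thesis using q(2)[of x] by simp
      qed
    qed
    also have "\<dots> = B * ((\<integral>x. indicator (cball 0 R) x * \<bar>\<phi> n x - v x\<bar> \<partial>lborel) + V * (1 / real (Suc n)))"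
      using i\<phi>[of n] ic[of n] by (simp add: V_def)
    finally show ?thesis .
  qed
  have "(\<lambda>n. B * ((\<integral>x. indicator (cball 0 R) x * \<bar>\<phi> n x - v x\<bar> \<partial>lborel) + V * (1 / real (Suc n)))) \<longlonglongrightarrow> B * (0 + V * 0)"
    by (intro tendsto_intros \<phi>(2) lim_1_over_n[THEN LIMSEQ_Suc])
  then have "(\<lambda>n. B * ((\<integral>x. indicator (cball 0 R) x * \<bar>\<phi> n x - v x\<bar> \<partial>lborel) + V * (1 / real (Suc n)))) \<longlonglongrightarrow> 0" by simp
  then have "(\<lambda>n. (\<integral>x. w n x * q x \<partial>lborel) - (\<integral>x. \<bar>v x\<bar> * q x \<partial>lborel)) \<longlonglongrightarrow> 0"
    by (rule Lim_null_comparison[rotated]) (use bound in \<open>auto intro!: always_eventually\<close>)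
  then show ?thesis by (simp add: LIM_zero_iff)
qed

text \<open>The one-sided Euler--Lagrange inequality of an extremal. It is obtained from the approximations
  \<open>sqrt (\<phi>\<^sub>n\<^sup>2 + \<epsilon>\<^sup>2) - \<epsilon>\<close> of \<open>|v|\<close>, so that no weak gradient of \<open>|v|\<close> is needed.\<close>

lemma extremal_inequality:
  fixes v :: "real^4 \<Rightarrow> real"
  assumes v: "loc_int v" and v4: "integrable lborel (\<lambda>x. v x ^ 4)"
    and \<phi>: "\<And>n::nat. test_function (\<phi> n)" "AE x in lborel. (\<lambda>n. \<phi> n x) \<longlonglongrightarrow> v x"
      "\<And>R. (\<lambda>n. \<integral>x. indicator (cball 0 R) x * \<bar>\<phi> n x - v x\<bar> \<partial>lborel) \<longlonglongrightarrow> 0"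
      "\<And>n. energy (\<phi> n) \<le> E + 1 / real (Suc n)"
    and extr: "sobolev_const\<^sup>2 * (\<integral>x. v x ^ 4 \<partial>lborel) = E\<^sup>2"
    and \<psi>: "test_function \<psi>" "\<And>x. 0 \<le> \<psi> x"
  shows "sobolev_const\<^sup>2 * (\<integral>x. \<bar>v x\<bar> ^ 3 * \<psi> x \<partial>lborel) \<le> - E * (\<integral>x. \<bar>v x\<bar> * lap \<psi> x \<partial>lborel)"
proof -
  let ?K = sobolev_const
  have K: "?K > 0" by (rule sobolev_const_pos)
  have vm [measurable]: "v \<in> borel_measurable borel" using v by (simp add: loc_int_def)
  have [measurable]: "\<phi> n \<in> borel_measurable borel" for n using \<phi>(1) by (rule test_function_measurable)
  have \<psi>m [measurable]: "\<psi> \<in> borel_measurable borel" using \<psi>(1) by (rule test_function_measurable)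
  have \<psi>c: "C1c \<psi>" using \<psi>(1) by (rule test_function_C1c)
  define J where "J = (\<integral>x. \<bar>v x\<bar> * lap \<psi> x \<partial>lborel)"
  define T where "T = (\<integral>x. \<bar>v x\<bar> ^ 3 * \<psi> x \<partial>lborel)"
  define Q where "Q = (\<integral>x. v x ^ 4 \<partial>lborel)"
  define w where "w n x = sqrt ((\<phi> n x)\<^sup>2 + (1 / real (Suc n))\<^sup>2) - 1 / real (Suc n)" for n x
  have w: "C1c (w n)" "energy (w n) \<le> energy (\<phi> n)" "\<bar>w n x - \<bar>\<phi> n x\<bar>\<bar> \<le> 1 / real (Suc n)" for n x
    using C1c_sqrt[OF test_function_C1c[OF \<phi>(1)], of "1 / real (Suc n)" n] unfolding w_def by auto
  have wm [measurable]: "w n \<in> borel_measurable borel" for n using C1c_measurable(1)[OF w(1)] .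
  define J' where "J' n = (\<integral>x. w n x * lap \<psi> x \<partial>lborel)" for n
  have J': "J' \<longlonglongrightarrow> J"
  proof -
    obtain R where R: "\<And>x. R \<le> norm x \<Longrightarrow> lap \<psi> x = 0" using test_function_lap(2)[OF \<psi>(1)] by blast
    show ?thesis unfolding J'_def[abs_def] J_def
      by (rule abs_approx_limit[OF v test_function_lap(1)[OF \<psi>(1)] R test_function_C1c[OF \<phi>(1)] \<phi>(3) w(1,3)])
  qed
  obtain B0 where B0: "B0 > 0" "\<And>x. norm (\<psi> x) \<le> B0" and iT: "integrable lborel (\<lambda>x. \<bar>v x\<bar> ^ 3 * \<psi> x)"
  proof -
    obtain R where R: "\<And>x. R \<le> norm x \<Longrightarrow> \<psi> x = 0 \<and> grad \<psi> x = 0" using C1c_support[OF \<psi>c] by blast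
    obtain B0 where B0: "B0 > 0" "\<And>x. norm (\<psi> x) \<le> B0" using compact_support_bounded[OF C1c_continuous[OF \<psi>c]] R by blast
    have "integrable lborel (\<lambda>x. \<bar>v x\<bar> ^ 3 * \<psi> x)"
    proof (rule Bochner_Integration.integrable_bound)
      show "integrable lborel (\<lambda>x. \<psi> x + B0 * v x ^ 4)"
        using v4 C1c_integrable_power[OF \<psi>c, of 1] by simp
      show "AE x in lborel. norm (\<bar>v x\<bar> ^ 3 * \<psi> x) \<le> norm (\<psi> x + B0 * v x ^ 4)"
      proof (rule AE_I2)
        fix x
        \<comment> \<open>Where the modulus is at most 1 its cube is bounded by 1, elsewhere by the
          fourth power.\<close>
        have "\<bar>v x\<bar> ^ 3 * \<psi> x \<le> \<psi> x + B0 * v x ^ 4"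
        proof (cases "\<bar>v x\<bar> \<le> 1")
          case True
          then have "\<bar>v x\<bar> ^ 3 * \<psi> x \<le> 1 * \<psi> x" using \<psi>(2)[of x] by (intro mult_right_mono power_le_one) auto
          then show ?thesis using B0(1) by (simp add: add_increasing2)
        next
          case False
          have "\<bar>v x\<bar> ^ 3 \<le> \<bar>v x\<bar> ^ 4" using False by (intro power_increasing) auto
          then have "\<bar>v x\<bar> ^ 3 * \<psi> x \<le> \<bar>v x\<bar> ^ 4 * B0" using B0(2)[of x] \<psi>(2)[of x] by (intro mult_mono) auto
          then show ?thesis using \<psi>(2)[of x] by (simp add: mult.commute add_increasing)
        qed
        then show "norm (\<bar>v x\<bar> ^ 3 * \<psi> x) \<le> norm (\<psi> x + B0 * v x ^ 4)"
          using \<psi>(2)[of x] by (simp add: abs_mult)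
      qed
    qed simp
    then show thesis using that B0 by blast
  qed
  \<comment> \<open>The squared sharp inequality for \<open>w n x + t * \<psi> x\<close>, with Fatou
    on the left and convergence of the bounds on the right.\<close>
  have key: "?K\<^sup>2 * (Q + 4 * t * T) \<le> (E - 2 * t * J + t\<^sup>2 * energy \<psi>)\<^sup>2" if t: "t > 0" for t
  proof -
    define B where "B n = E + 1 / real (Suc n) - 2 * t * J' n + t\<^sup>2 * energy \<psi>" for n
    have Bl: "(\<lambda>n. (B n / ?K)\<^sup>2) \<longlonglongrightarrow> ((E + 0 - 2 * t * J + t\<^sup>2 * energy \<psi>) / ?K)\<^sup>2"
      unfolding B_def using K by (intro tendsto_intros J' lim_1_over_n[THEN LIMSEQ_Suc]) auto
    have "(\<integral>\<^sup>+x. ennreal ((\<bar>v x\<bar> + t * \<psi> x) ^ 4) \<partial>lborel) \<le> ennreal (((E + 0 - 2 * t * J + t\<^sup>2 * energy \<psi>) / ?K)\<^sup>2)"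
    proof (rule nn_integral_Fatou_le[OF _ _ _ Bl])
      show "(\<lambda>x. (w n x + t * \<psi> x) ^ 4) \<in> borel_measurable lborel" for n by simp
      show "AE x in lborel. (\<lambda>n. (w n x + t * \<psi> x) ^ 4) \<longlonglongrightarrow> (\<bar>v x\<bar> + t * \<psi> x) ^ 4"
        using \<phi>(2)
      proof eventually_elim
        fix x assume "(\<lambda>n. \<phi> n x) \<longlonglongrightarrow> v x"
        then have "(\<lambda>n. w n x) \<longlonglongrightarrow> sqrt ((v x)\<^sup>2 + 0\<^sup>2) - 0"
          unfolding w_def by (intro tendsto_intros lim_1_over_n[THEN LIMSEQ_Suc])
        then have "(\<lambda>n. w n x) \<longlonglongrightarrow> \<bar>v x\<bar>" by simp
        then show "(\<lambda>n. (w n x + t * \<psi> x) ^ 4) \<longlonglongrightarrow> (\<bar>v x\<bar> + t * \<psi> x) ^ 4" by (intro tendsto_intros)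
      qed
      fix n
      have c: "C1c (\<lambda>x. w n x + t * \<psi> x)" using C1c_add(1)[OF w(1) C1c_cmult(1)[OF \<psi>c]] .
      have "energy (\<lambda>x. w n x + t * \<psi> x) \<le> B n"
        unfolding energy_add[OF w(1) \<psi>(1)] B_def J'_def using w(2)[of n] \<phi>(4)[of n] by simp
      then have "(energy (\<lambda>x. w n x + t * \<psi> x))\<^sup>2 \<le> (B n)\<^sup>2" by (intro power_mono energy_nonneg)
      then have "?K\<^sup>2 * quart (\<lambda>x. w n x + t * \<psi> x) \<le> (B n)\<^sup>2" using Sobolev_sharp_C1c[OF c] by simp
      then have "quart (\<lambda>x. w n x + t * \<psi> x) \<le> (B n / ?K)\<^sup>2"
        using K by (simp add: power_divide le_divide_eq mult.commute)
      moreover have "(\<integral>\<^sup>+x. ennreal ((w n x + t * \<psi> x) ^ 4) \<partial>lborel) = ennreal (quart (\<lambda>x. w n x + t * \<psi> x))"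
        unfolding quart_def using C1c_integrable_power[OF c, of 4] by (intro nn_integral_eq_integral) auto
      ultimately show "(\<integral>\<^sup>+x. ennreal ((w n x + t * \<psi> x) ^ 4) \<partial>lborel) \<le> ennreal ((B n / ?K)\<^sup>2)" by (simp add: ennreal_leI)
    qed
    moreover have "ennreal (Q + 4 * t * T) \<le> (\<integral>\<^sup>+x. ennreal ((\<bar>v x\<bar> + t * \<psi> x) ^ 4) \<partial>lborel)"
    proof -
      have "ennreal (Q + 4 * t * T) = ennreal (\<integral>x. v x ^ 4 + 4 * t * (\<bar>v x\<bar> ^ 3 * \<psi> x) \<partial>lborel)"
        using v4 iT by (simp add: Q_def T_def)
      also have "\<dots> = (\<integral>\<^sup>+x. ennreal (v x ^ 4 + 4 * t * (\<bar>v x\<bar> ^ 3 * \<psi> x)) \<partial>lborel)"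
        using v4 iT t \<psi>(2) by (intro nn_integral_eq_integral[symmetric]) auto
      also have "\<dots> \<le> (\<integral>\<^sup>+x. ennreal ((\<bar>v x\<bar> + t * \<psi> x) ^ 4) \<partial>lborel)"
      proof (intro nn_integral_mono ennreal_leI)
        fix x
        \<comment> \<open>As the modulus of \<open>v\<close> and \<psi> are nonnegative, the
          binomial terms of higher order in \<open>t\<close> may be dropped.\<close>
        have "(\<bar>v x\<bar> + t * \<psi> x) ^ 4 = \<bar>v x\<bar> ^ 4 + 4 * t * (\<bar>v x\<bar> ^ 3 * \<psi> x) + (t * \<psi> x)\<^sup>2 * (6 * \<bar>v x\<bar>\<^sup>2 + 4 * \<bar>v x\<bar> * (t * \<psi> x) + (t * \<psi> x)\<^sup>2)"
          by (simp add: power4_eq_xxxx power3_eq_cube power2_eq_square algebra_simps)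
        moreover have "0 \<le> (t * \<psi> x)\<^sup>2 * (6 * \<bar>v x\<bar>\<^sup>2 + 4 * \<bar>v x\<bar> * (t * \<psi> x) + (t * \<psi> x)\<^sup>2)"
          using t \<psi>(2)[of x] by (intro mult_nonneg_nonneg add_nonneg_nonneg) auto
        ultimately show "v x ^ 4 + 4 * t * (\<bar>v x\<bar> ^ 3 * \<psi> x) \<le> (\<bar>v x\<bar> + t * \<psi> x) ^ 4" by simp
      qed
      finally show ?thesis .
    qed
    ultimately have "ennreal (Q + 4 * t * T) \<le> ennreal (((E + 0 - 2 * t * J + t\<^sup>2 * energy \<psi>) / ?K)\<^sup>2)" by (rule order_trans[rotated])
    then have "Q + 4 * t * T \<le> ((E - 2 * t * J + t\<^sup>2 * energy \<psi>) / ?K)\<^sup>2" by (subst (asm) ennreal_le_iff) auto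
    then show ?thesis using K by (simp add: power_divide le_divide_eq mult.commute)
  qed
  \<comment> \<open>By \<open>extr\<close> the terms of order 0 in \<open>t\<close> cancel; after
    division by \<open>t\<close> the limit at 0 leaves the first variation.\<close>
  have "4 * ?K\<^sup>2 * T + 4 * E * J \<le> t * (2 * E * energy \<psi> + (t * energy \<psi> - 2 * J)\<^sup>2)" if t: "t > 0" for t
  proof -
    have "t * (4 * ?K\<^sup>2 * T + 4 * E * J) \<le> t * (t * (2 * E * energy \<psi> + (t * energy \<psi> - 2 * J)\<^sup>2))"
      using key[OF t] extr[folded Q_def] by (simp add: power2_eq_square algebra_simps)
    then show ?thesis using t by simp
  qed
  moreover have "((\<lambda>t. t * (2 * E * energy \<psi> + (t * energy \<psi> - 2 * J)\<^sup>2)) \<longlongrightarrow> 0 * (2 * E * energy \<psi> + (0 * energy \<psi> - 2 * J)\<^sup>2)) (at_right 0)"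
    by (intro tendsto_intros)
  ultimately have "4 * ?K\<^sup>2 * T + 4 * E * J \<le> 0 * (2 * E * energy \<psi> + (0 * energy \<psi> - 2 * J)\<^sup>2)"
    by (intro tendsto_lowerbound) (auto intro!: eventually_at_rightI[of 0 1])
  then show ?thesis by (simp add: T_def J_def)
qed

section \<open>Absence of extremals in L^2\<close>

lemma lap_scale:
  fixes \<chi>' :: "'a::euclidean_space \<Rightarrow> real"
  assumes "test_function \<chi>'" "s \<noteq> 0"
  shows "lap (\<lambda>x. \<chi>' (s *\<^sub>R x)) x = s\<^sup>2 * lap \<chi>' (s *\<^sub>R x)"
proof -
  have p: "partial_deriv e (\<lambda>x. f (s *\<^sub>R x)) = (\<lambda>x. s * partial_deriv e f (s *\<^sub>R x))" if f: "test_function f" and e: "e \<in> Basis" for f :: "'a \<Rightarrow> real" and e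
  proof
    fix x
    have "f differentiable at (0 + s *\<^sub>R x)" using test_function_C_k[OF f] by (rule C_k_Suc_differentiable)
    from partial_deriv_eq[OF has_derivative_affine[OF this], of e]
    show "partial_deriv e (\<lambda>x. f (s *\<^sub>R x)) x = s * partial_deriv e f (s *\<^sub>R x)" using e by (simp add: inner_grad)
  qed
  have m: "partial_deriv e (\<lambda>x. c * f x) = (\<lambda>x. c * partial_deriv e f x)" if f: "test_function f" and e: "e \<in> Basis" for f :: "'a \<Rightarrow> real" and e c
  proof
    fix x show "partial_deriv e (\<lambda>x. c * f x) x = c * partial_deriv e f x"
      using partial_deriv_eq[OF has_derivative_mult_right[OF C1c_has_derivative[OF test_function_C1c[OF f]]], of e c x] e
      by (simp add: inner_grad)
  qed
  have "partial_deriv e (partial_deriv e (\<lambda>x. \<chi>' (s *\<^sub>R x))) x = s\<^sup>2 * partial_deriv e (partial_deriv e \<chi>') (s *\<^sub>R x)" if e: "e \<in> Basis" for e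
  proof -
    have t: "test_function (partial_deriv e \<chi>')" "test_function (\<lambda>x. partial_deriv e \<chi>' (s *\<^sub>R x))"
      using test_function_partial_deriv[OF assms(1) e] test_function_affine[of "partial_deriv e \<chi>'" s 0] assms(2) by auto
    show ?thesis unfolding p[OF assms(1) e] m[OF t(2) e] p[OF t(1) e] by (simp add: power2_eq_square)
  qed
  then show ?thesis by (simp add: lap_def sum_distrib_left)
qed

lemma bump_lower_bound:
  fixes x :: "'a::euclidean_space"
  assumes "norm x \<le> 1 / 2"
  shows "cutexp 0 (3 / 4) \<le> bump 1 x"
proof -
  have "(norm x)\<^sup>2 \<le> (1 / 2)\<^sup>2" using assms by (intro power_mono) auto
  then have 1: "3 / 4 \<le> 1 - x \<bullet> x" by (simp add: dot_square_norm power_divide)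
  then have "1 / (1 - x \<bullet> x) \<le> 1 / (3 / 4)" by (intro divide_left_mono) auto
  then have "- (1 / (3 / 4)) \<le> - (1 / (1 - x \<bullet> x))" by simp
  then show ?thesis using 1 by (simp add: bump_def cutexp_def)
qed

text \<open>Inside the ball of radius \<open>M\<close> the integrand is kept; outside, AM-GM gives
  |v| \<le> \<mu>/2 + v^2/(2 \<mu>). The free weight \<mu> balances the volume of the large ball
  against the small tail.\<close>

lemma L1_ball_bound:
  fixes v :: "'a::euclidean_space \<Rightarrow> real"
  assumes v: "loc_int v" and v2: "integrable lborel (\<lambda>x. (v x)\<^sup>2)" and \<mu>: "\<mu> > 0"
  shows "(\<integral>x. indicator (cball 0 \<rho>) x * \<bar>v x\<bar> \<partial>lborel) \<le> (\<integral>x. indicator (cball 0 M) x * \<bar>v x\<bar> \<partial>lborel)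
    + (\<mu> * measure lborel (cball (0::'a) \<rho>) + (\<integral>x. indicator (- cball 0 M) x * (v x)\<^sup>2 \<partial>lborel) / \<mu>) / 2"
proof -
  have i: "integrable lborel (\<lambda>x. indicator (cball 0 r) x * \<bar>v x\<bar>)" for r
  proof -
    have "integrable lborel (\<lambda>x. norm (indicator (cball 0 r) x *\<^sub>R v x))"
      using v unfolding loc_int_def by (intro integrable_norm) blast
    then show ?thesis by (simp add: abs_mult)
  qed
  have c: "integrable lborel (\<lambda>x::'a. indicator (cball 0 \<rho>) x * (\<mu> / 2))" by (rule cball_integrable_const)
  have "integrable lborel (\<lambda>x. indicator (- cball 0 M) x *\<^sub>R (v x)\<^sup>2)"
    using v2 by (intro integrable_mult_indicator) auto
  then have t: "integrable lborel (\<lambda>x. indicator (- cball 0 M) x * (v x)\<^sup>2 * (1 / (2 * \<mu>)))" by simp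
  have "(\<integral>x. indicator (cball 0 \<rho>) x * \<bar>v x\<bar> \<partial>lborel) \<le> (\<integral>x. indicator (cball 0 M) x * \<bar>v x\<bar>
     + indicator (cball 0 \<rho>) x * (\<mu> / 2) + indicator (- cball 0 M) x * (v x)\<^sup>2 * (1 / (2 * \<mu>)) \<partial>lborel)"
  proof (rule integral_mono[OF i])
    show "integrable lborel (\<lambda>x. indicator (cball 0 M) x * \<bar>v x\<bar> + indicator (cball 0 \<rho>) x * (\<mu> / 2) + indicator (- cball 0 M) x * (v x)\<^sup>2 * (1 / (2 * \<mu>)))"
      using i c t by (intro Bochner_Integration.integrable_add)
    fix x
    have "0 \<le> (\<mu> - \<bar>v x\<bar>)\<^sup>2" by simp
    then have "2 * \<mu> * \<bar>v x\<bar> \<le> \<mu>\<^sup>2 + (v x)\<^sup>2" by (simp add: power2_diff)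
    then have am: "\<bar>v x\<bar> \<le> \<mu> / 2 + (v x)\<^sup>2 * (1 / (2 * \<mu>))" using \<mu> by (simp add: field_simps power2_eq_square)
    have "0 \<le> (v x)\<^sup>2 * (1 / (2 * \<mu>))" using \<mu> by simp
    then show "indicator (cball 0 \<rho>) x * \<bar>v x\<bar> \<le> indicator (cball 0 M) x * \<bar>v x\<bar> + indicator (cball 0 \<rho>) x * (\<mu> / 2) + indicator (- cball 0 M) x * (v x)\<^sup>2 * (1 / (2 * \<mu>))"
      using am \<mu> by (auto simp: indicator_def)
  qed
  also have "\<dots> = (\<integral>x. indicator (cball 0 M) x * \<bar>v x\<bar> \<partial>lborel) + measure lborel (cball (0::'a) \<rho>) * (\<mu> / 2)
      + (\<integral>x. indicator (- cball 0 M) x * (v x)\<^sup>2 \<partial>lborel) * (1 / (2 * \<mu>))"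
  proof -
    have "(\<integral>x. indicator (- cball 0 M) x * (v x)\<^sup>2 * (1 / (2 * \<mu>)) \<partial>lborel) = (\<integral>x. indicator (- cball 0 M) x * (v x)\<^sup>2 \<partial>lborel) * (1 / (2 * \<mu>))"
      by (rule integral_mult_left_zero)
    then show ?thesis using i c t by simp
  qed
  finally show ?thesis by (simp add: add_divide_distrib mult.commute)
qed

lemma L2_tail:
  fixes v :: "'a::euclidean_space \<Rightarrow> real"
  assumes v2: "integrable lborel (\<lambda>x. (v x)\<^sup>2)" and m: "v \<in> borel_measurable borel" and "\<eta> > 0"
  shows "\<exists>M. (\<integral>x. indicator (- cball 0 M) x * (v x)\<^sup>2 \<partial>lborel) \<le> \<eta>"
proof -
  note [measurable] = m
  have "(\<lambda>n. \<integral>x. indicator (- cball 0 (real n)) x * (v x)\<^sup>2 \<partial>lborel) \<longlonglongrightarrow> (\<integral>x. 0 \<partial>(lborel :: 'a measure))"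
  proof (rule integral_dominated_convergence[where w = "\<lambda>x. (v x)\<^sup>2"])
    show "AE x in lborel. (\<lambda>n. indicator (- cball 0 (real n)) x * (v x)\<^sup>2) \<longlonglongrightarrow> 0"
    proof (rule AE_I2)
      fix x :: 'a
      obtain N :: nat where N: "norm x \<le> real N" using real_arch_simple by blast
      have "\<forall>\<^sub>F n in sequentially. indicator (- cball 0 (real n)) x * (v x)\<^sup>2 = 0"
        using N by (intro eventually_sequentiallyI[of N]) (auto simp: indicator_def intro: order_trans)
      then show "(\<lambda>n. indicator (- cball 0 (real n)) x * (v x)\<^sup>2) \<longlonglongrightarrow> 0" by (rule tendsto_eventually)
    qed
  qed (use v2 in \<open>auto simp: indicator_def\<close>)
  then have "\<forall>\<^sub>F n in sequentially. (\<integral>x. indicator (- cball 0 (real n)) x * (v x)\<^sup>2 \<partial>lborel) < \<eta>"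
    using \<open>\<eta> > 0\<close> by (intro order_tendstoD) auto
  then show ?thesis by (auto simp: eventually_sequentially intro: less_imp_le)
qed

text \<open>Testing the extremal inequality with the rescaled bumps \<open>\<psi>(s x)\<close>: in dimension 4 the function
  \<open>s\<^sup>2 (\<Delta>\<psi>)(s x)\<close> is bounded in \<open>L\<^sup>2\<close> and escapes to infinity as \<open>s \<rightarrow> 0\<close>, so the right-hand side vanishes
  in the limit for an extremal in \<open>L\<^sup>2\<close>.\<close>

lemma no_L2_extremal:
  fixes v :: "real^4 \<Rightarrow> real"
  assumes v: "loc_int v" and v2: "integrable lborel (\<lambda>x. (v x)\<^sup>2)" and E: "0 \<le> E"
    and i3: "\<And>N. integrable lborel (\<lambda>x. indicator (cball 0 N) x * \<bar>v x\<bar> ^ 3)"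
    and i3': "\<And>\<psi>. test_function \<psi> \<Longrightarrow> integrable lborel (\<lambda>x. \<bar>v x\<bar> ^ 3 * \<psi> x)"
    and EL: "\<And>\<psi>. test_function \<psi> \<Longrightarrow> (\<And>x. 0 \<le> \<psi> x) \<Longrightarrow>
      sobolev_const\<^sup>2 * (\<integral>x. \<bar>v x\<bar> ^ 3 * \<psi> x \<partial>lborel) \<le> - E * (\<integral>x. \<bar>v x\<bar> * lap \<psi> x \<partial>lborel)"
  shows "AE x in lborel. v x = 0"
proof -
  have vm [measurable]: "v \<in> borel_measurable borel" using v by (simp add: loc_int_def)
  let ?b = "bump 1 :: real^4 \<Rightarrow> real"
  have b: "test_function ?b" by (rule test_function_bump) simp
  obtain R0 where R0: "\<And>x. R0 \<le> norm x \<Longrightarrow> lap ?b x = 0" using test_function_lap(2)[OF b] by blast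
  define R where "R = max R0 1"
  have R: "R > 0" "\<And>x. R \<le> norm x \<Longrightarrow> lap ?b x = 0" using R0 by (auto simp: R_def)
  obtain C where C: "C > 0" "\<And>x. norm (lap ?b x) \<le> C" using compact_support_bounded[OF test_function_lap(1)[OF b] R(2)] by blast
  define c0 where "c0 = cutexp 0 (3 / 4)"
  have c0: "c0 > 0" by (simp add: c0_def cutexp_def)
  define I where "I r = (\<integral>x. indicator (cball 0 r) x * \<bar>v x\<bar> \<partial>lborel)" for r
  define I3 where "I3 N = (\<integral>x. indicator (cball 0 N) x * \<bar>v x\<bar> ^ 3 \<partial>lborel)" for N
  have iI: "integrable lborel (\<lambda>x. indicator (cball 0 r) x * \<bar>v x\<bar>)" for r
  proof -
    have "integrable lborel (\<lambda>x. norm (indicator (cball 0 r) x *\<^sub>R v x))"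
      using v unfolding loc_int_def by (intro integrable_norm) blast
    then show ?thesis by (simp add: abs_mult)
  qed
  have vol: "measure lborel (cball (0::real^4) r) = r ^ 4 * omega4" if "r \<ge> 0" for r
  proof -
    have "measure lborel (cball (0::real^4) r) = measure lborel (ball (0::real^4) r)"
      using that by (simp add: content_cball content_ball)
    then show ?thesis using content_ball_conv_unit_ball[OF that, of "0::real^4"] by (simp add: omega4_def)
  qed
  \<comment> \<open>\<open>N\<close> is the radius of the ball on which \<open>v\<close> is to be
    shown to vanish, \<open>s\<close> the dilation parameter and \<open>M\<close> a radius beyond
    which the integral of v^2 is at most \<eta>^2. The bound \<open>s * N \<le> 1 / 2\<close> puts
    the ball of radius \<open>N\<close> where the dilated bump is at least
    \<open>c0\<close>.\<close>
  have main: "sobolev_const\<^sup>2 * (c0 * I3 N) \<le> E * C * (s\<^sup>2 * I M + (\<eta> * (R ^ 4 * omega4) + 1 * \<eta>) / 2)"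
    if N: "N > 0" and s: "s > 0" "s * N \<le> 1 / 2" and \<eta>: "\<eta> > 0" and M: "(\<integral>x. indicator (- cball 0 M) x * (v x)\<^sup>2 \<partial>lborel) \<le> \<eta>\<^sup>2"
    for N s \<eta> M
  proof -
    define \<psi> where "\<psi> x = ?b (s *\<^sub>R x)" for x
    have \<psi>: "test_function \<psi>" using test_function_affine[OF b, of s 0] s by (simp add: \<psi>_def[abs_def])
    have \<psi>0: "0 \<le> \<psi> x" for x by (simp add: \<psi>_def bump_nonneg)
    have "c0 * I3 N = (\<integral>x. c0 * (indicator (cball 0 N) x * \<bar>v x\<bar> ^ 3) \<partial>lborel)" by (simp add: I3_def)
    also have "\<dots> \<le> (\<integral>x. \<bar>v x\<bar> ^ 3 * \<psi> x \<partial>lborel)"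
    proof (rule integral_mono[OF _ i3'[OF \<psi>]])
      show "integrable lborel (\<lambda>x. c0 * (indicator (cball 0 N) x * \<bar>v x\<bar> ^ 3))" by (rule integrable_mult_right[OF i3])
      fix x :: "real^4"
      show "c0 * (indicator (cball 0 N) x * \<bar>v x\<bar> ^ 3) \<le> \<bar>v x\<bar> ^ 3 * \<psi> x"
      proof (cases "norm x \<le> N")
        case True
        then have "s * norm x \<le> s * N" using s by simp
        then have "norm (s *\<^sub>R x) \<le> 1 / 2" using s by (simp only: norm_scaleR abs_of_pos)
        then have "c0 \<le> \<psi> x" unfolding c0_def \<psi>_def by (rule bump_lower_bound)
        then have "c0 * \<bar>v x\<bar> ^ 3 \<le> \<psi> x * \<bar>v x\<bar> ^ 3" by (intro mult_right_mono) auto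
        then show ?thesis using True by (simp add: mult.commute)
      next
        case False
        then show ?thesis using \<psi>0[of x] by simp
      qed
    qed
    finally have "sobolev_const\<^sup>2 * (c0 * I3 N) \<le> sobolev_const\<^sup>2 * (\<integral>x. \<bar>v x\<bar> ^ 3 * \<psi> x \<partial>lborel)"
      by (intro mult_left_mono) auto
    also have "\<dots> \<le> - E * (\<integral>x. \<bar>v x\<bar> * lap \<psi> x \<partial>lborel)" by (rule EL[OF \<psi> \<psi>0])
    also have "\<dots> \<le> E * (s\<^sup>2 * C * I (R / s))"
    proof -
      have "norm (\<integral>x. \<bar>v x\<bar> * lap \<psi> x \<partial>lborel) \<le> (\<integral>x. s\<^sup>2 * C * (indicator (cball 0 (R / s)) x * \<bar>v x\<bar>) \<partial>lborel)"
      proof (rule order_trans[OF integral_norm_bound], rule integral_mono)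
        obtain R1 where "\<And>x. R1 \<le> norm x \<Longrightarrow> lap \<psi> x = 0" using test_function_lap(2)[OF \<psi>] by blast
        from loc_int_bounded_mult[OF v test_function_lap(1)[OF \<psi>] this]
        show "integrable lborel (\<lambda>x. norm (\<bar>v x\<bar> * lap \<psi> x))" by (rule integrable_norm)
        show "integrable lborel (\<lambda>x. s\<^sup>2 * C * (indicator (cball 0 (R / s)) x * \<bar>v x\<bar>))" by (rule integrable_mult_right[OF iI])
        fix x :: "real^4"
        have l: "lap \<psi> x = s\<^sup>2 * lap ?b (s *\<^sub>R x)" unfolding \<psi>_def using s by (intro lap_scale b) simp
        show "norm (\<bar>v x\<bar> * lap \<psi> x) \<le> s\<^sup>2 * C * (indicator (cball 0 (R / s)) x * \<bar>v x\<bar>)"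
        proof (cases "norm x \<le> R / s")
          case True
          have "\<bar>lap \<psi> x\<bar> \<le> s\<^sup>2 * C" unfolding l abs_mult using C(2)[of "s *\<^sub>R x"] by (simp add: mult_left_mono)
          then have "\<bar>v x\<bar> * \<bar>lap \<psi> x\<bar> \<le> \<bar>v x\<bar> * (s\<^sup>2 * C)" by (intro mult_left_mono) auto
          then show ?thesis using True by (simp add: abs_mult mult.commute)
        next
          case False
          then have "R \<le> norm (s *\<^sub>R x)" using s by (simp add: divide_less_eq mult.commute not_le)
          then show ?thesis using R(2) l False by simp
        qed
      qed
      also have "\<dots> = s\<^sup>2 * C * I (R / s)" unfolding I_def by (rule integral_mult_right_zero)
      finally have "- (\<integral>x. \<bar>v x\<bar> * lap \<psi> x \<partial>lborel) \<le> s\<^sup>2 * C * I (R / s)" by simp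
      from mult_left_mono[OF this E] show ?thesis by simp
    qed
    \<comment> \<open>The weight is \<mu> = \<eta> s^2. The ball of radius R/s has a volume
      proportional to s^-4, so after multiplication by s^2 both error terms are of order \<eta>,
      independently of s.\<close>
    also have "\<dots> \<le> E * (s\<^sup>2 * C * (I M + ((\<eta> * s\<^sup>2) * (R ^ 4 / s ^ 4 * omega4) + \<eta>\<^sup>2 / (\<eta> * s\<^sup>2)) / 2))"
    proof -
      have "I (R / s) \<le> I M + ((\<eta> * s\<^sup>2) * measure lborel (cball (0::real^4) (R / s)) + (\<integral>x. indicator (- cball 0 M) x * (v x)\<^sup>2 \<partial>lborel) / (\<eta> * s\<^sup>2)) / 2"
        unfolding I_def using s \<eta> by (intro L1_ball_bound v v2) simp
      also have "\<dots> \<le> I M + ((\<eta> * s\<^sup>2) * (R ^ 4 / s ^ 4 * omega4) + \<eta>\<^sup>2 / (\<eta> * s\<^sup>2)) / 2"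
        using M s \<eta> R(1) by (simp add: vol power_divide divide_right_mono)
      finally show ?thesis using E C(1) by (intro mult_left_mono) auto
    qed
    also have "\<dots> = E * C * (s\<^sup>2 * I M + (\<eta> * (R ^ 4 * omega4) + 1 * \<eta>) / 2)"
    proof -
      have "s\<^sup>2 * ((\<eta> * s\<^sup>2) * (R ^ 4 / s ^ 4 * omega4)) = \<eta> * (R ^ 4 * omega4)"
        using s by (simp add: power2_eq_square power4_eq_xxxx)
      moreover have "s\<^sup>2 * (\<eta>\<^sup>2 / (\<eta> * s\<^sup>2)) = \<eta>" using s \<eta> by (simp add: power2_eq_square)
      moreover have "z * (i + (x + y) / 2) = z * i + (z * x + 1 * (z * y)) / 2" for z i x y :: real
        by (simp add: distrib_left)
      ultimately have "s\<^sup>2 * (I M + ((\<eta> * s\<^sup>2) * (R ^ 4 / s ^ 4 * omega4) + \<eta>\<^sup>2 / (\<eta> * s\<^sup>2)) / 2) = s\<^sup>2 * I M + (\<eta> * (R ^ 4 * omega4) + 1 * \<eta>) / 2"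
        by (simp only:)
      then show ?thesis by (simp add: mult.assoc mult.left_commute)
    qed
    finally show ?thesis .
  qed
  \<comment> \<open>Order of the choices: \<eta> determines \<open>M\<close>, then \<open>s\<close>
    tends to 0, which removes \<open>I M\<close>, and finally \<eta> tends to 0.\<close>
  have I3_0: "I3 N = 0" if N: "N > 0" for N
  proof -
    have "sobolev_const\<^sup>2 * (c0 * I3 N) \<le> 0 + \<eta> * (E * C * (R ^ 4 * omega4 + 1) / 2)" if \<eta>: "\<eta> > 0" for \<eta>
    proof -
      obtain M where M: "(\<integral>x. indicator (- cball 0 M) x * (v x)\<^sup>2 \<partial>lborel) \<le> \<eta>\<^sup>2" using L2_tail[OF v2 vm, of "\<eta>\<^sup>2"] \<eta> by auto
      have "((\<lambda>s. E * C * (s\<^sup>2 * I M + (\<eta> * (R ^ 4 * omega4) + 1 * \<eta>) / 2)) \<longlongrightarrow> E * C * (0\<^sup>2 * I M + (\<eta> * (R ^ 4 * omega4) + 1 * \<eta>) / 2)) (at_right 0)"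
        by (intro tendsto_intros)
      moreover have "\<forall>\<^sub>F s in at_right 0. sobolev_const\<^sup>2 * (c0 * I3 N) \<le> E * C * (s\<^sup>2 * I M + (\<eta> * (R ^ 4 * omega4) + 1 * \<eta>) / 2)"
      proof (rule eventually_at_rightI[of 0 "1 / (2 * N)"])
        fix s assume "s \<in> {0<..<1 / (2 * N)}"
        then show "sobolev_const\<^sup>2 * (c0 * I3 N) \<le> E * C * (s\<^sup>2 * I M + (\<eta> * (R ^ 4 * omega4) + 1 * \<eta>) / 2)"
          using N by (intro main[OF N _ _ \<eta> M]) (auto simp: less_divide_eq)
      qed (use N in simp)
      ultimately have "sobolev_const\<^sup>2 * (c0 * I3 N) \<le> E * C * (0\<^sup>2 * I M + (\<eta> * (R ^ 4 * omega4) + 1 * \<eta>) / 2)"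
        by (intro tendsto_lowerbound) auto
      then show ?thesis by (simp add: algebra_simps)
    qed
    then have "sobolev_const\<^sup>2 * (c0 * I3 N) \<le> 0" by (rule le_if_le_add_mult)
    then have "I3 N \<le> 0" using c0 sobolev_const_pos by (simp add: mult_le_0_iff)
    moreover have "0 \<le> I3 N" unfolding I3_def by (intro Bochner_Integration.integral_nonneg) simp
    ultimately show ?thesis by simp
  qed
  have "AE x in lborel. indicator (cball 0 (real (Suc n))) x * \<bar>v x\<bar> ^ 3 = 0" for n
    using I3_0[of "real (Suc n)"] integral_nonneg_eq_0_iff_AE[OF i3[of "real (Suc n)"]] by (simp add: I3_def)
  then have "AE x in lborel. \<forall>n. indicator (cball 0 (real (Suc n))) x * \<bar>v x\<bar> ^ 3 = 0" by (subst AE_all_countable) blast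
  then show ?thesis
  proof eventually_elim
    fix x assume x: "\<forall>n. indicator (cball 0 (real (Suc n))) x * \<bar>v x\<bar> ^ 3 = 0"
    obtain N :: nat where "norm x \<le> real N" using real_arch_simple by blast
    then have "x \<in> cball 0 (real (Suc N))" by simp
    then show "v x = 0" using x[rule_format, of N] by simp
  qed
qed

text \<open>Equality would make the Borel representative \<open>v\<close> an extremal that lies in
  L^2, so \<open>extremal_inequality\<close> and \<open>no_L2_extremal\<close> together force it to
  vanish.\<close>

lemma Sobolev_H1_strict:
  fixes u :: "real^4 \<Rightarrow> real"
  assumes u: "u \<in> H1" and nz: "\<not> (AE x in lebesgue. u x = 0)"
  shows "sobolev_const * (Lp_norm 4 u)\<^sup>2 < (Lp_norm 2 (weak_grad u))\<^sup>2"
proof (rule ccontr)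
  assume "\<not> ?thesis"
  then have eq: "sobolev_const * (Lp_norm 4 u)\<^sup>2 = (Lp_norm 2 (weak_grad u))\<^sup>2" using Sobolev_H1(2)[OF u] by simp
  define E where "E = (Lp_norm 2 (weak_grad u))\<^sup>2"
  obtain v \<phi> where v: "v \<in> borel_measurable borel" "AE x in lebesgue. u x = v x" "loc_int v" "integrable lborel (\<lambda>x. (v x)\<^sup>2)"
    and \<phi>: "\<And>n::nat. test_function (\<phi> n)" "AE x in lborel. (\<lambda>n. \<phi> n x) \<longlonglongrightarrow> v x"
      "\<And>R. (\<lambda>n. \<integral>x. indicator (cball 0 R) x * \<bar>\<phi> n x - v x\<bar> \<partial>lborel) \<longlonglongrightarrow> 0"
      "\<And>n. energy (\<phi> n) \<le> E + 1 / real (Suc n)"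
    using H1_approximation[OF u] unfolding E_def by blast
  have um [measurable]: "u \<in> borel_measurable lebesgue" using u by (simp add: H1_def Lp_space_2_iff)
  note [measurable] = v(1)
  have vL [measurable]: "v \<in> borel_measurable lebesgue" using v(1) by (intro measurable_completion) simp
  have ae: "AE x in lebesgue. u x ^ 4 = v x ^ 4" using v(2) by eventually_elim simp
  have "integrable lebesgue (\<lambda>x. v x ^ 4)"
    using Sobolev_H1(1)[OF u] ae by (intro integrable_cong_AE_imp[of lebesgue "\<lambda>x. u x ^ 4" "\<lambda>x. v x ^ 4"]) auto
  then have v4: "integrable lborel (\<lambda>x. v x ^ 4)" by (simp add: integrable_completion)
  have "(\<integral>x. u x ^ 4 \<partial>lebesgue) = (\<integral>x. v x ^ 4 \<partial>lborel)" using ae by (intro integral_lebesgue_cong_AE) auto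
  then have Q: "(Lp_norm 4 u) ^ 4 = (\<integral>x. v x ^ 4 \<partial>lborel)" by (simp add: Lp_norm_4_pow)
  have "E\<^sup>2 = sobolev_const\<^sup>2 * ((Lp_norm 4 u)\<^sup>2)\<^sup>2" unfolding E_def eq[symmetric] by (rule power_mult_distrib)
  then have extr: "sobolev_const\<^sup>2 * (\<integral>x. v x ^ 4 \<partial>lborel) = E\<^sup>2" using Q by simp
  \<comment> \<open>The cube of the modulus lies below v^2 + v^4, and \<open>v\<close> belongs to
    L^2 and to L^4.\<close>
  have i3: "integrable lborel (\<lambda>x. \<bar>v x\<bar> ^ 3)"
  proof (rule Bochner_Integration.integrable_bound)
    show "integrable lborel (\<lambda>x. (v x)\<^sup>2 + v x ^ 4)" using v(4) v4 by simp
    show "AE x in lborel. norm (\<bar>v x\<bar> ^ 3) \<le> norm ((v x)\<^sup>2 + v x ^ 4)"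
    proof (rule AE_I2)
      fix x
      have "\<bar>v x\<bar> ^ 3 \<le> \<bar>v x\<bar> ^ 2 + \<bar>v x\<bar> ^ 4"
      proof (cases "\<bar>v x\<bar> \<le> 1")
        case True
        then have "\<bar>v x\<bar> ^ 3 \<le> \<bar>v x\<bar> ^ 2" by (intro power_decreasing) auto
        then show ?thesis by (simp add: add_increasing2)
      next
        case False
        then have "\<bar>v x\<bar> ^ 3 \<le> \<bar>v x\<bar> ^ 4" by (intro power_increasing) auto
        then show ?thesis by (simp add: add_increasing)
      qed
      then show "norm (\<bar>v x\<bar> ^ 3) \<le> norm ((v x)\<^sup>2 + v x ^ 4)" by (simp add: power_abs)
    qed
  qed simp
  have "AE x in lborel. v x = 0"
  proof (rule no_L2_extremal[OF v(3,4)])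
    show "0 \<le> E" by (simp add: E_def)
    show "integrable lborel (\<lambda>x. indicator (cball 0 N) x * \<bar>v x\<bar> ^ 3)" for N
      using integrable_mult_indicator[of "cball 0 N" lborel "\<lambda>x. \<bar>v x\<bar> ^ 3"] i3 by simp
    fix \<psi> :: "real^4 \<Rightarrow> real" assume \<psi>: "test_function \<psi>"
    show "integrable lborel (\<lambda>x. \<bar>v x\<bar> ^ 3 * \<psi> x)"
      using loc_int_test[OF integrable_loc_int[OF i3] \<psi>] by (simp add: mult.commute)
    assume "\<And>x. 0 \<le> \<psi> x"
    with \<psi> show "sobolev_const\<^sup>2 * (\<integral>x. \<bar>v x\<bar> ^ 3 * \<psi> x \<partial>lborel) \<le> - E * (\<integral>x. \<bar>v x\<bar> * lap \<psi> x \<partial>lborel)"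
      by (rule extremal_inequality[OF v(3) v4 \<phi> extr])
  qed
  then have "AE x in lebesgue. v x = 0" by (rule AE_lborel_lebesgue)
  then have "AE x in lebesgue. u x = 0" using v(2) by eventually_elim simp
  with nz show False by simp
qed

section \<open>The constrained minimisation problem\<close>

lemma integral_scale:
  fixes f :: "'a::euclidean_space \<Rightarrow> real"
  assumes [measurable]: "f \<in> borel_measurable borel" and "s > 0"
  shows "(\<integral>x. f (s *\<^sub>R x) \<partial>lborel) = (\<integral>x. f x \<partial>lborel) / s ^ DIM('a)"
proof -
  have "(\<integral>x. f x \<partial>lborel) = (\<integral>x. f x \<partial>density (distr lborel borel (\<lambda>x. 0 + s *\<^sub>R x)) (\<lambda>_. ennreal (\<bar>s\<bar> ^ DIM('a))))"
    using lborel_affine[of s "0::'a"] assms(2) by simp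
  also have "\<dots> = s ^ DIM('a) * (\<integral>x. f (s *\<^sub>R x) \<partial>lborel)"
    using assms(2) by (subst integral_density) (auto simp: integral_distr)
  finally show ?thesis using assms(2) by simp
qed

text \<open>For \<sigma> l U(l x) the energy carries the powers l^2 from the amplitude, l^2 from the
  gradient and l^-4 from the change of variables, which cancel; so do l^4 and l^-4 in the quartic
  integral. In the mass \<sigma>^2 l^-2 remains, and this determines l.\<close>

lemma S_mass_scaling:
  fixes U :: "real^4 \<Rightarrow> real"
  assumes U: "C1c U" and r: "radial_decreasing U" and q: "0 < quart U" and "\<sigma> > 0" "c > 0"
  shows "\<exists>u\<in>S_mass c. (Lp_norm 2 (weak_grad u))\<^sup>2 = \<sigma>\<^sup>2 * energy U \<and> (Lp_norm 4 u) ^ 4 = \<sigma> ^ 4 * quart U"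
proof -
  have [measurable]: "U \<in> borel_measurable borel" "grad U \<in> borel_measurable borel" using C1c_measurable[OF U] by auto
  define m where "m = (\<integral>x. (U x)\<^sup>2 \<partial>lborel)"
  have "m \<noteq> 0"
  proof
    assume "m = 0"
    then have "AE x in lborel. (U x)\<^sup>2 = 0"
      unfolding m_def using integral_nonneg_eq_0_iff_AE[OF C1c_integrable_power[OF U, of 2]] by simp
    then have "AE x in lebesgue. U x = 0" by (simp add: AE_completion_iff)
    then show False using q quart_eq_0_iff[OF U] by simp
  qed
  then have m: "m > 0" unfolding m_def by (simp add: less_le)
  \<comment> \<open>The solution of \<sigma>^2 m/l^2 = c.\<close>
  define l where "l = \<sigma> * sqrt (m / c)"
  have l: "l > 0" using assms m by (simp add: l_def)
  have l2: "l\<^sup>2 * c = \<sigma>\<^sup>2 * m" using assms m by (simp add: l_def power_mult_distrib)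
  define V where "V x = (\<sigma> * l) * U (l *\<^sub>R x)" for x
  have S: "C1c (\<lambda>x. U (l *\<^sub>R x))" "grad (\<lambda>x. U (l *\<^sub>R x)) = (\<lambda>x. l *\<^sub>R grad U (l *\<^sub>R x))" using C1c_scale[OF U] l by auto
  have V: "C1c V" "grad V = (\<lambda>x. (\<sigma> * l) *\<^sub>R l *\<^sub>R grad U (l *\<^sub>R x))"
    unfolding V_def[abs_def] using C1c_cmult[OF S(1), of "\<sigma> * l"] S(2) by auto
  have e: "energy V = \<sigma>\<^sup>2 * energy U"
  proof -
    have "energy V = (\<integral>x. (\<sigma>\<^sup>2 * l ^ 4) * (norm (grad U (l *\<^sub>R x)))\<^sup>2 \<partial>lborel)"
      unfolding energy_def V(2) by (intro Bochner_Integration.integral_cong refl)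
        (simp add: power_mult_distrib power2_eq_square power4_eq_xxxx)
    also have "\<dots> = (\<sigma>\<^sup>2 * l ^ 4) * (\<integral>x. (norm (grad U (l *\<^sub>R x)))\<^sup>2 \<partial>lborel)" by simp
    also have "\<dots> = \<sigma>\<^sup>2 * energy U"
      using l integral_scale[of "\<lambda>x. (norm (grad U x))\<^sup>2" l] by (simp add: energy_def)
    finally show ?thesis .
  qed
  have qV: "quart V = \<sigma> ^ 4 * quart U"
  proof -
    have "quart V = (\<sigma> ^ 4 * l ^ 4) * (\<integral>x. U (l *\<^sub>R x) ^ 4 \<partial>lborel)"
      by (simp add: quart_def V_def power_mult_distrib)
    then show ?thesis using l integral_scale[of "\<lambda>x. U x ^ 4" l] by (simp add: quart_def)
  qed
  have mV: "(\<integral>x. (V x)\<^sup>2 \<partial>lborel) = c"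
  proof -
    have "(\<integral>x. (V x)\<^sup>2 \<partial>lborel) = (\<sigma>\<^sup>2 * l\<^sup>2) * (\<integral>x. (U (l *\<^sub>R x))\<^sup>2 \<partial>lborel)"
      by (simp add: V_def power_mult_distrib)
    also have "\<dots> = \<sigma>\<^sup>2 * m / l\<^sup>2"
      using l integral_scale[of "\<lambda>x. (U x)\<^sup>2" l] by (simp add: m_def power2_eq_square power4_eq_xxxx)
    finally show ?thesis using l l2 by (simp add: nonzero_divide_eq_eq mult.commute)
  qed
  obtain H where H: "U = (\<lambda>x. H (norm x))" using r by (auto simp: radial_decreasing_def)
  have "radial V" unfolding radial_def
    by (intro exI[of _ "\<lambda>t. (\<sigma> * l) * H (l * t)"] AE_I2) (use l in \<open>simp add: V_def H\<close>)
  then have "V \<in> S_mass c"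
    using C1c_lebesgue(1,4)[OF V(1)] mV by (simp add: S_mass_def H1_rad_def)
  then show ?thesis using C1c_lebesgue(2,3)[OF V(1)] e qV by auto
qed

text \<open>A positive mass excludes the zero function, the one case of equality in H^1.\<close>

lemma S_mass_strict:
  assumes u: "u \<in> S_mass c" and c: "c > 0"
  shows "sobolev_const\<^sup>2 * (Lp_norm 4 u) ^ 4 < ((Lp_norm 2 (weak_grad u))\<^sup>2)\<^sup>2" "0 < (Lp_norm 2 (weak_grad u))\<^sup>2"
proof -
  have h: "u \<in> H1" "(Lp_norm 2 u)\<^sup>2 = c" using u by (auto simp: S_mass_def H1_rad_def)
  have "\<not> (AE x in lebesgue. u x = 0)"
  proof
    assume "AE x in lebesgue. u x = 0"
    then have "AE x in lebesgue. (norm (u x))\<^sup>2 = 0" by eventually_elim simp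
    then have "(\<integral>x. (norm (u x))\<^sup>2 \<partial>lebesgue) = 0" by (rule integral_eq_zero_AE)
    then show False using h(2) c by (simp add: Lp_norm_2_sq)
  qed
  then have s: "sobolev_const * (Lp_norm 4 u)\<^sup>2 < (Lp_norm 2 (weak_grad u))\<^sup>2" by (rule Sobolev_H1_strict[OF h(1)])
  have nn: "0 \<le> sobolev_const * (Lp_norm 4 u)\<^sup>2" using sobolev_const_pos by simp
  show "0 < (Lp_norm 2 (weak_grad u))\<^sup>2" using le_less_trans[OF nn s] .
  have "(sobolev_const * (Lp_norm 4 u)\<^sup>2)\<^sup>2 < ((Lp_norm 2 (weak_grad u))\<^sup>2)\<^sup>2" using s nn by (intro power_strict_mono) auto
  then show "sobolev_const\<^sup>2 * (Lp_norm 4 u) ^ 4 < ((Lp_norm 2 (weak_grad u))\<^sup>2)\<^sup>2" by (simp add: power_mult_distrib)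
qed

text \<open>With s = \<sigma>^2 the scaling family has one parameter and two fixed numbers
  \<open>e\<close> and \<open>q\<close>, where e^2/q lies between S^2 and \<kappa>^2. The upper
  bounds for all the infima are computed from these data alone.\<close>

lemma S_mass_near_extremal:
  assumes "c > 0" "\<kappa> > sobolev_const"
  shows "\<exists>e q. 0 < e \<and> 0 < q \<and> e\<^sup>2 < \<kappa>\<^sup>2 * q \<and> sobolev_const\<^sup>2 * q \<le> e\<^sup>2 \<and>
    (\<forall>s>0. \<exists>u\<in>S_mass c. (Lp_norm 2 (weak_grad u))\<^sup>2 = s * e \<and> (Lp_norm 4 u) ^ 4 = s\<^sup>2 * q)"
proof -
  obtain U :: "real^4 \<Rightarrow> real" where U: "C1c U" "radial_decreasing U" "0 < quart U" "energy U < \<kappa> * sqrt (quart U)"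
    using sobolev_const_approx_radial[OF assms(2)] by blast
  have "0 < sobolev_const\<^sup>2 * quart U" using sobolev_const_pos U(3) by simp
  then have "0 < (energy U)\<^sup>2" using Sobolev_sharp_C1c[OF U(1)] by linarith
  then have "0 < energy U" using energy_nonneg[of U] by (simp add: less_le)
  moreover have "(energy U)\<^sup>2 < (\<kappa> * sqrt (quart U))\<^sup>2" using U(4) energy_nonneg by (intro power_strict_mono) auto
  then have "(energy U)\<^sup>2 < \<kappa>\<^sup>2 * quart U" using U(3) by (simp add: power_mult_distrib)
  moreover have "\<exists>u\<in>S_mass c. (Lp_norm 2 (weak_grad u))\<^sup>2 = s * energy U \<and> (Lp_norm 4 u) ^ 4 = s\<^sup>2 * quart U" if "s > 0" for s
  proof -
    have "sqrt s ^ 4 = s\<^sup>2" using that by (simp add: power4_eq_xxxx power2_eq_square)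
    then show ?thesis using S_mass_scaling[OF U(1,2,3), of "sqrt s" c] that assms(1) by simp
  qed
  ultimately show ?thesis using U(3) Sobolev_sharp_C1c[OF U(1)] by (intro exI[of _ "energy U"] exI[of _ "quart U"]) auto
qed

section \<open>The functional as a polynomial in the two norms\<close>

lemma I0_alt: "I0 a b u = a / 2 * (Lp_norm 2 (weak_grad u))\<^sup>2 + b / 4 * ((Lp_norm 2 (weak_grad u))\<^sup>2)\<^sup>2 - 1 / 4 * (Lp_norm 4 u) ^ 4"
  by (simp add: I0_def)

lemma P0_iff: "u \<in> P0 a b c \<longleftrightarrow> u \<in> S_mass c \<and>
    (Lp_norm 4 u) ^ 4 = a * (Lp_norm 2 (weak_grad u))\<^sup>2 + b * ((Lp_norm 2 (weak_grad u))\<^sup>2)\<^sup>2"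
  by (auto simp: P0_def)

lemma P0_minus_eq: "a > 0 \<Longrightarrow> c > 0 \<Longrightarrow> P0_minus a b c = P0 a b c"
proof -
  assume ac: "a > 0" "c > 0"
  have "2 * a * (Lp_norm 2 (weak_grad u))\<^sup>2 + 4 * b * (Lp_norm 2 (weak_grad u)) ^ 4 - 4 * (Lp_norm 4 u) ^ 4 < 0" if u: "u \<in> P0 a b c" for u
  proof -
    have s: "u \<in> S_mass c" using u by (simp add: P0_iff)
    have "2 * a * (Lp_norm 2 (weak_grad u))\<^sup>2 + 4 * b * (Lp_norm 2 (weak_grad u)) ^ 4 - 4 * (Lp_norm 4 u) ^ 4 = - 2 * (a * (Lp_norm 2 (weak_grad u))\<^sup>2)"
      using u unfolding P0_def by simp
    also have "\<dots> < 0" using S_mass_strict(2)[OF s ac(2)] ac(1) by simp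
    finally show ?thesis .
  qed
  then show ?thesis by (auto simp: P0_minus_def)
qed

lemma I0_P0: "u \<in> P0 a b c \<Longrightarrow> I0 a b u = a * (Lp_norm 2 (weak_grad u))\<^sup>2 / 4"
proof -
  assume u: "u \<in> P0 a b c"
  define X where "X = (Lp_norm 2 (weak_grad u))\<^sup>2"
  have "(Lp_norm 4 u) ^ 4 = a * X + b * X\<^sup>2" using u unfolding P0_iff X_def by blast
  then have "I0 a b u = a / 2 * X + b / 4 * X\<^sup>2 - 1 / 4 * (a * X + b * X\<^sup>2)" unfolding I0_alt X_def by simp
  also have "\<dots> = a * X / 4" by (simp add: field_simps)
  finally show ?thesis by (simp add: X_def)
qed

text \<open>For b at least S^-2 the term b X^2 exceeds |u|_4^4 by strictness, and a X/2 is positive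
  by itself.\<close>

lemma I0_pos:
  assumes u: "u \<in> S_mass c" and "a > 0" "c > 0" and b: "b \<ge> 1 / sobolev_const\<^sup>2"
  shows "0 < I0 a b u"
proof -
  define X where "X = (Lp_norm 2 (weak_grad u))\<^sup>2"
  have X: "X > 0" "sobolev_const\<^sup>2 * (Lp_norm 4 u) ^ 4 < X\<^sup>2" using S_mass_strict[OF u \<open>c > 0\<close>] by (auto simp: X_def)
  have K: "sobolev_const\<^sup>2 > 0" using sobolev_const_pos by simp
  have "(Lp_norm 4 u) ^ 4 < 1 / sobolev_const\<^sup>2 * X\<^sup>2" using X(2) K by (simp add: less_divide_eq mult.commute)
  also have "\<dots> \<le> b * X\<^sup>2" using b by (intro mult_right_mono) auto
  finally have "(Lp_norm 4 u) ^ 4 < b * X\<^sup>2" .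
  moreover have "0 < a / 2 * X" using X(1) \<open>a > 0\<close> by simp
  moreover have "I0 a b u = a / 2 * X + b / 4 * X\<^sup>2 - 1 / 4 * (Lp_norm 4 u) ^ 4" by (simp only: I0_alt X_def)
  ultimately show ?thesis by linarith
qed

text \<open>Dividing S^2 (a X + b X^2) < X^2 by X leaves a linear inequality, which can be solved
  for X because 1 - b S^2 is positive.\<close>

lemma I0_P0_greater:
  assumes u: "u \<in> P0 a b c" and ac: "a > 0" "c > 0" and b: "b < 1 / sobolev_const\<^sup>2"
  shows "a\<^sup>2 * sobolev_const\<^sup>2 / (4 * (1 - b * sobolev_const\<^sup>2)) < I0 a b u"
proof -
  let ?K = "sobolev_const\<^sup>2"
  define X where "X = (Lp_norm 2 (weak_grad u))\<^sup>2"
  have s: "u \<in> S_mass c" "(Lp_norm 4 u) ^ 4 = a * X + b * X\<^sup>2" using u by (auto simp: P0_iff X_def)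
  have X: "X > 0" "?K * (a * X + b * X\<^sup>2) < X\<^sup>2" using S_mass_strict[OF s(1) ac(2)] s(2) by (auto simp: X_def)
  have K: "?K > 0" using sobolev_const_pos by simp
  have bK: "1 - b * ?K > 0" using b K by (simp add: less_divide_eq)
  have "X * (?K * (a + b * X)) < X * X" using X(2) by (simp add: power2_eq_square algebra_simps)
  then have "?K * (a + b * X) < X" using X(1) by simp
  then have "a * ?K < X * (1 - b * ?K)" by (simp add: algebra_simps)
  then have "a * ?K / (1 - b * ?K) < X" using bK by (simp add: divide_less_eq)
  then have "a / 4 * (a * ?K / (1 - b * ?K)) < a / 4 * X" using ac by (intro mult_strict_left_mono) auto
  moreover have "a / 4 * (a * ?K / (1 - b * ?K)) = a\<^sup>2 * ?K / (4 * (1 - b * ?K))" by (simp add: power2_eq_square)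
  moreover have "a / 4 * X = I0 a b u" by (simp add: I0_P0[OF u] X_def)
  ultimately show ?thesis by linarith
qed

text \<open>The upper bound holds for every \<kappa> > S with b \<kappa>^2 < 1, by a member of the
  scaling family, and \<kappa> then decreases to S; the lower bound is
  \<open>I0_P0_greater\<close>.\<close>

lemma INF_I0_P0:
  assumes a: "a > 0" and c: "c > 0" and b: "b > 0" "b < 1 / sobolev_const\<^sup>2"
  shows "(INF u\<in>P0 a b c. ereal (I0 a b u)) = ereal (a\<^sup>2 * sobolev_const\<^sup>2 / (4 * (1 - b * sobolev_const\<^sup>2)))"
proof (rule antisym)
  let ?K = "sobolev_const"
  have K: "?K > 0" by (rule sobolev_const_pos)
  have bK: "b * ?K\<^sup>2 < 1" using b K by (simp add: less_divide_eq)
  have le: "(INF u\<in>P0 a b c. ereal (I0 a b u)) \<le> ereal (a\<^sup>2 * \<kappa>\<^sup>2 / (4 * (1 - b * \<kappa>\<^sup>2)))" if \<kappa>: "\<kappa> > ?K" "b * \<kappa>\<^sup>2 < 1" for \<kappa>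
  proof -
    obtain e q where eq: "0 < e" "0 < q" "e\<^sup>2 < \<kappa>\<^sup>2 * q"
      and fam: "\<And>s. s > 0 \<Longrightarrow> \<exists>u\<in>S_mass c. (Lp_norm 2 (weak_grad u))\<^sup>2 = s * e \<and> (Lp_norm 4 u) ^ 4 = s\<^sup>2 * q"
      using S_mass_near_extremal[OF c \<kappa>(1)] by blast
    have "b * e\<^sup>2 < b * (\<kappa>\<^sup>2 * q)" using eq(3) b(1) by simp
    also have "\<dots> = (b * \<kappa>\<^sup>2) * q" by simp
    also have "\<dots> \<le> 1 * q" using \<kappa>(2) eq(2) by (intro mult_right_mono) auto
    finally have d: "0 < q - b * e\<^sup>2" by simp
    \<comment> \<open>The parameter at which the family meets the constraint s^2 q = a s e + b s^2
      e^2; it is positive since b e^2 < q.\<close>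
    define s where "s = a * e / (q - b * e\<^sup>2)"
    have s: "s > 0" using a eq d by (simp add: s_def)
    obtain u where u: "u \<in> S_mass c" "(Lp_norm 2 (weak_grad u))\<^sup>2 = s * e" "(Lp_norm 4 u) ^ 4 = s\<^sup>2 * q" using fam[OF s] by blast
    have "s * (q - b * e\<^sup>2) = a * e" using d by (simp add: s_def)
    then have "s * (s * (q - b * e\<^sup>2)) = s * (a * e)" by simp
    then have "s\<^sup>2 * q = a * (s * e) + b * (s * e)\<^sup>2" by (simp add: power2_eq_square algebra_simps)
    then have P: "u \<in> P0 a b c" using u by (simp add: P0_iff)
    have "I0 a b u = a * (s * e) / 4" using I0_P0[OF P] u(2) by simp
    also have "\<dots> = a\<^sup>2 * e\<^sup>2 / (4 * (q - b * e\<^sup>2))"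
    proof -
      have "a * (a * e / r * e) / 4 = a\<^sup>2 * e\<^sup>2 / (4 * r)" for r by (simp add: power2_eq_square)
      then show ?thesis by (simp only: s_def)
    qed
    also have "\<dots> \<le> a\<^sup>2 * \<kappa>\<^sup>2 / (4 * (1 - b * \<kappa>\<^sup>2))"
    proof -
      have "e\<^sup>2 * (1 - b * \<kappa>\<^sup>2) \<le> \<kappa>\<^sup>2 * (q - b * e\<^sup>2)" using eq(3) by (simp add: algebra_simps)
      then have "e\<^sup>2 / (q - b * e\<^sup>2) \<le> \<kappa>\<^sup>2 / (1 - b * \<kappa>\<^sup>2)" using d \<kappa>(2) by (simp add: frac_le_eq divide_le_eq le_divide_eq mult.commute)
      then have "a\<^sup>2 / 4 * (e\<^sup>2 / (q - b * e\<^sup>2)) \<le> a\<^sup>2 / 4 * (\<kappa>\<^sup>2 / (1 - b * \<kappa>\<^sup>2))" by (intro mult_left_mono) auto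
      then show ?thesis by simp
    qed
    finally have "ereal (I0 a b u) \<le> ereal (a\<^sup>2 * \<kappa>\<^sup>2 / (4 * (1 - b * \<kappa>\<^sup>2)))" by simp
    then show ?thesis using P by (meson INF_lower order_trans)
  qed
  have lim: "((\<lambda>\<kappa>. a\<^sup>2 * \<kappa>\<^sup>2 / (4 * (1 - b * \<kappa>\<^sup>2))) \<longlongrightarrow> a\<^sup>2 * ?K\<^sup>2 / (4 * (1 - b * ?K\<^sup>2))) (at_right ?K)"
    using bK by (intro tendsto_intros) auto
  have "((\<lambda>\<kappa>. b * \<kappa>\<^sup>2) \<longlongrightarrow> b * ?K\<^sup>2) (at_right ?K)" by (intro tendsto_intros)
  then have "\<forall>\<^sub>F \<kappa> in at_right ?K. b * \<kappa>\<^sup>2 < 1" using bK by (rule order_tendstoD)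
  then have "\<forall>\<^sub>F \<kappa> in at_right ?K. (INF u\<in>P0 a b c. ereal (I0 a b u)) \<le> ereal (a\<^sup>2 * \<kappa>\<^sup>2 / (4 * (1 - b * \<kappa>\<^sup>2)))"
    using eventually_at_right_less by eventually_elim (rule le)
  then show "(INF u\<in>P0 a b c. ereal (I0 a b u)) \<le> ereal (a\<^sup>2 * ?K\<^sup>2 / (4 * (1 - b * ?K\<^sup>2)))"
    by (intro tendsto_lowerbound[OF tendsto_ereal[OF lim]]) auto
  show "ereal (a\<^sup>2 * ?K\<^sup>2 / (4 * (1 - b * ?K\<^sup>2))) \<le> (INF u\<in>P0 a b c. ereal (I0 a b u))"
    using I0_P0_greater[OF _ a c b(2)] by (intro INF_greatest) (simp add: less_imp_le)
qed

text \<open>The value 0 is approached as \<open>s\<close> tends to 0 in the scaling family, that is,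
  by spreading the fixed mass out.\<close>

lemma INF_I0_zero:
  assumes a: "a > 0" and c: "c > 0" and b: "b \<ge> 1 / sobolev_const\<^sup>2"
  shows "(INF u\<in>S_mass c. ereal (I0 a b u)) = 0"
proof (rule antisym)
  obtain e q where fam: "\<And>s. s > 0 \<Longrightarrow> \<exists>u\<in>S_mass c. (Lp_norm 2 (weak_grad u))\<^sup>2 = s * e \<and> (Lp_norm 4 u) ^ 4 = s\<^sup>2 * q"
    using S_mass_near_extremal[OF c, of "sobolev_const + 1"] by auto
  have le: "(INF u\<in>S_mass c. ereal (I0 a b u)) \<le> ereal (a / 2 * (s * e) + b / 4 * (s * e)\<^sup>2 - 1 / 4 * (s\<^sup>2 * q))" if s: "s > 0" for s
  proof -
    obtain u where u: "u \<in> S_mass c" "(Lp_norm 2 (weak_grad u))\<^sup>2 = s * e" "(Lp_norm 4 u) ^ 4 = s\<^sup>2 * q" using fam[OF s] by blast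
    then have "(INF u\<in>S_mass c. ereal (I0 a b u)) \<le> ereal (I0 a b u)" by (intro INF_lower)
    then show ?thesis using u by (simp add: I0_alt)
  qed
  have lim: "((\<lambda>s. a / 2 * (s * e) + b / 4 * (s * e)\<^sup>2 - 1 / 4 * (s\<^sup>2 * q)) \<longlongrightarrow> a / 2 * (0 * e) + b / 4 * (0 * e)\<^sup>2 - 1 / 4 * (0\<^sup>2 * q)) (at_right 0)"
    by (intro tendsto_intros)
  have "(INF u\<in>S_mass c. ereal (I0 a b u)) \<le> ereal (a / 2 * (0 * e) + b / 4 * (0 * e)\<^sup>2 - 1 / 4 * (0\<^sup>2 * q))"
  proof (rule tendsto_lowerbound[OF tendsto_ereal[OF lim]])
    show "\<forall>\<^sub>F s in at_right 0. (INF u\<in>S_mass c. ereal (I0 a b u)) \<le> ereal (a / 2 * (s * e) + b / 4 * (s * e)\<^sup>2 - 1 / 4 * (s\<^sup>2 * q))"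
      using le by (intro eventually_at_rightI[of 0 1]) auto
  qed simp
  then show "(INF u\<in>S_mass c. ereal (I0 a b u)) \<le> 0" by (simp add: zero_ereal_def)
  show "0 \<le> (INF u\<in>S_mass c. ereal (I0 a b u))"
    using I0_pos[OF _ a c b] by (intro INF_greatest) (simp add: less_imp_le)
qed

lemma INF_I0_unbounded:
  assumes a: "a > 0" and c: "c > 0" and b: "b > 0" "b < 1 / sobolev_const\<^sup>2"
  shows "(INF u\<in>S_mass c. ereal (I0 a b u)) = - \<infinity>"
proof (rule ereal_bot)
  fix B :: real
  \<comment> \<open>Here b \<kappa>^2 = 1, and b < S^-2 says that this \<kappa> exceeds S. A
    near-extremal below \<kappa> then satisfies b e^2 < q, so the coefficient of s^2 in the
    functional is negative.\<close>
  define \<kappa> where "\<kappa> = 1 / sqrt b"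
  have K: "sobolev_const > 0" by (rule sobolev_const_pos)
  have \<kappa>2: "b * \<kappa>\<^sup>2 = 1" "\<kappa> > 0" using b(1) by (auto simp: \<kappa>_def power_divide)
  have "b * sobolev_const\<^sup>2 < b * \<kappa>\<^sup>2" using b K \<kappa>2 by (simp add: less_divide_eq)
  then have "sobolev_const\<^sup>2 < \<kappa>\<^sup>2" using b(1) by simp
  then have "sobolev_const < \<kappa>" using \<kappa>2(2) by (simp add: power2_less_imp_less)
  then obtain e q where eq: "0 < e" "0 < q" "e\<^sup>2 < \<kappa>\<^sup>2 * q"
    and fam: "\<And>s. s > 0 \<Longrightarrow> \<exists>u\<in>S_mass c. (Lp_norm 2 (weak_grad u))\<^sup>2 = s * e \<and> (Lp_norm 4 u) ^ 4 = s\<^sup>2 * q"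
    using S_mass_near_extremal[OF c] by blast
  have "b * e\<^sup>2 < b * (\<kappa>\<^sup>2 * q)" using eq(3) b(1) by simp
  also have "\<dots> = q" using \<kappa>2(1) by (simp add: mult.assoc[symmetric])
  finally have d0: "b * e\<^sup>2 < q" .
  define d where "d = (q - b * e\<^sup>2) / 4"
  define p where "p = a / 2 * e"
  have d: "d > 0" "p > 0" using d0 a eq by (auto simp: d_def p_def)
  \<comment> \<open>Chosen so that \<open>p - s * d\<close> equals
    \<open>- \<bar>B\<bar> - d\<close>; as \<open>s \<ge> 1\<close>, the value
    \<open>s * (p - s * d)\<close> is then at most \<open>B\<close>.\<close>
  define s where "s = (p + \<bar>B\<bar>) / d + 1"
  have s: "s \<ge> 1" using d by (simp add: s_def)
  obtain u where u: "u \<in> S_mass c" "(Lp_norm 2 (weak_grad u))\<^sup>2 = s * e" "(Lp_norm 4 u) ^ 4 = s\<^sup>2 * q"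
    using fam[of s] s by auto
  have "I0 a b u = a / 2 * (s * e) + b / 4 * (s * e)\<^sup>2 - 1 / 4 * (s\<^sup>2 * q)" by (simp only: I0_alt u)
  also have "\<dots> = s * (p - s * d)" by (simp add: p_def d_def power2_eq_square field_simps)
  also have "s * d = p + \<bar>B\<bar> + d"     unfolding s_def distrib_right nonzero_divide_eq_eq[symmetric] using d by simp
  then have "s * (p - s * d) \<le> s * (- \<bar>B\<bar>)" using s d by (intro mult_left_mono) auto
  also have "\<dots> \<le> 1 * (- \<bar>B\<bar>)" using s by (intro mult_right_mono_neg) auto
  also have "\<dots> \<le> B" by simp
  finally have "ereal (I0 a b u) \<le> ereal B" by simp
  then show "(INF u\<in>S_mass c. ereal (I0 a b u)) \<le> ereal B" using u(1) by (meson INF_lower order_trans)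
qed

theorem theorem2p4:
  fixes a b c :: real
  assumes "a > 0" and "c > 0" and "b > 0"
  shows
    "(INF u\<in>S_mass c. ereal (I0 a b u)) = (if b \<ge> 1 / sobolev_const\<^sup>2 then 0 else -\<infinity>)
   \<and> (b \<ge> 1 / sobolev_const\<^sup>2 \<longrightarrow>
        \<not> (\<exists>v\<in>S_mass c. ereal (I0 a b v) = (INF u\<in>S_mass c. ereal (I0 a b u))))
   \<and> (b < 1 / sobolev_const\<^sup>2 \<longrightarrow>
        (let \<Lambda> = a\<^sup>2 * sobolev_const\<^sup>2 / (4 * (1 - b * sobolev_const\<^sup>2)) in
          (INF u\<in>P0 a b c. ereal (I0 a b u)) = ereal \<Lambda>
        \<and> (INF u\<in>P0_minus a b c. ereal (I0 a b u)) = ereal \<Lambda>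
        \<and> \<not> (\<exists>v\<in>P0 a b c. ereal (I0 a b v) = (INF u\<in>P0 a b c. ereal (I0 a b u)))
        \<and> \<not> (\<exists>v\<in>P0_minus a b c. ereal (I0 a b v) = (INF u\<in>P0_minus a b c. ereal (I0 a b u)))))"
proof (cases "b \<ge> 1 / sobolev_const\<^sup>2")
  case True
  then have z: "(INF u\<in>S_mass c. ereal (I0 a b u)) = 0" using assms by (intro INF_I0_zero)
  have "ereal (I0 a b v) \<noteq> 0" if "v \<in> S_mass c" for v
    using I0_pos[OF that assms(1,2) True] by simp
  then show ?thesis using True unfolding z by auto
next
  case False
  then have b: "b < 1 / sobolev_const\<^sup>2" by simp
  note i = INF_I0_P0[OF assms b]
  have "ereal (I0 a b v) \<noteq> ereal (a\<^sup>2 * sobolev_const\<^sup>2 / (4 * (1 - b * sobolev_const\<^sup>2)))" if "v \<in> P0 a b c" for v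
    using I0_P0_greater[OF that assms(1,2) b] by simp
  then show ?thesis
    using False INF_I0_unbounded[OF assms b] i unfolding P0_minus_eq[OF assms(1,2)] Let_def by auto
qed

end
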